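(* Let $(M,g,J)$ be a compact fiberwise Kähler toric manifold obtained from Construction Two such that each principal orbit is an $S^1$-bundle over $M_1\times\dots\times M_m$ with $M_1\cong\mathbb CP^{d_1/2}$, and $M$ is a $\mathbb CP^{(d_1+2)/2}$-bundle over $M_2\times\dots\times M_m$ (as described in the context). If $b_i>0$ for some $2\le i\le m$ and $b_j<0$ for some $2\le j\le m$, then $M$ admits at least a $1$-parameter family of Kähler metrics of constant positive scalar curvature.
   Context: Construction Two (cohomogeneity one): $(M_i,g_i^* )$, $1\le i\le m$, are compact Kähler–Einstein manifolds of real dimension $d_i$ with Einstein constant $1$ and Kähler forms $\omega_i^*$. Each principal orbit is a principal $S^1$-bundle $\pi:P\to M_1\times\dots\times M_m$ with connection form $\theta$, $d\theta=\pi^*\sum_i b_i\omega_i^*$, the $b_i$ being constants determined by the bundle; here $b_1=\frac{2}{d_1+2}$. On the open dense union of principal orbits, parametrized by $x\in(0,1)$ (after translation and scaling), the Kähler metric is $$g=\frac1{h}\,dx^2+h\,\theta\otimes\theta+\sum_{i=1}^m A_i\,\pi^*g_i^*,\qquad h=h(x)>0,\quad A_i=b_ix+a_i>0,$$ with $\theta$ dual to the generator $\partial_\phi$ of the $S^1$-fibres, and $J$ mapping the $x$-direction to the $\partial_\phi$-direction and restricting to the lifts of the complex structures of the $M_i$. There are two special orbits: at $x=0$ the $S^1$-fibre collapses together with $M_1$ ($A_1(0)=0$, i.e. $a_1=0$), and at $x=1$ only the $S^1$-fibre collapses; $A_i>0$ on $[0,1]$ for $2\le i\le m$; and $h(0)=h(1)=0$,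 $h'(0)=2$, $h'(1)=-2$. The $b_i$ are fixed by the manifold, while $h$ and $a_2,\dots,a_m$ vary with the metric. The metrics asserted are of this same form. *)

theory Defs
  imports "HOL-Analysis.Analysis"
begin

section \<open>Smooth functions on open subsets of coordinate spaces\<close>

text \<open>
  The coordinate space of a finite index set \<open>I\<close> is \<open>powertop_real I\<close>, whose points are the
  functions that are \<open>undefined\<close> outside \<open>I\<close>. Index sets of arbitrary type keep the coordinates of
  products of manifolds simple (disjoint sums of the index sets).
\<close>

definition pd :: "'k \<Rightarrow> (('k \<Rightarrow> real) \<Rightarrow> real) \<Rightarrow> ('k \<Rightarrow> real) \<Rightarrow> real" where
  "pd k f v = deriv (\<lambda>t. f (v(k := t))) (v k)"

definition smooth_on :: "'k set \<Rightarrow> ('k \<Rightarrow> real) set \<Rightarrow> (('k \<Rightarrow> real) \<Rightarrow> real) \<Rightarrow> bool" where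
  "smooth_on I S f \<longleftrightarrow>
    (\<forall>ks. set ks \<subseteq> I \<longrightarrow>
      continuous_map (subtopology (powertop_real I) S) euclideanreal (foldr pd ks f) \<and>
      (\<forall>k\<in>I. \<forall>v\<in>S. (\<lambda>t. foldr pd ks f (v(k := t))) field_differentiable at (v k)))"


section \<open>Smooth manifolds\<close>

type_synonym ('p, 'k) chart = "'p set \<times> ('p \<Rightarrow> 'k \<Rightarrow> real)"

record ('p, 'k) mfd =
  pts :: "'p set"
  idx :: "'k set"
  atlas :: "('p, 'k) chart set"

abbreviation cinv :: "('p, 'k) chart \<Rightarrow> ('k \<Rightarrow> real) \<Rightarrow> 'p" where
  "cinv c \<equiv> inv_into (fst c) (snd c)"

definition mdim :: "('p, 'k) mfd \<Rightarrow> nat" where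
  "mdim M = card (idx M)"

definition mtop :: "('p, 'k) mfd \<Rightarrow> 'p topology" where
  "mtop M = topology (\<lambda>S. S \<subseteq> pts M \<and>
     (\<forall>c\<in>atlas M. openin (powertop_real (idx M)) (snd c ` (S \<inter> fst c))))"

definition manifold :: "('p, 'k) mfd \<Rightarrow> bool" where
  "manifold M \<longleftrightarrow>
     finite (idx M) \<and>
     (\<Union>c\<in>atlas M. fst c) = pts M \<and>
     (\<forall>c\<in>atlas M. inj_on (snd c) (fst c)) \<and>
     (\<forall>c\<in>atlas M. \<forall>c'\<in>atlas M.
        openin (powertop_real (idx M)) (snd c ` (fst c \<inter> fst c')) \<and>
        (\<forall>k\<in>idx M. smooth_on (idx M) (snd c ` (fst c \<inter> fst c')) (\<lambda>v. snd c' (cinv c v) k))) \<and>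
     Hausdorff_space (mtop M) \<and> second_countable (mtop M)"

definition closed_manifold :: "('p, 'k) mfd \<Rightarrow> bool" where
  "closed_manifold M \<longleftrightarrow>
     manifold M \<and> pts M \<noteq> {} \<and> compact_space (mtop M) \<and> connected_space (mtop M)"

definition smooth_fun :: "('p, 'k) mfd \<Rightarrow> 'p set \<Rightarrow> ('p \<Rightarrow> real) \<Rightarrow> bool" where
  "smooth_fun M S f \<longleftrightarrow>
     (\<forall>c\<in>atlas M. smooth_on (idx M) (snd c ` (S \<inter> fst c)) (\<lambda>v. f (cinv c v)))"

definition smooth_near :: "('p, 'k) mfd \<Rightarrow> 'p \<Rightarrow> ('p \<Rightarrow> real) \<Rightarrow> bool" where
  "smooth_near M p f \<longleftrightarrow> (\<exists>S. openin (mtop M) S \<and> p \<in> S \<and> smooth_fun M S f)"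

definition smooth_map :: "('p, 'k) mfd \<Rightarrow> ('q, 'l) mfd \<Rightarrow> ('p \<Rightarrow> 'q) \<Rightarrow> bool" where
  "smooth_map M N F \<longleftrightarrow>
     continuous_map (mtop M) (mtop N) F \<and>
     (\<forall>c\<in>atlas N. \<forall>k\<in>idx N. smooth_fun M {p \<in> pts M. F p \<in> fst c} (\<lambda>p. snd c (F p) k))"

definition diffeo :: "('p, 'k) mfd \<Rightarrow> ('q, 'l) mfd \<Rightarrow> ('p \<Rightarrow> 'q) \<Rightarrow> bool" where
  "diffeo M N F \<longleftrightarrow>
     bij_betw F (pts M) (pts N) \<and> smooth_map M N F \<and> smooth_map N M (inv_into (pts M) F)"

definition open_sub :: "('p, 'k) mfd \<Rightarrow> 'p set \<Rightarrow> ('p, 'k) mfd" where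
  "open_sub M S = \<lparr>pts = S, idx = idx M, atlas = {(fst c \<inter> S, snd c) | c. c \<in> atlas M}\<rparr>"

definition prod_mfd :: "('p, 'k) mfd \<Rightarrow> ('q, 'l) mfd \<Rightarrow> ('p \<times> 'q, 'k + 'l) mfd" where
  "prod_mfd M N = \<lparr>pts = pts M \<times> pts N, idx = idx M <+> idx N,
     atlas = {(fst c \<times> fst c', \<lambda>(p, q). case_sum (snd c p) (snd c' q)) | c c'.
                c \<in> atlas M \<and> c' \<in> atlas N}\<rparr>"

definition prod_fam :: "'i set \<Rightarrow> ('i \<Rightarrow> ('p, 'k) mfd) \<Rightarrow> ('i \<Rightarrow> 'p, 'i \<times> 'k) mfd" where
  "prod_fam I M = \<lparr>pts = (\<Pi>\<^sub>E i\<in>I. pts (M i)), idx = Sigma I (\<lambda>i. idx (M i)),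
     atlas = {((\<Pi>\<^sub>E i\<in>I. fst (c i)),
               \<lambda>p. restrict (\<lambda>(i, k). snd (c i) (p i) k) (Sigma I (\<lambda>i. idx (M i)))) | c.
                \<forall>i\<in>I. c i \<in> atlas (M i)}\<rparr>"

definition unit_interval :: "(real, unit) mfd" where
  "unit_interval = \<lparr>pts = {0<..<1}, idx = UNIV, atlas = {({0<..<1}, \<lambda>t _. t)}\<rparr>"

text \<open>The charts of the circle are the branches of the argument.\<close>

definition circle :: "(complex, unit) mfd" where
  "circle = \<lparr>pts = sphere 0 1, idx = UNIV,
     atlas = {(sphere 0 1 - {cis a}, \<lambda>z _. THE t. a < t \<and> t < a + 2 * pi \<and> cis t = z) | a. True}\<rparr>"


section \<open>Tangent vectors\<close>

text \<open>
  A tangent vector at \<open>p\<close> acts on real functions as a derivation of the germs at \<open>p\<close>; it is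
  normalised to be \<open>0\<close> on functions that are not smooth near \<open>p\<close>, so that equality of tangent
  vectors is equality of functions.
\<close>

type_synonym 'p tv = "('p \<Rightarrow> real) \<Rightarrow> real"

definition cvec :: "('p, 'k) mfd \<Rightarrow> ('p, 'k) chart \<Rightarrow> 'p \<Rightarrow> 'k \<Rightarrow> 'p tv" where
  "cvec M c p k = (\<lambda>f. if smooth_near M p f then pd k (\<lambda>v. f (cinv c v)) (snd c p) else 0)"

definition tangent :: "('p, 'k) mfd \<Rightarrow> 'p \<Rightarrow> 'p tv set" where
  "tangent M p = {(\<lambda>f. \<Sum>k\<in>idx M. a k * cvec M c p k f) | a c. c \<in> atlas M \<and> p \<in> fst c}"

definition lincomb :: "real \<Rightarrow> 'p tv \<Rightarrow> real \<Rightarrow> 'p tv \<Rightarrow> 'p tv" where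
  "lincomb r u s w = (\<lambda>f. r * u f + s * w f)"

text \<open>The differential at \<open>p\<close> of a map \<open>F\<close> into \<open>N\<close>.\<close>

definition push :: "('q, 'l) mfd \<Rightarrow> ('p \<Rightarrow> 'q) \<Rightarrow> 'p \<Rightarrow> 'p tv \<Rightarrow> 'q tv" where
  "push N F p v = (\<lambda>f. if smooth_near N (F p) f then v (f \<circ> F) else 0)"


section \<open>Riemannian metrics and curvature\<close>

type_synonym 'p metric = "'p \<Rightarrow> 'p tv \<Rightarrow> 'p tv \<Rightarrow> real"

definition gcomp :: "('p, 'k) mfd \<Rightarrow> ('p, 'k) chart \<Rightarrow> 'p metric \<Rightarrow> 'k \<Rightarrow> 'k \<Rightarrow> ('k \<Rightarrow> real) \<Rightarrow> real" where
  "gcomp M c g i j v = g (cinv c v) (cvec M c (cinv c v) i) (cvec M c (cinv c v) j)"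

definition riemannian :: "('p, 'k) mfd \<Rightarrow> 'p metric \<Rightarrow> bool" where
  "riemannian M g \<longleftrightarrow>
     (\<forall>p\<in>pts M. \<forall>u\<in>tangent M p. \<forall>v\<in>tangent M p.
        g p u v = g p v u \<and>
        (u \<noteq> (\<lambda>_. 0) \<longrightarrow> g p u u > 0) \<and>
        (\<forall>w\<in>tangent M p. \<forall>r s. g p (lincomb r u s w) v = r * g p u v + s * g p w v)) \<and>
     (\<forall>c\<in>atlas M. \<forall>i\<in>idx M. \<forall>j\<in>idx M. smooth_on (idx M) (snd c ` fst c) (gcomp M c g i j))"

definition minv :: "'k set \<Rightarrow> ('k \<Rightarrow> 'k \<Rightarrow> real) \<Rightarrow> 'k \<Rightarrow> 'k \<Rightarrow> real" where
  "minv I G = (SOME H. \<forall>i\<in>I. \<forall>j\<in>I. (\<Sum>l\<in>I. G i l * H l j) = (if i = j then 1 else 0))"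

definition ginv :: "('p, 'k) mfd \<Rightarrow> ('p, 'k) chart \<Rightarrow> 'p metric \<Rightarrow> 'k \<Rightarrow> 'k \<Rightarrow> ('k \<Rightarrow> real) \<Rightarrow> real" where
  "ginv M c g i j v = minv (idx M) (\<lambda>k l. gcomp M c g k l v) i j"

text \<open>\<open>christoffel M c g i j k\<close> is the symbol with upper index \<open>i\<close> and lower indices \<open>j\<close>, \<open>k\<close>.\<close>

definition christoffel ::
  "('p, 'k) mfd \<Rightarrow> ('p, 'k) chart \<Rightarrow> 'p metric \<Rightarrow> 'k \<Rightarrow> 'k \<Rightarrow> 'k \<Rightarrow> ('k \<Rightarrow> real) \<Rightarrow> real" where
  "christoffel M c g i j k v =
     (\<Sum>l\<in>idx M. ginv M c g i l v *
        (pd j (gcomp M c g l k) v + pd k (gcomp M c g l j) v - pd l (gcomp M c g j k) v)) / 2"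

definition ricci :: "('p, 'k) mfd \<Rightarrow> ('p, 'k) chart \<Rightarrow> 'p metric \<Rightarrow> 'k \<Rightarrow> 'k \<Rightarrow> ('k \<Rightarrow> real) \<Rightarrow> real" where
  "ricci M c g j k v =
     (\<Sum>i\<in>idx M. pd i (christoffel M c g i j k) v - pd k (christoffel M c g i i j) v) +
     (\<Sum>i\<in>idx M. \<Sum>l\<in>idx M.
        christoffel M c g i i l v * christoffel M c g l j k v
        - christoffel M c g i k l v * christoffel M c g l i j v)"

definition scalar_curv :: "('p, 'k) mfd \<Rightarrow> ('p, 'k) chart \<Rightarrow> 'p metric \<Rightarrow> ('k \<Rightarrow> real) \<Rightarrow> real" where
  "scalar_curv M c g v = (\<Sum>j\<in>idx M. \<Sum>k\<in>idx M. ginv M c g j k v * ricci M c g j k v)"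

definition const_scalar_curv :: "('p, 'k) mfd \<Rightarrow> 'p metric \<Rightarrow> real \<Rightarrow> bool" where
  "const_scalar_curv M g s \<longleftrightarrow> (\<forall>c\<in>atlas M. \<forall>p\<in>fst c. scalar_curv M c g (snd c p) = s)"

definition einstein :: "('p, 'k) mfd \<Rightarrow> 'p metric \<Rightarrow> real \<Rightarrow> bool" where
  "einstein M g r \<longleftrightarrow> (\<forall>c\<in>atlas M. \<forall>p\<in>fst c. \<forall>i\<in>idx M. \<forall>j\<in>idx M.
     ricci M c g i j (snd c p) = r * gcomp M c g i j (snd c p))"


section \<open>Kaehler structures\<close>

type_synonym 'p endo = "'p \<Rightarrow> 'p tv \<Rightarrow> 'p tv"

text \<open>\<open>jcomp M c J i j\<close> is the \<open>i\<close>-th component of \<open>J\<close> applied to the \<open>j\<close>-th coordinate vector.\<close>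

definition jcomp :: "('p, 'k) mfd \<Rightarrow> ('p, 'k) chart \<Rightarrow> 'p endo \<Rightarrow> 'k \<Rightarrow> 'k \<Rightarrow> ('k \<Rightarrow> real) \<Rightarrow> real" where
  "jcomp M c J i j v = J (cinv c v) (cvec M c (cinv c v) j) (\<lambda>q. snd c q i)"

definition almost_complex :: "('p, 'k) mfd \<Rightarrow> 'p endo \<Rightarrow> bool" where
  "almost_complex M J \<longleftrightarrow>
     (\<forall>p\<in>pts M. \<forall>u\<in>tangent M p.
        J p u \<in> tangent M p \<and> J p (J p u) = (\<lambda>f. - u f) \<and>
        (\<forall>w\<in>tangent M p. \<forall>r s. J p (lincomb r u s w) = lincomb r (J p u) s (J p w))) \<and>
     (\<forall>c\<in>atlas M. \<forall>i\<in>idx M. \<forall>j\<in>idx M. smooth_on (idx M) (snd c ` fst c) (jcomp M c J i j))"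

definition nijenhuis ::
  "('p, 'k) mfd \<Rightarrow> ('p, 'k) chart \<Rightarrow> 'p endo \<Rightarrow> 'k \<Rightarrow> 'k \<Rightarrow> 'k \<Rightarrow> ('k \<Rightarrow> real) \<Rightarrow> real" where
  "nijenhuis M c J i j k v =
     (\<Sum>l\<in>idx M.
        jcomp M c J l j v * pd l (jcomp M c J i k) v
        - jcomp M c J l k v * pd l (jcomp M c J i j) v
        - jcomp M c J i l v * (pd j (jcomp M c J l k) v - pd k (jcomp M c J l j) v))"

text \<open>Integrability of \<open>J\<close>, as the vanishing of the Nijenhuis tensor.\<close>

definition complex_structure :: "('p, 'k) mfd \<Rightarrow> 'p endo \<Rightarrow> bool" where
  "complex_structure M J \<longleftrightarrow> almost_complex M J \<and>
     (\<forall>c\<in>atlas M. \<forall>p\<in>fst c. \<forall>i\<in>idx M. \<forall>j\<in>idx M. \<forall>k\<in>idx M. nijenhuis M c J i j k (snd c p) = 0)"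

definition kform :: "'p metric \<Rightarrow> 'p endo \<Rightarrow> 'p metric" where
  "kform g J p u v = g p (J p u) v"

definition closed_2form :: "('p, 'k) mfd \<Rightarrow> 'p metric \<Rightarrow> bool" where
  "closed_2form M w \<longleftrightarrow> (\<forall>c\<in>atlas M. \<forall>p\<in>fst c. \<forall>i\<in>idx M. \<forall>j\<in>idx M. \<forall>k\<in>idx M.
     pd i (gcomp M c w j k) (snd c p) + pd j (gcomp M c w k i) (snd c p)
     + pd k (gcomp M c w i j) (snd c p) = 0)"

definition kaehler :: "('p, 'k) mfd \<Rightarrow> 'p metric \<Rightarrow> 'p endo \<Rightarrow> bool" where
  "kaehler M g J \<longleftrightarrow>
     riemannian M g \<and> complex_structure M J \<and>
     (\<forall>p\<in>pts M. \<forall>u\<in>tangent M p. \<forall>v\<in>tangent M p. g p (J p u) (J p v) = g p u v) \<and>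
     closed_2form M (kform g J)"


section \<open>Complex projective space\<close>

definition line :: "(nat \<Rightarrow> complex) \<Rightarrow> (nat \<Rightarrow> complex) set" where
  "line z = {(\<lambda>k. c * z k) | c. c \<noteq> 0}"

text \<open>
  Points are the punctured complex lines in the space of vectors supported on \<open>{..n}\<close>. The index of
  an affine coordinate is \<open>(k, False)\<close> for its real part and \<open>(k, True)\<close> for its imaginary part;
  in the chart \<open>z j \<noteq> 0\<close>, the \<open>k\<close>-th affine coordinate skips the position \<open>j\<close>.
\<close>

definition CP_chart :: "nat \<Rightarrow> nat \<Rightarrow> ((nat \<Rightarrow> complex) set, nat \<times> bool) chart" where
  "CP_chart n j =
     ({line z | z. (\<forall>k>n. z k = 0) \<and> z j \<noteq> 0},
      \<lambda>L. restrict (\<lambda>(k, im). let z = (SOME z. z \<in> L); w = z (if k < j then k else Suc k) / z j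
                               in if im then Im w else Re w) ({..<n} \<times> UNIV))"

definition CP :: "nat \<Rightarrow> ((nat \<Rightarrow> complex) set, nat \<times> bool) mfd" where
  "CP n = \<lparr>pts = {line z | z. (\<forall>k>n. z k = 0) \<and> (\<exists>k\<le>n. z k \<noteq> 0)},
           idx = {..<n} \<times> UNIV, atlas = CP_chart n ` {..n}\<rparr>"

text \<open>The last conjunct says \<open>dw (J v) = \<i> dw v\<close> for every affine coordinate \<open>w\<close> of \<open>F\<close>.\<close>

definition biholomorphic_CP :: "('p, 'k) mfd \<Rightarrow> 'p endo \<Rightarrow> nat \<Rightarrow> ('p \<Rightarrow> (nat \<Rightarrow> complex) set) \<Rightarrow> bool" where
  "biholomorphic_CP M J n F \<longleftrightarrow> diffeo M (CP n) F \<and>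
     (\<forall>p\<in>pts M. \<forall>v\<in>tangent M p. \<forall>c\<in>atlas (CP n). F p \<in> fst c \<longrightarrow> (\<forall>k<n.
        J p v (\<lambda>q. snd c (F q) (k, False)) = - v (\<lambda>q. snd c (F q) (k, True)) \<and>
        J p v (\<lambda>q. snd c (F q) (k, True)) = v (\<lambda>q. snd c (F q) (k, False))))"


section \<open>Bundles and connections\<close>

definition fibre_bundle ::
  "('e, 'k) mfd \<Rightarrow> ('b, 'l) mfd \<Rightarrow> ('f, 'n) mfd \<Rightarrow> ('e \<Rightarrow> 'b) \<Rightarrow> bool" where
  "fibre_bundle E B F pr \<longleftrightarrow> smooth_map E B pr \<and>
     (\<forall>y\<in>pts B. \<exists>U \<Phi>. openin (mtop B) U \<and> y \<in> U \<and>
        diffeo (open_sub E {e \<in> pts E. pr e \<in> U}) (prod_mfd (open_sub B U) F) \<Phi> \<and>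
        (\<forall>e\<in>pts E. pr e \<in> U \<longrightarrow> fst (\<Phi> e) = pr e))"

definition circle_action :: "('p, 'k) mfd \<Rightarrow> (complex \<Rightarrow> 'p \<Rightarrow> 'p) \<Rightarrow> bool" where
  "circle_action P act \<longleftrightarrow>
     smooth_map (prod_mfd circle P) P (\<lambda>(z, p). act z p) \<and>
     (\<forall>p\<in>pts P. act 1 p = p \<and>
        (\<forall>z\<in>sphere 0 1. \<forall>w\<in>sphere 0 1. act (z * w) p = act z (act w p)))"

definition principal_circle_bundle ::
  "('p, 'k) mfd \<Rightarrow> ('b, 'l) mfd \<Rightarrow> (complex \<Rightarrow> 'p \<Rightarrow> 'p) \<Rightarrow> ('p \<Rightarrow> 'b) \<Rightarrow> bool" where
  "principal_circle_bundle P B act pr \<longleftrightarrow> circle_action P act \<and> smooth_map P B pr \<and>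
     (\<forall>y\<in>pts B. \<exists>U \<Phi>. openin (mtop B) U \<and> y \<in> U \<and>
        diffeo (open_sub P {p \<in> pts P. pr p \<in> U}) (prod_mfd (open_sub B U) circle) \<Phi> \<and>
        (\<forall>p\<in>pts P. pr p \<in> U \<longrightarrow> fst (\<Phi> p) = pr p \<and>
           (\<forall>z\<in>sphere 0 1. \<Phi> (act z p) = (pr p, z * snd (\<Phi> p)))))"

text \<open>The generator of the action, normalised to have period \<open>2 * pi\<close>.\<close>

definition generator :: "('p, 'k) mfd \<Rightarrow> (complex \<Rightarrow> 'p \<Rightarrow> 'p) \<Rightarrow> 'p \<Rightarrow> 'p tv" where
  "generator P act p = (\<lambda>f. if smooth_near P p f then deriv (\<lambda>t. f (act (cis t) p)) 0 else 0)"

definition fcomp :: "('p, 'k) mfd \<Rightarrow> ('p, 'k) chart \<Rightarrow> ('p \<Rightarrow> 'p tv \<Rightarrow> real) \<Rightarrow> 'k \<Rightarrow> ('k \<Rightarrow> real) \<Rightarrow> real" where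
  "fcomp M c \<theta> i v = \<theta> (cinv c v) (cvec M c (cinv c v) i)"

definition one_form :: "('p, 'k) mfd \<Rightarrow> ('p \<Rightarrow> 'p tv \<Rightarrow> real) \<Rightarrow> bool" where
  "one_form M \<theta> \<longleftrightarrow>
     (\<forall>p\<in>pts M. \<forall>u\<in>tangent M p. \<forall>w\<in>tangent M p. \<forall>r s.
        \<theta> p (lincomb r u s w) = r * \<theta> p u + s * \<theta> p w) \<and>
     (\<forall>c\<in>atlas M. \<forall>i\<in>idx M. smooth_on (idx M) (snd c ` fst c) (fcomp M c \<theta> i))"

definition connection_form ::
  "('p, 'k) mfd \<Rightarrow> (complex \<Rightarrow> 'p \<Rightarrow> 'p) \<Rightarrow> ('p \<Rightarrow> 'p tv \<Rightarrow> real) \<Rightarrow> bool" where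
  "connection_form P act \<theta> \<longleftrightarrow> one_form P \<theta> \<and>
     (\<forall>p\<in>pts P. \<theta> p (generator P act p) = 1 \<and>
        (\<forall>z\<in>sphere 0 1. \<forall>v\<in>tangent P p. \<theta> (act z p) (push P (act z) p v) = \<theta> p v))"

text \<open>\<open>d\<theta> = w\<close>\<close>

definition ext_deriv_eq :: "('p, 'k) mfd \<Rightarrow> ('p \<Rightarrow> 'p tv \<Rightarrow> real) \<Rightarrow> 'p metric \<Rightarrow> bool" where
  "ext_deriv_eq M \<theta> w \<longleftrightarrow> (\<forall>c\<in>atlas M. \<forall>p\<in>fst c. \<forall>i\<in>idx M. \<forall>j\<in>idx M.
     pd i (fcomp M c \<theta> j) (snd c p) - pd j (fcomp M c \<theta> i) (snd c p) = gcomp M c w i j (snd c p))"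


section \<open>The cohomogeneity one construction\<close>

text \<open>
  The data that do not depend on the metric on \<open>M\<close>. The map \<open>(x, q)\<close> identifies the union of the
  principal orbits with \<open>(0,1) \<times> P\<close>. The maps \<open>\<rho>\<close> and \<open>\<rho>'\<close> extend the projections of the
  principal orbits to the special orbits, which are identified with the base manifolds by the smooth
  sections \<open>\<sigma>\<close> and \<open>\<sigma>'\<close>: the orbit \<open>x = 0\<close> is the product of the factors \<open>2..m\<close>
  (the circle and the first factor collapse), the orbit \<open>x = 1\<close> is the product of all factors
  (only the circle collapses).
\<close>

locale construction_two =
  fixes m :: nat
    and N :: "nat \<Rightarrow> ('b, 'k) mfd" and gN :: "nat \<Rightarrow> 'b metric" and JN :: "nat \<Rightarrow> 'b endo"
    and b :: "nat \<Rightarrow> real"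
    and P :: "('p, 'l) mfd" and act :: "complex \<Rightarrow> 'p \<Rightarrow> 'p" and pr :: "'p \<Rightarrow> nat \<Rightarrow> 'b"
    and \<theta> :: "'p \<Rightarrow> 'p tv \<Rightarrow> real"
    and M :: "('a, 'n) mfd" and x :: "'a \<Rightarrow> real" and q :: "'a \<Rightarrow> 'p"
  assumes m_pos: "1 \<le> m"
    and factors: "\<And>i. i \<in> {1..m} \<Longrightarrow>
          closed_manifold (N i) \<and> mdim (N i) > 0 \<and> kaehler (N i) (gN i) (JN i) \<and> einstein (N i) (gN i) 1"
    and first_factor: "\<exists>F. biholomorphic_CP (N 1) (JN 1) (mdim (N 1) div 2) F"
    and principal: "manifold P" "principal_circle_bundle P (prod_fam {1..m} N) act pr"
    and connection: "connection_form P act \<theta>"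
    and curvature: "ext_deriv_eq P \<theta> (\<lambda>p u v. \<Sum>i=1..m. b i *
          kform (gN i) (JN i) (pr p i) (push (N i) (\<lambda>p. pr p i) p u) (push (N i) (\<lambda>p. pr p i) p v))"
    and b_first: "b 1 = 2 / (real (mdim (N 1)) + 2)"
    and total: "closed_manifold M" "smooth_fun M (pts M) x" "x ` pts M = {0..1}"
    and principal_dense: "mtop M closure_of {p \<in> pts M. 0 < x p \<and> x p < 1} = pts M"
    and principal_part: "diffeo (open_sub M {p \<in> pts M. 0 < x p \<and> x p < 1}) (prod_mfd unit_interval P)
          (\<lambda>p. (x p, q p))"
    and special_orbit_0: "\<exists>\<rho> \<sigma>.
          fibre_bundle M (prod_fam {2..m} N) (CP ((mdim (N 1) + 2) div 2)) \<rho> \<and>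
          (\<forall>p\<in>pts M. 0 < x p \<and> x p < 1 \<longrightarrow> (\<forall>i\<in>{2..m}. \<rho> p i = pr (q p) i)) \<and>
          smooth_map (prod_fam {2..m} N) M \<sigma> \<and>
          \<sigma> ` pts (prod_fam {2..m} N) = {p \<in> pts M. x p = 0} \<and>
          (\<forall>y\<in>pts (prod_fam {2..m} N). \<rho> (\<sigma> y) = y)"
    and special_orbit_1: "\<exists>\<rho>' \<sigma>'.
          smooth_map (open_sub M {p \<in> pts M. 0 < x p}) (prod_fam {1..m} N) \<rho>' \<and>
          (\<forall>p\<in>pts M. 0 < x p \<and> x p < 1 \<longrightarrow> \<rho>' p = pr (q p)) \<and>
          smooth_map (prod_fam {1..m} N) M \<sigma>' \<and>
          \<sigma>' ` pts (prod_fam {1..m} N) = {p \<in> pts M. x p = 1} \<and>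
          (\<forall>y\<in>pts (prod_fam {1..m} N). \<rho>' (\<sigma>' y) = y)"

text \<open>One-sided derivatives of all orders at the end points.\<close>

definition smooth_closed_interval :: "(real \<Rightarrow> real) \<Rightarrow> bool" where
  "smooth_closed_interval h \<longleftrightarrow> (\<exists>D. (\<forall>t\<in>{0..1}. D 0 t = h t) \<and>
     (\<forall>k. \<forall>t\<in>{0..1}. (D k has_real_derivative D (Suc k) t) (at t within {0..1})))"

definition profile :: "nat \<Rightarrow> (nat \<Rightarrow> real) \<Rightarrow> (real \<Rightarrow> real) \<Rightarrow> (nat \<Rightarrow> real) \<Rightarrow> bool" where
  "profile m b h a \<longleftrightarrow>
     smooth_closed_interval h \<and> (\<forall>t\<in>{0<..<1}. h t > 0) \<and> h 0 = 0 \<and> h 1 = 0 \<and>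
     (h has_real_derivative 2) (at 0 within {0..1}) \<and>
     (h has_real_derivative -2) (at 1 within {0..1}) \<and>
     a 1 = 0 \<and> (\<forall>i\<in>{2..m}. \<forall>t\<in>{0..1}. b i * t + a i > 0)"

text \<open>
  The form of \<open>g\<close> and \<open>J\<close> on the principal part. A tangent vector \<open>v\<close> of \<open>M\<close> has
  \<open>dx v = v x\<close>. The conditions on \<open>J\<close> say that \<open>J\<close> maps \<open>h \<cdot> \<partial>\<^sub>x\<close> to the generator of the circle
  action and acts on horizontal lifts as the complex structures of the factors; this orientation is the
  one for which \<open>g(J\<cdot>,\<cdot>)\<close> is closed, given that the curvature of \<open>\<theta>\<close> is the sum of the
  \<open>b i \<cdot> g\<^sub>i(J\<^sub>i\<cdot>,\<cdot>)\<close>.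
\<close>

definition metric_form ::
  "nat \<Rightarrow> (nat \<Rightarrow> ('b, 'k) mfd) \<Rightarrow> (nat \<Rightarrow> 'b metric) \<Rightarrow> (nat \<Rightarrow> 'b endo) \<Rightarrow> (nat \<Rightarrow> real) \<Rightarrow>
   ('p, 'l) mfd \<Rightarrow> ('p \<Rightarrow> nat \<Rightarrow> 'b) \<Rightarrow> ('p \<Rightarrow> 'p tv \<Rightarrow> real) \<Rightarrow>
   ('a, 'n) mfd \<Rightarrow> ('a \<Rightarrow> real) \<Rightarrow> ('a \<Rightarrow> 'p) \<Rightarrow>
   (real \<Rightarrow> real) \<Rightarrow> (nat \<Rightarrow> real) \<Rightarrow> 'a metric \<Rightarrow> 'a endo \<Rightarrow> bool" where
  "metric_form m N gN JN b P pr \<theta> M x q h a g J \<longleftrightarrow>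
     (\<forall>p\<in>pts M. 0 < x p \<and> x p < 1 \<longrightarrow>
       (let vert = (\<lambda>v. \<theta> (q p) (push P q p v));
            base = (\<lambda>i. push (N i) (\<lambda>p. pr (q p) i) p)
        in (\<forall>u\<in>tangent M p. \<forall>v\<in>tangent M p.
              g p u v = u x * v x / h (x p) + h (x p) * vert u * vert v
                + (\<Sum>i=1..m. (b i * x p + a i) * gN i (pr (q p) i) (base i u) (base i v))) \<and>
           (\<forall>v\<in>tangent M p.
              vert (J p v) = v x / h (x p) \<and>
              J p v x = - h (x p) * vert v \<and>
              (\<forall>i\<in>{1..m}. base i (J p v) = JN i (pr (q p) i) (base i v)))))"

end

theory Submission
 imports Defs "Jordan_Normal_Form.Determinant"
begin

text \<open>
  Deform the given metric by functions of the moment map \<open>x\<close>: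
  \<open>g = g0 + \<phi>(x) dx\<^sup>2 + \<psi>(x) (dx \<circ> J0)\<^sup>2 + \<Sum> (a\<^sub>i - a0\<^sub>i) \<rho>\<^sub>i\<^sup>* g\<^sub>i\<close>, where \<open>\<rho>\<^sub>i\<close> is the projection of
  \<open>M\<close> to \<open>M\<^sub>i\<close> (\<open>i \<ge> 2\<close>) and \<open>\<phi>\<close>, \<open>\<psi>\<close> are smooth up to the boundary because \<open>h\<close>, \<open>h0\<close> have the same end
  conditions. The Kaehler form changes by \<open>\<Sum> (a\<^sub>i - a0\<^sub>i) \<rho>\<^sub>i\<^sup>* \<omega>\<^sub>i\<close>, which together with \<open>g\<close> determines \<open>J\<close>. Identities
  are checked on the dense union of the principal orbits and extend by continuity.

  In a frame adapted to the circle bundle the scalar curvature is \<open>\<Sum> d\<^sub>i / A\<^sub>i - (V h)'' / V\<close> with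
  \<open>V = \<Prod> A\<^sub>i\<close>\<open>^(d\<^sub>i / 2)\<close>, so constancy is a linear equation for \<open>V h\<close> with polynomial right-hand
  side. It is solved by integrating twice from \<open>0\<close>; the two conditions at \<open>1\<close> are linear in the
  value \<open>s\<close> of the curvature, and compatible when a determinant vanishes. For \<open>a\<^sub>i = 1 / (t z\<^sub>i)\<close> the
  determinant is \<open>t G(t, r)\<close>, where \<open>r\<close> is the \<open>z\<^sub>j\<close> of an index with \<open>b\<^sub>j < 0\<close>; \<open>G(0, r)\<close> is affine in \<open>r\<close>
  and the two signs among the \<open>b\<^sub>i\<close> make its root positive. Monotonicity in \<open>r\<close> continues the root
  to small \<open>t > 0\<close>.
\<close>

section \<open>Calculus in coordinate spaces\<close>

text \<open>The obstacle is the special orbits: no coordinates of \<open>M\<close> adapted to the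
  circle bundle exist there. Hence nothing is built from \<open>h\<close> and \<open>a\<close>
  alone; every new tensor combines tensors already smooth on \<open>M\<close>, with coefficients
  that are smooth functions of \<open>x\<close>.

  The connection is guessed in a frame and recognised by being torsion-free and metric.

  For the family, \<open>t = 0\<close> stands for factors \<open>2..m\<close> of infinite size.
  There the profile is \<open>2 x (1 - x)\<close>, that of the Fubini-Study metric on the fibre; it
  meets both end conditions, so the determinant is divisible by \<open>t\<close>. Its next term is a
  multiple of the sum of \<open>n i * z i * b i\<close> over \<open>i >= 2\<close>, with
  \<open>2 * n i\<close> the dimension of factor \<open>i\<close>. Positivity of the profile is not
  obtained by perturbation: the right-hand side of the equation has the sign of \<open>R - s\<close>
  with \<open>R\<close> convex, which settles it for every solution of the end conditions. The
  metrics are told apart by \<open>a i0\<close>, because the normalisation \<open>a 1 = 0\<close>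
  together with the fixed \<open>b 1\<close> leaves no freedom of scaling.\<close>

abbreviation "der01 f d t == (f has_real_derivative d) (at t within {0..1})"

abbreviation "smo M == smooth_on (idx M)"

abbreviation "sci == smooth_closed_interval"

abbreviation "img c == snd c ` fst c"

abbreviation "rep c F d v == snd d (F (cinv c v))"

lemmas scr = sum.cong[OF refl]

abbreviation "cont == continuous_on"

abbreviation "Tan == tangent"

lemmas alg = algebra_simps

lemmas sdl = sum_distrib_left

lemmas sdr = sum_distrib_right

abbreviation Rn :: "'k set=>('k=>real) set" where
 "Rn I == PiE I (%_. UNIV)"

abbreviation opn :: "'k set=>('k=>real) set=>bool" where
 "opn I S == openin (top_of_set (Rn I)) S"

text \<open>On \<open>Rn I\<close> the coordinates outside \<open>I\<close> are frozen at
  \<open>undefined\<close>, so the identity is continuous in both directions. Passing to a subspace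
  of the function space makes \<open>continuous_on\<close> and \<open>openin\<close> available for
  chart images.\<close>

lemma powertop_real_eq: "powertop_real I = top_of_set (Rn I)"
proof -
 have 1: "continuous_map (powertop_real I) (top_of_set (Rn I)) id"
 proof -
  have "continuous_map (powertop_real I) (product_topology (%_. euclideanreal) UNIV) id" unfolding continuous_map_componentwise_UNIV
  proof
   fix k
   show "continuous_map (powertop_real I) euclideanreal (%x. id x k)"
   proof (cases "k:I")
    case False
    show ?thesis by (rule continuous_map_eq[where f="%_. undefined"]) (use False in \<open>auto simp: PiE_def extensional_def\<close>)
   qed (auto intro: continuous_map_product_projection)
  qed
  thus ?thesis by (auto simp: continuous_map_in_subtopology euclidean_product_topology)
 qed
 have 2: "continuous_map (top_of_set (Rn I)) (powertop_real I) id"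
  by (auto simp: continuous_map_componentwise PiE_def intro!: continuous_on_product_coordinates continuous_on_subset[OF continuous_on_product_coordinates])
 have "openin (powertop_real I) S = openin (top_of_set (Rn I)) S" for S using 1 2 topology_finer_continuous_id[of "powertop_real I" "top_of_set (Rn I)"]
   topology_finer_continuous_id[of "top_of_set (Rn I)" "powertop_real I"] by auto
 thus ?thesis by (metis topology_eq)
qed

lemma opn_subset: "opn I S ==> S <= Rn I" by (auto dest: openin_imp_subset)

text \<open>As \<open>I\<close> is finite, the radii that work for the single coordinates have a
  common positive lower bound, obtained as an eventuality at \<open>0\<close> from the
  right.\<close>

lemma opn_box:
 assumes "finite I" "opn I S" "v:S" shows "EX e>0. ALL w:Rn I. (ALL k:I. \<bar>w k - v k\<bar> < e) --> w:S"
proof -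
 obtain U where U: "!!i. i:I ==> open (U i)" "v:PiE I U" "PiE I U <= S" using assms(2,3) unfolding powertop_real_eq[symmetric] openin_product_topology_alt
  by (simp add: powertop_real_eq) metis
 have "\<forall>\<^sub>F e in at_right (0::real). ball (v i) e <= U i" if iI: "i:I" for i
 proof -
  obtain d where d: "d > 0" "ball (v i) d <= U i" using U(1)[OF iI] PiE_mem[OF U(2) iI] open_contains_ball by blast
  have "\<forall>\<^sub>F e in at_right (0::real). e < d" using d(1) eventually_at_right_less order_tendstoD(2) tendsto_ident_at by blast
  thus ?thesis
  proof eventually_elim
   case (elim e)
   hence "ball (v i) e <= ball (v i) d" by (intro subset_ball) simp
   thus ?case using d(2) by (rule order_trans)
  qed
 qed
 hence "\<forall>\<^sub>F e in at_right (0::real). (ALL i:I. ball (v i) e <= U i) & e > 0"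
  using assms(1) eventually_at_right_less[of "0::real"] by (simp add: eventually_conj_iff eventually_ball_finite_distrib)
 from eventually_happens'[OF _ this] obtain e where e: "e > 0" "!!i. i:I ==> ball (v i) e <= U i" by auto
 have "w:S" if "w:Rn I" "ALL k:I. \<bar>w k - v k\<bar> < e" for w
 proof -
  have "w:PiE I U" using that e(2) by (auto simp: PiE_iff subset_iff dist_real_def abs_minus_commute)
  thus ?thesis using U by auto
 qed
 thus ?thesis using e(1) by blast
qed

lemma continuous_on_box:
 fixes f :: "('k=>real)=>real"
 assumes "finite I" "S <= Rn I" "cont S f" "v:S" "e > 0" shows "EX d>0. ALL w:S. (ALL k:I. \<bar>w k - v k\<bar> < d) --> \<bar>f w - f v\<bar> < e"
proof -
 have "openin (top_of_set S) (S Int f -` ball (f v) e)" using continuous_openin_preimage_gen[OF assms(3)] by blast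
 then obtain U where U: "open U" "S Int f -` ball (f v) e = S Int U" by (auto simp: openin_open)
 have "opn I (Rn I Int U)" using U by (auto simp: openin_open)
 moreover have "v:Rn I Int U" using U assms by auto
 ultimately obtain d where "d > 0" "ALL w:Rn I. (ALL k:I. \<bar>w k - v k\<bar> < d) --> w:Rn I Int U" using opn_box[OF assms(1)] by meson
 thus ?thesis using U(2) assms(2) by (intro exI[of _ d]) (auto simp: set_eq_iff dist_real_def abs_minus_commute)
qed

lemma open_line:
 assumes "opn I S" "k:I" "v:Rn I" shows "open {t. v(k := t):S}"
proof -
 obtain U where U: "open U" "S = Rn I Int U" using assms(1) by (auto simp: openin_open)
 have "cont UNIV (%t. v(k := t))"
 proof (rule continuous_on_coordinatewise_then_product)
  fix j show "cont UNIV (%t. (v(k := t)) j)" by (cases "j = k") auto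
 qed
 hence "open ((%t. v(k := t)) -` U)" using U(1) open_vimage by blast
 moreover have "{t. v(k := t):S} = (%t. v(k := t)) -` U" using assms U by (auto simp: PiE_def extensional_def)
 ultimately show ?thesis by simp
qed

lemma upd_Rn: "v:Rn I ==> k:I ==> v(k := t):Rn I" by (auto simp: PiE_def extensional_def)

definition pdiff :: "'k set=>('k=>real) set=>(('k=>real)=>real)=>bool" where
 "pdiff I S f = ((ALL k:I. ALL v:S. (%t. f (v(k := t))) field_differentiable at (v k)))"

lemma pdiffD: "pdiff I S f ==> k:I ==> v:S ==> DERIV (%t. f (v(k := t))) (v k) :> pd k f v" unfolding pdiff_def pd_def by (metis field_differentiable_derivI)

lemma pd_eqI: "DERIV (%t. f (v(k := t))) (v k) :> D ==> pd k f v = D" unfolding pd_def by (rule DERIV_imp_deriv)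

lemma smooth_on_iff:
 assumes "S <= Rn I" shows "smooth_on I S f \<longleftrightarrow> (ALL ks. set ks <= I --> cont S (foldr pd ks f) & pdiff I S (foldr pd ks f))"
proof -
 have "subtopology (powertop_real I) S = top_of_set S" using assms by (simp add: powertop_real_eq subtopology_subtopology Int_absorb1)
 thus ?thesis unfolding smooth_on_def pdiff_def by simp
qed

lemma smooth_on_cont: "smooth_on I S f ==> S <= Rn I ==> cont S f" by (metis empty_subsetI foldr.simps(1) id_apply list.set(1) smooth_on_iff)

lemma smooth_on_pdiff: "smooth_on I S f ==> S <= Rn I ==> pdiff I S f" by (metis empty_subsetI foldr.simps(1) id_apply list.set(1) smooth_on_iff)

lemma smooth_on_pd: "smooth_on I S f ==> k:I ==> smooth_on I S (pd k f)"
proof -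
 assume a: "smooth_on I S f" "k:I"
 show ?thesis unfolding smooth_on_def
 proof (intro allI impI)
  fix ks assume "set ks <= I"
  thus "continuous_map (subtopology (powertop_real I) S) euclideanreal (foldr pd ks (pd k f)) &
    (ALL ka:I. ALL v:S. (%t. foldr pd ks (pd k f) (v(ka := t))) field_differentiable at (v ka))"
   using a(2) a(1)[unfolded smooth_on_def, THEN spec[of _ "ks @ [k]"]] by auto
 qed
qed

lemma eventually_line:
 assumes "opn I S" "k:I" "v:S" shows "\<forall>\<^sub>F t in nhds (v k). v(k := t):S" using open_line[OF assms(1,2)] assms opn_subset[OF assms(1)]
 by (auto simp: eventually_nhds intro!: exI[of _ "{t. v(k := t):S}"])

lemma has_pd_cong:
 assumes "opn I S" "k:I" "v:S" "!!w. w:S ==> f w = g w" shows "DERIV (%t. f (v(k := t))) (v k) :> D \<longleftrightarrow> DERIV (%t. g (v(k := t))) (v k) :> D"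
 by (intro DERIV_cong_ev refl eventually_mono[OF eventually_line[OF assms(1-3)]]) (use assms(4) in auto)

lemma pd_cong:
 assumes "opn I S" "k:I" "v:S" "!!w. w:S ==> f w = g w" shows "pd k f v = pd k g v" unfolding pd_def deriv_def using has_pd_cong[OF assms(1-3), of f g] assms(4) by simp

lemma pdiff_cong:
 assumes "opn I S" "!!w. w:S ==> f w = g w" "pdiff I S f" shows "pdiff I S g" unfolding pdiff_def field_differentiable_def
proof (intro ballI)
 fix k v assume "k:I" "v:S"
 thus "EX D. DERIV (%t. g (v(k := t))) (v k) :> D"
  using has_pd_cong[OF assms(1), of k v f g] assms(2) assms(3)[unfolded pdiff_def field_differentiable_def, THEN bspec, THEN bspec, of k v] by simp
qed

text \<open>A mean value argument, one coordinate at a time.\<close>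

lemma chain_curve:
 fixes ga :: "real=>'j=>real"
 assumes fin: "finite J" and T: "opn J T"
  and d: "pdiff J T f" and c: "!!j. j:J ==> cont T (pd j f)"
  and ga: "!!j. j:J ==> DERIV (%t. ga t j) t0 :> ga' j"
  and ev: "\<forall>\<^sub>F t in nhds t0. ga t:T" shows "DERIV (%t. f (ga t)) t0 :> (SUM j:J. pd j f (ga t0)*ga' j)"
proof -
 let ?v = "ga t0"
 have vT: "?v:T" using ev eventually_nhds_x_imp_x by blast
 hence vR: "?v:Rn J" using opn_subset[OF T] by auto
 obtain e where e: "e > 0" "!!w. w:Rn J ==> (ALL k:J. \<bar>w k - ?v k\<bar> < e) ==> w:T" using opn_box[OF fin T vT] by blast
 have near: "\<forall>\<^sub>F t in nhds t0. ALL j:J. \<bar>ga t j - ?v j\<bar> < r" if "r > 0" for r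
 proof (intro eventually_ball_finite fin ballI)
  fix j assume "j:J"
  hence "((%t. ga t j) \<longlongrightarrow> ?v j) (nhds t0)" using ga DERIV_isCont isCont_def tendsto_at_iff_tendsto_nhds by (metis (no_types, lifting))
  thus "\<forall>\<^sub>F t in nhds t0. \<bar>ga t j - ?v j\<bar> < r" using that by (auto dest!: tendstoD simp: dist_real_def)
 qed
 \<comment> \<open>\<open>P K t\<close> moves only the coordinates in \<open>K\<close> along the
   curve and keeps the rest at time \<open>t0\<close>; the induction over \<open>K\<close> releases
   one coordinate at a time.\<close>
 define P where "P K t = (%j. if j:K then ga t j else ?v j)" for K t
 have "DERIV (%t. f (P K t)) t0 :> (SUM j:K. pd j f ?v * ga' j)" if "finite K" "K <= J" for K using that
 proof (induction K rule: finite_induct)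
  case empty
  thus ?case by (simp add: P_def)
 next
  case (insert j K)
  hence j: "j:J" and K: "K <= J" by auto
  let ?D = "%t. f (P (insert j K) t) - f (P K t)"
  have upd: "P (insert j K) t = (P K t)(j := ga t j)" "P K t = (P K t)(j := ?v j)" for t using insert by (auto simp: P_def fun_eq_iff)
  have PR: "P K t:Rn J" for t using vR K by (auto simp: P_def PiE_def extensional_def)
  \<comment> \<open>\<open>xx\<close> is a mean value point in direction \<open>j\<close>. It lies
    between the old and the new coordinate, so \<open>q\<close> below tends to \<open>pd j f\<close>
    at \<open>ga t0\<close> by continuity.\<close>
  define good where "good t xx \<longleftrightarrow> \<bar>xx - ?v j\<bar> <= \<bar>ga t j - ?v j\<bar> & (P K t)(j := xx):T &
    ?D t = (ga t j - ?v j)*pd j f ((P K t)(j := xx))" for t xx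
  have ex: "\<forall>\<^sub>F t in nhds t0. EX xx. good t xx" using near[OF e(1)]
  proof eventually_elim
   case (elim t)
   have inT: "(P K t)(j := y):T" if "\<bar>y - ?v j\<bar> <= \<bar>ga t j - ?v j\<bar>" for y using elim that j by (intro e(2) upd_Rn PR) (force simp: P_def e(1))+
   have der: "DERIV (%y. f ((P K t)(j := y))) y :> pd j f ((P K t)(j := y))" if "\<bar>y - ?v j\<bar> <= \<bar>ga t j - ?v j\<bar>" for y
    using pdiffD[OF d j inT[OF that]] by simp
   consider "ga t j = ?v j" | "ga t j > ?v j" | "ga t j < ?v j" by linarith
   thus ?case
   proof cases
    case 1
    thus ?thesis using upd(1)[of t] upd(2)[of t, symmetric] inT[of "?v j"] by (auto simp: good_def intro!: exI[of _ "?v j"])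
   next
    case 2
    then obtain z where z: "z > ?v j" "z < ga t j" "f ((P K t)(j := ga t j)) - f ((P K t)(j := ?v j)) = (ga t j - ?v j)*pd j f ((P K t)(j := z))"
     using MVT2[OF 2, of "%y. f ((P K t)(j := y))" "%y. pd j f ((P K t)(j := y))"] der by auto
    moreover from z have "\<bar>z - ?v j\<bar> <= \<bar>ga t j - ?v j\<bar>" by auto
    ultimately show ?thesis using upd(1)[of t] upd(2)[of t, symmetric] inT[of z] unfolding good_def by (intro exI[of _ z]) auto
   next
    case 3
    then obtain z where z: "z < ?v j" "z > ga t j" "f ((P K t)(j := ?v j)) - f ((P K t)(j := ga t j)) = (?v j - ga t j)*pd j f ((P K t)(j := z))"
     using MVT2[OF 3, of "%y. f ((P K t)(j := y))" "%y. pd j f ((P K t)(j := y))"] der by auto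
    moreover from z have "\<bar>z - ?v j\<bar> <= \<bar>ga t j - ?v j\<bar>" by auto
    ultimately show ?thesis using upd(1)[of t] upd(2)[of t, symmetric] inT[of z] unfolding good_def by (intro exI[of _ z]) (auto simp: alg)
   qed
  qed
  define xi where "xi t = (SOME xx. good t xx)" for t
  have xi: "EX xx. good t xx ==> good t (xi t)" for t unfolding xi_def by (rule someI_ex)
  define q where "q t = pd j f ((P K t)(j := xi t))" for t
  have qlim: "(q \<longlongrightarrow> pd j f ?v) (at t0)"
  proof (rule tendstoI)
   fix r :: real assume "r > 0"
   then obtain dd where dd: "dd > 0" "!!w. w:T ==> (ALL k:J. \<bar>w k - ?v k\<bar> < dd) ==> \<bar>pd j f w - pd j f ?v\<bar> < r"
    using continuous_on_box[OF fin opn_subset[OF T] c[OF j] vT] by metis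
   have "\<forall>\<^sub>F t in nhds t0. dist (q t) (pd j f ?v) < r" using near[OF dd(1)] ex
   proof eventually_elim
    case (elim t)
    have g: "good t (xi t)" using elim(2) by (rule xi)
    show ?case unfolding q_def dist_real_def
    proof (rule dd(2))
     show "(P K t)(j := xi t):T" using g unfolding good_def by blast
     show "ALL k:J. \<bar>((P K t)(j := xi t)) k - ?v k\<bar> < dd"
     proof
      fix k assume k: "k:J"
      have "\<bar>xi t - ?v j\<bar> < dd" using g elim(1) j unfolding good_def by fastforce
      thus "\<bar>((P K t)(j := xi t)) k - ?v k\<bar> < dd" using elim(1) k dd(1) by (auto simp: P_def)
     qed
    qed
   qed
   thus "\<forall>\<^sub>F t in at t0. dist (q t) (pd j f ?v) < r" using eventually_nhds_conv_at by blast
  qed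
  have "DERIV (%t. ?D t) t0 :> pd j f ?v * ga' j" unfolding has_field_derivative_iff
  proof (rule Lim_transform_eventually)
   show "((%t. q t*((ga t j - ?v j)/(t - t0))) \<longlongrightarrow> pd j f ?v * ga' j) (at t0)"
    using ga[OF j] by (intro tendsto_mult qlim) (simp add: has_field_derivative_iff)
   have D0: "?D t0 = 0" using upd[of t0] by simp
   have "\<forall>\<^sub>F t in at t0. EX xx. good t xx" using ex eventually_nhds_conv_at by blast
   thus "\<forall>\<^sub>F t in at t0. q t*((ga t j - ?v j)/(t - t0)) = (?D t - ?D t0)/(t - t0)"
   proof eventually_elim
    case (elim t)
    hence "?D t = (ga t j - ?v j)*q t" using xi unfolding good_def q_def by blast
    thus ?case unfolding D0 by simp
   qed
  qed
  from DERIV_add[OF this insert.IH[OF K]] show ?case using insert by simp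
 qed
 from this[OF fin] have "DERIV (%t. f (P J t)) t0 :> (SUM j:J. pd j f ?v * ga' j)" by simp
 moreover have "\<forall>\<^sub>F t in nhds t0. f (P J t) = f (ga t)" using ev
 proof eventually_elim
  case (elim t)
  hence "P J t = ga t" using opn_subset[OF T] vR unfolding P_def by (auto simp: fun_eq_iff PiE_def extensional_def)
  thus ?case by simp
 qed
 ultimately show ?thesis using DERIV_cong_ev[OF refl _ refl, of "%t. f (P J t)" "%t. f (ga t)" t0] by blast
qed

lemma pd_const: "pd k (%_. c) v = 0" unfolding pd_def by simp

text \<open>\<open>smooth_on\<close> quantifies over all iterated derivatives. A class of
  continuous, partially differentiable functions that contains its own partial derivatives certifies
  them all at once. Agreement on \<open>S\<close> suffices, because \<open>S\<close> is open and
  \<open>pd\<close> sees only nearby values.\<close>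

lemma smooth_on_coinduct:
 assumes S: "opn I S" and f: "X f"
  and step: "!!f. X f ==> cont S f & pdiff I S f & (ALL k:I. EX g. X g & (ALL v:S. pd k f v = g v))" shows "smooth_on I S f"
proof -
 have "EX g. X g & (ALL v:S. foldr pd ks f v = g v)" if "set ks <= I" for ks using that
 proof (induction ks)
  case Nil
  thus ?case using f by auto
 next
  case (Cons k ks)
  then obtain g where g: "X g" "ALL v:S. foldr pd ks f v = g v" by auto
  obtain g' where g': "X g'" "ALL v:S. pd k g v = g' v" using step[OF g(1)] Cons.prems by auto
  have "ALL v:S. pd k (foldr pd ks f) v = g' v" using pd_cong[OF S, of k _ "foldr pd ks f" g] g(2) g'(2) Cons.prems by auto
  thus ?case using g'(1) by auto
 qed
 thus ?thesis unfolding smooth_on_iff[OF opn_subset[OF S]]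
 proof (intro allI impI)
  fix ks assume "!!ks. set ks <= I ==> EX g. X g & (ALL v:S. foldr pd ks f v = g v)" "set ks <= I"
  then obtain g where g: "X g" "ALL v:S. foldr pd ks f v = g v" by blast
  thus "cont S (foldr pd ks f) & pdiff I S (foldr pd ks f)" using step[OF g(1)] pdiff_cong[OF S, of g] continuous_on_cong[of S S "foldr pd ks f" g] by simp
 qed
qed

text \<open>The class fed to \<open>smooth_on_coinduct\<close>. In \<open>comp1\<close> the whole
  sequence \<open>D\<close> of derivatives is carried along, so that differentiating only shifts the
  index; derivatives within \<open>R\<close> admit functions on a closed interval.\<close>

inductive cl :: "'k set=>('k=>real) set=>'j set=>('j=>real) set=>(('k=>real)=>'j=>real)=>(('k=>real)=>real)=>bool" for I S J T F where
  base: "smooth_on I S f ==> cl I S J T F f"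
 | const: "cl I S J T F (%_. c)"
 | add: "cl I S J T F f ==> cl I S J T F g ==> cl I S J T F (%v. f v + g v)"
 | mult: "cl I S J T F f ==> cl I S J T F g ==> cl I S J T F (%v. f v * g v)"
 | comp1: "cl I S J T F f ==> (ALL v:S. f v:R) ==> (ALL k. ALL t:R. (D k has_real_derivative D (Suc k) t) (at t within R)) ==> cl I S J T F (%v. D (k::nat) (f v))"
 | comp: "smooth_on J T f ==> cl I S J T F (%v. f (F v))"

text \<open>A coordinate line through \<open>v\<close> stays in the open set \<open>S\<close> for a
  while, so \<open>f\<close> maps it into \<open>R\<close>, and a derivative of \<open>D\<close>
  within \<open>R\<close> is enough for the chain rule.\<close>

lemma has_pd_within:
 assumes "opn I S" "k:I" "v:S" "ALL w:S. f w:R"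
  "(D has_real_derivative d) (at (f v) within R)"
  "DERIV (%t. f (v(k := t))) (v k) :> e" shows "DERIV (%t. D (f (v(k := t)))) (v k) :> d*e"
proof -
 let ?L = "{t. v(k := t):S}"
 have L: "open ?L" "v k:?L" using open_line[OF assms(1,2)] opn_subset[OF assms(1)] assms(3) by auto
 have "((%t. f (v(k := t))) has_real_derivative e) (at (v k) within ?L)" using assms(6) has_field_derivative_at_within by blast
 moreover have "(D has_real_derivative d) (at (f (v(k := v k))) within (%t. f (v(k := t))) ` ?L)" using assms(4,5) by (auto intro: has_field_derivative_subset)
 ultimately have "((%t. D (f (v(k := t)))) has_real_derivative d*e) (at (v k) within ?L)"
  using DERIV_image_chain[of D d "%t. f (v(k := t))" "v k" ?L e] by (simp add: o_def)
 thus ?thesis using at_within_open[OF L(2,1)] by simp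
qed

context
 fixes I :: "'k set" and S and J :: "'j set" and T and F
 assumes S: "opn I S" and J: "finite J" and T: "opn J T"
  and F: "!!v. v:S ==> F v:T" and sF: "!!j. j:J ==> smooth_on I S (%v. F v j)"
begin

lemma has_pd_comp:
 assumes "smooth_on J T f" "k:I" "v:S" shows "DERIV (%t. f (F (v(k := t)))) (v k) :> (SUM j:J. pd j f (F v)*pd k (%v. F v j) v)"
proof -
 have T': "T <= Rn J" and S': "S <= Rn I" using T S opn_subset by auto
 have "DERIV (%t. f (F (v(k := t)))) (v k) :> (SUM j:J. pd j f (F (v(k := v k)))*pd k (%v. F v j) v)"
 proof (rule chain_curve[OF J T])
  show "pdiff J T f" by (rule smooth_on_pdiff[OF assms(1) T'])
  show "cont T (pd j f)" if "j:J" for j by (rule smooth_on_cont[OF smooth_on_pd[OF assms(1) that] T'])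
  show "DERIV (%t. F (v(k := t)) j) (v k) :> pd k (%v. F v j) v" if "j:J" for j by (rule pdiffD[OF smooth_on_pdiff[OF sF[OF that] S'] assms(2,3)])
  show "\<forall>\<^sub>F t in nhds (v k). F (v(k := t)):T" using eventually_line[OF S assms(2,3)] by eventually_elim (rule F)
 qed
 thus ?thesis by simp
qed

abbreviation "cD f == pdiff I S f & (ALL k:I. EX g. cl I S J T F g & (ALL v:S. pd k f v = g v))"
abbreviation "cE k f == EX g. cl I S J T F g & (ALL v:S. DERIV (%t. f (v(k := t))) (v k) :> g v)"

lemma cl_step:
 assumes "cl I S J T F f" shows "cont S f & cD f"
proof -
 have T': "T <= Rn J" and S': "S <= Rn I" using T S opn_subset by auto
 have *: "cD f"
  if ex: "!!k. k:I ==> cE k f" for f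
 proof (intro conjI ballI)
  show "pdiff I S f" using ex unfolding pdiff_def field_differentiable_def by blast
  fix k assume "k:I"
  then obtain g where "cl I S J T F g" "ALL v:S. DERIV (%t. f (v(k := t))) (v k) :> g v" using ex by blast
  thus "EX g. cl I S J T F g & (ALL v:S. pd k f v = g v)" using pd_eqI[of f _ k] by blast
 qed
 show ?thesis using assms
 proof (induction f rule: cl.induct)
  case (base f)
  thus ?case using smooth_on_cont[OF base S'] smooth_on_pdiff[OF base S'] smooth_on_pd[OF base] cl.base by blast
 next
  case (const c)
  have "cD (%_. c)"
  proof (rule *)
   fix k show "cE k (%v. c)" by (rule exI[of _ "%_. 0"]) (auto intro: cl.const)
  qed
  thus ?case by auto
 next
  case (add f g)
  have "cD (%v. f v + g v)"
  proof (rule *)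
   fix k assume k: "k:I"
   obtain f' g' where 1: "cl I S J T F f'" "ALL v:S. pd k f v = f' v" "cl I S J T F g'" "ALL v:S. pd k g v = g' v" using add.IH k by meson
   have "DERIV (%t. f (v(k := t)) + g (v(k := t))) (v k) :> f' v + g' v" if "v:S" for v
    using DERIV_add[OF pdiffD[of I S f k v] pdiffD[of I S g k v]] add.IH k that 1 by auto
   thus "cE k (%v. f v + g v)" using cl.add[OF 1(1,3)] by blast
  qed
  thus ?case using add.IH continuous_on_add by blast
 next
  case (mult f g)
  have "cD (%v. f v * g v)"
  proof (rule *)
   fix k assume k: "k:I"
   obtain f' g' where 1: "cl I S J T F f'" "ALL v:S. pd k f v = f' v" "cl I S J T F g'" "ALL v:S. pd k g v = g' v" using mult.IH k by meson
   have "DERIV (%t. f (v(k := t))*g (v(k := t))) (v k) :> f' v * g v + g' v * f v" if "v:S" for v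
    using DERIV_mult[OF pdiffD[of I S f k v] pdiffD[of I S g k v]] mult.IH k that 1 by auto
   thus "EX h. cl I S J T F h & (ALL v:S. DERIV (%t. f (v(k := t))*g (v(k := t))) (v k) :> h v)"
    using cl.add[OF cl.mult[OF 1(1) mult.hyps(2)] cl.mult[OF 1(3) mult.hyps(1)]] by blast
  qed
  thus ?case using mult.IH continuous_on_mult by blast
 next
  case (comp1 f R D n)
  have "cD (%v. D n (f v))"
  proof (rule *)
   fix k assume k: "k:I"
   obtain f' where 1: "cl I S J T F f'" "ALL v:S. pd k f v = f' v" using comp1.IH k by meson
   have "DERIV (%t. D n (f (v(k := t)))) (v k) :> D (Suc n) (f v)*f' v" if "v:S" for v
   proof (rule has_pd_within[OF S k that, where f = f and D = "D n" and R = R])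
    show "ALL v:S. f v:R" "(D n has_real_derivative D (Suc n) (f v)) (at (f v) within R)" using comp1.hyps that by auto
    show "DERIV (%t. f (v(k := t))) (v k) :> f' v" using pdiffD[of I S f k v] comp1.IH k that 1 by auto
   qed
   thus "cE k (%v. D n (f v))" using cl.mult[OF cl.comp1[OF comp1.hyps, of "Suc n"] 1(1)] by blast
  qed
  moreover have "cont R (D n)" using comp1.hyps by (auto intro: DERIV_continuous_on)
  hence "cont S (%v. D n (f v))" using comp1 by (auto intro: continuous_on_compose2)
  ultimately show ?case by blast
 next
  case (comp f)
  have clF: "cl I S J T F (%v. SUM j:K. pd j f (F v)*pd k (%v. F v j) v)" if "k:I" "finite K" "K <= J" for k K using that(2,3)
  proof (induction K rule: finite_induct)
   case empty
   thus ?case using cl.const[of I S J T F 0] by simp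
  next
   case (insert j K)
   hence "cl I S J T F (%v. pd j f (F v))" "cl I S J T F (pd k (%v. F v j))" using cl.comp[OF smooth_on_pd[OF comp]] cl.base[OF smooth_on_pd[OF sF that(1)]] by auto
   from cl.add[OF cl.mult[OF this] insert.IH] show ?case using insert by simp
  qed
  have "cD (%v. f (F v))"
   by (rule *) (use clF[OF _ J order_refl] has_pd_comp[OF comp] in blast)
  moreover have "cont S (%v. f (F v))"
  proof (rule continuous_on_compose2[OF smooth_on_cont[OF comp T']])
   show "cont S F"
   proof (rule continuous_on_coordinatewise_then_product)
    fix j
    show "cont S (%v. F v j)"
    proof (cases "j:J")
     case True
     thus ?thesis using smooth_on_cont[OF sF S'] by blast
    next
     case False
     hence "cont S (%v. F v j) = cont S (%v. undefined::real)" using F T' by (intro continuous_on_cong) (auto simp: PiE_def extensional_def)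
     thus ?thesis by simp
    qed
   qed
  qed (use F in auto)
  ultimately show ?case by blast
 qed
qed

lemma cl_smooth: "cl I S J T F f ==> smooth_on I S f" using smooth_on_coinduct[OF S, of "cl I S J T F"] cl_step by blast

lemma smooth_comp: "smooth_on J T f ==> smooth_on I S (%v. f (F v))" by (rule cl_smooth[OF cl.comp])

lemma pd_comp: "smooth_on J T f ==> k:I ==> v:S ==> pd k (%v. f (F v)) v = (SUM j:J. pd j f (F v)*pd k (%v. F v j) v)" by (rule pd_eqI[OF has_pd_comp])

end

text \<open>An empty index set \<open>J\<close> makes the inner map \<open>F\<close> trivial and
  leaves the closure rules on \<open>S\<close> alone.\<close>

lemmas cl_smooth0 = cl_smooth[where J = "{}" and T = "{%_. undefined}" and F = "%_ _. undefined", simplified]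

context
 fixes I :: "'k set" and S
 assumes S: "opn I S"
begin

lemma smooth_const: "smooth_on I S (%_. c)" by (rule cl_smooth0[OF S cl.const])

lemma smooth_add: "smooth_on I S f ==> smooth_on I S g ==> smooth_on I S (%v. f v + g v)" by (rule cl_smooth0[OF S cl.add[OF cl.base cl.base]])

lemma smooth_mult: "smooth_on I S f ==> smooth_on I S g ==> smooth_on I S (%v. f v * g v)" by (rule cl_smooth0[OF S cl.mult[OF cl.base cl.base]])

lemma smooth_minus: "smooth_on I S f ==> smooth_on I S (%v. - f v)" using smooth_mult[OF smooth_const[of "-1"]] by simp

lemma smooth_diff: "smooth_on I S f ==> smooth_on I S g ==> smooth_on I S (%v. f v - g v)" using smooth_add[OF _ smooth_minus] by simp

lemma smooth_sum: "(!!a. a:A ==> smooth_on I S (f a)) ==> smooth_on I S (%v. SUM a:A. f a v)"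
 by (induction A rule: infinite_finite_induct) (auto intro: smooth_const smooth_add)

lemma smooth_prod: "(!!a. a:A ==> smooth_on I S (f a)) ==> smooth_on I S (%v. PROD a:A. f a v)"
 by (induction A rule: infinite_finite_induct) (auto intro: smooth_const smooth_mult)

lemma smooth_comp1:
 assumes "smooth_on I S f" "!!v. v:S ==> f v:R"
  "!!k t. t:R ==> (D k has_real_derivative D (Suc k) t) (at t within R)" shows "smooth_on I S (%v. D (k::nat) (f v))"
 by (rule cl_smooth0[OF S cl.comp1[OF cl.base[OF assms(1)], where R = R]]) (use assms in auto)

lemma smooth_inverse:
 assumes "smooth_on I S f" "!!v. v:S ==> f v ~= 0" shows "smooth_on I S (%v. inverse (f v))"
proof -
 define D where "D k t = (-1)^k*fact k*inverse t^Suc k" for k and t :: real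
 have "(D k has_real_derivative D (Suc k) t) (at t within -{0})" if "t:-{0}" for k t unfolding D_def using that
  by (auto intro!: derivative_eq_intros simp: alg simp flip: power_Suc)
   (simp add: alg power_Suc)
 from smooth_comp1[OF assms(1), of "-{0}" D 0, OF _ this] assms(2) show ?thesis by (simp add: D_def)
qed

lemma smooth_divide:
 "smooth_on I S f ==> smooth_on I S g ==> (!!v. v:S ==> g v ~= 0) ==> smooth_on I S (%v. f v/g v)" unfolding divide_inverse by (intro smooth_mult smooth_inverse)

lemma smooth_cong: "(!!v. v:S ==> f v = g v) ==> smooth_on I S f ==> smooth_on I S g"
proof (rule smooth_on_coinduct[OF S, of "%g. EX f. smooth_on I S f & (ALL v:S. f v = g v)"])
 fix g assume "EX f. smooth_on I S f & (ALL v:S. f v = g v)"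
 then obtain f where f: "smooth_on I S f" "!!v. v:S ==> f v = g v" by blast
 have S': "S <= Rn I" by (rule opn_subset[OF S])
 have "cont S g" using smooth_on_cont[OF f(1) S'] continuous_on_cong[of S S f g] f(2) by simp
 moreover have "pdiff I S g" by (rule pdiff_cong[OF S f(2) smooth_on_pdiff[OF f(1) S']])
 moreover have "EX f. smooth_on I S f & (ALL v:S. f v = pd k g v)" if "k:I" for k
  by (rule exI[of _ "pd k f"]) (use pd_cong[OF S that, of _ f g] f(2) smooth_on_pd[OF f(1) that] in auto)
 ultimately show "cont S g & pdiff I S g &
   (ALL k:I. EX h. (EX f. smooth_on I S f & (ALL v:S. f v = h v)) & (ALL v:S. pd k g v = h v))"
 proof (intro conjI ballI)
  fix k assume "k:I"
  then obtain f' where "smooth_on I S f'" "ALL v:S. f' v = pd k g v" using \<open>!!k. k:I ==> EX f. smooth_on I S f & (ALL v:S. f v = pd k g v)\<close> by blast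
  thus "EX h. (EX f. smooth_on I S f & (ALL v:S. f v = h v)) & (ALL v:S. pd k g v = h v)" by (intro exI[of _ "pd k g"] exI[of _ f'] conjI ballI refl) auto
 qed
qed blast

lemma has_pd: "smooth_on I S f ==> k:I ==> v:S ==> DERIV (%t. f (v(k := t))) (v k) :> pd k f v" using pdiffD smooth_on_pdiff opn_subset[OF S] by metis

lemma pd_add: "smooth_on I S f ==> smooth_on I S g ==> k:I ==> v:S ==> pd k (%v. f v + g v) v = pd k f v + pd k g v" by (rule pd_eqI) (intro DERIV_add has_pd)

lemma pd_minus: "smooth_on I S f ==> k:I ==> v:S ==> pd k (%v. - f v) v = - pd k f v" by (rule pd_eqI) (intro DERIV_minus has_pd)

lemma pd_mult: "smooth_on I S f ==> smooth_on I S g ==> k:I ==> v:S ==> pd k (%v. f v * g v) v = pd k f v * g v + f v * pd k g v"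
 by (rule pd_eqI) (use DERIV_mult[OF has_pd[of f k v] has_pd[of g k v]] in \<open>auto simp: alg\<close>)

lemma pd_sum: "(!!a. a:A ==> smooth_on I S (f a)) ==> k:I ==> v:S ==> pd k (%v. SUM a:A. f a v) v = (SUM a:A. pd k (f a) v)" by (rule pd_eqI) (intro DERIV_sum has_pd)

lemma smooth_subset: "smooth_on I S f ==> S' <= S ==> smooth_on I S' f" unfolding smooth_on_def by (meson continuous_map_from_subtopology_mono subsetD)

end

context
 fixes I :: "'k set" and S
 assumes fin: "finite I" and S: "opn I S"
begin

text \<open>The mean value theorem is applied in direction \<open>i\<close> to the difference of
  \<open>f\<close> in direction \<open>j\<close>, then in direction \<open>j\<close> to
  \<open>pd i f\<close>.\<close>

lemma second_difference:
 assumes f: "smooth_on I S f" and ij: "i:I" "j:I" "i ~= j" and r: "0 < r"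
  and box: "!!s t. \<bar>s - v i\<bar> <= r ==> \<bar>t - v j\<bar> <= r ==> v(i := s, j := t):S" shows "EX xx et. \<bar>xx - v i\<bar> <= r & \<bar>et - v j\<bar> <= r &
  f (v(i := v i + r, j := v j + r)) - f (v(i := v i + r, j := v j)) - f (v(i := v i, j := v j + r)) + f (v(i := v i, j := v j))
  = r*r*pd j (pd i f) (v(i := xx, j := et))"
proof -
 let ?P = "%s t. v(i := s, j := t)"
 have di: "DERIV (%s. f (?P s t)) s :> pd i f (?P s t)" if "\<bar>s - v i\<bar> <= r" "\<bar>t - v j\<bar> <= r" for s t
  using has_pd[OF S f ij(1) box[OF that]] ij by (simp add: fun_upd_twist)
 have dj: "DERIV (%t. pd i f (?P s t)) t :> pd j (pd i f) (?P s t)" if "\<bar>s - v i\<bar> <= r" "\<bar>t - v j\<bar> <= r" for s t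
  using has_pd[OF S smooth_on_pd[OF f ij(1)] ij(2) box[OF that]] ij by simp
 have d1: "DERIV (%s. f (?P s (v j + r)) - f (?P s (v j))) s :> pd i f (?P s (v j + r)) - pd i f (?P s (v j))" if "v i <= s" "s <= v i + r" for s
  using that r by (intro DERIV_diff di) auto
 obtain xx where xx: "v i < xx" "xx < v i + r"
  "(f (?P (v i + r) (v j + r)) - f (?P (v i + r) (v j))) - (f (?P (v i) (v j + r)) - f (?P (v i) (v j)))
   = (v i + r - v i)*(pd i f (?P xx (v j + r)) - pd i f (?P xx (v j)))" using MVT2[OF _ d1] r by (metis (no_types, lifting) less_add_same_cancel1)
 have d2: "DERIV (%t. pd i f (?P xx t)) t :> pd j (pd i f) (?P xx t)" if "v j <= t" "t <= v j + r" for t using that r xx(1,2) by (intro dj) auto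
 obtain et where et: "v j < et" "et < v j + r"
  "pd i f (?P xx (v j + r)) - pd i f (?P xx (v j)) = (v j + r - v j)*pd j (pd i f) (?P xx et)" using MVT2[OF _ d2] r by (metis (no_types, lifting) less_add_same_cancel1)
 show ?thesis using xx et by (intro exI[of _ xx] exI[of _ et]) (auto simp: alg)
qed

text \<open>Schwarz: the same second difference over a square of side \<open>r\<close> is
  \<open>r * r\<close> times either mixed derivative at some point of the square, and both mixed
  derivatives are continuous.\<close>

lemma pd_swap:
 assumes f: "smooth_on I S f" and ij: "i:I" "j:I" and v: "v:S" shows "pd i (pd j f) v = pd j (pd i f) v"
proof (cases "i = j")
 case False
 let ?L = "pd j (pd i f) v" and ?M = "pd i (pd j f) v"
 have S': "S <= Rn I" by (rule opn_subset[OF S])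
 have "\<bar>?M - ?L\<bar> <= 2*e" if e: "e > 0" for e
 proof -
  have c: "cont S (pd j (pd i f))" "cont S (pd i (pd j f))" using smooth_on_cont[OF smooth_on_pd[OF smooth_on_pd[OF f]] S'] ij by auto
  obtain d0 where d0: "d0 > 0" "!!w. w:Rn I ==> (ALL k:I. \<bar>w k - v k\<bar> < d0) ==> w:S" using opn_box[OF fin S v] by blast
  obtain d1 where d1: "d1 > 0" "!!w. w:S ==> (ALL k:I. \<bar>w k - v k\<bar> < d1) ==> \<bar>pd j (pd i f) w - ?L\<bar> < e"
   using continuous_on_box[OF fin S' c(1) v e] by blast
  obtain d2 where d2: "d2 > 0" "!!w. w:S ==> (ALL k:I. \<bar>w k - v k\<bar> < d2) ==> \<bar>pd i (pd j f) w - ?M\<bar> < e"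
   using continuous_on_box[OF fin S' c(2) v e] by blast
  define r where "r = min d0 (min d1 d2)/2"
  have r: "0 < r" "r < d0" "r < d1" "r < d2" using d0(1) d1(1) d2(1) by (auto simp: r_def)
  have R: "v(i := s, j := t):Rn I" for s t using v S' ij by (intro upd_Rn) auto
  have near: "\<bar>(v(i := s, j := t)) k - v k\<bar> < d" if "\<bar>s - v i\<bar> <= r" "\<bar>t - v j\<bar> <= r" "r < d" for s t d k using that r(1) by auto
  have box: "v(i := s, j := t):S" if "\<bar>s - v i\<bar> <= r" "\<bar>t - v j\<bar> <= r" for s t using near[OF that r(2)] by (intro d0(2) R) blast
  have tw: "v(j := t, i := s) = v(i := s, j := t)" for s t using False by (rule fun_upd_twist[symmetric])
  obtain x y where 1: "\<bar>x - v i\<bar> <= r" "\<bar>y - v j\<bar> <= r"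
    "f (v(i := v i + r, j := v j + r)) - f (v(i := v i + r, j := v j)) - f (v(i := v i, j := v j + r)) + f (v(i := v i, j := v j))
     = r*r*pd j (pd i f) (v(i := x, j := y))" using second_difference[OF f ij False r(1) box] by blast
  obtain x' y' where 2: "\<bar>x' - v i\<bar> <= r" "\<bar>y' - v j\<bar> <= r"
    "f (v(i := v i + r, j := v j + r)) - f (v(i := v i, j := v j + r)) - f (v(i := v i + r, j := v j)) + f (v(i := v i, j := v j))
     = r*r*pd i (pd j f) (v(i := x', j := y'))" using second_difference[OF f ij(2,1) False[symmetric] r(1), of v] box unfolding tw by blast
  have "r*r*pd j (pd i f) (v(i := x, j := y)) = r*r*pd i (pd j f) (v(i := x', j := y'))" using 1(3) 2(3) by linarith
  hence "pd j (pd i f) (v(i := x, j := y)) = pd i (pd j f) (v(i := x', j := y'))" using r(1) by simp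
  moreover have "\<bar>pd j (pd i f) (v(i := x, j := y)) - ?L\<bar> < e" using near[OF 1(1,2) r(3)] by (intro d1(2) box 1) blast
  moreover have "\<bar>pd i (pd j f) (v(i := x', j := y')) - ?M\<bar> < e" using near[OF 2(1,2) r(4)] by (intro d2(2) box 2) blast
  ultimately show ?thesis by linarith
 qed
 from this[of "\<bar>?M - ?L\<bar>/4"] show ?thesis by (cases "?M = ?L") auto
qed simp

end

section \<open>Inverses of positive definite matrix functions\<close>

definition posdef :: "'k set=>('k=>'k=>real)=>bool" where
 "posdef I G = ((ALL i:I. ALL j:I. G i j = G j i) & (ALL u. (EX i:I. u i ~= 0) --> (SUM i:I. SUM j:I. G i j*u i*u j) > 0))"

lemma minv_right:
 assumes "EX H. ALL i:I. ALL j:I. (SUM l:I. G i l*H l j) = (if i = j then 1 else 0 :: real)" "i:I" "j:I" shows "(SUM l:I. G i l*minv I G l j) = (if i = j then 1 else 0)"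
 using someI_ex[OF assms(1)] assms(2,3) unfolding minv_def by blast

context
 fixes I :: "'k set"
 assumes fin: "finite I"
begin

lemma sum_dm: "i:I ==> (SUM l:I. (if i = l then 1 else 0)*f l) = (f i :: real)"
 "i:I ==> (SUM l:I. (if l = i then 1 else 0)*f l) = f i"
 "i:I ==> (SUM l:I. f l*(if i = l then 1 else 0)) = f i"
 "i:I ==> (SUM l:I. f l*(if l = i then 1 else 0)) = f i" using fin by (simp_all add: if_distrib if_distribR cong: if_cong)

text \<open>In matrix form \<open>H^T = H^T (G K) = (G H)^T K = K\<close> for symmetric
  \<open>G\<close>. With \<open>K = H\<close> this is the symmetry of the inverse, and the two
  together give uniqueness.\<close>

lemma right_inverse_unique:
 assumes sym: "!!i j. i:I ==> j:I ==> G i j = (G j i :: real)"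
  and H: "!!i j. i:I ==> j:I ==> (SUM l:I. G i l*H l j) = (if i = j then 1 else 0)"
  and K: "!!i j. i:I ==> j:I ==> (SUM l:I. G i l*K l j) = (if i = j then 1 else 0)"
  and ij: "i:I" "j:I" shows "H j i = K i j"
proof -
 have "H j i = (SUM k:I. H k i*(SUM l:I. G k l*K l j))" using ij by (simp add: K sum_dm)
 also have "... = (SUM k:I. SUM l:I. H k i*G k l*K l j)" by (simp add: sdl mult.assoc)
 also have "... = (SUM l:I. SUM k:I. H k i*G k l*K l j)" by (rule sum.swap)
 also have "... = (SUM l:I. (SUM k:I. G l k*H k i)*K l j)" unfolding sdr by (intro scr) (simp add: sym mult.commute)
 also have "... = K i j" using ij by (simp add: H sum_dm)
 finally show ?thesis .
qed

end

context
 fixes I :: "'k set" and S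
 assumes fin: "finite I" and S: "opn I S"
begin

text \<open>The point is smooth dependence on \<open>v\<close>, which adjugate over determinant
  shows. The determinant is nonzero because a null vector would annihilate the positive quadratic
  form. A bijection numbers the rows so that determinants of matrices apply.\<close>

lemma cramer:
 fixes G :: "('k=>real)=>'k=>'k=>real"
 assumes sm: "!!i j. i:I ==> j:I ==> smooth_on I S (%v. G v i j)"
  and pos: "!!v. v:S ==> posdef I (G v)" shows "EX H. (ALL i:I. ALL j:I. smooth_on I S (%v. H v i j)) &
  (ALL v:S. ALL i:I. ALL j:I. (SUM l:I. G v i l*H v l j) = (if i = j then 1 else 0))"
proof -
 obtain f where f: "bij_betw f {0..<card I} I" using ex_bij_betw_nat_finite[OF fin] by blast
 define n where "n = card I"
 define f' where "f' = inv_into {0..<n} f"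
 have f'I: "i:I ==> f' i < n" "i:I ==> f (f' i) = i" for i using f bij_betw_inv_into[OF f] bij_betw_inv_into_right[OF f] unfolding f'_def n_def
  by (auto simp: bij_betw_def)
 have fI: "a < n ==> f a:I" "a < n ==> f' (f a) = a" for a using f bij_betw_inv_into_left[OF f] unfolding f'_def n_def by (auto simp: bij_betw_def)
 define A where "A v = mat n n (%(a, b). G v (f a) (f b))" for v
 have A: "A v:carrier_mat n n" for v by (simp add: A_def)
 have sdet: "smooth_on I S (%v. det (B v))" if "!!v. B v:carrier_mat k k" "!!a b. a < k ==> b < k ==> smooth_on I S (%v. B v $$ (a, b))" for B and k
  unfolding det_def'[OF that(1)] by (intro smooth_sum[OF S] smooth_mult[OF S] smooth_const[OF S] smooth_prod[OF S] that(2))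
   (auto dest: permutes_in_image)
 have sA: "smooth_on I S (%v. A v $$ (a, b))" if "a < n" "b < n" for a b using that sm fI by (simp add: A_def)
 have sadj: "smooth_on I S (%v. adj_mat (A v) $$ (a, b))" if "a < n" "b < n" for a b
 proof -
  have "smooth_on I S (%v. det (mat_delete (A v) b a))"
  proof (rule sdet)
   show "mat_delete (A v) b a:carrier_mat (n - 1) (n - 1)" for v using A by (rule mat_delete_carrier)
   show "smooth_on I S (%v. mat_delete (A v) b a $$ (a', b'))" if "a' < n - 1" "b' < n - 1" for a' b'
    using that \<open>a < n\<close> \<open>b < n\<close> sA by (auto simp: mat_delete_def A_def)
  qed
  thus ?thesis using that by (simp add: adj_mat_def cofactor_def A_def smooth_mult[OF S] smooth_const[OF S])
 qed
 have detA: "det (A v) ~= 0" if v: "v:S" for v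
 proof
  assume "det (A v) = 0"
  then obtain u where u: "u:carrier_vec n" "u ~= 0\<^sub>v n" "A v *\<^sub>v u = 0\<^sub>v n" using det_0_iff_vec_prod_zero[OF A] by blast
  define w where "w i = vec_index u (f' i)" for i
  obtain a where a: "a < n" "vec_index u a ~= 0" using u(1,2) by (auto simp: vec_eq_iff)
  have "EX i:I. w i ~= 0" using a fI[OF a(1)] by (auto simp: w_def intro!: bexI[of _ "f a"])
  hence gt: "(SUM i:I. SUM j:I. G v i j*w i*w j) > 0" using pos[OF v] unfolding posdef_def by blast
  have Gw: "(SUM j:I. G v i j*w j) = 0" (is "?L = _") if i: "i:I" for i
  proof -
   have "?L = (SUM b:{0..<n}. G v i (f b)*w (f b))" using f unfolding n_def by (intro sum.reindex_bij_betw[symmetric])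
   also have "... = vec_index (A v *\<^sub>v u) (f' i)" using f'I[OF i] u(1) fI by (auto simp: A_def scalar_prod_def w_def intro!: sum.cong)
   finally show ?thesis using u(3) f'I[OF i] by simp
  qed
  have "(SUM i:I. SUM j:I. G v i j*w i*w j) = 0"
  proof (rule sum.neutral, rule ballI)
   fix i assume "i:I"
   have "(SUM j:I. G v i j*w i*w j) = w i*(SUM j:I. G v i j*w j)" by (simp add: sdl mult_ac)
   thus "(SUM j:I. G v i j*w i*w j) = 0" using Gw[OF \<open>i:I\<close>] by simp
  qed
  with gt show False by simp
 qed
 define H where "H v i j = adj_mat (A v) $$ (f' i, f' j)/det (A v)" for v i j
 have "smooth_on I S (%v. H v i j)" if "i:I" "j:I" for i j unfolding H_def using that f'I detA A sA by (intro smooth_divide[OF S] sadj sdet) auto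
 moreover have "(SUM l:I. G v i l*H v l j) = (if i = j then 1 else 0)" (is "?L = _") if v: "v:S" and ij: "i:I" "j:I" for v i j
 proof -
  have "?L = (SUM b:{0..<n}. G v i (f b)*H v (f b) j)" using f unfolding n_def by (intro sum.reindex_bij_betw[symmetric])
  also have "... = (A v * adj_mat (A v)) $$ (f' i, f' j)/det (A v)" using f'I[OF ij(1)] f'I[OF ij(2)] fI adj_mat(1)[OF A, of v]
   by (auto simp: A_def H_def scalar_prod_def sum_divide_distrib intro!: sum.cong)
  also have "... = (if i = j then 1 else 0)"
  proof -
   have "(A v * adj_mat (A v)) $$ (f' i, f' j) = (if f' i = f' j then det (A v) else 0)" using f'I[OF ij(1)] f'I[OF ij(2)] by (simp add: adj_mat(2)[OF A])
   moreover have "f' i = f' j \<longleftrightarrow> i = j" using f'I(2)[OF ij(1)] f'I(2)[OF ij(2)] by metis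
   ultimately show ?thesis using detA[OF v] by simp
  qed
  finally show ?thesis .
 qed
 ultimately show ?thesis by blast
qed

text \<open>\<open>minv\<close> is chosen anew by \<open>SOME\<close> at every point; uniqueness of
  the inverse identifies it with the smooth matrix of \<open>cramer\<close>.\<close>

lemma minv_facts:
 fixes G :: "('k=>real)=>'k=>'k=>real"
 assumes sm: "!!i j. i:I ==> j:I ==> smooth_on I S (%v. G v i j)"
  and pos: "!!v. v:S ==> posdef I (G v)"
  and ij: "i:I" "j:I" shows "smooth_on I S (%v. minv I (G v) i j)" (is ?A)
  "v:S ==> (SUM l:I. G v i l*minv I (G v) l j) = (if i = j then 1 else 0)"
  "v:S ==> minv I (G v) i j = minv I (G v) j i"
  "v:S ==> (SUM l:I. minv I (G v) i l*G v l j) = (if i = j then 1 else 0)"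
proof -
 from cramer[of G, OF sm pos] obtain H where
  "(ALL i:I. ALL j:I. smooth_on I S (%v. H v i j)) &
  (ALL v:S. ALL i:I. ALL j:I. (SUM l:I. G v i l*H v l j) = (if i = j then 1 else 0))" ..
 hence H: "!!i j. i:I ==> j:I ==> smooth_on I S (%v. H v i j)"
  "!!v i j. v:S ==> i:I ==> j:I ==> (SUM l:I. G v i l*H v l j) = (if i = j then 1 else 0)" by blast+
 have R: "(SUM l:I. G v i l*minv I (G v) l j) = (if i = j then 1 else 0)" if "v:S" "i:I" "j:I" for v i j using H(2)[OF that(1)] that by (intro minv_right) blast+
 have sy: "G v i j = G v j i" if "v:S" "i:I" "j:I" for v i j using pos that unfolding posdef_def by blast
 have eq: "H v j i = minv I (G v) i j" if "v:S" "i:I" "j:I" for v i j by (rule right_inverse_unique[OF fin sy H(2) R]) (use that in auto)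
 show ?A by (rule smooth_cong[OF S _ H(1)[OF ij(2,1)]]) (use eq ij in auto)
 assume v: "v:S"
 show "(SUM l:I. G v i l*minv I (G v) l j) = (if i = j then 1 else 0)" by (rule R[OF v ij])
 have sm: "minv I (G v) i j = minv I (G v) j i" if "i:I" "j:I" for i j by (rule right_inverse_unique[OF fin sy R R]) (use that v in auto)
 show "minv I (G v) i j = minv I (G v) j i" by (rule sm[OF ij])
 show "(SUM l:I. minv I (G v) i l*G v l j) = (if i = j then 1 else 0)" using R[OF v ij(2,1)] sm[OF ij(1)] sy[OF v ij(2)] by (auto simp: mult.commute intro!: sum.cong)
qed

end

text \<open>Curvature of a bare matrix of functions, so that the same results serve \<open>M\<close>
  and each of the factors.\<close>

definition chr :: "'k set=>('k=>'k=>('k=>real)=>real)=>'k=>'k=>'k=>('k=>real)=>real" where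
 "chr I G i j k v = (SUM l:I. minv I (%k l. G k l v) i l*(pd j (G l k) v + pd k (G l j) v - pd l (G j k) v))/2"

definition ric :: "'k set=>('k=>'k=>('k=>real)=>real)=>'k=>'k=>('k=>real)=>real" where
 "ric I G j k v = (SUM i:I. pd i (chr I G i j k) v - pd k (chr I G i i j) v) +
  (SUM i:I. SUM l:I. chr I G i i l v * chr I G l j k v - chr I G i k l v * chr I G l i j v)"

definition scal :: "'k set=>('k=>'k=>('k=>real)=>real)=>('k=>real)=>real" where
 "scal I G v = (SUM j:I. SUM k:I. minv I (%k l. G k l v) j k*ric I G j k v)"

lemma christoffel_eq: "christoffel M c g = chr (idx M) (gcomp M c g)" by (simp add: fun_eq_iff christoffel_def chr_def ginv_def)

lemma ricci_eq: "ricci M c g = ric (idx M) (gcomp M c g)" by (simp add: fun_eq_iff ricci_def ric_def christoffel_eq)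

lemma scalar_curv_eq: "scalar_curv M c g = scal (idx M) (gcomp M c g)" by (simp add: fun_eq_iff scalar_curv_def scal_def ginv_def ricci_eq)

section \<open>Metrics and frames\<close>

locale local_metric =
 fixes I :: "'k set" and S :: "('k=>real) set" and G :: "'k=>'k=>('k=>real)=>real"
 assumes fin: "finite I" and S: "opn I S"
  and smG: "!!i j. i:I ==> j:I ==> smooth_on I S (G i j)"
  and pos: "!!v. v:S ==> posdef I (%i j. G i j v)"
begin

abbreviation "Ginv i j v == minv I (%k l. G k l v) i j"
abbreviation "Gam == chr I G"

lemma symG: "v:S ==> i:I ==> j:I ==> G i j v = G j i v" using pos[of v] unfolding posdef_def by simp

lemma pd_symG: "v:S ==> i:I ==> j:I ==> k:I ==> pd k (G i j) v = pd k (G j i) v" by (rule pd_cong[OF S]) (auto intro: symG)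

lemma Ginv:
 assumes "i:I" "j:I" shows "smooth_on I S (Ginv i j)"
  "v:S ==> (SUM l:I. G i l v * Ginv l j v) = (if i = j then 1 else 0)"
  "v:S ==> Ginv i j v = Ginv j i v"
  "v:S ==> (SUM l:I. Ginv i l v * G l j v) = (if i = j then 1 else 0)" using minv_facts[OF fin S, of "%v i j. G i j v", OF smG pos assms] by auto

lemma smGam: "i:I ==> j:I ==> k:I ==> smooth_on I S (Gam i j k)" unfolding chr_def
 by (intro smooth_divide[OF S] smooth_const[OF S] smooth_sum[OF S] smooth_mult[OF S] smooth_add[OF S] smooth_diff[OF S]
   Ginv(1) smooth_on_pd smG) auto

lemma smric: "j:I ==> k:I ==> smooth_on I S (ric I G j k)" unfolding ric_def
 by (intro smooth_sum[OF S] smooth_mult[OF S] smooth_add[OF S] smooth_diff[OF S] smooth_on_pd smGam) auto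

lemma smscal: "smooth_on I S (scal I G)" unfolding scal_def by (intro smooth_sum[OF S] smooth_mult[OF S] Ginv(1) smric) auto

lemma Gam_sym: "v:S ==> i:I ==> j:I ==> k:I ==> Gam i j k v = Gam i k j v" unfolding chr_def by (auto simp: pd_symG alg intro!: sum.cong)

lemma pd_Gam_sym: "v:S ==> i:I ==> j:I ==> k:I ==> l:I ==> pd l (Gam i j k) v = pd l (Gam i k j) v" by (rule pd_cong[OF S]) (auto intro: Gam_sym)

lemma Gam_lower:
 assumes "v:S" "e:I" "b:I" "c:I" shows "(SUM d:I. G e d v * Gam d b c v) = (pd b (G e c) v + pd c (G e b) v - pd e (G b c) v)/2" (is "?L = _")
proof -
 define X where "X l = (pd b (G l c) v + pd c (G l b) v - pd l (G b c) v)/2" for l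
 have "?L = (SUM d:I. SUM l:I. G e d v * Ginv d l v * X l)" unfolding chr_def X_def by (simp add: sdl sum_divide_distrib mult.assoc)
 also have "... = (SUM l:I. (SUM d:I. G e d v * Ginv d l v)*X l)" by (subst sum.swap) (simp add: sdr)
 also have "... = (SUM l:I. (if e = l then 1 else 0)*X l)" using assms by (intro scr) (simp only: Ginv(2))
 also have "... = X e" using sum_dm(1)[OF fin assms(2)] .
 finally show ?thesis unfolding X_def .
qed

lemma pd_G:
 assumes "v:S" "a:I" "b:I" "c:I" shows "pd a (G b c) v = (SUM d:I. Gam d a b v * G d c v) + (SUM d:I. Gam d a c v * G b d v)"
proof -
 have "(SUM d:I. Gam d a b v * G d c v) = (SUM d:I. G c d v * Gam d a b v)" using assms symG by (auto intro!: sum.cong simp: mult.commute)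
 moreover have "(SUM d:I. Gam d a c v * G b d v) = (SUM d:I. G b d v * Gam d a c v)" by (simp add: mult.commute)
 ultimately show ?thesis using assms by (simp add: Gam_lower pd_symG field_simps)
qed

text \<open>\<open>nab b Z a\<close> is the \<open>a\<close>-component of the covariant derivative
  of the field \<open>Z\<close> along coordinate \<open>b\<close>; \<open>riem a d b c\<close> below
  is the curvature tensor with upper index \<open>a\<close>, argument \<open>d\<close> and plane
  \<open>b\<close>, \<open>c\<close>.\<close>

definition nab :: "'k=>('k=>('k=>real)=>real)=>'k=>('k=>real)=>real" where
 "nab b Z a v = pd b (Z a) v + (SUM c:I. Gam a b c v * Z c v)"

definition riem :: "'k=>'k=>'k=>'k=>('k=>real)=>real" where
 "riem a d b c v = pd b (Gam a c d) v - pd c (Gam a b d) v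
  + (SUM e:I. Gam a b e v * Gam e c d v - Gam a c e v * Gam e b d v)"

lemma sm_nab: "(!!a. a:I ==> smooth_on I S (Z a)) ==> a:I ==> b:I ==> smooth_on I S (nab b Z a)"
 unfolding nab_def by (intro smooth_sum[OF S] smooth_mult[OF S] smooth_add[OF S] smooth_on_pd smGam)

text \<open>The commutator of second covariant derivatives. The terms in which the symbol contracts
  with the direction of differentiation are symmetric in \<open>b\<close>, \<open>c\<close>; they
  are left out of both halves of the difference.\<close>

lemma ricci_identity:
 assumes Z: "!!a. a:I ==> smooth_on I S (Z a)" and v: "v:S" and I: "a:I" "b:I" "c:I"
 shows "(pd b (nab c Z a) v + (SUM e:I. Gam a b e v * nab c Z e v)) - (pd c (nab b Z a) v + (SUM e:I. Gam a c e v * nab b Z e v))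
  = (SUM d:I. riem a d b c v * Z d v)"
proof -
 have pdn: "pd b (nab c Z a) v = pd b (pd c (Z a)) v + (SUM d:I. pd b (Gam a c d) v * Z d v + Gam a c d v * pd b (Z d) v)" if "b:I" "c:I" for b c
 proof -
  have "pd b (nab c Z a) v = pd b (%v. pd c (Z a) v + (SUM d:I. Gam a c d v * Z d v)) v" by (simp add: nab_def[abs_def])
  also have "... = pd b (pd c (Z a)) v + pd b (%v. SUM d:I. Gam a c d v * Z d v) v"
   using that I v Z by (intro pd_add[OF S] smooth_sum[OF S] smooth_mult[OF S] smooth_on_pd smGam) auto
  also have "pd b (%v. SUM d:I. Gam a c d v * Z d v) v = (SUM d:I. pd b (%v. Gam a c d v * Z d v) v)"
   using that I v Z by (intro pd_sum[OF S] smooth_mult[OF S] smGam) auto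
  also have "... = (SUM d:I. pd b (Gam a c d) v * Z d v + Gam a c d v * pd b (Z d) v)" using that I v Z by (intro sum.cong refl pd_mult[OF S] smGam) auto
  finally show ?thesis .
 qed
 have gg: "(SUM e:I. Gam a b e v * nab c Z e v) = (SUM e:I. Gam a b e v * pd c (Z e) v) + (SUM d:I. (SUM e:I. Gam a b e v * Gam e c d v)*Z d v)" (is "?L = _")
  if "b:I" "c:I" for b c
 proof -
  have "?L = (SUM e:I. Gam a b e v * pd c (Z e) v) + (SUM e:I. SUM d:I. Gam a b e v * Gam e c d v * Z d v)" by (simp add: nab_def distrib_left sum.distrib sdl mult.assoc)
  also have "(SUM e:I. SUM d:I. Gam a b e v * Gam e c d v * Z d v) = (SUM d:I. (SUM e:I. Gam a b e v * Gam e c d v)*Z d v)" by (subst sum.swap) (simp add: sdr)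
  finally show ?thesis .
 qed
 have "pd b (pd c (Z a)) v = pd c (pd b (Z a)) v" using pd_swap[OF fin S Z I(2,3) v] I(1) by blast
 thus ?thesis unfolding pdn[OF I(2,3)] pdn[OF I(3,2)] gg[OF I(2,3)] gg[OF I(3,2)] riem_def by (simp add: sum.distrib sum_subtractf left_diff_distrib distrib_right sdr)
qed

lemma ric_riem:
 assumes v: "v:S" and I: "d:I" "c:I" shows "ric I G d c v = (SUM a:I. riem a d a c v)"
proof -
 have "pd a (Gam a d c) v = pd a (Gam a c d) v" "Gam a d c v = Gam a c d v" if "a:I" for a using v I that by (auto intro: pd_Gam_sym Gam_sym)
 thus ?thesis unfolding ric_def riem_def by (simp add: sum.distrib)
qed

end

locale frame = local_metric I S G for I :: "'k set" and S :: "('k=>real) set" and G :: "'k=>'k=>('k=>real)=>real" +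
 fixes A :: "'a set" and E e :: "'a=>'k=>('k=>real)=>real"
 assumes finA: "finite A"
  and smE: "!!X a. X:A ==> a:I ==> smooth_on I S (E X a)"
  and sme: "!!X a. X:A ==> a:I ==> smooth_on I S (e X a)"
  and dual1: "!!v X Y. v:S ==> X:A ==> Y:A ==> (SUM a:I. e X a v * E Y a v) = (if X = Y then 1 else 0)"
  and dual2: "!!v a b. v:S ==> a:I ==> b:I ==> (SUM X:A. E X a v * e X b v) = (if a = b then 1 else 0)"
begin

definition dE :: "'a=>(('k=>real)=>real)=>('k=>real)=>real" where
 "dE X f v = (SUM a:I. E X a v * pd a f v)"

text \<open>The exterior derivative of the covector \<open>e D\<close> on the pair
  \<open>E X\<close>, \<open>E Y\<close>; by duality it is minus the \<open>D\<close>-component of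
  their bracket.\<close>

definition ext :: "'a=>'a=>'a=>('k=>real)=>real" where
 "ext D X Y v = (SUM a:I. SUM b:I. (pd b (e D a) v - pd a (e D b) v)*E X b v * E Y a v)"

definition gE :: "'a=>'a=>('k=>real)=>real" where
 "gE X Y v = (SUM a:I. SUM b:I. G a b v * E X a v * E Y b v)"

lemma gE_sym: "v:S ==> gE X Y v = gE Y X v" unfolding gE_def by (subst sum.swap) (auto intro!: sum.cong simp: symG)

lemma dE_cong: "(!!w. w:S ==> f w = g w) ==> v:S ==> dE X f v = dE X g v" unfolding dE_def by (intro sum.cong refl arg_cong2[where f = "(*)"] pd_cong[OF S]) auto

lemma dE_const: "dE X (%_. c) v = 0" by (simp add: dE_def pd_const)

lemma dE_mult: "smooth_on I S f ==> smooth_on I S g ==> v:S ==> dE X (%v. f v * g v) v = dE X f v * g v + f v * dE X g v"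
 by (simp add: dE_def pd_mult[OF S] distrib_left sum.distrib sdl sdr mult_ac)

lemma dE_sum: "(!!a. a:B ==> smooth_on I S (f a)) ==> v:S ==> dE X (%v. SUM a:B. f a v) v = (SUM a:B. dE X (f a) v)"
 unfolding dE_def by (subst sum.swap) (simp add: pd_sum[OF S] sdl)

lemma sum_expand:
 assumes "v:S" "a:I" shows "(SUM X:A. (SUM b:I. e X b v * u b)*E X a v) = u a" (is "?L = _")
proof -
 have "?L = (SUM b:I. SUM X:A. E X a v * e X b v * u b)" unfolding sdr by (subst sum.swap) (simp add: mult_ac)
 also have "... = (SUM b:I. (if a = b then 1 else 0)*u b)" using assms by (intro scr) (simp only: dual2 flip: sdr)
 also have "... = u a" by (rule sum_dm(1)[OF fin assms(2)])
 finally show ?thesis .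
qed

text \<open>The \<open>D\<close>-component of the covariant derivative of \<open>E C\<close> along
  \<open>E B\<close> for the Levi-Civita connection of \<open>G\<close>.\<close>

definition wh :: "'a=>'a=>'a=>('k=>real)=>real" where
 "wh D B C v = (SUM a:I. e D a v * (SUM b:I. E B b v * nab b (E C) a v))"

lemma wh_expand: "v:S ==> a:I ==> (SUM D:A. wh D B C v * E D a v) = (SUM b:I. E B b v * nab b (E C) a v)" unfolding wh_def by (rule sum_expand)

lemma pd_dual:
 assumes "v:S" "D:A" "C:A" "b:I" shows "(SUM a:I. e D a v * pd b (E C a) v) = - (SUM a:I. pd b (e D a) v * E C a v)"
proof -
 have "pd b (%v. SUM a:I. e D a v * E C a v) v = pd b (%v. if D = C then 1 else 0) v" using assms dual1 by (intro pd_cong[OF S]) auto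
 moreover have "pd b (%v. SUM a:I. e D a v * E C a v) v = (SUM a:I. pd b (%v. e D a v * E C a v) v)" using assms by (intro pd_sum[OF S] smooth_mult[OF S] sme smE) auto
 moreover have "... = (SUM a:I. pd b (e D a) v * E C a v + e D a v * pd b (E C a) v)" using assms by (intro sum.cong refl pd_mult[OF S] sme smE) auto
 ultimately show ?thesis by (simp add: pd_const sum.distrib)
qed

text \<open>Differentiating the constant pairing of \<open>e D\<close> with \<open>E C\<close>
  (\<open>pd_dual\<close>) moves the derivative from the field to the covector; the Christoffel
  terms drop out by their symmetry.\<close>

lemma wh_torsion:
 assumes v: "v:S" and BCD: "D:A" "B:A" "C:A" shows "wh D B C v - wh D C B v = - ext D B C v" (is "?L = _")
proof -
 have 1: "wh D B C v = (SUM a:I. e D a v * (SUM b:I. E B b v * pd b (E C a) v)) + (SUM a:I. e D a v * (SUM b:I. SUM c:I. Gam a b c v * E B b v * E C c v))" for B C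
  by (simp add: wh_def nab_def distrib_left sum.distrib sdl mult_ac)
 have 2: "(SUM b:I. SUM c:I. Gam a b c v * E B b v * E C c v) = (SUM b:I. SUM c:I. Gam a b c v * E C b v * E B c v)" if "a:I" for a
  by (subst sum.swap) (use that v Gam_sym in \<open>auto intro!: sum.cong\<close>)
 have 3: "(SUM a:I. e D a v * (SUM b:I. E B b v * pd b (E C a) v)) = - (SUM b:I. SUM a:I. pd b (e D a) v * E B b v * E C a v)" (is "?L1 = _") if "B:A" "C:A" for B C
 proof -
  have "?L1 = (SUM b:I. E B b v * (SUM a:I. e D a v * pd b (E C a) v))" unfolding sdl by (subst sum.swap) (simp add: mult_ac)
  also have "... = (SUM b:I. E B b v * - (SUM a:I. pd b (e D a) v * E C a v))" using v BCD that by (intro scr) (simp only: pd_dual)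
  finally show ?thesis by (simp add: sdl sum_negf mult_ac)
 qed
 have "?L = (SUM b:I. SUM a:I. pd b (e D a) v * E C b v * E B a v) - (SUM b:I. SUM a:I. pd b (e D a) v * E B b v * E C a v)"
  unfolding 1 3[OF BCD(2,3)] 3[OF BCD(3,2)] using 2 by simp
 also have "... = (SUM a:I. SUM b:I. pd a (e D b) v * E C a v * E B b v) - (SUM a:I. SUM b:I. pd b (e D a) v * E B b v * E C a v)"
  using sum.swap[of "%b a. pd b (e D a) v * E B b v * E C a v" I I] by simp
 also have "... = - ext D B C v" unfolding ext_def by (simp add: alg sum_subtractf)
 finally show ?thesis .
qed

lemma gE_bilinear:
 "(SUM D:A. k D*gE D C v) = (SUM a:I. SUM b:I. G a b v * (SUM D:A. k D*E D a v)*E C b v)" (is "?L = _")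
 "(SUM D:A. k D*gE C D v) = (SUM a:I. SUM b:I. G a b v * E C a v * (SUM D:A. k D*E D b v))" (is ?A)
proof -
 show "?L = (SUM a:I. SUM b:I. G a b v * (SUM D:A. k D*E D a v)*E C b v)" unfolding gE_def sdl sdr by (subst sum.swap, rule scr, subst sum.swap) (simp add: mult_ac)
 show ?A unfolding gE_def sdl sdr
  by (subst sum.swap, rule scr, subst sum.swap) (simp add: mult_ac)
qed

lemma wh_metric:
 assumes v: "v:S" and XBC: "X:A" "B:A" "C:A" shows "dE X (gE B C) v = (SUM D:A. wh D X B v * gE D C v) + (SUM D:A. wh D X C v * gE B D v)"
proof -
 define N where "N Y a = (SUM x:I. E X x v * nab x (E Y) a v)" for Y a
 have pdg: "pd x (gE B C) v = (SUM a:I. SUM b:I. pd x (G a b) v * E B a v * E C b v + G a b v * pd x (E B a) v * E C b v + G a b v * E B a v * pd x (E C b) v)"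
  if x: "x:I" for x
 proof -
  have "pd x (%v. SUM a:I. SUM b:I. G a b v * E B a v * E C b v) v = (SUM a:I. pd x (%v. SUM b:I. G a b v * E B a v * E C b v) v)"
   using x v XBC by (intro pd_sum[OF S] smooth_sum[OF S] smooth_mult[OF S] smG smE) auto
  also have "... = (SUM a:I. SUM b:I. pd x (%v. G a b v * E B a v * E C b v) v)" using x v XBC by (intro sum.cong refl pd_sum[OF S] smooth_mult[OF S] smG smE) auto
  also have "... = (SUM a:I. SUM b:I. pd x (G a b) v * E B a v * E C b v + G a b v * pd x (E B a) v * E C b v + G a b v * E B a v * pd x (E C b) v)"
  proof (intro scr)
   fix a b assume ab: "a:I" "b:I"
   show "pd x (%v. G a b v * E B a v * E C b v) v = pd x (G a b) v * E B a v * E C b v + G a b v * pd x (E B a) v * E C b v + G a b v * E B a v * pd x (E C b) v"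
    using x v XBC ab by (simp add: pd_mult[OF S] smooth_mult[OF S] smG smE alg)
  qed
  finally show ?thesis by (simp add: gE_def[abs_def])
 qed
 have "pd x (gE B C) v = (SUM a:I. SUM b:I. G a b v * nab x (E B) a v * E C b v) + (SUM a:I. SUM b:I. G a b v * E B a v * nab x (E C) b v)" if x: "x:I" for x
 proof -
  have "(SUM a:I. SUM b:I. pd x (G a b) v * E B a v * E C b v) = (SUM a:I. SUM b:I. (SUM d:I. Gam d x a v * G d b v)*E B a v * E C b v) + (SUM a:I. SUM b:I. (SUM d:I. Gam d x b v * G a d v)*E B a v * E C b v)"
   unfolding sum.distrib[symmetric] using v x by (intro scr) (simp add: pd_G distrib_right)
  also have "(SUM a:I. SUM b:I. (SUM d:I. Gam d x a v * G d b v)*E B a v * E C b v) = (SUM d:I. SUM b:I. G d b v * (SUM a:I. Gam d x a v * E B a v)*E C b v)" (is "?L = _")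
  proof -
   have "?L = (SUM a:I. SUM d:I. SUM b:I. Gam d x a v * G d b v * E B a v * E C b v)" unfolding sdr by (intro sum.cong refl sum.swap)
   also have "... = (SUM d:I. SUM b:I. SUM a:I. Gam d x a v * G d b v * E B a v * E C b v)" by (subst sum.swap, intro sum.cong refl sum.swap)
   finally show ?thesis by (simp add: sdl sdr mult_ac)
  qed
  also have "(SUM a:I. SUM b:I. (SUM d:I. Gam d x b v * G a d v)*E B a v * E C b v) = (SUM a:I. SUM d:I. G a d v * E B a v * (SUM b:I. Gam d x b v * E C b v))"
  proof (rule scr)
   fix a
   show "(SUM b:I. (SUM d:I. Gam d x b v * G a d v)*E B a v * E C b v) = (SUM d:I. G a d v * E B a v * (SUM b:I. Gam d x b v * E C b v))"
    unfolding sdr sdl by (subst sum.swap) (simp add: mult_ac)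
  qed
  finally show ?thesis unfolding pdg[OF x] nab_def by (simp add: sum.distrib distrib_left distrib_right)
 qed
 hence "dE X (gE B C) v = (SUM x:I. E X x v * ((SUM a:I. SUM b:I. G a b v * nab x (E B) a v * E C b v) + (SUM a:I. SUM b:I. G a b v * E B a v * nab x (E C) b v)))"
  unfolding dE_def by simp
 also have "... = (SUM a:I. SUM b:I. G a b v * N B a*E C b v) + (SUM a:I. SUM b:I. G a b v * E B a v * N C b)"
 proof -
  have "(SUM x:I. E X x v * (SUM a:I. SUM b:I. G a b v * nab x (E B) a v * E C b v)) = (SUM a:I. SUM b:I. G a b v * N B a*E C b v)" unfolding N_def sdl sdr
   by (subst sum.swap, rule scr, subst sum.swap) (simp add: mult_ac)
  moreover have "(SUM x:I. E X x v * (SUM a:I. SUM b:I. G a b v * E B a v * nab x (E C) b v)) = (SUM a:I. SUM b:I. G a b v * E B a v * N C b)" unfolding N_def sdl sdr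
   by (subst sum.swap, rule scr, subst sum.swap) (simp add: mult_ac)
  ultimately show ?thesis by (simp add: distrib_left sum.distrib)
 qed
 also have "... = (SUM D:A. wh D X B v * gE D C v) + (SUM D:A. wh D X C v * gE B D v)" unfolding gE_bilinear N_def using v by (simp add: wh_expand)
 finally show ?thesis .
qed

text \<open>Lowering the first index gives an array \<open>T\<close> that is symmetric in its last
  two arguments and skew in the first and third. Applying the two rules alternately, three times
  each, yields \<open>T = - T\<close>. The inverse \<open>gi\<close> raises the index again.\<close>

lemma koszul_unique:
 assumes gsym: "!!X Y. X:A ==> Y:A ==> g X Y = (g Y X :: real)"
  and gi: "!!D H. D:A ==> H:A ==> (SUM C:A. g D C*gi C H) = (if D = H then 1 else 0)"
  and tsym: "!!D B C. D:A ==> B:A ==> C:A ==> t D B C = t D C B"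
  and tskew: "!!X B C. X:A ==> B:A ==> C:A ==> (SUM D:A. t D X B*g D C) + (SUM D:A. t D X C*g B D) = 0"
  and "H:A" "X:A" "B:A" shows "t H X B = 0"
proof -
 define T where "T C X B = (SUM D:A. t D X B*g D C)" for C X B
 have 1: "T C X B = T C B X" if "C:A" "X:A" "B:A" for C X B unfolding T_def using that tsym by (auto intro!: sum.cong)
 have 2: "T C X B = - T B X C" if "C:A" "X:A" "B:A" for C X B
 proof -
  have "(SUM D:A. t D X C*g B D) = T B X C" unfolding T_def using that gsym by (auto intro!: sum.cong)
  thus ?thesis using tskew[OF that(2,3,1)] unfolding T_def by linarith
 qed
 have T0: "T C X B = 0" if "C:A" for C using 1[of C X B] 2[of C B X] 1[of X B C] 2[of X C B] 1[of B C X] 2[of B X C] that assms(5-7) by linarith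
 have "t H X B = (SUM D:A. t D X B*(if D = H then 1 else 0))" by (rule sum_dm(4)[OF finA assms(5), symmetric])
 also have "... = (SUM D:A. SUM C:A. t D X B*g D C*gi C H)" using gi assms(5) by (intro scr) (simp add: mult.assoc flip: sdl)
 also have "... = (SUM C:A. T C X B*gi C H)" unfolding T_def by (subst sum.swap) (simp add: sdr)
 also have "... = 0" using T0 by simp
 finally show ?thesis .
qed

end

text \<open>Candidate coefficients \<open>w\<close> are only tested for torsion and for
  compatibility with the metric. By \<open>koszul_unique\<close> they are the Levi-Civita
  coefficients, and no Christoffel symbol of the total space has to be computed.\<close>

locale frame_connection = frame I S G A E e for I :: "'k set" and S :: "('k=>real) set" and G :: "'k=>'k=>('k=>real)=>real"
  and A :: "'a set" and E e :: "'a=>'k=>('k=>real)=>real" +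
 fixes w :: "'a=>'a=>'a=>('k=>real)=>real" and gi :: "'a=>'a=>('k=>real)=>real"
 assumes smw: "!!D B C. D:A ==> B:A ==> C:A ==> smooth_on I S (w D B C)"
  and tor: "!!v D B C. v:S ==> D:A ==> B:A ==> C:A ==> w D B C v - w D C B v = - ext D B C v"
  and met: "!!v X B C. v:S ==> X:A ==> B:A ==> C:A ==>
   dE X (gE B C) v = (SUM D:A. w D X B v * gE D C v) + (SUM D:A. w D X C v * gE B D v)"
  and gi: "!!v D H. v:S ==> D:A ==> H:A ==> (SUM C:A. gE D C v * gi C H v) = (if D = H then 1 else 0)"
begin

lemma w_eq:
 assumes v: "v:S" and DBC: "D:A" "B:A" "C:A" shows "wh D B C v = w D B C v"
proof -
 have "wh D B C v - w D B C v = 0"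
 proof (rule koszul_unique[where g = "%X Y. gE X Y v" and gi = "%X Y. gi X Y v"])
  show "wh D B C v - w D B C v = wh D C B v - w D C B v" if "D:A" "B:A" "C:A" for D B C using wh_torsion[OF v that] tor[OF v that] by linarith
  show "(SUM D:A. (wh D X B v - w D X B v)*gE D C v) + (SUM D:A. (wh D X C v - w D X C v)*gE B D v) = 0" if "X:A" "B:A" "C:A" for X B C
   using wh_metric[OF v that] met[OF v that] by (simp add: left_diff_distrib sum_subtractf)
 qed (use assms gE_sym gi in auto)
 thus ?thesis by simp
qed

lemma conn:
 assumes "v:S" "B:A" "C:A" "a:I" shows "(SUM b:I. E B b v * nab b (E C) a v) = (SUM D:A. w D B C v * E D a v)" using assms by (simp add: w_eq flip: wh_expand)

text \<open>The \<open>D\<close>-component of the curvature operator of \<open>E P\<close>,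
  \<open>E C\<close> applied to \<open>E B\<close>; the bracket of the two fields is expressed
  through \<open>w\<close>, which is torsion-free.\<close>

definition curv :: "'a=>'a=>'a=>'a=>('k=>real)=>real" where
 "curv D P C B v = dE P (w D C B) v - dE C (w D P B) v
  + (SUM H:A. w D P H v * w H C B v - w D C H v * w H P B v)
  - (SUM H:A. (w H P C v - w H C P v)*w D H B v)"

text \<open>Both sides expand \<open>U\<close>, the covariant derivative along \<open>E P\<close> of
  the covariant derivative of \<open>E B\<close> along \<open>E C\<close>: the left side through
  coordinates, the right side through the coefficients \<open>w\<close>.\<close>

lemma second_derivative:
 assumes v: "v:S" and A: "P:A" "C:A" "B:A" and a: "a:I" shows "(SUM b:I. SUM c:I. E P b v * pd b (E C c) v * nab c (E B) a v)
  + (SUM b:I. SUM c:I. E P b v * E C c v * (pd b (nab c (E B) a) v + (SUM e:I. Gam a b e v * nab c (E B) e v)))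
  = (SUM D:A. dE P (w D C B) v * E D a v) + (SUM D:A. (SUM H:A. w D P H v * w H C B v)*E D a v)"
proof -
 define N where "N a v = (SUM c:I. E C c v * nab c (E B) a v)" for a v
 have Neq: "N a v = (SUM D:A. w D C B v * E D a v)" if "v:S" "a:I" for v a unfolding N_def using conn[OF that(1) A(2,3) that(2)] .
 have p1: "pd b (N a) v = (SUM c:I. pd b (E C c) v * nab c (E B) a v + E C c v * pd b (nab c (E B) a) v)" if b: "b:I" for b unfolding N_def[abs_def] using b v a A
  by (subst pd_sum[OF S]) (auto intro!: smooth_mult[OF S] sm_nab smE sum.cong pd_mult[OF S])
 have p2: "pd b (N a) v = (SUM D:A. pd b (w D C B) v * E D a v + w D C B v * pd b (E D a) v)" if b: "b:I" for b
 proof -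
  have "pd b (N a) v = pd b (%v. SUM D:A. w D C B v * E D a v) v" using Neq a by (intro pd_cong[OF S b v]) auto
  also have "... = (SUM D:A. pd b (w D C B) v * E D a v + w D C B v * pd b (E D a) v)" using b v a A
   by (subst pd_sum[OF S]) (auto intro!: smooth_mult[OF S] smw smE sum.cong pd_mult[OF S])
  finally show ?thesis .
 qed
 define U where "U = (SUM b:I. E P b v * (pd b (N a) v + (SUM e:I. Gam a b e v * N e v)))"
 have "U = (SUM b:I. SUM c:I. E P b v * pd b (E C c) v * nab c (E B) a v)
  + (SUM b:I. SUM c:I. E P b v * E C c v * (pd b (nab c (E B) a) v + (SUM e:I. Gam a b e v * nab c (E B) e v)))"
 proof -
  have "(SUM e:I. Gam a b e v * N e v) = (SUM c:I. E C c v * (SUM e:I. Gam a b e v * nab c (E B) e v))" for b unfolding N_def sdl by (subst sum.swap) (simp add: mult_ac)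
  thus ?thesis unfolding U_def by (simp add: p1 distrib_left sum.distrib sdl mult_ac)
 qed
 moreover have "U = (SUM D:A. dE P (w D C B) v * E D a v) + (SUM D:A. (SUM H:A. w D P H v * w H C B v)*E D a v)"
 proof -
  have g: "(SUM e:I. Gam a b e v * N e v) = (SUM D:A. w D C B v * (SUM e:I. Gam a b e v * E D e v))" (is "?L = _") for b
  proof -
   have "?L = (SUM e:I. SUM D:A. Gam a b e v * (w D C B v * E D e v))" using v by (simp add: Neq sdl)
   thus ?thesis unfolding sdl by (subst (asm) sum.swap) (simp add: mult_ac)
  qed
  have "U = (SUM b:I. E P b v * (SUM D:A. pd b (w D C B) v * E D a v)) + (SUM b:I. E P b v * (SUM D:A. w D C B v * nab b (E D) a v))"
   unfolding U_def g by (simp add: p2 nab_def distrib_left sum.distrib)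
  also have "(SUM b:I. E P b v * (SUM D:A. pd b (w D C B) v * E D a v)) = (SUM D:A. dE P (w D C B) v * E D a v)"
   unfolding dE_def sdl sdr by (subst sum.swap) (simp add: mult_ac)
  also have "(SUM b:I. E P b v * (SUM D:A. w D C B v * nab b (E D) a v)) = (SUM H:A. w H C B v * (SUM b:I. E P b v * nab b (E H) a v))"
   unfolding sdl by (subst sum.swap) (simp add: mult_ac)
  also have "... = (SUM H:A. SUM D:A. w H C B v * (w D P H v * E D a v))" using v A a by (simp add: conn sdl)
  also have "... = (SUM D:A. (SUM H:A. w D P H v * w H C B v)*E D a v)" unfolding sdr by (subst sum.swap) (simp add: mult_ac)
  finally show ?thesis .
 qed
 ultimately show ?thesis by simp
qed

lemma bracket:
 assumes v: "v:S" and A: "P:A" "C:A" and c: "c:I"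
 shows "(SUM b:I. E P b v * pd b (E C c) v) - (SUM b:I. E C b v * pd b (E P c) v) = (SUM H:A. (w H P C v - w H C P v)*E H c v)"
proof -
 have "(SUM b:I. SUM d:I. E P b v * (Gam c b d v * E C d v)) = (SUM b:I. SUM d:I. E C b v * (Gam c b d v * E P d v))"
  by (subst sum.swap) (use v c Gam_sym in \<open>auto intro!: sum.cong\<close>)
 hence "(SUM b:I. E P b v * pd b (E C c) v) - (SUM b:I. E C b v * pd b (E P c) v)
  = (SUM b:I. E P b v * nab b (E C) c v) - (SUM b:I. E C b v * nab b (E P) c v)" by (simp add: nab_def distrib_left sum.distrib sdl)
 also have "... = (SUM H:A. (w H P C v - w H C P v)*E H c v)" using v A c by (simp add: conn left_diff_distrib sum_subtractf)
 finally show ?thesis .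
qed

text \<open>Antisymmetrising \<open>second_derivative\<close> in \<open>P\<close> and
  \<open>C\<close> leaves the curvature and a first-order term, which is the derivative along the
  bracket of the two fields.\<close>

lemma curv_riem:
 assumes v: "v:S" and A: "P:A" "C:A" "B:A" and a: "a:I"
 shows "(SUM b:I. SUM c:I. E P b v * E C c v * (SUM d:I. riem a d b c v * E B d v)) = (SUM D:A. curv D P C B v * E D a v)" (is "?L = _")
proof -
 define Q where "Q b c = pd b (nab c (E B) a) v + (SUM e:I. Gam a b e v * nab c (E B) e v)" for b c
 have Q: "(SUM d:I. riem a d b c v * E B d v) = Q b c - Q c b" if "b:I" "c:I" for b c unfolding Q_def using ricci_identity[of "E B" v a b c] smE[OF A(3)] v a that by auto
 have "?L
  = (SUM b:I. SUM c:I. E P b v * E C c v * Q b c) - (SUM b:I. SUM c:I. E C b v * E P c v * Q b c)"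
 proof -
  have "(SUM b:I. SUM c:I. E C b v * E P c v * Q b c) = (SUM b:I. SUM c:I. E P b v * E C c v * Q c b)" by (subst sum.swap) (simp add: mult_ac)
  thus ?thesis using Q by (simp add: right_diff_distrib sum_subtractf)
 qed
 also have "... = (SUM D:A. dE P (w D C B) v * E D a v) + (SUM D:A. (SUM H:A. w D P H v * w H C B v)*E D a v)
  - (SUM D:A. dE C (w D P B) v * E D a v) - (SUM D:A. (SUM H:A. w D C H v * w H P B v)*E D a v)
  - ((SUM b:I. SUM c:I. E P b v * pd b (E C c) v * nab c (E B) a v) - (SUM b:I. SUM c:I. E C b v * pd b (E P c) v * nab c (E B) a v))"
  using second_derivative[OF v A a] second_derivative[OF v A(2,1,3) a] unfolding Q_def by linarith
 also have "(SUM b:I. SUM c:I. E P b v * pd b (E C c) v * nab c (E B) a v) - (SUM b:I. SUM c:I. E C b v * pd b (E P c) v * nab c (E B) a v)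
  = (SUM D:A. (SUM H:A. (w H P C v - w H C P v)*w D H B v)*E D a v)"
 proof -
  have "(SUM b:I. SUM c:I. E P b v * pd b (E C c) v * nab c (E B) a v) - (SUM b:I. SUM c:I. E C b v * pd b (E P c) v * nab c (E B) a v)
   = (SUM c:I. (SUM H:A. (w H P C v - w H C P v)*E H c v)*nab c (E B) a v)"
  proof -
   have "(SUM b:I. SUM c:I. E P b v * pd b (E C c) v * nab c (E B) a v) = (SUM c:I. (SUM b:I. E P b v * pd b (E C c) v)*nab c (E B) a v)" for P C
    by (subst sum.swap) (simp add: sdr)
   hence "(SUM b:I. SUM c:I. E P b v * pd b (E C c) v * nab c (E B) a v) - (SUM b:I. SUM c:I. E C b v * pd b (E P c) v * nab c (E B) a v)
    = (SUM c:I. ((SUM b:I. E P b v * pd b (E C c) v) - (SUM b:I. E C b v * pd b (E P c) v))*nab c (E B) a v)" by (simp add: left_diff_distrib sum_subtractf)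
   also have "... = (SUM c:I. (SUM H:A. (w H P C v - w H C P v)*E H c v)*nab c (E B) a v)" using v A by (intro scr) (simp only: bracket)
   finally show ?thesis .
  qed
  also have "... = (SUM H:A. (w H P C v - w H C P v)*(SUM c:I. E H c v * nab c (E B) a v))" unfolding sdr sdl by (subst sum.swap) (simp add: mult_ac)
  also have "... = (SUM H:A. SUM D:A. (w H P C v - w H C P v)*(w D H B v * E D a v))" using v A a by (simp add: conn sdl)
  also have "... = (SUM D:A. (SUM H:A. (w H P C v - w H C P v)*w D H B v)*E D a v)" unfolding sdr by (subst sum.swap) (simp add: mult_ac)
  finally show ?thesis .
 qed
 finally show ?thesis unfolding curv_def by (simp add: distrib_right left_diff_distrib sum.distrib sum_subtractf)
qed

definition ricF :: "'a=>'a=>('k=>real)=>real" where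
 "ricF B C v = (SUM D:A. curv D D C B v)"

lemma ric_frame:
 assumes v: "v:S" and A: "B:A" "C:A" shows "(SUM d:I. SUM c:I. E B d v * E C c v * ric I G d c v) = ricF B C v"
proof -
 define R where "R a b = (SUM c:I. E C c v * (SUM d:I. riem a d b c v * E B d v))" for a b
 have "curv D D C B v = (SUM a:I. e D a v * (SUM b:I. E D b v * R a b))" if D: "D:A" for D
 proof -
  have "(SUM a:I. e D a v * (SUM b:I. E D b v * R a b)) = (SUM a:I. e D a v * (SUM H:A. curv H D C B v * E H a v))"
   using curv_riem[OF v D A(2,1)] unfolding R_def by (intro scr) (simp add: sdl mult.assoc)
  also have "... = (SUM H:A. curv H D C B v * (SUM a:I. e D a v * E H a v))" unfolding sdl by (subst sum.swap) (simp add: mult_ac)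
  also have "... = (SUM H:A. curv H D C B v * (if D = H then 1 else 0))" using v D by (intro scr) (simp only: dual1)
  also have "... = curv D D C B v" by (rule sum_dm(3)[OF finA D])
  finally show ?thesis ..
 qed
 hence "ricF B C v = (SUM D:A. SUM a:I. e D a v * (SUM b:I. E D b v * R a b))" unfolding ricF_def by simp
 also have "... = (SUM a:I. SUM b:I. (SUM D:A. E D b v * e D a v) * R a b)" unfolding sdl sdr by (subst sum.swap, rule scr, subst sum.swap) (simp add: mult_ac)
 also have "... = (SUM a:I. SUM b:I. (if b = a then 1 else 0) * R a b)" using v by (intro scr) (simp only: dual2)
 also have "... = (SUM a:I. R a a)" by (intro scr) (rule sum_dm(2)[OF fin])
 also have "... = (SUM c:I. SUM d:I. E C c v * E B d v * (SUM a:I. riem a d a c v))" unfolding R_def sdl by (subst sum.swap, rule scr, subst sum.swap) (simp add: mult_ac)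
 also have "... = (SUM c:I. SUM d:I. E B d v * E C c v * ric I G d c v)" using v by (intro scr) (simp add: ric_riem mult_ac)
 finally show ?thesis by (subst sum.swap) simp
qed

lemma Ginv_frame:
 assumes v: "v:S" and jk: "j:I" "k:I" shows "Ginv j k v = (SUM B:A. SUM C:A. gi B C v * E B j v * E C k v)"
proof -
 define K where "K j k = (SUM B:A. SUM C:A. gi B C v * E B j v * E C k v)" for j k
 have GE: "(SUM l:I. G i l v * E B l v) = (SUM X:A. e X i v * gE X B v)" (is "?L = _") if i: "i:I" for i B
 proof -
  have "(SUM X:A. e X i v * gE X B v) = (SUM a:I. (SUM X:A. E X a v * e X i v)*(SUM l:I. G a l v * E B l v))" unfolding gE_def sdl sdr
   by (subst sum.swap, rule scr, subst sum.swap) (simp add: mult_ac)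
  also have "... = (SUM a:I. (if a = i then 1 else 0)*(SUM l:I. G a l v * E B l v))" using v i by (intro scr) (simp only: dual2)
  also have "... = ?L" by (rule sum_dm(2)[OF fin i])
  finally show ?thesis ..
 qed
 have K: "(SUM l:I. G i l v * K l k) = (if i = k then 1 else 0)" (is "?L = _") if "i:I" "k:I" for i k
 proof -
  have "?L = (SUM B:A. (SUM C:A. gi B C v * E C k v)*(SUM l:I. G i l v * E B l v))" unfolding K_def sdl sdr by (subst sum.swap) (simp add: mult_ac)
  also have "... = (SUM B:A. SUM X:A. SUM C:A. gi B C v * E C k v * (e X i v * gE X B v))" using that by (simp add: GE sdl sdr)
  also have "... = (SUM B:A. SUM C:A. SUM X:A. gi B C v * E C k v * (e X i v * gE X B v))" by (intro sum.cong refl sum.swap)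
  also have "... = (SUM C:A. SUM X:A. (SUM B:A. gE X B v * gi B C v)*(E C k v * e X i v))" unfolding sdr by (subst sum.swap, rule scr, subst sum.swap) (simp add: mult_ac)
  also have "... = (SUM C:A. SUM X:A. (if X = C then 1 else 0)*(E C k v * e X i v))" using v by (intro scr) (simp only: gi)
  also have "... = (SUM C:A. E C k v * e C i v)" by (intro scr) (rule sum_dm(2)[OF finA])
  also have "... = (if i = k then 1 else 0)" using dual2[OF v that(2,1)] by auto
  finally show ?thesis .
 qed
 have "Ginv k j v = K j k" by (rule right_inverse_unique[OF fin _ _ K]) (use jk v symG Ginv(2) in auto)
 thus ?thesis unfolding K_def using Ginv(3)[OF jk v] by simp
qed

theorem scal_frame:
 assumes v: "v:S" shows "scal I G v = (SUM B:A. SUM C:A. gi B C v * ricF B C v)"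
proof -
 have "scal I G v = (SUM j:I. SUM k:I. SUM B:A. SUM C:A. gi B C v * E B j v * E C k v * ric I G j k v)" unfolding scal_def using v by (simp add: Ginv_frame sdr)
 also have "... = (SUM j:I. SUM B:A. SUM k:I. SUM C:A. gi B C v * E B j v * E C k v * ric I G j k v)" by (intro sum.cong refl sum.swap)
 also have "... = (SUM B:A. SUM j:I. SUM k:I. SUM C:A. gi B C v * E B j v * E C k v * ric I G j k v)" by (rule sum.swap)
 also have "... = (SUM B:A. SUM C:A. gi B C v * (SUM j:I. SUM k:I. E B j v * E C k v * ric I G j k v))"
 proof (rule scr)
  fix B
  have "(SUM j:I. SUM k:I. SUM C:A. gi B C v * E B j v * E C k v * ric I G j k v) = (SUM j:I. SUM C:A. SUM k:I. gi B C v * E B j v * E C k v * ric I G j k v)"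
   by (intro sum.cong refl sum.swap)
  also have "... = (SUM C:A. SUM j:I. SUM k:I. gi B C v * E B j v * E C k v * ric I G j k v)" by (rule sum.swap)
  finally show "(SUM j:I. SUM k:I. SUM C:A. gi B C v * E B j v * E C k v * ric I G j k v) = (SUM C:A. gi B C v * (SUM j:I. SUM k:I. E B j v * E C k v * ric I G j k v))"
   by (simp add: sdl mult.assoc)
 qed
 also have "... = (SUM B:A. SUM C:A. gi B C v * ricF B C v)" using v by (simp add: ric_frame)
 finally show ?thesis .
qed

end

context frame begin

lemma dE_cmult: "smooth_on I S f ==> v:S ==> dE X (%v. c*f v) v = c*dE X f v" using dE_mult[OF smooth_const[OF S] _, of f v X c] by (simp add: dE_const)

lemma dE_inverse:
 assumes "smooth_on I S f" "!!w. w:S ==> f w ~= 0" "v:S" shows "dE X (%v. inverse (f v)) v = - dE X f v/(f v)\<^sup>2"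
proof -
 have "dE X (%v. f v * inverse (f v)) v = dE X (%v. 1) v" using assms by (intro dE_cong) auto
 hence "dE X f v * inverse (f v) + f v * dE X (%v. inverse (f v)) v = 0" using dE_mult[OF assms(1) smooth_inverse[OF S assms(1,2)] assms(3), of X] by (simp add: dE_const)
 moreover have "f v ~= 0" using assms(2,3) by blast
 ultimately show ?thesis by (simp add: eq_neg_iff_add_eq_0 power2_eq_square divide_simps) (simp add: alg)
qed

end

section \<open>The Ricci tensor in an adapted frame\<close>

abbreviation bK :: "'c set=>(bool + 'c) set" where "bK K == UNIV <+> K"

abbreviation "XF == Inl False"

abbreviation "XT == Inl True"

lemma casesA: "D:bK K ==> (D = Inl False ==> P) ==> (D = Inl True ==> P) ==> (!!k. D = Inr k ==> k:K ==> P) ==> P" by (elim PlusE) (metis (full_types))+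

lemma sum_Plus_bool: "finite K ==> (SUM B:bK K. f B) = f XF + f XT + (SUM k:K. f (Inr k :: bool + 'c))" for f :: "bool + 'c=>real"
 by (subst sum.Plus) (simp_all add: UNIV_bool o_def)

text \<open>
  The frame \<open>\<partial>\<^sub>x\<close> (index \<open>Inl False\<close>), \<open>\<partial>\<^sub>\<phi>\<close> (index \<open>Inl True\<close>) and the horizontal lifts of coordinate
  fields on the factors (indices \<open>Inr k\<close>); \<open>blk k\<close> is the factor to which \<open>k\<close> belongs, and the \<open>k\<close>-th
  column of \<open>J\<close> is the image of the \<open>k\<close>-th coordinate vector.
\<close>

locale adapted_frame = frame I S G "bK K" E e for I :: "'k set" and S :: "('k=>real) set" and G :: "'k=>'k=>('k=>real)=>real"
  and K :: "'c set" and E e :: "bool + 'c=>'k=>('k=>real)=>real" +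
 fixes blk :: "'c=>'i" and b :: "'c=>real" and Aa :: "'c=>('k=>real)=>real"
  and hh h1 h2 :: "('k=>real)=>real"
  and gam gai J :: "'c=>'c=>('k=>real)=>real" and Ga :: "'c=>'c=>'c=>('k=>real)=>real"
 assumes finK: "finite K"
  and sm: "smooth_on I S hh" "smooth_on I S h1" "!!k. k:K ==> smooth_on I S (Aa k)"
   "!!k l. k:K ==> l:K ==> smooth_on I S (gam k l)" "!!k l. k:K ==> l:K ==> smooth_on I S (J k l)"
   "!!m k l. m:K ==> k:K ==> l:K ==> smooth_on I S (Ga m k l)"
  and hpos: "!!v. v:S ==> hh v > 0" and Apos: "!!v k. v:S ==> k:K ==> Aa k v > 0"
  and gEs: "!!v. v:S ==> gE XF XF v = 1/hh v" "!!v. v:S ==> gE XT XT v = hh v"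
   "!!v. v:S ==> gE XF XT v = 0"
   "!!v c k. v:S ==> k:K ==> gE (Inl c) (Inr k) v = 0"
   "!!v k l. v:S ==> k:K ==> l:K ==> gE (Inr k) (Inr l) v = Aa k v * gam k l v"
  and exts: "!!v B C. v:S ==> B:bK K ==> C:bK K ==> ext XF B C v = 0"
   "!!v B C m. v:S ==> B:bK K ==> C:bK K ==> m:K ==> ext (Inr m) B C v = 0"
   "!!v c C. v:S ==> C:bK K ==> ext XT (Inl c) C v = 0"
   "!!v k l. v:S ==> k:K ==> l:K ==> ext XT (Inr k) (Inr l) v = b k*(SUM m:K. J m k v * gam m l v)"
  and dX: "!!v. v:S ==> dE XF hh v = h1 v" "!!v. v:S ==> dE XF h1 v = h2 v"
   "!!v k. v:S ==> k:K ==> dE XF (Aa k) v = b k"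
  and dPh: "!!v. v:S ==> dE XT hh v = 0" "!!v. v:S ==> dE XT h1 v = 0"
   "!!v k. v:S ==> k:K ==> dE XT (Aa k) v = 0"
  and dK: "!!v m. v:S ==> m:K ==> dE (Inr m) hh v = 0" "!!v m. v:S ==> m:K ==> dE (Inr m) h1 v = 0"
   "!!v k m. v:S ==> m:K ==> k:K ==> dE (Inr m) (Aa k) v = 0"
  and dXP: "!!v c k l. v:S ==> k:K ==> l:K ==> dE (Inl c) (gam k l) v = 0"
   "!!v c k l. v:S ==> k:K ==> l:K ==> dE (Inl c) (J k l) v = 0"
   "!!v c m k l. v:S ==> m:K ==> k:K ==> l:K ==> dE (Inl c) (Ga m k l) v = 0"
  and dgam: "!!v m k l. v:S ==> m:K ==> k:K ==> l:K ==>
    dE (Inr m) (gam k l) v = (SUM n:K. Ga n m k v * gam n l v) + (SUM n:K. Ga n m l v * gam k n v)"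
  and bl: "!!v k l. v:S ==> k:K ==> l:K ==> blk k ~= blk l ==> gam k l v = 0"
   "!!v k l. v:S ==> k:K ==> l:K ==> blk k ~= blk l ==> J k l v = 0"
   "!!v m k l. v:S ==> m:K ==> k:K ==> l:K ==> blk m ~= blk k | blk m ~= blk l ==> Ga m k l v = 0"
   "!!v k l. v:S ==> k:K ==> l:K ==> blk k ~= blk l ==> gai k l v = 0"
  and bA: "!!k l. k:K ==> l:K ==> blk k = blk l ==> b k = b l" "!!v k l. v:S ==> k:K ==> l:K ==> blk k = blk l ==> Aa k v = Aa l v"
  and gsy: "!!v k l. v:S ==> k:K ==> l:K ==> gam k l v = gam l k v"
  and Gasy: "!!v m k l. v:S ==> m:K ==> k:K ==> l:K ==> Ga m k l v = Ga m l k v"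
  and gai: "!!v k l. v:S ==> k:K ==> l:K ==> (SUM m:K. gam k m v * gai m l v) = (if k = l then 1 else 0)"
   "!!v k l. v:S ==> k:K ==> l:K ==> gai k l v = gai l k v"
  and skew: "!!v k l. v:S ==> k:K ==> l:K ==> (SUM m:K. J m k v * gam m l v) = - (SUM m:K. J m l v * gam m k v)"
  and JJ: "!!v k l. v:S ==> k:K ==> l:K ==> (SUM m:K. J k m v * J m l v) = (if k = l then - 1 else 0)"
  and einst: "!!v k l. v:S ==> k:K ==> l:K ==> blk k = blk l ==>
   (SUM m:K. dE (Inr m) (Ga m l k) v - dE (Inr l) (Ga m m k) v)
   + (SUM m:K. SUM n:K. Ga m m n v * Ga n l k v - Ga m l n v * Ga n m k v) = gam k l v"
begin

definition om :: "'c=>'c=>('k=>real)=>real" where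
 "om k l v = (SUM m:K. J m k v * gam m l v)"

text \<open>The factors of the connection coefficients get names, so that the simplifier meets them
  as units whose derivatives are listed in \<open>dEs\<close>.\<close>

definition sc :: "real=>(('k=>real)=>real)=>('k=>real)=>real" where
 "sc c f v = c*f v"
definition p where "p v = h1 v * inverse (hh v)"
definition q where "q v = hh v * h1 v"
definition r where "r k l v = hh v * gam k l v"
definition al where "al k v = inverse (Aa k v)"
definition jj where "jj m l v = hh v * (al l v * J m l v)"

text \<open>Guessed from the Koszul formula. \<open>p\<close> and \<open>q\<close> belong to the
  surface metric in \<open>x\<close> and the fibre angle; \<open>r\<close> and \<open>al\<close>
  come from the growth rate \<open>b\<close> of the coefficients \<open>Aa\<close>;
  \<open>om\<close> and \<open>jj\<close> come from the curvature of the connection form;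
  \<open>Ga\<close> are the symbols of the factors.\<close>

definition w :: "bool + 'c=>bool + 'c=>bool + 'c=>('k=>real)=>real" where
 "w D B C = (case (D, B, C) of
  (Inl False, Inl False, Inl False)=>sc (- 1/2) p
 | (Inl False, Inl True, Inl True)=>sc (- 1/2) q
 | (Inl False, Inr k, Inr l)=>sc (- b k/2) (r k l)
 | (Inl True, Inl False, Inl True)=>sc (1/2) p
 | (Inl True, Inl True, Inl False)=>sc (1/2) p
 | (Inl True, Inr k, Inr l)=>sc (- b k/2) (om k l)
 | (Inr m, Inl False, Inr l)=>sc (if m = l then b l/2 else 0) (al l)
 | (Inr m, Inr l, Inl False)=>sc (if m = l then b l/2 else 0) (al l)
 | (Inr m, Inl True, Inr l)=>sc (b l/2) (jj m l)
 | (Inr m, Inr l, Inl True)=>sc (b l/2) (jj m l)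
 | (Inr m, Inr k, Inr l)=>Ga m k l
 | _=>(%_. 0))"

definition gi :: "bool + 'c=>bool + 'c=>('k=>real)=>real" where
 "gi B C v = (case (B, C) of
  (Inl False, Inl False)=>hh v | (Inl True, Inl True)=>1/hh v
 | (Inr k, Inr l)=>gai k l v/Aa k v | _=>0)"

lemmas sumA = sum_Plus_bool[OF finK]

lemma gEs': "v:S ==> gE XT XF v = 0" "v:S ==> k:K ==> gE (Inr k) (Inl c) v = 0" using gEs gE_sym by metis+

lemma hne: "v:S ==> hh v ~= 0" using hpos[of v] by simp
lemma Ane: "v:S ==> k:K ==> Aa k v ~= 0" using Apos[of v k] by simp

lemma sm_om: "k:K ==> l:K ==> smooth_on I S (om k l)" unfolding om_def by (intro smooth_sum[OF S] smooth_mult[OF S] sm)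

lemma smhi: "smooth_on I S (%v. inverse (hh v))" "k:K ==> smooth_on I S (%v. inverse (Aa k v))" using sm hne Ane by (auto intro!: smooth_inverse[OF S])

lemma sm_sc: "smooth_on I S f ==> smooth_on I S (sc c f)" unfolding sc_def by (intro smooth_mult[OF S] smooth_const[OF S])

lemma sm_aux: "smooth_on I S p" "smooth_on I S q" "k:K ==> l:K ==> smooth_on I S (r k l)"
 "k:K ==> smooth_on I S (al k)" "k:K ==> l:K ==> smooth_on I S (jj k l)" unfolding p_def q_def r_def al_def jj_def by (intro smooth_mult[OF S] sm smhi; simp)+

lemmas smi = smooth_const[OF S] smooth_mult[OF S] sm smhi sm_om sm_sc sm_aux

lemma smw: "D:bK K ==> B:bK K ==> C:bK K ==> smooth_on I S (w D B C)" by (erule casesA; erule casesA; erule casesA) (simp_all add: w_def smi)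

lemma dom: "v:S ==> k:K ==> l:K ==> dE (Inl c) (om k l) v = 0" unfolding om_def[abs_def] by (simp add: dE_sum smi dE_mult dXP)

lemma om_skew: "v:S ==> k:K ==> l:K ==> om k l v = - om l k v" unfolding om_def by (rule skew)

lemma om_bl: "v:S ==> k:K ==> l:K ==> blk k ~= blk l ==> om k l v = 0" unfolding om_def by (rule sum.neutral) (metis bl(1,2) mult_zero_left mult_zero_right)

lemma tor:
 assumes v: "v:S" and DBC: "D:bK K" "B:bK K" "C:bK K" shows "w D B C v - w D C B v = - ext D B C v"
proof -
 have anti: "ext D B C v = - ext D C B v" for D B C unfolding ext_def sum_negf[symmetric] by (subst sum.swap) (auto intro!: sum.cong simp: alg)
 have e': "C:bK K ==> ext XT C (Inl c) v = 0" for c C using anti[of "Inl True" C "Inl c"] exts(3)[OF v, of C c] by simp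
 show ?thesis
 \<comment> \<open>In all other cases \<open>w\<close> is symmetric clause by clause, with
   \<open>Gasy\<close> for the factors. Here \<open>b k\<close> and \<open>b l\<close> must be
   exchanged, which is possible because \<open>gam\<close> and \<open>om\<close> vanish between
   different blocks; \<open>gam\<close> is symmetric and \<open>om\<close> skew.\<close>
 proof (cases "EX k l. D = Inl True & B = Inr k & C = Inr l | (EX m. D = Inl False & B = Inr k & C = Inr l)")
  case True
  then obtain k l where kl: "B = Inr k" "C = Inr l" "k:K" "l:K" and D: "D = Inl True | D = Inl False" using DBC by auto
  have "b l * om k l v = b k * om k l v" "b l*gam k l v = b k*gam k l v" using om_bl[OF v kl(3,4)] bl(1)[OF v kl(3,4)] bA(1)[OF kl(3,4)] by (cases "blk k = blk l"; simp)+
  thus ?thesis using D kl v exts(1)[OF v DBC(2,3)] exts(4)[OF v kl(3,4)] om_skew[OF v kl(4,3)] gsy[OF v kl(4,3)] DBC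
   by (auto simp: w_def sc_def r_def om_def[symmetric] alg)
 next
  case False
  thus ?thesis using DBC(2,3) exts(1)[OF v DBC(2,3)] exts(2)[OF v DBC(2,3)] exts(3)[OF v] e' Gasy[OF v]
   by (cases rule: casesA[OF DBC(1)]; cases rule: casesA[OF DBC(2)]; cases rule: casesA[OF DBC(3)]) (auto simp: w_def)
 qed
qed

text \<open>\<open>J\<close> does not mix blocks and \<open>Aa\<close> is constant on each, so the
  weight can be pulled out of the sum. \<open>GaA\<close> does the same for the symbols of the
  factors.\<close>

lemma JA:
 assumes "v:S" "k:K" "l:K" shows "(SUM m:K. J m k v * (Aa m v * gam m l v)) = Aa k v * om k l v" (is "?L = _")
proof -
 have "?L = (SUM m:K. Aa k v * (J m k v * gam m l v))"
 proof (rule scr)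
  fix m assume m: "m:K"
  show "J m k v * (Aa m v * gam m l v) = Aa k v * (J m k v * gam m l v)" using bl(2)[OF assms(1) m assms(2)] bA(2)[OF assms(1) m assms(2)] by (cases "blk m = blk k") auto
 qed
 thus ?thesis by (simp add: om_def sdl)
qed

lemma GaA:
 assumes "v:S" "k:K" "n:K" shows "(SUM m:K. Ga m n k v * (Aa m v * f m)) = Aa k v * (SUM m:K. Ga m n k v * f m)" (is "?L = _")
proof -
 have "?L = (SUM m:K. Aa k v * (Ga m n k v * f m))"
 proof (rule scr)
  fix m assume m: "m:K"
  show "Ga m n k v * (Aa m v * f m) = Aa k v * (Ga m n k v * f m)" using bl(3)[OF assms(1) m assms(3,2)] bA(2)[OF assms(1) m assms(2)] by (cases "blk m = blk k") auto
 qed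
 thus ?thesis by (simp add: sdl)
qed

lemma dEs:
 assumes v: "v:S" shows "smooth_on I S f ==> dE X (sc c f) v = c*dE X f v"
  "dE XF p v = (h2 v * hh v - (h1 v)\<^sup>2)/(hh v)\<^sup>2" "dE XF q v = (h1 v)\<^sup>2 + hh v * h2 v"
  "k:K ==> l:K ==> dE XF (r k l) v = h1 v * gam k l v"
  "k:K ==> dE XF (al k) v = - b k*(al k v)\<^sup>2"
  "dE XT p v = 0" "dE XT q v = 0"
  "k:K ==> l:K ==> dE XT (r k l) v = 0"
  "k:K ==> dE XT (al k) v = 0"
  "k:K ==> l:K ==> dE XT (jj k l) v = 0"
  "m:K ==> dE (Inr m) p v = 0" "m:K ==> dE (Inr m) q v = 0"
  "m:K ==> k:K ==> dE (Inr m) (al k) v = 0" unfolding sc_def[abs_def] p_def[abs_def] q_def[abs_def] r_def[abs_def] jj_def[abs_def] al_def[abs_def]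
 by (simp_all add: v smi dE_cmult dE_mult dE_inverse hne Ane dX dPh dK dXP)
  (simp_all add: v hne Ane power2_eq_square field_simps)

lemma gE_funs:
 assumes "v:S" shows "dE X (gE XF XF) v = dE X (%v. inverse (hh v)) v" (is ?A)
  "dE X (gE XT XT) v = dE X hh v" (is ?B)
  "dE X (gE XF XT) v = 0" (is ?C) "dE X (gE XT XF) v = 0" (is ?D)
  "k:K ==> dE X (gE (Inl c) (Inr k)) v = 0" (is "PROP ?E") "k:K ==> dE X (gE (Inr k) (Inl c)) v = 0" (is "PROP ?G")
  "k:K ==> l:K ==> dE X (gE (Inr k) (Inr l)) v = dE X (Aa k) v * gam k l v + Aa k v * dE X (gam k l) v"
proof -
 have z: "(!!w. w:S ==> f w = 0) ==> dE X f v = 0" for f using dE_cong[of f "%_. 0" v X] assms by (simp add: dE_const)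
 show ?A
  ?B by (rule dE_cong; simp add: gEs assms divide_inverse)+
 show ?C ?D
  "PROP ?E" "PROP ?G" by (rule z; simp add: gEs gEs')+
 assume kl: "k:K" "l:K"
 have "dE X (gE (Inr k) (Inr l)) v = dE X (%v. Aa k v * gam k l v) v" by (rule dE_cong) (simp_all add: gEs assms kl)
 thus "dE X (gE (Inr k) (Inr l)) v = dE X (Aa k) v * gam k l v + Aa k v * dE X (gam k l) v" using assms kl by (simp add: dE_mult smi)
qed

text \<open>The coefficients with lowered index: the inner product of the derivative of
  \<open>E B\<close> along \<open>E X\<close> with \<open>E C\<close>. Compatibility with the metric
  is then a statement about \<open>Q X B C + Q X C B\<close>.\<close>

definition Q where "Q X B C v = (SUM D:bK K. w D X B v * gE D C v)"

lemma Q_delta: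
 assumes "v:S" "l:K" "k:K" shows "(SUM m:K. sc (if m = l then b l/2 else 0) (al l) v * (Aa m v * gam m k v)) = b l/2*gam l k v" (is "?L = _")
proof -
 have "?L
   = (SUM m:K. (if m = l then 1 else 0)*(b l/2*(al l v * (Aa m v * gam m k v))))" by (intro scr) (simp add: sc_def)
 also have "... = b l/2*(al l v * (Aa l v * gam l k v))" by (rule sum_dm(2)[OF finK assms(2)])
 finally show ?thesis using assms by (simp add: al_def Ane)
qed

lemma Q_jj:
 assumes "v:S" "l:K" "k:K" shows "(SUM m:K. sc (b l/2) (jj m l) v * (Aa m v * gam m k v)) = b l/2*hh v * om l k v" (is "?L = _")
proof -
 have "?L = b l/2*hh v * al l v * (SUM m:K. J m l v * (Aa m v * gam m k v))" by (simp add: sc_def jj_def sdl mult_ac)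
 thus ?thesis using assms by (simp add: JA al_def Ane)
qed

lemma Qs:
 assumes v: "v:S" shows "Q XF XF XF v = - h1 v/(2*(hh v)\<^sup>2)"
  "Q XT XF XF v = 0" "Q XF XT XF v = 0"
  "Q XT XT XF v = - h1 v/2" "Q XF XF XT v = 0"
  "Q XT XF XT v = h1 v/2" "Q XF XT XT v = h1 v/2"
  "Q XT XT XT v = 0"
  "k:K ==> l:K ==> Q XF (Inr k) (Inr l) v = b k/2*gam k l v"
  "k:K ==> l:K ==> Q XT (Inr k) (Inr l) v = b k/2*hh v * om k l v"
  "k:K ==> l:K ==> Q (Inr k) XF (Inr l) v = b k/2*gam k l v"
  "k:K ==> l:K ==> Q (Inr k) XT (Inr l) v = b k/2*hh v * om k l v"
  "k:K ==> l:K ==> Q (Inr k) (Inr l) XF v = - b k/2*gam k l v"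
  "k:K ==> l:K ==> Q (Inr k) (Inr l) XT v = - b k/2*hh v * om k l v"
  "k:K ==> l:K ==> m:K ==> Q (Inr k) (Inr l) (Inr m) v = Aa l v * (SUM n:K. Ga n k l v * gam n m v)" unfolding Q_def sumA
 by (simp_all add: v w_def gEs gEs' Q_delta Q_jj GaA)
  (simp_all add: v sc_def p_def q_def r_def hne power2_eq_square field_simps)

lemma Qs0:
 assumes v: "v:S" and k: "k:K" shows "Q (Inl c) (Inl d) (Inr k) v = 0" "Q (Inl c) (Inr k) (Inl d) v = 0" "Q (Inr k) (Inl c) (Inl d) v = 0"
 unfolding Q_def sumA by (cases c; cases d; simp add: v k w_def gEs gEs')+

lemma b_gam: "v:S ==> k:K ==> l:K ==> b k*gam k l v = b l*gam k l v"
 "v:S ==> k:K ==> l:K ==> b k * om k l v = b l * om k l v" using bl(1)[of v k l] om_bl[of v k l] bA(1)[of k l] by (cases "blk k = blk l"; simp)+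

lemma A_gam: "v:S ==> k:K ==> l:K ==> m:K ==> Aa k v * (SUM n:K. Ga n m l v * gam k n v) = Aa l v * (SUM n:K. Ga n m l v * gam n k v)" unfolding sdl
proof (rule scr)
 fix n assume "v:S" "k:K" "l:K" "m:K" "n:K"
 thus "Aa k v * (Ga n m l v * gam k n v) = Aa l v * (Ga n m l v * gam n k v)"
  using bl(3)[of v n m l] bl(1)[of v k n] gsy[of v k n] bA(2)[of v k l] by (cases "blk k = blk n"; cases "blk n = blk l"; simp)
qed

lemma met:
 assumes v: "v:S" and XBC: "X:bK K" "B:bK K" "C:bK K"
 shows "dE X (gE B C) v = (SUM D:bK K. w D X B v * gE D C v) + (SUM D:bK K. w D X C v * gE B D v)"
proof -
 have "dE X (gE B C) v = Q X B C v + Q X C B v"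
 proof (cases "EX k:K. EX l:K. B = Inr k & C = Inr l")
  case True
  then obtain k l where kl: "k:K" "l:K" "B = Inr k" "C = Inr l" by blast
  have 1: "b l*gam l k v = b k*gam k l v" using b_gam(1)[OF v kl(1,2)] gsy[OF v kl(1,2)] by auto
  have 2: "b l * om l k v = - (b k * om k l v)" using b_gam(2)[OF v kl(1,2)] om_skew[OF v kl(1,2)] by auto
  show ?thesis
  proof (cases rule: casesA[OF XBC(1)])
   case 1
   thus ?thesis using \<open>b l*gam l k v = b k*gam k l v\<close> by (simp add: v kl Qs gE_funs dX dXP)
  next
   case 2
   have "b k*hh v * om k l v + b l*hh v * om l k v = 0" (is "?L = _")
   proof -
    have "?L = hh v * (b k * om k l v + b l * om l k v)" by (simp add: alg)
    thus ?thesis using \<open>b l * om l k v = - (b k * om k l v)\<close> by simp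
   qed
   thus ?thesis using 2 by (simp add: v kl Qs gE_funs dPh dXP)
  next
   case (3 m)
   thus ?thesis using A_gam[OF v kl(1,2) 3(2)] by (simp add: v kl Qs gE_funs dK dgam distrib_left)
  qed
 next
  case False
  thus ?thesis by (cases rule: casesA[OF XBC(1)]; cases rule: casesA[OF XBC(2)]; cases rule: casesA[OF XBC(3)])
    (simp_all add: v Qs Qs0 gE_funs dX dPh dK dXP dgam dE_inverse smi hne)
 qed
 thus ?thesis unfolding Q_def using gE_sym[OF v, of B] by simp
qed

lemma gi_inverse:
 assumes v: "v:S" and DH: "D:bK K" "H:bK K" shows "(SUM C:bK K. gE D C v * gi C H v) = (if D = H then 1 else 0)"
proof -
 have 1: "(SUM m:K. Aa k v * gam k m v * gai m l v/Aa m v) = (if k = l then 1 else 0)" (is "?L = _") if kl: "k:K" "l:K" for k l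
 proof -
  have "?L = (SUM m:K. gam k m v * gai m l v)"
  proof (rule scr)
   fix m assume "m:K"
   thus "Aa k v * gam k m v * gai m l v/Aa m v = gam k m v * gai m l v"
    using bl(1)[OF v kl(1), of m] bA(2)[OF v kl(1), of m] Ane[OF v, of m] by (cases "blk k = blk m") auto
  qed
  thus ?thesis using gai(1)[OF v kl] by simp
 qed
 show ?thesis by (cases rule: casesA[OF DH(1)]; cases rule: casesA[OF DH(2)])
   (simp_all add: v sumA gi_def gEs gEs' hne 1)
qed

sublocale frame_connection I S G "bK K" E e w gi by unfold_locales (use smw tor met gi_inverse in auto)

text \<open>The logarithmic derivative in \<open>x\<close> of the product of the
  \<open>A i ^ (d_i / 2)\<close>: every index \<open>k\<close> contributes half an exponent.\<close>

definition T where "T v = (SUM k:K. b k/2*al k v)"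

lemma sum_K_delta: "l:K ==> (SUM m:K. (if m = l then f m else 0)) = (f l :: real)"
 "l:K ==> (SUM m:K. (if l = m then f m else 0)) = (f l :: real)" using finK by simp_all

lemma curv_sum: "(SUM k:K. curv (Inr k) (Inr k) C B v) = (SUM k:K. dE (Inr k) (w (Inr k) C B) v - dE C (w (Inr k) (Inr k) B) v)
 + (SUM k:K. w (Inr k) (Inr k) XF v * w XF C B v - w (Inr k) C XF v * w XF (Inr k) B v
    - (w XF (Inr k) C v - w XF C (Inr k) v)*w (Inr k) XF B v)
 + (SUM k:K. w (Inr k) (Inr k) XT v * w XT C B v - w (Inr k) C XT v * w XT (Inr k) B v
    - (w XT (Inr k) C v - w XT C (Inr k) v)*w (Inr k) XT B v)
 + (SUM k:K. SUM n:K. w (Inr k) (Inr k) (Inr n) v * w (Inr n) C B v - w (Inr k) C (Inr n) v * w (Inr n) (Inr k) B v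
    - (w (Inr n) (Inr k) C v - w (Inr n) C (Inr k) v)*w (Inr k) (Inr n) B v)" unfolding curv_def sumA by (simp add: sum.distrib sum_subtractf alg)

lemma sum_sc_delta:
 "l:K ==> (SUM m:K. sc (if m = l then c else 0) f v * g m) = c*f v * g l" (is "PROP ?A")
 "m:K ==> (SUM l:K. sc (if m = l then d l else 0) (f' l) v * g l) = d m*f' m v * g m" (is "PROP ?B")
proof -
 have "l:K ==> (SUM m:K. sc (if m = l then c else 0) f v * g m) = (SUM m:K. if m = l then c*f v * g m else 0)" by (intro sum.cong) (auto simp: sc_def)
 thus "PROP ?A" by (simp add: sum_K_delta)
 have "m:K ==> (SUM l:K. sc (if m = l then d l else 0) (f' l) v * g l) = (SUM l:K. if m = l then d l*f' l v * g l else 0)" by (intro sum.cong) (auto simp: sc_def)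
 thus "PROP ?B" by (simp add: sum_K_delta)
qed

text \<open>This is \<open>- T' / 2\<close>, with \<open>T'\<close> the derivative of
  \<open>T\<close> in \<open>x\<close>.\<close>

definition B2 where "B2 v = (SUM k:K. (b k/2*al k v)\<^sup>2)"

lemma ricF_XX:
 assumes v: "v:S" shows "hh v * ricF XF XF v = - h2 v/2 - h1 v * T v/2 + hh v * B2 v"
proof -
 have 1: "curv XT XT XF XF v = - ((h2 v * hh v - (h1 v)\<^sup>2)/(hh v)\<^sup>2)/2 - (p v)\<^sup>2/2"
  unfolding curv_def sumA by (simp add: w_def v dE_const dEs smi sc_def power2_eq_square)
 have 0: "curv XF XF XF XF v = 0" unfolding curv_def by simp
 have "(SUM k:K. curv (Inr k) (Inr k) XF XF v) = (SUM k:K. 2*(b k/2*al k v)\<^sup>2) + (SUM k:K. (b k/2*al k v)*(- p v/2)) - (SUM k:K. (b k/2*al k v)\<^sup>2)"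
 proof -
  have "(SUM k:K. dE (Inr k) (w (Inr k) XF XF) v - dE XF (w (Inr k) (Inr k) XF) v) = (SUM k:K. 2*(b k/2*al k v)\<^sup>2)"
   by (intro scr) (simp add: w_def v dE_const dEs smi power2_eq_square)
  moreover have "(SUM k:K. SUM n:K. w (Inr k) XF (Inr n) v * w (Inr n) (Inr k) XF v) = (SUM k:K. (b k/2*al k v)\<^sup>2)"
   by (intro scr) (simp add: w_def sum_sc_delta, simp add: sc_def power2_eq_square)
  ultimately show ?thesis unfolding curv_sum by (simp add: w_def sc_def sum_negf sum_subtractf)
 qed
 hence 2: "(SUM k:K. curv (Inr k) (Inr k) XF XF v) = B2 v - p v/2*T v" unfolding B2_def T_def by (simp add: sdl sum_negf mult_ac flip: sum_divide_distrib)
 show ?thesis unfolding ricF_def sumA 0 1 2 using hne[OF v] by (simp add: p_def field_simps power2_eq_square)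
qed

lemma J_square_trace:
 assumes v: "v:S" shows "(SUM k:K. SUM n:K. w (Inr k) XT (Inr n) v * w (Inr n) (Inr k) XT v) = - (hh v)\<^sup>2*B2 v"
proof -
 have "(SUM n:K. w (Inr k) XT (Inr n) v * w (Inr n) (Inr k) XT v) = - (hh v)\<^sup>2*(b k/2*al k v)\<^sup>2" (is "?L = _") if k: "k:K" for k
 proof -
  have "?L = (SUM n:K. (hh v)\<^sup>2*(b k/2*al k v)\<^sup>2*(J k n v * J n k v))"
  proof (rule scr)
   fix n assume n: "n:K"
   show "w (Inr k) XT (Inr n) v * w (Inr n) (Inr k) XT v = (hh v)\<^sup>2*(b k/2*al k v)\<^sup>2*(J k n v * J n k v)" using bl(2)[OF v k n] bA(1)[OF k n] bA(2)[OF v k n]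
    by (cases "blk k = blk n") (auto simp: w_def sc_def jj_def al_def power2_eq_square)
  qed
  thus ?thesis using JJ[OF v k k] by (simp flip: sdl)
 qed
 thus ?thesis unfolding B2_def by (simp add: sdl sum_negf)
qed

text \<open>The same value as in \<open>ricF_XX\<close>, as the invariance of the Ricci tensor under
  the complex structure demands. Here \<open>B2\<close> enters through the square of
  \<open>J\<close>, see \<open>J_square_trace\<close>.\<close>

lemma ricF_PP:
 assumes v: "v:S" shows "ricF XT XT v/hh v = - h2 v/2 - h1 v * T v/2 + hh v * B2 v"
proof -
 have 1: "curv XF XF XT XT v = - hh v * h2 v/2" unfolding curv_def sumA using hne[OF v]
  by (simp add: w_def v dE_const dEs smi sc_def p_def q_def power2_eq_square field_simps)
 have 0: "curv XT XT XT XT v = 0" unfolding curv_def by simp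
 have "(SUM k:K. curv (Inr k) (Inr k) XT XT v) = (SUM k:K. (b k/2*al k v)*(- q v/2)) + (hh v)\<^sup>2*B2 v"
 proof -
  have "(SUM k:K. dE (Inr k) (w (Inr k) XT XT) v - dE XT (w (Inr k) (Inr k) XT) v) = 0" by (intro sum.neutral) (simp add: w_def v dE_const dEs smi)
  thus ?thesis unfolding curv_sum using J_square_trace[OF v] by (simp add: w_def sc_def sum_negf sum_subtractf)
 qed
 hence 2: "(SUM k:K. curv (Inr k) (Inr k) XT XT v) = (hh v)\<^sup>2*B2 v - q v/2*T v" unfolding T_def by (simp add: sdl sum_negf mult_ac flip: sum_divide_distrib)
 show ?thesis unfolding ricF_def sumA 0 1 2 using hne[OF v] by (simp add: q_def field_simps power2_eq_square)
qed

text \<open>\<open>J\<close> is the product of the symmetric \<open>gai\<close> and the skew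
  \<open>om\<close>, so its trace vanishes; the weights are constant on blocks and do not disturb
  this.\<close>

lemma trJ:
 assumes v: "v:S" shows "(SUM k:K. b k*al k v * J k k v) = 0" (is "?L = _")
proof -
 have J: "J k l v = (SUM n:K. gai k n v * om l n v)" if kl: "k:K" "l:K" for k l
 proof -
  have "(SUM n:K. gai k n v * om l n v) = (SUM m:K. SUM n:K. J m l v * (gam m n v * gai n k v))"
   unfolding om_def sdl using gai(2)[OF v kl(1)] by (subst sum.swap) (simp add: mult_ac)
  also have "... = (SUM m:K. J m l v * (if m = k then 1 else 0))" using kl by (intro scr) (simp only: gai(1)[OF v] flip: sdl)
  finally show ?thesis using sum_dm(4)[OF finK kl(1)] by simp
 qed
 define X where "X = (SUM k:K. SUM n:K. b k*al k v * (gai k n v * om k n v))"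
 have "X = (SUM n:K. SUM k:K. b k*al k v * (gai k n v * om k n v))" unfolding X_def by (rule sum.swap)
 also have "... = (SUM n:K. SUM k:K. - (b n*al n v * (gai n k v * om n k v)))"
 proof (intro scr)
  fix n k assume nk: "n:K" "k:K"
  show "b k*al k v * (gai k n v * om k n v) = - (b n*al n v * (gai n k v * om n k v))"
   using bl(4)[OF v nk(2,1)] gai(2)[OF v nk] om_skew[OF v nk] bA(1)[OF nk] bA(2)[OF v nk] by (cases "blk k = blk n") (auto simp: al_def)
 qed
 also have "... = - X" unfolding X_def by (simp add: sum_negf)
 finally have "X = 0" by simp
 moreover have "X = ?L" unfolding X_def using J by (simp add: sdl)
 ultimately show ?thesis by simp
qed

lemma J_om:
 assumes v: "v:S" and kl: "k:K" "l:K" shows "(SUM m:K. J m l v * om m k v) = - gam l k v" (is "?L = _")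
proof -
 have "?L = (SUM n:K. SUM m:K. J n m v * J m l v * gam n k v)" unfolding om_def sdl by (subst sum.swap) (simp add: mult_ac)
 also have "... = (SUM n:K. (if n = l then - 1 else 0)*gam n k v)" using JJ[OF v] kl by (simp flip: sdr)
 also have "... = (SUM n:K. (if n = l then 1 else 0)*(- gam n k v))" by (intro sum.cong) auto
 also have "... = - gam l k v" by (rule sum_dm(2)[OF finK kl(2)])
 finally show ?thesis .
qed

text \<open>The factor contributes \<open>gam\<close> through its Einstein constant
  \<open>1\<close>, and \<open>s1\<close> brings in \<open>T\<close>. The terms with
  \<open>be\<close> cancel: the planes through \<open>XF\<close> and through \<open>XT\<close> give
  one half of \<open>hh * b k * be * gam k l\<close> each, the horizontal planes minus the
  whole.\<close>

lemma ricF_KK: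
 assumes v: "v:S" and kl: "k:K" "l:K" "blk k = blk l" shows "ricF (Inr k) (Inr l) v = (1 - b k/2*(h1 v + hh v * T v))*gam k l v"
proof -
 have bk: "b l = b k" "al l v = al k v" using bA(1)[OF kl] bA(2)[OF v kl] by (auto simp: al_def)
 have gs: "gam l k v = gam k l v" using gsy[OF v kl(1,2)] by simp
 have os: "om l k v = - om k l v" by (rule om_skew[OF v kl(2,1)])
 define be where "be = b k/2*al k v"
 have X: "curv XF XF (Inr l) (Inr k) v = - b k*h1 v * gam k l v/4 + hh v * b k*be*gam k l v/2" (is "?L = _")
 proof -
  have "(SUM m:K. w XF (Inr l) (Inr m) v * w (Inr m) XF (Inr k) v) = (SUM m:K. sc (if m = k then b k/2 else 0) (al k) v * (- b l/2*r l m v))"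
   by (intro scr) (simp add: w_def sc_def)
  also have "... = - hh v * b k*be*gam k l v/2" by (subst sum_sc_delta(1)[OF kl(1)]) (simp add: bk gs r_def be_def)
  finally have s: "(SUM m:K. w XF (Inr l) (Inr m) v * w (Inr m) XF (Inr k) v) = - hh v * b k*be*gam k l v/2" .
  have "?L = - b l/2*(h1 v * gam l k v) + p v/2*(b l/2*r l k v)/1
   - (SUM m:K. w XF (Inr l) (Inr m) v * w (Inr m) XF (Inr k) v)"
   unfolding curv_def sumA using kl v by (simp add: w_def dE_const dEs smi sum_subtractf) (simp add: sc_def sum_negf)
  thus ?thesis unfolding s using hne[OF v] by (simp add: bk gs r_def p_def field_simps)
 qed
 have P: "curv XT XT (Inr l) (Inr k) v = - b k*h1 v * gam k l v/4 + hh v * b k*be*gam k l v/2" (is "?L = _")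
 proof -
  have "(SUM m:K. w XT (Inr l) (Inr m) v * w (Inr m) XT (Inr k) v) = (SUM m:K. (hh v * b k*be/2)*(J m k v * om m l v))"
   using om_skew[OF v kl(2)] by (intro scr) (simp add: w_def sc_def jj_def bk be_def)
  also have "... = - hh v * b k*be*gam k l v/2" unfolding sdl[symmetric] J_om[OF v kl(2,1)] by simp
  finally have s: "(SUM m:K. w XT (Inr l) (Inr m) v * w (Inr m) XT (Inr k) v) = - hh v * b k*be*gam k l v/2" .
  have "?L = - p v/2*(b l/2*r l k v)
   - (SUM m:K. w XT (Inr l) (Inr m) v * w (Inr m) XT (Inr k) v)"
   unfolding curv_def sumA using kl v by (simp add: w_def dE_const dEs smi dom sum_subtractf) (simp add: sc_def sum_negf)
  thus ?thesis unfolding s using hne[OF v] by (simp add: bk gs r_def p_def field_simps)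
 qed
 have K: "(SUM m:K. curv (Inr m) (Inr m) (Inr l) (Inr k) v) = gam k l v - hh v * b k*T v * gam k l v/2 - hh v * b k*be*gam k l v"
 proof -
  have s1: "(SUM m:K. w (Inr m) (Inr m) XF v * w XF (Inr l) (Inr k) v) = - hh v * b k*T v * gam k l v/2"
   unfolding T_def by (simp add: w_def sc_def r_def bk gs sdl sdr sum_negf sum_divide_distrib mult_ac)
  have s2: "(SUM m:K. w (Inr m) (Inr l) XF v * w XF (Inr m) (Inr k) v) = - hh v * b k*be*gam k l v/2" (is "?L = _")
  proof -
   have "?L = b l/2*al l v * (- b l/2*r l k v)" using kl by (simp add: w_def sum_sc_delta) (simp add: sc_def)
   thus ?thesis by (simp add: bk gs r_def be_def)
  qed
  have s3: "(SUM m:K. (w XF (Inr m) (Inr l) v - w XF (Inr l) (Inr m) v)*w (Inr m) XF (Inr k) v) = 0"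
  proof (rule sum.neutral, rule ballI)
   fix m assume m: "m:K"
   have "w XF (Inr m) (Inr l) v = w XF (Inr l) (Inr m) v" using b_gam(1)[OF v m kl(2)] gsy[OF v m kl(2)] by (cases "gam m l v = 0") (simp_all add: w_def sc_def r_def)
   thus "(w XF (Inr m) (Inr l) v - w XF (Inr l) (Inr m) v)*w (Inr m) XF (Inr k) v = 0" by simp
  qed
  have s4: "(SUM m:K. w (Inr m) (Inr m) XT v * w XT (Inr l) (Inr k) v) = 0" (is "?L = _")
  proof -
   have "?L = (SUM m:K. b m*al m v * J m m v)*(hh v/2*w XT (Inr l) (Inr k) v)" unfolding sdr by (intro scr) (simp add: w_def sc_def jj_def)
   thus ?thesis using trJ[OF v] by simp
  qed
  have s5: "(SUM m:K. w (Inr m) (Inr l) XT v * w XT (Inr m) (Inr k) v) = hh v * b k*be*gam k l v/2" (is "?L = _")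
  proof -
   have "?L = (SUM m:K. (- hh v * b k*be/2)*(J m l v * om m k v))" using b_gam(2)[OF v _ kl(1)] by (intro scr) (auto simp: w_def sc_def jj_def bk be_def)
   also have "... = hh v * b k*be*gam k l v/2" unfolding sdl[symmetric] J_om[OF v kl(1,2)] by (simp add: gs)
   finally show ?thesis .
  qed
  have s6: "(SUM m:K. (w XT (Inr m) (Inr l) v - w XT (Inr l) (Inr m) v)*w (Inr m) XT (Inr k) v) = hh v * b k*be*gam k l v" (is "?L = _")
  proof -
   have "?L = (SUM m:K. (- hh v * b k*be)*(J m k v * om m l v))"
   proof (rule scr)
    fix m assume m: "m:K"
    have "w XT (Inr m) (Inr l) v - w XT (Inr l) (Inr m) v = - (b k * om m l v)" using b_gam(2)[OF v m kl(2)] om_skew[OF v kl(2) m] bk(1) by (auto simp: w_def sc_def)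
    thus "(w XT (Inr m) (Inr l) v - w XT (Inr l) (Inr m) v)*w (Inr m) XT (Inr k) v = (- hh v * b k*be)*(J m k v * om m l v)" by (simp add: w_def sc_def jj_def be_def)
   qed
   also have "... = hh v * b k*be*gam k l v" unfolding sdl[symmetric] J_om[OF v kl(2,1)] by simp
   finally show ?thesis .
  qed
  have s7: "(SUM m:K. dE (Inr m) (w (Inr m) (Inr l) (Inr k)) v - dE (Inr l) (w (Inr m) (Inr m) (Inr k)) v)
   + (SUM m:K. SUM n:K. w (Inr m) (Inr m) (Inr n) v * w (Inr n) (Inr l) (Inr k) v - w (Inr m) (Inr l) (Inr n) v * w (Inr n) (Inr m) (Inr k) v
    - (w (Inr n) (Inr m) (Inr l) v - w (Inr n) (Inr l) (Inr m) v)*w (Inr m) (Inr n) (Inr k) v) = gam k l v" using einst[OF v kl] Gasy[OF v _ _ kl(2)] by (simp add: w_def)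
  show ?thesis using s7 unfolding curv_sum sum_subtractf s1 s2 s3 s4 s5 s6 by (simp add: sum_subtractf alg)
 qed
 show ?thesis unfolding ricF_def sumA X P K by (simp add: alg)
qed

text \<open>With \<open>V' / V\<close> equal to the sum of the \<open>b k / (2 * Aa k)\<close>, the
  terms after the first sum are \<open>- (V h)'' / V\<close> written out by the product
  rule.\<close>

theorem adapted_scal:
 assumes v: "v:S" shows "scal I G v = (SUM k:K. 1/Aa k v) - h2 v - 2*h1 v * (SUM k:K. b k/(2*Aa k v))
  - hh v * ((SUM k:K. b k/(2*Aa k v))\<^sup>2 - (SUM k:K. (b k)\<^sup>2/(2*(Aa k v)\<^sup>2)))"
proof -
 have K: "(SUM k:K. SUM l:K. gi (Inr k) (Inr l) v * ricF (Inr k) (Inr l) v) = (SUM k:K. al k v * (1 - b k/2*(h1 v + hh v * T v)))"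
 proof (rule scr)
  fix k assume k: "k:K"
  have "(SUM l:K. gi (Inr k) (Inr l) v * ricF (Inr k) (Inr l) v) = (SUM l:K. al k v * (1 - b k/2*(h1 v + hh v * T v))*(gam k l v * gai l k v))"
  proof (rule scr)
   fix l assume l: "l:K"
   show "gi (Inr k) (Inr l) v * ricF (Inr k) (Inr l) v = al k v * (1 - b k/2*(h1 v + hh v * T v))*(gam k l v * gai l k v)"
   proof (cases "blk k = blk l")
    case True
    show ?thesis unfolding ricF_KK[OF v k l True] by (simp add: gi_def al_def inverse_eq_divide gai(2)[OF v k l])
   next
    case False
    thus ?thesis using bl(4)[OF v k l] bl(4)[OF v l k] by (simp add: gi_def)
   qed
  qed
  also have "... = al k v * (1 - b k/2*(h1 v + hh v * T v))" using gai(1)[OF v k k] by (simp flip: sdl)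
  finally show "(SUM l:K. gi (Inr k) (Inr l) v * ricF (Inr k) (Inr l) v) = al k v * (1 - b k/2*(h1 v + hh v * T v))" .
 qed
 have "scal I G v = hh v * ricF XF XF v + ricF XT XT v/hh v + (SUM k:K. SUM l:K. gi (Inr k) (Inr l) v * ricF (Inr k) (Inr l) v)"
  unfolding scal_frame[OF v] sumA by (simp add: gi_def)
 also have "... = - h2 v - h1 v * T v + 2*hh v * B2 v + (SUM k:K. al k v) - (h1 v + hh v * T v)*T v"
 proof -
  have "(SUM k:K. al k v * (1 - b k/2*X)) = (SUM k:K. al k v) - X*T v" (is "?L = _") for X
  proof -
   have "?L = (SUM k:K. al k v - X*(b k/2*al k v))" by (intro scr) (simp add: alg)
   thus ?thesis unfolding T_def sdl sum_subtractf .
  qed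
  from this[of "h1 v + hh v * T v"] show ?thesis unfolding ricF_XX[OF v] ricF_PP[OF v] K by linarith
 qed
 finally have eq: "scal I G v = - h2 v - h1 v * T v + 2*hh v * B2 v + (SUM k:K. al k v) - (h1 v + hh v * T v)*T v" .
 define t where "t = (SUM k:K. b k/(2*Aa k v))"
 define d where "d = (SUM k:K. (b k)\<^sup>2/(2*(Aa k v)\<^sup>2))"
 have "T v = t" unfolding T_def al_def t_def by (intro scr) (simp add: inverse_eq_divide)
 moreover have "B2 v = d/2" unfolding B2_def al_def d_def sum_divide_distrib by (intro scr) (simp add: inverse_eq_divide power_divide)
 moreover have "(SUM k:K. al k v) = (SUM k:K. 1/Aa k v)" by (simp add: al_def inverse_eq_divide)
 ultimately show ?thesis unfolding eq t_def[symmetric] d_def[symmetric] by (simp add: power2_eq_square alg)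
qed

end

lemma opn_preimage:
 assumes S: "opn I S" and F: "!!j. j:J ==> smooth_on I S (%v. F v j)" "!!v. v:S ==> F v:Rn J" and T: "opn J T" shows "opn I {v:S. F v:T}"
proof -
 have "cont S F"
 proof (rule continuous_on_coordinatewise_then_product)
  fix j
  show "cont S (%v. F v j)"
  proof (cases "j:J")
   case True
   thus ?thesis using smooth_on_cont[OF F(1) opn_subset[OF S]] by blast
  next
   case False
   hence "cont S (%v. F v j) = cont S (%v. undefined::real)" using F(2) by (intro continuous_on_cong) (auto simp: PiE_def extensional_def)
   thus ?thesis by simp
  qed
 qed
 moreover obtain U where U: "open U" "T = Rn J Int U" using T by (auto simp: openin_open)
 ultimately have "openin (top_of_set S) (S Int F -` U)" by (simp add: continuous_openin_preimage_gen)
 moreover have "S Int F -` U = {v:S. F v:T}" using F(2) U by auto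
 ultimately show ?thesis using S openin_trans by metis
qed

lemma smooth_on_local:
 assumes "opn I S" "!!v. v:S ==> EX T. opn I T & v:T & T <= S & smooth_on I T f" shows "smooth_on I S f" unfolding smooth_on_iff[OF opn_subset[OF assms(1)]]
proof (intro allI impI conjI)
 fix ks assume ks: "set ks <= I"
 have loc: "EX T. opn I T & v:T & T <= S & cont T (foldr pd ks f) & pdiff I T (foldr pd ks f)" if "v:S" for v
  using assms(2)[OF that] ks smooth_on_iff[OF opn_subset] by metis
 thus "pdiff I S (foldr pd ks f)" unfolding pdiff_def by blast
 show "cont S (foldr pd ks f)" unfolding continuous_openin_preimage_eq
 proof (intro allI impI)
  fix t :: "real set" assume t: "open t"
  have "EX U. openin (top_of_set S) U & v:U & U <= S Int foldr pd ks f -` t" if v: "v:S Int foldr pd ks f -` t" for v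
  proof -
   obtain T where T: "opn I T" "v:T" "T <= S" "cont T (foldr pd ks f)" using loc v by blast
   have "openin (top_of_set T) (T Int foldr pd ks f -` t)" using continuous_openin_preimage_gen[OF T(4) t] .
   hence o: "opn I (T Int foldr pd ks f -` t)" using T(1) openin_trans by blast
   have "openin (top_of_set S) (T Int foldr pd ks f -` t)" by (rule openin_subset_trans[OF o _ opn_subset[OF assms(1)]]) (use T(3) in auto)
   thus ?thesis using T v by (intro exI[of _ "T Int foldr pd ks f -` t"]) auto
  qed
  thus "openin (top_of_set S) (S Int foldr pd ks f -` t)" by (subst openin_subopen) blast
 qed
qed

section \<open>Manifolds and tangent vectors\<close>

abbreviation "chopen M S == S <= pts M & (ALL c:atlas M. opn (idx M) (snd c ` (S Int fst c)))"

text \<open>\<open>mtop\<close> applies \<open>topology\<close> to a predicate, which is meaningful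
  once the predicate is known to be a topology. Injectivity of the charts makes images commute with
  intersections.\<close>

lemma istopology_mtop:
 assumes "!!c. c:atlas M ==> inj_on (snd c) (fst c)" shows "istopology (%S. chopen M S)"
 unfolding istopology_def
proof (intro conjI allI impI)
 fix S T assume ST: "chopen M S"
  "chopen M T"
 thus "S Int T <= pts M" by blast
 show "ALL c:atlas M. opn (idx M) (snd c ` (S Int T Int fst c))"
 proof
  fix c assume c: "c:atlas M"
  have "snd c ` (S Int T Int fst c) = snd c ` (S Int fst c) Int snd c ` (T Int fst c)" using inj_onD[OF assms[OF c]] by (auto intro!: image_eqI)
  thus "opn (idx M) (snd c ` (S Int T Int fst c))" using ST c openin_Int by metis
 qed
next
 fix \<K> assume K: "ALL S:\<K>. chopen M S"
 thus "Union \<K> <= pts M" by blast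
 show "ALL c:atlas M. opn (idx M) (snd c ` (Union \<K> Int fst c))"
 proof
  fix c assume c: "c:atlas M"
  have "snd c ` (Union \<K> Int fst c) = (UN S:\<K>. snd c ` (S Int fst c))" by auto
  thus "opn (idx M) (snd c ` (Union \<K> Int fst c))" using K c by (metis (no_types, lifting) imageE openin_Union)
 qed
qed

lemma openin_mtop:
 assumes "!!c. c:atlas M ==> inj_on (snd c) (fst c)"
 shows "openin (mtop M) S \<longleftrightarrow> chopen M S"
proof -
 have "istopology (%S. chopen M S)" by (rule istopology_mtop[OF assms])
 thus ?thesis unfolding mtop_def powertop_real_eq by (simp add: topology_inverse')
qed

lemma topspace_mtop:
 assumes "!!c. c:atlas M ==> inj_on (snd c) (fst c)" "!!c. c:atlas M ==> opn (idx M) (img c)"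
  "!!c. c:atlas M ==> fst c <= pts M" shows "topspace (mtop M) = pts M"
proof -
 have "openin (mtop M) (pts M)" using assms(2,3) by (simp add: openin_mtop[of M, OF assms(1)] Int_absorb1)
 moreover have "openin (mtop M) S ==> S <= pts M" for S by (simp add: openin_mtop[of M, OF assms(1)])
 ultimately show ?thesis by (metis openin_subset openin_topspace subset_antisym)
qed

context
 fixes M :: "('p, 'k) mfd"
 assumes M: "manifold M"
begin

lemma mfd_fin: "finite (idx M)" using M unfolding manifold_def by blast

lemma mfd_cover: "p:pts M ==> EX c:atlas M. p:fst c"
proof -
 have "(UN c:atlas M. fst c) = pts M" using M unfolding manifold_def by blast
 thus "p:pts M ==> EX c:atlas M. p:fst c" by blast
qed

lemma mfd_openin: "openin (mtop M) S \<longleftrightarrow> chopen M S"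
 by (rule openin_mtop) (use M in \<open>auto simp: manifold_def\<close>)

lemma mfd_chart:
 assumes "c:atlas M" shows "inj_on (snd c) (fst c)" (is ?A) "fst c <= pts M" "opn (idx M) (img c)"
proof -
 show ?A using M assms unfolding manifold_def by blast
 have "(UN c:atlas M. fst c) = pts M" using M unfolding manifold_def by blast
 thus "fst c <= pts M" using assms by blast
 have "openin (powertop_real (idx M)) (snd c ` (fst c Int fst c))" using M assms unfolding manifold_def by blast
 thus "opn (idx M) (img c)" by (simp add: powertop_real_eq)
qed

lemma mfd_trans:
 assumes "c:atlas M" "c':atlas M" shows "opn (idx M) (snd c ` (fst c Int fst c'))"
  "k:idx M ==> smo M (snd c ` (fst c Int fst c')) (%v. snd c' (cinv c v) k)" using M assms unfolding manifold_def powertop_real_eq by blast+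

lemma topspace_mfd: "topspace (mtop M) = pts M" by (rule topspace_mtop) (use mfd_chart in auto)

lemma cinv_chart: "c:atlas M ==> p:fst c ==> cinv c (snd c p) = p" using mfd_chart(1) by simp

lemma chart_cinv: "v:img c ==> snd c (cinv c v) = v" "v:img c ==> cinv c v:fst c" by (auto simp: f_inv_into_f inv_into_into)

lemma chart_Rn: "c:atlas M ==> p:fst c ==> snd c p:Rn (idx M)" using opn_subset[OF mfd_chart(3)] by blast

text \<open>Representatives in two charts differ by a transition map. The third part is the
  transformation rule of first derivatives, the reason why tangent vectors do not depend on the
  chart.\<close>

lemma smooth_transition:
 assumes c: "c:atlas M" "c':atlas M" and T: "opn (idx M) T" "T <= img c"
  and f: "smo M T (%v. f (cinv c v))" shows "opn (idx M) (snd c' ` (cinv c ` T Int fst c'))"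
  "smo M (snd c' ` (cinv c ` T Int fst c')) (%v. f (cinv c' v))" (is ?B)
  "p:fst c' ==> p:cinv c ` T ==> k:idx M ==> pd k (%v. f (cinv c' v)) (snd c' p)
   = (SUM j:idx M. pd j (%v. f (cinv c v)) (snd c p)*pd k (%v. snd c (cinv c' v) j) (snd c' p))"
proof -
 let ?A = "snd c' ` (fst c' Int fst c)" and ?tu = "%v. snd c (cinv c' v)"
 let ?T' = "{v:?A. ?tu v:T}"
 have A: "opn (idx M) ?A" by (rule mfd_trans(1)[OF c(2,1)])
 have T': "snd c' ` (cinv c ` T Int fst c') = ?T'"
 proof -
  have "q:cinv c ` T \<longleftrightarrow> q:fst c & snd c q:T" for q
  proof
   show "q:fst c & snd c q:T" if q: "q:cinv c ` T"
   proof -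
    obtain w where w: "w:T" "q = cinv c w" using q by blast
    hence "w:img c" using T(2) by blast
    thus ?thesis using chart_cinv[of w c] w by simp
   qed
   show "q:cinv c ` T" if q: "q:fst c & snd c q:T" using q cinv_chart[OF c(1), of q] by (metis imageI)
  qed
  moreover define Z where "Z = cinv c ` T"
  ultimately have "q:Z \<longleftrightarrow> q:fst c & snd c q:T" for q by blast
  thus ?thesis unfolding Z_def[symmetric] using cinv_chart[OF c(2)] by (auto simp: image_iff)
 qed
 have Rn: "?tu v:Rn (idx M)" if "v:?A" for v
 proof -
  obtain q where "q:fst c'" "q:fst c" "v = snd c' q" using \<open>v:?A\<close> by blast
  thus ?thesis using chart_Rn[OF c(1)] cinv_chart[OF c(2)] by metis
 qed
 show op: "opn (idx M) (snd c' ` (cinv c ` T Int fst c'))" unfolding T' by (rule opn_preimage[OF A mfd_trans(2)[OF c(2,1)] Rn T(1)])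
 have sm: "smo M ?T' (%v. ?tu v j)" if "j:idx M" for j using smooth_subset[OF A mfd_trans(2)[OF c(2,1) that]] by auto
 have eq: "f (cinv c (?tu v)) = f (cinv c' v)" if "v:?T'" for v using that cinv_chart[OF c(2)] cinv_chart[OF c(1)] by auto
 show ?B unfolding T'
  using op[unfolded T'] by (rule smooth_cong[OF _ eq]) (auto intro!: smooth_comp[OF op[unfolded T'] mfd_fin T(1) _ sm f])
 assume p: "p:fst c'" "p:cinv c ` T" and k: "k:idx M"
 hence pT: "snd c' p:?T'" using T' by blast
 have "pd k (%v. f (cinv c' v)) (snd c' p) = pd k (%v. f (cinv c (?tu v))) (snd c' p)" using eq by (intro pd_cong[OF op[unfolded T'] k pT]) simp
 also have "... = (SUM j:idx M. pd j (%v. f (cinv c v)) (?tu (snd c' p))*pd k (%v. ?tu v j) (snd c' p))"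
  by (rule pd_comp[OF op[unfolded T'] mfd_fin T(1) _ sm f k pT]) auto
 also have "?tu (snd c' p) = snd c p" using p(1) cinv_chart[OF c(2)] by simp
 finally show "pd k (%v. f (cinv c' v)) (snd c' p)
   = (SUM j:idx M. pd j (%v. f (cinv c v)) (snd c p)*pd k (%v. snd c (cinv c' v) j) (snd c' p))" .
qed

text \<open>A single chart decides: by \<open>smooth_transition\<close> the image of
  \<open>T\<close> in the manifold is open, and the function is smooth on it in all other
  charts.\<close>

lemma near_iff:
 assumes c: "c:atlas M" "p:fst c" shows "smooth_near M p f \<longleftrightarrow> (EX T. opn (idx M) T & snd c p:T & T <= img c & smo M T (%v. f (cinv c v)))"
proof
 assume "smooth_near M p f"
 then obtain S where S: "openin (mtop M) S" "p:S" "smooth_fun M S f" unfolding smooth_near_def by blast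
 thus "EX T. opn (idx M) T & snd c p:T & T <= img c & smo M T (%v. f (cinv c v))"
  using c unfolding mfd_openin smooth_fun_def by (intro exI[of _ "snd c ` (S Int fst c)"]) auto
next
 assume "EX T. opn (idx M) T & snd c p:T & T <= img c & smo M T (%v. f (cinv c v))"
 then obtain T where T: "opn (idx M) T" "snd c p:T" "T <= img c" "smo M T (%v. f (cinv c v))" by blast
 have "openin (mtop M) (cinv c ` T)" unfolding mfd_openin
 proof (intro conjI ballI smooth_transition(1)[OF c(1) _ T(1,3,4)])
  show "cinv c ` T <= pts M" using T(3) mfd_chart(2)[OF c(1)] chart_cinv(2)[of _ c] by blast
 qed
 moreover have "p:cinv c ` T" using T(2) cinv_chart[OF c] by (metis imageI)
 moreover have "smooth_fun M (cinv c ` T) f" unfolding smooth_fun_def using smooth_transition(2)[OF c(1) _ T(1,3,4)] by blast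
 ultimately show "smooth_near M p f" unfolding smooth_near_def by blast
qed

lemma crd_near: "c:atlas M ==> p:fst c ==> k:idx M ==> smooth_near M p (%q. snd c q k)"
proof -
 assume c: "c:atlas M" "p:fst c" "k:idx M"
 show ?thesis unfolding near_iff[OF c(1,2)] using mfd_trans[OF c(1,1)] c by (intro exI[of _ "img c"]) auto
qed

lemma pd_crd:
 assumes c: "c:atlas M" and v: "v:img c" and kl: "k:idx M" shows "pd k (%v. snd c (cinv c v) l) v = (if k = l then 1 else 0)" (is "?L = _")
proof -
 have "?L = pd k (%v. v l) v" by (rule pd_cong[OF mfd_chart(3)[OF c] kl v]) (simp only: chart_cinv(1))
 also have "... = (if k = l then 1 else 0)" by (cases "k = l") (auto simp: pd_def)
 finally show ?thesis .
qed

end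

section \<open>Tangent vectors by components\<close>

definition tvec :: "('p, 'k) mfd=>('p, 'k) chart=>'p=>('k=>real)=>'p tv" where
 "tvec M c p xx = (%f. SUM k:idx M. xx k*cvec M c p k f)"

lemma tangent_tvec: "Tan M p = {tvec M c p xx | xx c. c:atlas M & p:fst c}" unfolding tangent_def tvec_def ..

context
 fixes M :: "('p, 'k) mfd"
 assumes M: "manifold M"
begin

lemma tvec_near: "smooth_near M p f ==> tvec M c p xx f = (SUM k:idx M. xx k*pd k (%v. f (cinv c v)) (snd c p))" unfolding tvec_def cvec_def by simp

lemma tvec_far: "~ smooth_near M p f ==> tvec M c p xx f = 0" unfolding tvec_def cvec_def by simp

lemma tvec_crd: "c:atlas M ==> p:fst c ==> k:idx M ==> tvec M c p xx (%q. snd c q k) = xx k"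
 using sum_dm(4)[OF mfd_fin[OF M], of k xx] by (simp add: tvec_near crd_near[OF M] pd_crd[OF M])

text \<open>The components of a tangent vector in any chart are its values on the coordinate
  functions, even if the vector was built in another chart \<open>c'\<close>.\<close>

lemma tangent_near:
 assumes v: "v:Tan M p" and c: "c:atlas M" "p:fst c" and f: "smooth_near M p f" shows "v f = (SUM k:idx M. v (%q. snd c q k)*pd k (%v. f (cinv c v)) (snd c p))"
proof -
 obtain c' xx where c': "v = tvec M c' p xx" "c':atlas M" "p:fst c'" using v unfolding tangent_tvec by blast
 obtain T where T: "opn (idx M) T" "snd c p:T" "T <= img c" "smo M T (%v. f (cinv c v))" using f near_iff[OF M c] by blast
 have pT: "p:cinv c ` T" using T(2) cinv_chart[OF M c] by (metis imageI)
 have "v f = (SUM k:idx M. xx k*(SUM j:idx M. pd j (%v. f (cinv c v)) (snd c p)*pd k (%v. snd c (cinv c' v) j) (snd c' p)))"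
  unfolding c' using smooth_transition(3)[OF M c(1) c'(2) T(1,3,4) c'(3) pT] f by (simp add: tvec_near)
 also have "... = (SUM j:idx M. (SUM k:idx M. xx k*pd k (%v. snd c (cinv c' v) j) (snd c' p))*pd j (%v. f (cinv c v)) (snd c p))"
  unfolding sdl sdr by (subst sum.swap) (simp add: mult_ac)
 also have "... = (SUM j:idx M. v (%q. snd c q j)*pd j (%v. f (cinv c v)) (snd c p))" unfolding c'(1) using crd_near[OF M c] by (simp add: tvec_near)
 finally show ?thesis .
qed

lemma tangent_far: "v:Tan M p ==> ~ smooth_near M p f ==> v f = 0" unfolding tangent_tvec using tvec_far by auto

lemma tangent_eq_tvec:
 assumes v: "v:Tan M p" and c: "c:atlas M" "p:fst c" shows "v = tvec M c p (%k. v (%q. snd c q k))"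
proof
 fix f
 show "v f = tvec M c p (%k. v (%q. snd c q k)) f" using tangent_near[OF v c, of f] tangent_far[OF v, of f] tvec_near tvec_far by (cases "smooth_near M p f") auto
qed

lemma tvec_tangent: "c:atlas M ==> p:fst c ==> tvec M c p xx:Tan M p" unfolding tangent_tvec by blast

lemma tangent_eqI:
 assumes "u:Tan M p" "v:Tan M p" "c:atlas M" "p:fst c" "!!k. k:idx M ==> u (%q. snd c q k) = v (%q. snd c q k)" shows "u = v"
proof -
 have "tvec M c p (%k. u (%q. snd c q k)) = tvec M c p (%k. v (%q. snd c q k))" using assms(5) by (simp add: tvec_def)
 thus ?thesis using tangent_eq_tvec[OF assms(1,3,4)] tangent_eq_tvec[OF assms(2,3,4)] by argo
qed

lemma cvec_tvec: "k:idx M ==> cvec M c p k = tvec M c p (%j. if j = k then 1 else 0)"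
 unfolding tvec_def using sum_dm(2)[OF mfd_fin[OF M]] by (simp add: fun_eq_iff)

lemma cvec_tangent: "c:atlas M ==> p:fst c ==> k:idx M ==> cvec M c p k:Tan M p" by (simp add: cvec_tvec tvec_tangent)

lemma tangent_lincomb: "p:pts M ==> u:Tan M p ==> w:Tan M p ==> lincomb r u s w:Tan M p"
proof -
 assume a: "p:pts M" "u:Tan M p" "w:Tan M p"
 obtain c where c: "c:atlas M" "p:fst c" using mfd_cover[OF M a(1)] by blast
 have "lincomb r u s w = tvec M c p (%k. r*u (%q. snd c q k) + s*w (%q. snd c q k))" by (subst tangent_eq_tvec[OF a(2) c], subst tangent_eq_tvec[OF a(3) c])
   (simp add: lincomb_def tvec_def fun_eq_iff distrib_right sum.distrib sdl mult.assoc)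
 thus ?thesis using tvec_tangent[OF c] by simp
qed

text \<open>Tangent vectors act on germs. This later replaces the global map \<open>rh\<close> by
  \<open>pr (q p)\<close> on \<open>W\<close>, where the two agree.\<close>

lemma tangent_local:
 assumes U: "openin (mtop M) U" "p:U" and eq: "!!q. q:U ==> f q = g q" shows "smooth_near M p f \<longleftrightarrow> smooth_near M p g" "v:Tan M p ==> v f = v g"
proof -
 have *: "smooth_near M p g" if n: "smooth_near M p f" and e: "!!q. q:U ==> f q = g q" for f g
 proof -
  obtain S where S: "openin (mtop M) S" "p:S" "smooth_fun M S f" using n unfolding smooth_near_def by blast
  have SU: "openin (mtop M) (S Int U)" using S(1) U(1) by blast
  have sg: "smo M (snd c ` (S Int U Int fst c)) (%v. g (cinv c v))" if c: "c:atlas M" for c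
  proof -
   have o: "opn (idx M) (snd c ` (S Int U Int fst c))" "opn (idx M) (snd c ` (S Int fst c))" using SU S(1) c unfolding mfd_openin[OF M] by blast+
   have "smo M (snd c ` (S Int U Int fst c)) (%v. f (cinv c v))"
    using S(3) c smooth_subset[OF o(2), of _ "snd c ` (S Int U Int fst c)"] unfolding smooth_fun_def by blast
   moreover have "f (cinv c v) = g (cinv c v)" if "v:snd c ` (S Int U Int fst c)" for v
   proof -
    obtain q where q: "q:S" "q:U" "q:fst c" "v = snd c q" using \<open>v:_\<close> by blast
    thus ?thesis using e[OF q(2)] cinv_chart[OF M c q(3)] by simp
   qed
   ultimately show ?thesis by (rule smooth_cong[OF o(1), rotated])
  qed
  show ?thesis unfolding smooth_near_def smooth_fun_def by (intro exI[of _ "S Int U"] conjI ballI SU IntI S(2) U(2) sg)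
 qed
 show iff: "smooth_near M p f \<longleftrightarrow> smooth_near M p g" using *[of f g] *[of g f] eq by auto
 assume v: "v:Tan M p"
 then obtain c xx where c: "c:atlas M" "p:fst c" unfolding tangent_tvec by blast
 show "v f = v g"
 proof (cases "smooth_near M p f")
  case True
  have o: "opn (idx M) (snd c ` (U Int fst c))" using U(1) c unfolding mfd_openin[OF M] by blast
  have "pd k (%v. f (cinv c v)) (snd c p) = pd k (%v. g (cinv c v)) (snd c p)" if "k:idx M" for k
  proof (rule pd_cong[OF o that])
   show "snd c p:snd c ` (U Int fst c)" using U(2) c by blast
   show "f (cinv c w) = g (cinv c w)" if "w:snd c ` (U Int fst c)" for w
   proof -
    obtain q where q: "q:U" "q:fst c" "w = snd c q" using \<open>w:_\<close> by blast
    thus ?thesis using eq[OF q(1)] cinv_chart[OF M c(1) q(2)] by simp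
   qed
  qed
  thus ?thesis using tangent_near[OF v c] True iff by simp
 next
  case False
  thus ?thesis using tangent_far[OF v] iff by simp
 qed
qed

end

text \<open>Just enough structure to speak of open sets and of representatives in charts. It is what
  is established for the auxiliary domains: products, families, open subsets, the interval and the
  circle.\<close>

definition premfd :: "('p, 'k) mfd=>bool" where
 "premfd M = (finite (idx M) & (ALL c:atlas M. inj_on (snd c) (fst c) & fst c <= pts M) &
  (ALL c:atlas M. ALL c':atlas M. opn (idx M) (snd c ` (fst c Int fst c'))))"

lemma manifold_premfd: "manifold M ==> premfd M" unfolding premfd_def using mfd_fin mfd_chart mfd_trans by metis

context
 fixes M :: "('p, 'k) mfd"
 assumes M: "premfd M"
begin

lemma pre_fin: "finite (idx M)" using M unfolding premfd_def by blast

lemma pre_chart: "c:atlas M ==> inj_on (snd c) (fst c)" "c:atlas M ==> fst c <= pts M"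
 "c:atlas M ==> c':atlas M ==> opn (idx M) (snd c ` (fst c Int fst c'))" using M unfolding premfd_def by blast+

lemma pre_chart_opn: "c:atlas M ==> opn (idx M) (img c)" using pre_chart(3)[of c c] by simp

lemma pre_openin: "openin (mtop M) S \<longleftrightarrow> chopen M S"
 by (rule openin_mtop[of M, OF pre_chart(1)])

lemma pre_chart_open: "c:atlas M ==> openin (mtop M) (fst c)" unfolding pre_openin using pre_chart by (metis inf_commute)

lemma pre_topspace: "topspace (mtop M) = pts M" by (rule topspace_mtop) (use pre_chart pre_chart_opn in auto)

lemma pre_cinv: "c:atlas M ==> p:fst c ==> cinv c (snd c p) = p" using pre_chart(1) by simp

end

lemma smooth_map_rep:
 assumes M: "premfd M" and X: "premfd X" and F: "smooth_map M X F"
  and c: "c:atlas M" "p:fst c" and d: "d:atlas X" "F p:fst d" shows "EX T. opn (idx M) T & snd c p:T & T <= img c & (ALL v:T. F (cinv c v):fst d) &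
  (ALL j:idx X. smo M T (%v. rep c F d v j))"
proof -
 let ?S = "{q:pts M. F q:fst d}"
 have "continuous_map (mtop M) (mtop X) F" using F unfolding smooth_map_def by blast
 hence "openin (mtop M) ?S" using openin_continuous_map_preimage[OF _ pre_chart_open[OF X d(1)]] pre_topspace[OF M] by metis
 hence "opn (idx M) (snd c ` (?S Int fst c))" using c(1) unfolding pre_openin[OF M] by blast
 moreover have "snd c p:snd c ` (?S Int fst c)" using c d pre_chart(2)[OF M c(1)] by auto
 moreover have "ALL j:idx X. smo M (snd c ` (?S Int fst c)) (%v. rep c F d v j)" using F c(1) d(1) unfolding smooth_map_def smooth_fun_def by blast
 moreover have "ALL v:snd c ` (?S Int fst c). F (cinv c v):fst d"
 proof
  fix v assume "v:snd c ` (?S Int fst c)"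
  then obtain q where q: "q:?S" "q:fst c" "v = snd c q" by blast
  thus "F (cinv c v):fst d" using pre_cinv[OF M c(1) q(2)] by simp
 qed
 ultimately show ?thesis by (intro exI[of _ "snd c ` (?S Int fst c)"] conjI) auto
qed

lemma smooth_map_funcset:
 assumes "premfd M" "premfd X" "smooth_map M X F" "p:pts M" shows "F p:pts X"
proof -
 have "continuous_map (mtop M) (mtop X) F" using assms(3) unfolding smooth_map_def by blast
 hence "F:topspace (mtop M) \<rightarrow> topspace (mtop X)" by (rule continuous_map_funspace)
 thus ?thesis using assms(4) unfolding pre_topspace[OF assms(1)] pre_topspace[OF assms(2)] by blast
qed

text \<open>Smoothness at a point, in every pair of charts. Components of maps into product
  families, and maps such as \<open>q\<close> that are controlled on the open part \<open>W\<close>,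
  are handled in this form.\<close>

definition lsm :: "('p, 'k) mfd=>('q, 'l) mfd=>('p=>'q)=>'p=>bool" where
 "lsm M N F p = (p:pts M & F p:pts N & (ALL c:atlas M. p:fst c --> (ALL c':atlas N. F p:fst c' -->
  (EX T. opn (idx M) T & snd c p:T & T <= img c & (ALL v:T. F (cinv c v):fst c') &
   (ALL j:idx N. smo M T (%v. rep c F c' v j))))))"

lemma lsmE:
 assumes "lsm M N F p" "c:atlas M" "p:fst c" "c':atlas N" "F p:fst c'"
 obtains T where "opn (idx M) T" "snd c p:T" "T <= img c" "!!v. v:T ==> F (cinv c v):fst c'"
  "!!j. j:idx N ==> smo M T (%v. rep c F c' v j)"
proof -
 note assms(1)[unfolded lsm_def, THEN conjunct2, THEN conjunct2, THEN bspec, OF assms(2), THEN mp, OF assms(3), THEN bspec, OF assms(4), THEN mp, OF assms(5)]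
 thus ?thesis using that by (elim exE conjE) blast
qed

context
 fixes M :: "('p, 'k) mfd" and N :: "('q, 'l) mfd" and F :: "'p=>'q" and p :: 'p
 assumes M: "manifold M" and N: "manifold N" and F: "lsm M N F p"
begin

lemma lsm_pull:
 assumes c: "c:atlas M" "p:fst c" and c': "c':atlas N" "F p:fst c'"
  and f: "opn (idx N) T'" "snd c' (F p):T'" "T' <= img c'" "smo N T' (%v. f (cinv c' v))"
 obtains T where "opn (idx M) T" "snd c p:T" "T <= img c" "!!v. v:T ==> F (cinv c v):fst c'"
  "!!j. j:idx N ==> smo M T (%v. rep c F c' v j)"
  "!!v. v:T ==> rep c F c' v:T'"
  "smo M T (%v. f (F (cinv c v)))"
  "!!k v. k:idx M ==> v:T ==> pd k (%v. f (F (cinv c v))) v = (SUM j:idx N. pd j (%v. f (cinv c' v)) (rep c F c' v)*pd k (%v. rep c F c' v j) v)"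
proof -
 obtain T where T: "opn (idx M) T" "snd c p:T" "T <= img c" "!!v. v:T ==> F (cinv c v):fst c'"
  "!!j. j:idx N ==> smo M T (%v. rep c F c' v j)" by (rule lsmE[OF F c c']) blast
 let ?F = "%v. rep c F c' v"
 define U where "U = {v:T. ?F v:T'}"
 have U: "opn (idx M) U" unfolding U_def by (rule opn_preimage[OF T(1,5) _ f(1)]) (use T(4) chart_Rn[OF N c'(1)] in auto)
 have sF: "smo M U (%v. ?F v j)" if "j:idx N" for j by (rule smooth_subset[OF T(1) T(5)[OF that]]) (auto simp: U_def)
 have eq: "f (cinv c' (?F v)) = f (F (cinv c v))" if "v:U" for v using that T(4) cinv_chart[OF N c'(1)] by (auto simp: U_def)
 have UT: "?F v:T'" if "v:U" for v using that by (simp add: U_def)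
 show ?thesis
 proof (rule that[of U])
  show "opn (idx M) U" by (rule U)
  show "snd c p:U" using T(2) f(2) cinv_chart[OF M c] by (simp add: U_def)
  show "smo M U (%v. f (F (cinv c v)))" by (rule smooth_cong[OF U eq smooth_comp[OF U mfd_fin[OF N] f(1) UT sF f(4)]])
  show "pd k (%v. f (F (cinv c v))) v = (SUM j:idx N. pd j (%v. f (cinv c' v)) (?F v)*pd k (%v. ?F v j) v)" (is "?L = _") if "k:idx M" "v:U" for k v
  proof -
   have "?L = pd k (%v. f (cinv c' (?F v))) v" using eq by (intro pd_cong[OF U that]) simp
   also have "... = (SUM j:idx N. pd j (%v. f (cinv c' v)) (?F v)*pd k (%v. ?F v j) v)" by (rule pd_comp[OF U mfd_fin[OF N] f(1) UT sF f(4) that])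
   finally show ?thesis .
  qed
  show "U <= img c" using T(3) by (auto simp: U_def)
  show "F (cinv c v):fst c'" if "v:U" for v using that T(4) by (simp add: U_def)
  show "smo M U (%v. ?F v j)" if "j:idx N" for j by (rule sF[OF that])
  show "?F v:T'" if "v:U" for v by (rule UT[OF that])
 qed
qed

lemma lsm_near:
 assumes "smooth_near N (F p) f" shows "smooth_near M p (f \<circ> F)"
proof -
 obtain c where c: "c:atlas M" "p:fst c" using mfd_cover[OF M] F unfolding lsm_def by blast
 obtain c' where c': "c':atlas N" "F p:fst c'" using mfd_cover[OF N] F unfolding lsm_def by blast
 obtain T' where f: "opn (idx N) T'" "snd c' (F p):T'" "T' <= img c'" "smo N T' (%v. f (cinv c' v))" using assms near_iff[OF N c'] by blast
 show ?thesis unfolding near_iff[OF M c] o_def by (rule lsm_pull[OF c c' f]) blast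
qed

lemma push_comp1:
 assumes v: "v:Tan M p" and c': "c':atlas N" "F p:fst c'" shows "push N F p v = tvec N c' (F p) (%j. v (%q. snd c' (F q) j))"
proof
 fix f
 obtain c where c: "c:atlas M" "p:fst c" using mfd_cover[OF M] F unfolding lsm_def by blast
 show "push N F p v f = tvec N c' (F p) (%j. v (%q. snd c' (F q) j)) f"
 proof (cases "smooth_near N (F p) f")
  case True
  then obtain T' where f: "opn (idx N) T'" "snd c' (F p):T'" "T' <= img c'" "smo N T' (%v. f (cinv c' v))" using near_iff[OF N c'] by blast
  obtain T where T: "snd c p:T" "!!k v. k:idx M ==> v:T ==> pd k (%v. f (F (cinv c v))) v = (SUM j:idx N. pd j (%v. f (cinv c' v)) (rep c F c' v)*pd k (%v. rep c F c' v j) v)"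
   by (rule lsm_pull[OF c c' f]) blast
  have "push N F p v f = v (f \<circ> F)" using True by (simp add: push_def)
  also have "... = (SUM k:idx M. v (%q. snd c q k)*pd k (%v. f (F (cinv c v))) (snd c p))" using tangent_near[OF M v c lsm_near[OF True]] by (simp add: o_def)
  also have "... = (SUM k:idx M. SUM j:idx N. v (%q. snd c q k)*(pd j (%v. f (cinv c' v)) (snd c' (F p))*pd k (%v. rep c F c' v j) (snd c p)))"
   using T cinv_chart[OF M c] by (simp add: sdl)
  also have "... = (SUM j:idx N. (SUM k:idx M. v (%q. snd c q k)*pd k (%v. rep c F c' v j) (snd c p))*pd j (%v. f (cinv c' v)) (snd c' (F p)))"
   unfolding sdr by (subst sum.swap) (simp add: mult_ac)
  also have "... = (SUM j:idx N. v (%q. snd c' (F q) j)*pd j (%v. f (cinv c' v)) (snd c' (F p)))"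
  proof (intro sum.cong refl arg_cong2[where f = "(*)"])
   fix j assume "j:idx N"
   hence "smooth_near M p (%q. snd c' (F q) j)" using lsm_near[OF crd_near[OF N c']] by (simp add: o_def)
   from tangent_near[OF M v c this]
   show "(SUM k:idx M. v (%q. snd c q k)*pd k (%v. rep c F c' v j) (snd c p)) = v (%q. snd c' (F q) j)" by simp
  qed
  finally show ?thesis using tvec_near[OF N True] by simp
 next
  case False
  thus ?thesis using tvec_far[OF N False] by (simp add: push_def)
 qed
qed

lemma push_tangent: "v:Tan M p ==> push N F p v:Tan N (F p)"
proof -
 assume v: "v:Tan M p"
 obtain c' where c': "c':atlas N" "F p:fst c'" using mfd_cover[OF N] F unfolding lsm_def by blast
 show ?thesis unfolding push_comp1[OF v c'] by (rule tvec_tangent[OF N c'])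
qed

lemma push_cvec:
 assumes c: "c:atlas M" "p:fst c" and c': "c':atlas N" "F p:fst c'" and k: "k:idx M"
 shows "push N F p (cvec M c p k) = tvec N c' (F p) (%j. pd k (%v. rep c F c' v j) (snd c p))"
proof -
 have "cvec M c p k (%q. snd c' (F q) j) = pd k (%v. rep c F c' v j) (snd c p)" if "j:idx N" for j
  using lsm_near[OF crd_near[OF N c' that]] by (simp add: cvec_def o_def)
 thus ?thesis unfolding push_comp1[OF cvec_tangent[OF M c k] c'] tvec_def by simp
qed

end

lemma push_lincomb: "push N F p (lincomb r u s w) = lincomb r (push N F p u) s (push N F p w)" by (simp add: push_def lincomb_def fun_eq_iff)

lemma push_push:
 assumes "manifold N" "manifold Q" "lsm N Q H (F p)" shows "push Q H (F p) (push N F p v) = push Q (%p. H (F p)) p v"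
 using lsm_near[OF assms] by (auto simp: push_def fun_eq_iff o_def)

lemma lsm_compose:
 assumes M: "manifold M" and N: "manifold N" and Q: "manifold Q" and F: "lsm M N F p" and H: "lsm N Q H (F p)" shows "lsm M Q (%p. H (F p)) p" unfolding lsm_def
proof (intro conjI ballI impI)
 show "p:pts M" "H (F p):pts Q" using F H unfolding lsm_def by auto
 fix c c'' assume c: "c:atlas M" "p:fst c" and c'': "c'':atlas Q" "H (F p):fst c''"
 obtain c' where c': "c':atlas N" "F p:fst c'" using mfd_cover[OF N] F unfolding lsm_def by blast
 obtain T' where T': "opn (idx N) T'" "snd c' (F p):T'" "T' <= img c'" "!!v. v:T' ==> H (cinv c' v):fst c''"
  "!!j. j:idx Q ==> smo N T' (%v. snd c'' (H (cinv c' v)) j)" by (rule lsmE[OF H c' c'']) blast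
 obtain T where T: "opn (idx M) T" "snd c p:T" "T <= img c" "!!v. v:T ==> F (cinv c v):fst c'"
  "!!j. j:idx N ==> smo M T (%v. rep c F c' v j)" by (rule lsmE[OF F c c']) blast
 let ?F = "%v. rep c F c' v"
 define U where "U = {v:T. ?F v:T'}"
 have U: "opn (idx M) U" unfolding U_def by (rule opn_preimage[OF T(1,5) _ T'(1)]) (use T(4) chart_Rn[OF N c'(1)] in auto)
 have sF: "smo M U (%v. ?F v j)" if "j:idx N" for j by (rule smooth_subset[OF T(1) T(5)[OF that]]) (auto simp: U_def)
 have eq: "cinv c' (?F v) = F (cinv c v)" if "v:U" for v using that T(4) cinv_chart[OF N c'(1)] by (auto simp: U_def)
 have UT: "?F v:T'" if "v:U" for v using that by (simp add: U_def)
 show "EX T. opn (idx M) T & snd c p:T & T <= img c & (ALL v:T. H (F (cinv c v)):fst c'') &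
   (ALL j:idx Q. smo M T (%v. snd c'' (H (F (cinv c v))) j))"
 proof (intro exI[of _ U] conjI ballI)
  show "opn (idx M) U" by (rule U)
  show "snd c p:U" using T(2) T'(2) cinv_chart[OF M c] by (simp add: U_def)
  show "U <= img c" using T(3) by (auto simp: U_def)
  show "H (F (cinv c v)):fst c''" if "v:U" for v using T'(4)[OF UT[OF that]] eq[OF that] by simp
  show "smo M U (%v. snd c'' (H (F (cinv c v))) j)" if j: "j:idx Q" for j
  proof (rule smooth_cong[OF U _ smooth_comp[OF U mfd_fin[OF N] T'(1) UT sF T'(5)[OF j]]])
   show "snd c'' (H (cinv c' (?F v))) j = snd c'' (H (F (cinv c v))) j" if "v:U" for v using eq[OF that] by simp
  qed
 qed
qed

lemma opn_Rn: "opn I (Rn I)" by simp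

lemma smooth_coord:
 assumes S: "opn I S" shows "smooth_on I S (%v. v k)"
proof (rule smooth_on_coinduct[OF S, of "%f. f = (%v. v k) | (EX c. f = (%_. c))"])
 fix f :: "('a=>real)=>real" assume "f = (%v. v k) | (EX c. f = (%_. c))"
 thus "cont S f & pdiff I S f & (ALL j:I. EX g. (g = (%v. v k) | (EX c. g = (%_. c))) & (ALL v:S. pd j f v = g v))"
 proof
  assume f: "f = (%v. v k)"
  have d: "DERIV (%t. f (v(j := t))) (v j) :> (if j = k then 1 else 0)" for v j unfolding f by (cases "j = k") auto
  have "cont S f" unfolding f by (rule continuous_on_subset[OF continuous_on_product_coordinates]) auto
  moreover have "pdiff I S f" unfolding pdiff_def field_differentiable_def using d by blast
  moreover have "pd j f v = (if j = k then 1 else 0)" for j v using d by (rule pd_eqI)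
  ultimately show ?thesis by auto
 next
  assume "EX c. f = (%_. c)"
  then obtain c where "f = (%_. c)" by blast
  thus ?thesis by (auto simp: pdiff_def pd_const)
 qed
qed auto

section \<open>Charts of products, families, the interval and the circle\<close>

lemma opn_Plus:
 assumes "opn I U" "opn J V" shows "opn (I <+> J) {case_sum u v | u v. u:U & v:V}"
proof -
 have U: "U <= Rn I" and V: "V <= Rn J" using assms opn_subset by auto
 have 1: "opn (I <+> J) {z:Rn (I <+> J). (%i. z (Inl i)):U}" by (rule opn_preimage[OF opn_Rn smooth_coord[OF opn_Rn] _ assms(1)]) (auto simp: PiE_def extensional_def)
 have 2: "opn (I <+> J) {z:Rn (I <+> J). (%j. z (Inr j)):V}" by (rule opn_preimage[OF opn_Rn smooth_coord[OF opn_Rn] _ assms(2)]) (auto simp: PiE_def extensional_def)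
 have "{case_sum u v | u v. u:U & v:V} = {z:Rn (I <+> J). (%i. z (Inl i)):U} Int {z:Rn (I <+> J). (%j. z (Inr j)):V}"
 proof (rule subset_antisym; rule subsetI)
  fix z assume "z:{case_sum u v | u v. u:U & v:V}"
  then obtain u v where z: "z = case_sum u v" "u:U" "v:V" by blast
  moreover have "z:Rn (I <+> J)" using z U V by (auto simp: PiE_def extensional_def split: sum.splits)
  ultimately show "z:{z:Rn (I <+> J). (%i. z (Inl i)):U} Int {z:Rn (I <+> J). (%j. z (Inr j)):V}" by auto
 next
  fix z assume z: "z:{z:Rn (I <+> J). (%i. z (Inl i)):U} Int {z:Rn (I <+> J). (%j. z (Inr j)):V}"
  have "z = case_sum (%i. z (Inl i)) (%j. z (Inr j))" by (auto simp: fun_eq_iff split: sum.splits)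
  thus "z:{case_sum u v | u v. u:U & v:V}" using z by blast
 qed
 thus ?thesis using openin_Int[OF 1 2] by simp
qed

lemma opn_Sigma:
 assumes L: "finite L" and U: "!!i. i:L ==> opn (K i) (U i)" shows "opn (Sigma L K) {z:Rn (Sigma L K). ALL i:L. restrict (%k. z (i, k)) (K i):U i}"
proof -
 have "opn (Sigma L K) (Rn (Sigma L K) Int (INT i:L. {z:Rn (Sigma L K). restrict (%k. z (i, k)) (K i):U i}))"
 proof (cases "L = {}")
  case False
  have "opn (Sigma L K) {z:Rn (Sigma L K). restrict (%k. z (i, k)) (K i):U i}" if "i:L" for i
   by (rule opn_preimage[OF opn_Rn _ _ U[OF that]]) (auto intro: smooth_coord[OF opn_Rn])
  thus ?thesis using L False by (intro openin_Int opn_Rn openin_Inter) auto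
 qed simp
 moreover have "Rn (Sigma L K) Int (INT i:L. {z:Rn (Sigma L K). restrict (%k. z (i, k)) (K i):U i})
  = {z:Rn (Sigma L K). ALL i:L. restrict (%k. z (i, k)) (K i):U i}" by auto
 ultimately show ?thesis by simp
qed

lemma premfd_prod:
 assumes M: "premfd M" and N: "premfd N" shows "premfd (prod_mfd M N)" unfolding premfd_def
proof (intro conjI ballI)
 show "finite (idx (prod_mfd M N))" using pre_fin[OF M] pre_fin[OF N] by (simp add: prod_mfd_def)
 fix d assume "d:atlas (prod_mfd M N)"
 then obtain c c' where d: "d = (fst c \<times> fst c', %(p, q). case_sum (snd c p) (snd c' q))" and c: "c:atlas M" "c':atlas N" unfolding prod_mfd_def by auto
 have inj: "snd c p = snd c q \<longleftrightarrow> p = q" if "p:fst c" "q:fst c" for p q using pre_chart(1)[OF M c(1)] that by (auto dest: inj_onD)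
 have inj': "snd c' p = snd c' q \<longleftrightarrow> p = q" if "p:fst c'" "q:fst c'" for p q using pre_chart(1)[OF N c(2)] that by (auto dest: inj_onD)
 have cs: "case_sum u v = case_sum u' v' \<longleftrightarrow> u = u' & v = v'" for u u' :: "'b=>real" and v v' :: "'d=>real"
  by (metis case_sum_o_inj(1) case_sum_o_inj(2))
 show "inj_on (snd d) (fst d)" unfolding d by (auto simp: inj_on_def cs inj inj')
 show "fst d <= pts (prod_mfd M N)" unfolding d prod_mfd_def using pre_chart(2)[OF M c(1)] pre_chart(2)[OF N c(2)] by auto
 fix d2 assume "d2:atlas (prod_mfd M N)"
 then obtain c2 c2' where d2: "d2 = (fst c2 \<times> fst c2', %(p, q). case_sum (snd c2 p) (snd c2' q))" and c2: "c2:atlas M" "c2':atlas N" unfolding prod_mfd_def by auto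
 have "snd d ` (fst d Int fst d2) = {case_sum u v | u v. u:snd c ` (fst c Int fst c2) & v:snd c' ` (fst c' Int fst c2')}"
  unfolding d d2 by (auto simp: image_iff)
 thus "opn (idx (prod_mfd M N)) (snd d ` (fst d Int fst d2))"
  using opn_Plus[OF pre_chart(3)[OF M c(1) c2(1)] pre_chart(3)[OF N c(2) c2(2)]] by (simp add: prod_mfd_def)
qed

lemma premfd_open_sub:
 assumes M: "premfd M" and W: "openin (mtop M) W" shows "premfd (open_sub M W)" unfolding premfd_def
proof (intro conjI ballI)
 show "finite (idx (open_sub M W))" using pre_fin[OF M] by (simp add: open_sub_def)
 fix d assume "d:atlas (open_sub M W)"
 then obtain c where d: "d = (fst c Int W, snd c)" and c: "c:atlas M" unfolding open_sub_def by auto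
 show "inj_on (snd d) (fst d)" unfolding d using pre_chart(1)[OF M c] by (auto intro: inj_on_subset)
 show "fst d <= pts (open_sub M W)" unfolding d open_sub_def by auto
 fix d2 assume "d2:atlas (open_sub M W)"
 then obtain c2 where d2: "d2 = (fst c2 Int W, snd c2)" and c2: "c2:atlas M" unfolding open_sub_def by auto
 have "openin (mtop M) (fst c2 Int W)" using pre_chart_open[OF M c2] W by blast
 hence "opn (idx M) (snd c ` (fst c2 Int W Int fst c))" using c unfolding pre_openin[OF M] by blast
 moreover have "snd d ` (fst d Int fst d2) = snd c ` (fst c2 Int W Int fst c)" unfolding d d2 by auto
 ultimately show "opn (idx (open_sub M W)) (snd d ` (fst d Int fst d2))" by (simp add: open_sub_def)
qed

definition fam_chart :: "'i set=>('i=>'k set)=>('i=>('p, 'k) chart)=>('i=>'p, 'i \<times> 'k) chart" where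
 "fam_chart L K c = ((\<Pi>\<^sub>E i\<in>L. fst (c i)), %p. restrict (%(i, k). snd (c i) (p i) k) (Sigma L K))"

lemma atlas_prod_fam: "atlas (prod_fam L M) = {fam_chart L (%i. idx (M i)) c | c. ALL i:L. c i:atlas (M i)}" unfolding prod_fam_def fam_chart_def by simp

lemma premfd_prod_fam:
 assumes L: "finite L" and M: "!!i. i:L ==> premfd (M i)" shows "premfd (prod_fam L M)" unfolding premfd_def
proof (intro conjI ballI)
 show "finite (idx (prod_fam L M))" using L pre_fin[OF M] by (simp add: prod_fam_def)
 fix d assume "d:atlas (prod_fam L M)"
 then obtain c where d: "d = fam_chart L (%i. idx (M i)) c" and c: "!!i. i:L ==> c i:atlas (M i)" unfolding atlas_prod_fam by blast
 have ext: "snd (c i) q:extensional (idx (M i))" if "i:L" "q:fst (c i)" for i q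
  using opn_subset[OF pre_chart_opn[OF M[OF that(1)] c[OF that(1)]]] that(2) by (auto simp: PiE_def)
 have comp: "restrict (%k. snd d p (i, k)) (idx (M i)) = snd (c i) (p i)" if "i:L" "p:fst d" for i p
 proof -
  have "p i:fst (c i)" using that unfolding d fam_chart_def by auto
  thus ?thesis using ext[OF that(1), of "p i"] that(1) unfolding d fam_chart_def by (auto simp: fun_eq_iff extensional_def)
 qed
 show "inj_on (snd d) (fst d)"
 proof (rule inj_onI)
  fix p q assume pq: "p:fst d" "q:fst d" "snd d p = snd d q"
  have "p i = q i" if "i:L" for i
  proof -
   have "p i:fst (c i)" "q i:fst (c i)" using pq that unfolding d fam_chart_def by auto
   moreover have "snd (c i) (p i) = snd (c i) (q i)" using comp[OF that pq(1)] comp[OF that pq(2)] pq(3) by simp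
   ultimately show ?thesis using pre_chart(1)[OF M[OF that] c[OF that]] by (auto dest: inj_onD)
  qed
  thus "p = q" using pq(1,2) unfolding d fam_chart_def by (auto intro: PiE_ext)
 qed
 show "fst d <= pts (prod_fam L M)" unfolding d fam_chart_def prod_fam_def using pre_chart(2)[OF M c] by (auto simp: PiE_iff subset_iff)
 fix d2 assume "d2:atlas (prod_fam L M)"
 then obtain c2 where d2: "d2 = fam_chart L (%i. idx (M i)) c2" and c2: "!!i. i:L ==> c2 i:atlas (M i)" unfolding atlas_prod_fam by blast
 let ?K = "%i. idx (M i)" and ?U = "%i. snd (c i) ` (fst (c i) Int fst (c2 i))"
 have "snd d ` (fst d Int fst d2) = {z:Rn (Sigma L ?K). ALL i:L. restrict (%k. z (i, k)) (?K i):?U i}"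
 proof (rule subset_antisym; rule subsetI)
  fix z assume "z:snd d ` (fst d Int fst d2)"
  then obtain p where p: "p:fst d" "p:fst d2" "z = snd d p" by blast
  have "z:Rn (Sigma L ?K)" unfolding p(3) d fam_chart_def by simp
  moreover have "p i:fst (c i) Int fst (c2 i)" if "i:L" for i using p(1,2) that unfolding d d2 fam_chart_def by auto
  ultimately show "z:{z:Rn (Sigma L ?K). ALL i:L. restrict (%k. z (i, k)) (?K i):?U i}" using comp[OF _ p(1)] p(3) by auto
 next
  fix z assume z: "z:{z:Rn (Sigma L ?K). ALL i:L. restrict (%k. z (i, k)) (?K i):?U i}"
  hence "ALL i:L. EX r. r:fst (c i) Int fst (c2 i) & restrict (%k. z (i, k)) (?K i) = snd (c i) r" by blast
  then obtain r where r: "!!i. i:L ==> r i:fst (c i) Int fst (c2 i)" "!!i. i:L ==> restrict (%k. z (i, k)) (?K i) = snd (c i) (r i)" by metis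
  define p where "p = restrict r L"
  have p: "p:fst d" "p:fst d2" using r(1) unfolding d d2 fam_chart_def p_def by auto
  have "z = snd d p"
  proof
   fix ik
   show "z ik = snd d p ik"
   proof (cases "ik:Sigma L ?K")
    case True
    then obtain i k where ik: "ik = (i, k)" "i:L" "k:?K i" by blast
    have "restrict (%k. z (i, k)) (?K i) k = snd (c i) (r i) k" by (simp only: r(2)[OF ik(2)])
    hence "z ik = snd (c i) (r i) k" using ik by simp
    thus ?thesis using ik unfolding d fam_chart_def p_def by simp
   next
    case False
    have "z:extensional (Sigma L ?K)" using z by (simp add: PiE_def)
    hence "z ik = undefined" using extensional_arb[OF _ False] by blast
    thus ?thesis using False unfolding d fam_chart_def by simp
   qed
  qed
  thus "z:snd d ` (fst d Int fst d2)" using p by blast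
 qed
 thus "opn (idx (prod_fam L M)) (snd d ` (fst d Int fst d2))" using opn_Sigma[OF L, of ?K ?U] pre_chart(3)[OF M c c2] by (simp add: prod_fam_def)
qed

lemma opn_unit:
 assumes "open A" shows "opn (UNIV :: unit set) ((%t _. t) ` A)"
proof -
 have "(%t _. t) ` A = (%v. v ()) -` A" by (auto simp: image_iff) (metis (full_types) old.unit.exhaust ext)
 moreover have "open ((%v. v ()) -` A :: (unit=>real) set)" using assms by (intro open_vimage continuous_on_product_coordinates)
 moreover have "Rn (UNIV :: unit set) = UNIV" by auto
 ultimately show ?thesis by simp
qed

lemma premfd_unit_interval: "premfd unit_interval" unfolding premfd_def unit_interval_def using opn_unit[of "{0<..<1}"] by (auto simp: inj_on_def fun_eq_iff)

definition arg_branch :: "real=>complex=>real" where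
 "arg_branch a z = (THE t. a < t & t < a + 2*pi & cis t = z)"

lemma arg_branch:
 assumes "z:sphere 0 1 - {cis a}" shows "a < arg_branch a z" "arg_branch a z < a + 2*pi" (is ?A) "cis (arg_branch a z) = z" (is ?B)
  and "!!t. a < t ==> t < a + 2*pi ==> cis t = z ==> arg_branch a z = t" (is "PROP ?C")
proof -
 have ex: "EX! t. a < t & t < a + 2*pi & cis t = z"
 proof (rule ex_ex1I)
  \<comment> \<open>\<open>s\<close> is the argument relative to \<open>cis a\<close>; it is nonzero
    and at most \<open>pi\<close> in absolute value, so one of \<open>a + s\<close> and
    \<open>a + s + 2 * pi\<close> lies in the branch.\<close>
  define s where "s = Arg (z/cis a)"
  have "z/cis a = cis s"
  proof -
   have "norm (z/cis a) = 1" "z/cis a ~= 0" using assms by (auto simp: norm_divide)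
   thus ?thesis unfolding s_def using cis_Arg[of "z/cis a"] by (simp add: sgn_eq)
  qed
  moreover have "cis (s + 2*pi) = cis s" by (simp add: cis_mult[symmetric] del: cis_mult)
  ultimately have cs: "cis (a + s) = z" "cis (a + (s + 2*pi)) = z"
  proof -
   have "cis a*cis s = z" using \<open>z/cis a = cis s\<close> by (metis cis_neq_zero nonzero_mult_div_cancel_left times_divide_eq_right)
   thus "cis (a + s) = z" by (simp add: cis_mult)
   thus "cis (a + (s + 2*pi)) = z" using \<open>cis (s + 2*pi) = cis s\<close> by (metis cis_mult)
  qed
  have "s ~= 0" using cs(1) assms by auto
  moreover have "- pi < s" "s <= pi" unfolding s_def using Arg_bounded[of "z/cis a"] by auto
  ultimately show "EX t. a < t & t < a + 2*pi & cis t = z"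
   using cs pi_gt_zero by (cases "s > 0") (force intro!: exI[of _ "a + s"], force intro!: exI[of _ "a + (s + 2*pi)"])
 next
  fix t t' assume t: "a < t & t < a + 2*pi & cis t = z" "a < t' & t' < a + 2*pi & cis t' = z"
  hence "cis (t - t') = 1" by (metis cis_divide cis_neq_zero divide_self_if)
  hence "cos (t - t') = 1" by (metis cis.simps(1) one_complex.simps(1))
  then obtain n :: int where n: "t - t' = of_int n*2*pi" using cos_one_2pi_int by blast
  have "\<bar>t - t'\<bar> < 2*pi" using t by auto
  hence "\<bar>of_int n :: real\<bar> < 1" using n pi_gt_zero by (simp add: abs_mult)
  hence "n = 0" by linarith
  thus "t = t'" using n by simp
 qed
 from theI'[OF ex] show "a < arg_branch a z" ?A ?B unfolding arg_branch_def by auto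
 show "PROP ?C" unfolding arg_branch_def using ex by (intro the1_equality) auto
qed

lemma atlas_circle: "atlas circle = {(sphere 0 1 - {cis a}, %z _. arg_branch a z) | a. True}" unfolding circle_def arg_branch_def by simp

lemma premfd_circle: "premfd circle" unfolding premfd_def
proof (intro conjI ballI)
 show "finite (idx circle)" by (simp add: circle_def)
 fix c assume "c:atlas circle"
 then obtain a where c: "c = (sphere 0 1 - {cis a}, %z _. arg_branch a z)" unfolding atlas_circle by blast
 show "inj_on (snd c) (fst c)"
 proof (rule inj_onI)
  fix z z' assume "z:fst c" "z':fst c" "snd c z = snd c z'"
  hence "z:sphere 0 1 - {cis a}" "z':sphere 0 1 - {cis a}" "arg_branch a z = arg_branch a z'" unfolding c fst_conv snd_conv by (simp_all only: fun_eq_iff)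
  thus "z = z'" using arg_branch(3) by metis
 qed
 show "fst c <= pts circle" unfolding c circle_def by auto
 fix c' assume "c':atlas circle"
 then obtain a' where c': "c' = (sphere 0 1 - {cis a'}, %z _. arg_branch a' z)" unfolding atlas_circle by blast
 have "snd c ` (fst c Int fst c') = (%t _. t) ` {t:{a<..<a + 2*pi}. cis t ~= cis a'}"
 proof (rule subset_antisym; rule subsetI)
  fix v assume "v:snd c ` (fst c Int fst c')"
  then obtain z where "z:fst c Int fst c'" "v = snd c z" by blast
  hence z: "z:sphere 0 1 - {cis a}" "z ~= cis a'" "v = (%_. arg_branch a z)" unfolding c c' by auto
  thus "v:(%t _. t) ` {t:{a<..<a + 2*pi}. cis t ~= cis a'}" using arg_branch(1-3)[OF z(1)] by auto
 next
  fix v :: "unit=>real" assume "v:(%t _. t) ` {t:{a<..<a + 2*pi}. cis t ~= cis a'}"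
  then obtain t where t: "a < t" "t < a + 2*pi" "cis t ~= cis a'" "v = (%_. t)" by auto
  have "cis t ~= cis a"
  proof
   assume "cis t = cis a"
   hence "cis (t - a) = 1" by (metis cis_divide cis_neq_zero divide_self_if)
   hence "cos (t - a) = 1" by (metis cis.simps(1) one_complex.simps(1))
   then obtain n :: int where n: "t - a = of_int n*2*pi" using cos_one_2pi_int by blast
   hence "t - a = of_int n*(2*pi)" by simp
   moreover have "0 < t - a" "t - a < 1*(2*pi)" using t by simp_all
   ultimately have "0 < of_int n*(2*pi)" "of_int n*(2*pi) < 1*(2*pi)" by metis+
   hence "0 < (of_int n :: real)" "(of_int n :: real) < 1" using pi_gt_zero by (auto simp: zero_less_mult_iff mult_less_cancel_right)
   thus False by simp
  qed
  hence "cis t:sphere 0 1 - {cis a}" by auto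
  moreover from arg_branch(4)[OF this t(1,2)] have ab: "arg_branch a (cis t) = t" by simp
  moreover have "v = snd c (cis t)" unfolding c t(4) by (simp add: ab)
  moreover have "cis t:fst c Int fst c'" unfolding c c' using t(3) \<open>cis t:_\<close> by simp
  ultimately have "v = snd c (cis t)" "cis t:fst c Int fst c'" by blast+
  thus "v:snd c ` (fst c Int fst c')" by blast
 qed
 moreover have "open {t:{a<..<a + 2*pi}. cis t ~= cis a'}"
 proof -
  have "open (cis -` (- {cis a'}))" by (intro open_vimage) (auto intro!: continuous_intros)
  hence "open ({a<..<a + 2*pi} Int cis -` (- {cis a'}))" by (intro open_Int) auto
  moreover have "{a<..<a + 2*pi} Int cis -` (- {cis a'}) = {t:{a<..<a + 2*pi}. cis t ~= cis a'}" by auto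
  ultimately show ?thesis by simp
 qed
 ultimately show "opn (idx circle) (snd c ` (fst c Int fst c'))" using opn_unit by (simp add: circle_def)
qed

lemma lsm_prod_fam:
 assumes M: "manifold M" and L: "finite L" and N: "!!i. i:L ==> manifold (N i)"
  and F: "smooth_map M (prod_fam L N) F" and p: "p:pts M" and i: "i:L" shows "lsm M (N i) (%p. F p i) p"
proof -
 have X: "premfd (prod_fam L N)" by (rule premfd_prod_fam[OF L manifold_premfd[OF N]])
 have Fp: "F p:(\<Pi>\<^sub>E i\<in>L. pts (N i))" using smooth_map_funcset[OF manifold_premfd[OF M] X F p] by (simp add: prod_fam_def)
 show ?thesis unfolding lsm_def
 proof (intro conjI ballI impI p)
  show "F p i:pts (N i)" using Fp i by auto
  fix c c' assume c: "c:atlas M" "p:fst c" and c': "c':atlas (N i)" "F p i:fst c'"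
  have "ALL j:L. EX e. e:atlas (N j) & F p j:fst e" using mfd_cover[OF N] Fp by blast
  then obtain e where e: "!!j. j:L ==> e j:atlas (N j)" "!!j. j:L ==> F p j:fst (e j)" by metis
  \<comment> \<open>The given chart \<open>c'\<close> in slot \<open>i\<close> and any charts around
    the point in the other slots make a chart of the product.\<close>
  define e' where "e' = e(i := c')"
  define d where "d = fam_chart L (%i. idx (N i)) e'"
  have d: "d:atlas (prod_fam L N)" unfolding atlas_prod_fam d_def e'_def using e c' by auto
  have Fd: "F p:fst d" unfolding d_def fam_chart_def e'_def using e c' Fp by (auto simp: PiE_iff)
  obtain T where T: "opn (idx M) T" "snd c p:T" "T <= img c" "ALL v:T. F (cinv c v):fst d"
   "ALL j:idx (prod_fam L N). smo M T (%v. rep c F d v j)" using smooth_map_rep[OF manifold_premfd[OF M] X F c d Fd] by blast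
  show "EX T. opn (idx M) T & snd c p:T & T <= img c & (ALL v:T. F (cinv c v) i:fst c') &
   (ALL j:idx (N i). smo M T (%v. snd c' (F (cinv c v) i) j))"
  proof (intro exI[of _ T] conjI ballI T(1-3))
   show "F (cinv c v) i:fst c'" if "v:T" for v
   proof -
    have "F (cinv c v):fst d" using T(4) that by blast
    hence "F (cinv c v) i:fst (e' i)" using i unfolding d_def fam_chart_def by auto
    thus ?thesis by (simp add: e'_def)
   qed
   show "smo M T (%v. snd c' (F (cinv c v) i) j)" if j: "j:idx (N i)" for j
   proof -
    have "(i, j):idx (prod_fam L N)" using i j by (simp add: prod_fam_def)
    hence "smo M T (%v. rep c F d v (i, j))" using T(5) by blast
    moreover have "(%v. rep c F d v (i, j)) = (%v. snd c' (F (cinv c v) i) j)" using i j unfolding d_def fam_chart_def e'_def by simp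
    ultimately show ?thesis by simp
   qed
  qed
 qed
qed

lemma open_sub_chart: "c:atlas M ==> (fst c Int W, snd c):atlas (open_sub M W)"
proof -
 assume "c:atlas M"
 hence "(fst c Int W, snd c):{(fst c Int W, snd c) | c. c:atlas M}" by blast
 thus ?thesis by (simp add: open_sub_def)
qed

lemma smooth_map_rep_sub:
 assumes M: "manifold M" and W: "openin (mtop M) W" and X: "premfd X" and F: "smooth_map (open_sub M W) X F"
  and c: "c:atlas M" "p:fst c" "p:W" and d: "d:atlas X" "F p:fst d"
 shows "EX T. opn (idx M) T & snd c p:T & T <= snd c ` (fst c Int W) & (ALL v:T. F (cinv c v):fst d) &
  (ALL j:idx X. smo M T (%v. rep c F d v j))"
proof -
 define c' where "c' = (fst c Int W, snd c)"
 have c': "c':atlas (open_sub M W)" "p:fst c'" using c unfolding c'_def by (auto intro: open_sub_chart)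
 obtain T where T: "opn (idx M) T" "snd c p:T" "T <= snd c ` (fst c Int W)" "!!v. v:T ==> F (cinv c' v):fst d"
  "!!j. j:idx X ==> smo M T (%v. rep c' F d v j)"
  using smooth_map_rep[OF premfd_open_sub[OF manifold_premfd[OF M] W] X F c' d] by (auto simp: c'_def open_sub_def)
 have eq: "cinv c' v = cinv c v" if vT: "v:T" for v
 proof -
  obtain r where r: "r:fst c" "r:W" "v = snd c r" using T(3) vT by blast
  have "inj_on (snd c) (fst c Int W)" using mfd_chart(1)[OF M c(1)] by (rule inj_on_subset) auto
  hence "cinv c' (snd c r) = r" using r by (simp add: c'_def)
  thus ?thesis using r cinv_chart[OF M c(1)] by simp
 qed
 show ?thesis
 proof (intro exI[of _ T] conjI ballI T(1-3))
  show "F (cinv c v):fst d" if "v:T" for v using T(4)[OF that] eq[OF that] by simp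
  show "smo M T (%v. rep c F d v j)" if "j:idx X" for j by (rule smooth_cong[OF T(1) _ T(5)[OF that]]) (simp add: eq)
 qed
qed

lemma lsm_snd:
 assumes M: "manifold M" and W: "openin (mtop M) W" and P: "manifold P"
  and F: "smooth_map (open_sub M W) (prod_mfd unit_interval P) (%p. (x p, q p))" and p: "p:W" shows "lsm M P q p"
proof -
 have X: "premfd (prod_mfd unit_interval P)" by (rule premfd_prod[OF premfd_unit_interval manifold_premfd[OF P]])
 have Wp: "W <= pts M" using W mfd_openin[OF M] by blast
 have "(x p, q p):pts (prod_mfd unit_interval P)" using smooth_map_funcset[OF premfd_open_sub[OF manifold_premfd[OF M] W] X F] p by (simp add: open_sub_def)
 hence xq: "0 < x p" "x p < 1" "q p:pts P" by (auto simp: prod_mfd_def unit_interval_def)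
 show ?thesis unfolding lsm_def
 proof (intro conjI ballI impI xq(3))
  show "p:pts M" using p Wp by blast
  fix c c' assume c: "c:atlas M" "p:fst c" and c': "c':atlas P" "q p:fst c'"
  define d where "d = ({0<..<1 :: real} \<times> fst c', %(t, y). case_sum (%_ :: unit. t) (snd c' y))"
  have d: "d:atlas (prod_mfd unit_interval P)" unfolding d_def prod_mfd_def unit_interval_def using c' by force
  have Fd: "(x p, q p):fst d" unfolding d_def using xq c' by auto
  obtain T where T: "opn (idx M) T" "snd c p:T" "T <= snd c ` (fst c Int W)" "!!v. v:T ==> (x (cinv c v), q (cinv c v)):fst d"
   "!!j. j:idx (prod_mfd unit_interval P) ==> smo M T (%v. snd d (x (cinv c v), q (cinv c v)) j)" using smooth_map_rep_sub[OF M W X F c p d Fd] by blast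
  show "EX T. opn (idx M) T & snd c p:T & T <= img c & (ALL v:T. q (cinv c v):fst c') &
   (ALL j:idx P. smo M T (%v. rep c q c' v j))"
  proof (intro exI[of _ T] conjI ballI T(1,2))
   show "T <= img c" using T(3) by blast
   show "q (cinv c v):fst c'" if "v:T" for v using T(4)[OF that] unfolding d_def by auto
   show "smo M T (%v. rep c q c' v j)" if "j:idx P" for j
   proof -
    have "Inr j:idx (prod_mfd unit_interval P)" using that by (simp add: prod_mfd_def InrI)
    from T(5)[OF this] show ?thesis unfolding d_def by simp
   qed
  qed
 qed
qed

text \<open>Supplies tangent vectors as velocities of a parametrised map \<open>Ps\<close>; vectors
  with prescribed projections arise in this way. The value is given on functions smooth near the
  point, as tangent vectors are normalised to \<open>0\<close> on the others.\<close>

lemma curve_tangent: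
 assumes M: "manifold M" and finI: "finite I" and z: "Ps z:pts M"
  and rep: "!!c. c:atlas M ==> Ps z:fst c ==> EX T. opn I T & r0:T & (ALL w:T. Ps (de w):fst c) &
   (ALL j:idx M. smooth_on I T (%w. snd c (Ps (de w)) j))"
  and r0: "de r0 = z" shows "EX v:Tan M (Ps z). ALL f. smooth_near M (Ps z) f --> v f = (SUM j:I. ze j*pd j (%w. f (Ps (de w))) r0)"
proof -
 obtain c where c: "c:atlas M" "Ps z:fst c" using mfd_cover[OF M z] by blast
 obtain T where T: "opn I T" "r0:T" "!!w. w:T ==> Ps (de w):fst c" "!!j. j:idx M ==> smooth_on I T (%w. snd c (Ps (de w)) j)" using rep[OF c] by blast
 let ?F = "%w. snd c (Ps (de w))"
 define v where "v = tvec M c (Ps z) (%k. SUM j:I. ze j*pd j (%w. ?F w k) r0)"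
 have "v f = (SUM j:I. ze j*pd j (%w. f (Ps (de w))) r0)" if n: "smooth_near M (Ps z) f" for f
 proof -
  obtain T' where T': "opn (idx M) T'" "snd c (Ps z):T'" "T' <= img c" "smo M T' (%v. f (cinv c v))" using n near_iff[OF M c] by blast
  define U where "U = {w:T. ?F w:T'}"
  have U: "opn I U" unfolding U_def by (rule opn_preimage[OF T(1,4) _ T'(1)]) (use T(3) chart_Rn[OF M c(1)] in auto)
  have sF: "smooth_on I U (%w. ?F w j)" if "j:idx M" for j by (rule smooth_subset[OF T(1) T(4)[OF that]]) (auto simp: U_def)
  have eq: "f (Ps (de w)) = f (cinv c (?F w))" if "w:U" for w using that T(3) cinv_chart[OF M c(1)] by (auto simp: U_def)
  have UT: "?F w:T'" if "w:U" for w using that by (simp add: U_def)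
  have wU: "r0:U" using T(2) T'(2) r0 by (simp add: U_def)
  have "pd j (%w. f (Ps (de w))) r0 = (SUM k:idx M. pd k (%v. f (cinv c v)) (snd c (Ps z))*pd j (%w. ?F w k) r0)" (is "?L = _") if "j:I" for j
  proof -
   have "?L = pd j (%w. f (cinv c (?F w))) r0" by (rule pd_cong[OF U that wU eq])
   thus ?thesis using pd_comp[OF U mfd_fin[OF M] T'(1) UT sF T'(4) that wU] r0 by simp
  qed
  hence "(SUM j:I. ze j*pd j (%w. f (Ps (de w))) r0) = (SUM j:I. SUM k:idx M. ze j*(pd k (%v. f (cinv c v)) (snd c (Ps z))*pd j (%w. ?F w k) r0))" by (simp add: sdl)
  also have "... = (SUM k:idx M. (SUM j:I. ze j*pd j (%w. ?F w k) r0)*pd k (%v. f (cinv c v)) (snd c (Ps z)))" unfolding sdr by (subst sum.swap) (simp add: mult_ac)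
  finally show ?thesis unfolding v_def tvec_near[OF M n] by simp
 qed
 moreover have "v:Tan M (Ps z)" unfolding v_def by (rule tvec_tangent[OF M c])
 ultimately show ?thesis by blast
qed

lemma curve_tangent_map:
 assumes M: "manifold M" and X: "premfd X" and Ps: "smooth_map X M Ps" and d: "d:atlas X" "z:fst d"
 shows "EX v:Tan M (Ps z). ALL f. smooth_near M (Ps z) f --> v f = (SUM j:idx X. ze j*pd j (%w. f (Ps (cinv d w))) (snd d z))"
proof (rule curve_tangent[where Ps = Ps and z = z and de = "cinv d" and ?r0.0 = "snd d z", OF M pre_fin[OF X]])
 show "Ps z:pts M" using smooth_map_funcset[OF X manifold_premfd[OF M] Ps] pre_chart(2)[OF X d(1)] d(2) by blast
 show "cinv d (snd d z) = z" by (rule pre_cinv[OF X d])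
 show "EX T. opn (idx X) T & snd d z:T & (ALL w:T. Ps (cinv d w):fst c) &
   (ALL j:idx M. smo X T (%w. snd c (Ps (cinv d w)) j))" if "c:atlas M" "Ps z:fst c" for c using smooth_map_rep[OF X manifold_premfd[OF M] Ps d that] by blast
qed

lemma curve_tangent_sub:
 assumes M: "manifold M" and W: "openin (mtop M) W" and X: "premfd X" and Ps: "smooth_map X (open_sub M W) Ps" and d: "d:atlas X" "z:fst d"
 shows "EX v:Tan M (Ps z). ALL f. smooth_near M (Ps z) f --> v f = (SUM j:idx X. ze j*pd j (%w. f (Ps (cinv d w))) (snd d z))"
proof (rule curve_tangent[where Ps = Ps and z = z and de = "cinv d" and ?r0.0 = "snd d z", OF M pre_fin[OF X]])
 have Y: "premfd (open_sub M W)" by (rule premfd_open_sub[OF manifold_premfd[OF M] W])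
 have zW: "Ps z:W" using smooth_map_funcset[OF X Y Ps] pre_chart(2)[OF X d(1)] d(2) by (auto simp: open_sub_def)
 thus "Ps z:pts M" using W mfd_openin[OF M] by blast
 show "cinv d (snd d z) = z" by (rule pre_cinv[OF X d])
 show "EX T. opn (idx X) T & snd d z:T & (ALL w:T. Ps (cinv d w):fst c) &
   (ALL j:idx M. smo X T (%w. snd c (Ps (cinv d w)) j))" if "c:atlas M" "Ps z:fst c" for c
 proof -
  have "(fst c Int W, snd c):atlas (open_sub M W)" using that by (intro open_sub_chart)
  from smooth_map_rep[OF X Y Ps d this] zW that show ?thesis by (auto simp: open_sub_def)
 qed
qed

lemma opn_vimage: "opn I S ==> smooth_on I S f ==> open A ==> opn I {v:S. f v:A}"
proof -
 assume a: "opn I S" "smooth_on I S f" "open A"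
 have "openin (top_of_set S) (S Int f -` A)" using continuous_openin_preimage_gen[OF smooth_on_cont[OF a(2) opn_subset[OF a(1)]] a(3)] .
 moreover have "S Int f -` A = {v:S. f v:A}" by auto
 ultimately show ?thesis using openin_trans[OF _ a(1)] by metis
qed

section \<open>Linear forms on tangent spaces and pullback of one-forms\<close>

definition tlin :: "('p, 'k) mfd=>'p=>('p tv=>real)=>bool" where
 "tlin M p fi = ((ALL u:Tan M p. ALL w:Tan M p. ALL r s. fi (lincomb r u s w) = r*fi u + s*fi w))"

lemma tlinD: "tlin M p fi ==> u:Tan M p ==> w:Tan M p ==> fi (lincomb r u s w) = r*fi u + s*fi w" unfolding tlin_def by blast

text \<open>\<open>fi\<close> is linear on tangent vectors only, hence the induction carries along
  that the partial sums are tangent.\<close>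

lemma tlin_expand:
 assumes M: "manifold M" and c: "c:atlas M" "p:fst c" and fi: "tlin M p fi" shows "fi (tvec M c p xx) = (SUM k:idx M. xx k*fi (cvec M c p k))"
proof -
 have pM: "p:pts M" using c mfd_chart(2)[OF M] by blast
 have *: "(%f. SUM k:K. xx k*cvec M c p k f):Tan M p & fi (%f. SUM k:K. xx k*cvec M c p k f) = (SUM k:K. xx k*fi (cvec M c p k))" if "finite K" "K <= idx M" for K
  using that
 proof (induction K rule: finite_induct)
  case empty
  have z: "(%f. 0) = tvec M c p (%_. 0)" by (simp add: tvec_def)
  hence "(%f. 0):Tan M p" using tvec_tangent[OF M c] by simp
  moreover have "fi (lincomb 0 (%f. 0) 0 (%f. 0)) = 0" using tlinD[OF fi calculation calculation, of 0 0] by simp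
  ultimately show ?case by (simp add: lincomb_def)
 next
  case (insert k K)
  hence k: "k:idx M" and IH: "(%f. SUM k:K. xx k*cvec M c p k f):Tan M p"
   "fi (%f. SUM k:K. xx k*cvec M c p k f) = (SUM k:K. xx k*fi (cvec M c p k))" by auto
  have eq: "(%f. SUM k:insert k K. xx k*cvec M c p k f) = lincomb (xx k) (cvec M c p k) 1 (%f. SUM k:K. xx k*cvec M c p k f)" using insert(1,2) by (simp add: lincomb_def)
  show ?case unfolding eq using tangent_lincomb[OF M pM cvec_tangent[OF M c k] IH(1)] tlinD[OF fi cvec_tangent[OF M c k] IH(1)] IH(2) insert(1,2) by simp
 qed
 from *[OF mfd_fin[OF M] order_refl] show ?thesis unfolding tvec_def by blast
qed

lemma tlin_push:
 assumes "manifold M" "manifold N" "lsm M N F p" "tlin N (F p) fi" shows "tlin M p (%u. fi (push N F p u))"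
 using assms push_tangent[OF assms(1-3)] by (auto simp: tlin_def push_lincomb)

text \<open>The exterior derivative commutes with pullback: in the antisymmetrised derivative the
  second derivatives of \<open>F\<close> cancel by \<open>pd_swap\<close>.\<close>

lemma pullback_form:
 assumes M: "manifold M" and N: "manifold N" and F: "lsm M N F p"
  and c: "c:atlas M" "p:fst c" and c': "c':atlas N" "F p:fst c'" and \<theta>: "one_form N \<theta>"
 obtains T where "opn (idx M) T" "snd c p:T" "T <= img c"
  "!!v. v:T ==> F (cinv c v):fst c'"
  "!!a. a:idx M ==> smo M T (%v. SUM l:idx N. fcomp N c' \<theta> l (rep c F c' v)*pd a (%v. rep c F c' v l) v)"
  "!!a b v. a:idx M ==> b:idx M ==> v:T ==>
   pd a (%v. SUM l:idx N. fcomp N c' \<theta> l (rep c F c' v)*pd b (%v. rep c F c' v l) v) v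
   - pd b (%v. SUM l:idx N. fcomp N c' \<theta> l (rep c F c' v)*pd a (%v. rep c F c' v l) v) v
   = (SUM k:idx N. SUM l:idx N. (pd k (fcomp N c' \<theta> l) (rep c F c' v) - pd l (fcomp N c' \<theta> k) (rep c F c' v))
      * pd a (%v. rep c F c' v k) v * pd b (%v. rep c F c' v l) v)"
proof -
 obtain T where T: "opn (idx M) T" "snd c p:T" "T <= img c" "!!v. v:T ==> F (cinv c v):fst c'"
  "!!j. j:idx N ==> smo M T (%v. rep c F c' v j)" by (rule lsmE[OF F c c']) blast
 define Q where "Q l v = rep c F c' v l" for l v
 let ?Q = "%v. rep c F c' v"
 define t where "t l = fcomp N c' \<theta> l" for l
 have QT: "?Q v:img c'" if "v:T" for v using T(4)[OF that] by blast
 have V: "opn (idx N) (img c')" by (rule mfd_chart(3)[OF N c'(1)])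
 have st: "smo N (img c') (t l)" if "l:idx N" for l using \<theta> c'(1) that unfolding one_form_def t_def by blast
 have stQ: "smo M T (%v. t l (?Q v))" if "l:idx N" for l by (rule smooth_comp[OF T(1) mfd_fin[OF N] V QT T(5) st[OF that]])
 have sQ: "smo M T (Q l)" if "l:idx N" for l using T(5)[OF that] by (simp add: Q_def[abs_def])
 have pdt: "pd a (%v. t l (?Q v)) v = (SUM k:idx N. pd k (t l) (?Q v)*pd a (Q k) v)" if "a:idx M" "l:idx N" "v:T" for a l v
  using pd_comp[OF T(1) mfd_fin[OF N] V QT T(5) st[OF that(2)] that(1,3)] by (simp add: Q_def[abs_def])
 define al where "al a v = (SUM l:idx N. t l (?Q v)*pd a (Q l) v)" for a v
 have sal: "smo M T (al a)" if "a:idx M" for a unfolding al_def using that by (intro smooth_sum[OF T(1)] smooth_mult[OF T(1)] stQ smooth_on_pd sQ)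
 have pdal: "pd a (al b) v = (SUM l:idx N. SUM k:idx N. pd k (t l) (?Q v)*pd a (Q k) v * pd b (Q l) v) + (SUM l:idx N. t l (?Q v)*pd a (pd b (Q l)) v)"
  if "a:idx M" "b:idx M" "v:T" for a b v
 proof -
  have "pd a (al b) v = (SUM l:idx N. pd a (%v. t l (?Q v)*pd b (Q l) v) v)"
   unfolding al_def[abs_def] using that by (intro pd_sum[OF T(1)] smooth_mult[OF T(1)] stQ smooth_on_pd sQ)
  also have "... = (SUM l:idx N. pd a (%v. t l (?Q v)) v * pd b (Q l) v + t l (?Q v)*pd a (pd b (Q l)) v)"
   using that by (intro sum.cong refl pd_mult[OF T(1)] stQ smooth_on_pd sQ)
  finally show ?thesis using that by (simp add: pdt sum.distrib sdr)
 qed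
 have d: "pd a (al b) v - pd b (al a) v = (SUM k:idx N. SUM l:idx N. (pd k (t l) (?Q v) - pd l (t k) (?Q v))*pd a (Q k) v * pd b (Q l) v)" (is "?L = _")
  if ab: "a:idx M" "b:idx M" "v:T" for a b v
 proof -
  have "pd a (pd b (Q l)) v = pd b (pd a (Q l)) v" if "l:idx N" for l using pd_swap[OF mfd_fin[OF M] T(1) sQ[OF that] ab] .
  hence "?L = (SUM l:idx N. SUM k:idx N. pd k (t l) (?Q v)*pd a (Q k) v * pd b (Q l) v)
   - (SUM l:idx N. SUM k:idx N. pd k (t l) (?Q v)*pd b (Q k) v * pd a (Q l) v)" using pdal[OF ab] pdal[OF ab(2,1,3)] by simp
  also have "(SUM l:idx N. SUM k:idx N. pd k (t l) (?Q v)*pd a (Q k) v * pd b (Q l) v) = (SUM k:idx N. SUM l:idx N. pd k (t l) (?Q v)*pd a (Q k) v * pd b (Q l) v)"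
   by (rule sum.swap)
  finally show ?thesis by (simp add: alg sum_subtractf)
 qed
 show ?thesis by (rule that[of T]) (use T sal d in \<open>simp_all add: al_def[abs_def] t_def[abs_def] Q_def[abs_def]\<close>)
qed

section \<open>The principal part\<close>

context construction_two begin

abbreviation "mform == metric_form m N gN JN b P pr \<theta> M x q"
text \<open>With \<open>V\<close> the product of the \<open>A i ^ (d_i / 2)\<close>,
  \<open>S1\<close> is \<open>V' / V\<close> and \<open>S2\<close> is minus its derivative, so
  \<open>S1^2 - S2 = V'' / V\<close>.\<close>

abbreviation "S0 a y == SUM i=1..m. real (mdim (N i))/(b i*y + a i)"
abbreviation "S1 a y == SUM i=1..m. real (mdim (N i))*b i/(2*(b i*y + a i))"
abbreviation "S2 a y == SUM i=1..m. real (mdim (N i))*(b i)\<^sup>2/(2*(b i*y + a i)\<^sup>2)"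


definition W where "W = {p:pts M. 0 < x p & x p < 1}"

lemma mM: "manifold M" using total(1) unfolding closed_manifold_def by blast
lemma mN: "i:{1..m} ==> manifold (N i)" using factors unfolding closed_manifold_def by blast
lemma mP: "manifold P" by (rule principal(1))

lemma x_smooth: "c:atlas M ==> smo M (img c) (%v. x (cinv c v))"
proof -
 assume c: "c:atlas M"
 hence "smo M (snd c ` (pts M Int fst c)) (%v. x (cinv c v))" using total(2) unfolding smooth_fun_def by blast
 moreover have "pts M Int fst c = fst c" using mfd_chart(2)[OF mM c] by blast
 ultimately show ?thesis by simp
qed

lemma x_near: "p:pts M ==> smooth_near M p x" unfolding smooth_near_def using total(2) topspace_mfd[OF mM] by (metis openin_topspace)

lemma x_range: "p:pts M ==> x p:{0..1}" using total(3) by blast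

lemma W_chart: "c:atlas M ==> snd c ` (W Int fst c) = {v:img c. x (cinv c v):{0<..<1}}"
proof -
 assume c: "c:atlas M"
 have *: "p:W \<longleftrightarrow> x p:{0<..<1}" if "p:fst c" for p using mfd_chart(2)[OF mM c] that by (auto simp: W_def)
 have "x (cinv c (snd c p)) = x p" if "p:fst c" for p using cinv_chart[OF mM c that] by simp
 thus ?thesis using*by auto
qed

lemma W_open: "openin (mtop M) W" unfolding mfd_openin[OF mM]
proof (intro conjI ballI)
 show "W <= pts M" by (auto simp: W_def)
 show "opn (idx M) (snd c ` (W Int fst c))" if "c:atlas M" for c unfolding W_chart[OF that] by (rule opn_vimage[OF mfd_chart(3)[OF mM that] x_smooth[OF that]]) simp
qed

lemma W_pts: "p:W ==> p:pts M" by (simp add: W_def)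

lemma diffeoW: "diffeo (open_sub M W) (prod_mfd unit_interval P) (%p. (x p, q p))" using principal_part unfolding W_def .

lemma q_lsm: "p:W ==> lsm M P q p" by (rule lsm_snd[OF mM W_open mP _]) (use diffeoW in \<open>auto simp: diffeo_def\<close>)

lemma pr_lsm: "y:pts P ==> i:{1..m} ==> lsm P (N i) (%y. pr y i) y" using principal(2) unfolding principal_circle_bundle_def
 by (intro lsm_prod_fam[OF mP finite_atLeastAtMost mN]) blast+

lemma qP: "p:W ==> q p:pts P" using q_lsm unfolding lsm_def by blast

lemma prq_lsm: "p:W ==> i:{1..m} ==> lsm M (N i) (%p. pr (q p) i) p" using lsm_compose[OF mM mP mN q_lsm pr_lsm[OF qP]] by blast

definition vert where "vert p v = \<theta> (q p) (push P q p v)"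
definition base where "base i p = push (N i) (%p. pr (q p) i) p"
abbreviation "gb i p u w == gN i (pr (q p) i) (base i p u) (base i p w)"
abbreviation "gf h a p u w == u x*w x/h (x p) + h (x p) * vert p u * vert p w
  + (SUM i=1..m. (b i*x p + a i)*gb i p u w)"


lemma one_form_\<theta>: "one_form P \<theta>" using connection unfolding connection_form_def by blast

lemma tlin_\<theta>: "y:pts P ==> tlin P y (\<theta> y)" using one_form_\<theta> unfolding one_form_def tlin_def by blast

lemma vert_lin: "p:W ==> tlin M p (vert p)" unfolding vert_def[abs_def] by (rule tlin_push[OF mM mP q_lsm tlin_\<theta>[OF qP]])

lemma base_push: "p:W ==> i:{1..m} ==> base i p v = push (N i) (%y. pr y i) (q p) (push P q p v)" unfolding base_def
 using push_push[where F = q and p = p and H = "%y. pr y i", OF mP mN pr_lsm[OF qP]] by simp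

lemma base_tangent: "p:W ==> i:{1..m} ==> v:Tan M p ==> base i p v:Tan (N i) (pr (q p) i)" unfolding base_def by (rule push_tangent[OF mM mN prq_lsm])

lemma base_lincomb: "base i p (lincomb r u s w) = lincomb r (base i p u) s (base i p w)" unfolding base_def by (rule push_lincomb)

end

lemma pd_coord: "pd j (%w. w k) v = (if j = k then 1 else 0)" by (cases "j = k") (auto simp: pd_def)

lemma prod_chart: "c:atlas M ==> c':atlas N ==> (fst c \<times> fst c', %(p, q). case_sum (snd c p) (snd c' q)):atlas (prod_mfd M N)"
proof -
 assume "c:atlas M" "c':atlas N"
 hence "(fst c \<times> fst c', %(p, q). case_sum (snd c p) (snd c' q)) :
   {(fst c \<times> fst c', %(p, q). case_sum (snd c p) (snd c' q)) | c c'. c:atlas M & c':atlas N}" by blast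
 thus ?thesis by (simp add: prod_mfd_def)
qed

context construction_two begin

text \<open>\<open>(x, q)\<close> is a diffeomorphism, so the speed in \<open>x\<close> and the
  image in \<open>P\<close> can be prescribed independently; the vector is the velocity of the
  inverse map in a product chart.\<close>

lemma principal_lift:
 assumes p: "p:W" and u: "u:Tan P (q p)" shows "EX v:Tan M p. v x = xx & push P q p v = u"
proof -
 let ?X = "prod_mfd unit_interval P" and ?F = "%p. (x p, q p)"
 define Ps where "Ps = inv_into W ?F"
 have X: "premfd ?X" by (rule premfd_prod[OF premfd_unit_interval manifold_premfd[OF mP]])
 have bij: "bij_betw ?F W (pts ?X)" and sm: "smooth_map ?X (open_sub M W) Ps" using diffeoW unfolding diffeo_def Ps_def by (auto simp: open_sub_def)
 have FPs: "x (Ps z) = fst z" "q (Ps z) = snd z" if "z:pts ?X" for z using bij_betw_inv_into_right[OF bij that] unfolding Ps_def by (metis fst_conv, metis snd_conv)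
 have Psp: "Ps (x p, q p) = p" using bij_betw_inv_into_left[OF bij p] unfolding Ps_def by simp
 obtain c' where c': "c':atlas P" "q p:fst c'" using mfd_cover[OF mP qP[OF p]] by blast
 define d where "d = ({0<..<1 :: real} \<times> fst c', %(t, y). case_sum (%_ :: unit. t) (snd c' y))"
 have d: "d:atlas ?X" unfolding d_def prod_mfd_def unit_interval_def using c' by force
 have zd: "(x p, q p):fst d" unfolding d_def using p c' by (auto simp: W_def)
 define ze where "ze = case_sum (%_ :: unit. xx) (%k. u (%y. snd c' y k))"
 obtain v where v: "v:Tan M p" "!!f. smooth_near M p f ==> v f = (SUM j:idx ?X. ze j*pd j (%w. f (Ps (cinv d w))) (snd d (x p, q p)))"
  using curve_tangent_sub[OF mM W_open X sm d zd, of ze] unfolding Psp by blast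
 have O: "opn (idx ?X) (img d)" by (rule pre_chart_opn[OF X d])
 have vf: "v f = ze k" if n: "smooth_near M p f" and k: "k:idx ?X" and f: "!!z. z:fst d ==> f (Ps z) = snd d z k" for f k
 proof -
  have "pd j (%w. f (Ps (cinv d w))) (snd d (x p, q p)) = (if j = k then 1 else 0)" (is "?L = _") if j: "j:idx ?X" for j
  proof -
   have "?L = pd j (%w. w k) (snd d (x p, q p))"
   proof (rule pd_cong[OF O j])
    show "snd d (x p, q p):img d" using zd by blast
    fix w assume "w:img d"
    then obtain z where z: "z:fst d" "w = snd d z" by blast
    thus "f (Ps (cinv d w)) = w k" using f[OF z(1)] pre_cinv[OF X d z(1)] by simp
   qed
   thus ?thesis by (simp add: pd_coord)
  qed
  hence "v f = (SUM j:idx ?X. ze j*(if j = k then 1 else 0))" using v(2)[OF n] by simp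
  thus ?thesis using sum_dm(4)[OF pre_fin[OF X] k] by simp
 qed
 have dX: "z:pts ?X" if "z:fst d" for z using pre_chart(2)[OF X d] that by blast
 have "v x = ze (Inl ())"
 proof (rule vf[OF x_near[OF W_pts[OF p]]])
  show "Inl ():idx ?X" by (auto simp: prod_mfd_def unit_interval_def)
  show "x (Ps z) = snd d z (Inl ())" if "z:fst d" for z using FPs(1)[OF dX[OF that]] by (cases z) (simp add: d_def)
 qed
 moreover have "push P q p v = u"
 proof -
  have "v (%r. snd c' (q r) k) = u (%y. snd c' y k)" (is "?L = _") if k: "k:idx P" for k
  proof -
   have "?L = ze (Inr k)"
   proof (rule vf)
    show "smooth_near M p (%r. snd c' (q r) k)" using lsm_near[OF mM mP q_lsm[OF p] crd_near[OF mP c' k]] by (simp add: o_def)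
    show "Inr k:idx ?X" using k by (auto simp: prod_mfd_def)
    show "snd c' (q (Ps z)) k = snd d z (Inr k)" if "z:fst d" for z using FPs(2)[OF dX[OF that]] by (cases z) (simp add: d_def)
   qed
   thus ?thesis by (simp add: ze_def)
  qed
  thus ?thesis unfolding push_comp1[OF mM mP q_lsm[OF p] v(1) c'] using tangent_eq_tvec[OF mP u c'] by (simp add: tvec_def cong: sum.cong)
 qed
 ultimately show ?thesis using v(1) by (auto simp: ze_def)
qed

lemma B_pre: "premfd (prod_fam {1..m} N)" by (rule premfd_prod_fam[OF finite_atLeastAtMost manifold_premfd[OF mN]])

lemma pr_pts: "y:pts P ==> pr y:pts (prod_fam {1..m} N)"
 using smooth_map_funcset[OF manifold_premfd[OF mP] B_pre] principal(2) unfolding principal_circle_bundle_def by blast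

lemma trivialization:
 assumes "y:pts P"
 obtains U Ph where "openin (mtop (prod_fam {1..m} N)) U" "pr y:U"
  "diffeo (open_sub P {p:pts P. pr p:U}) (prod_mfd (open_sub (prod_fam {1..m} N) U) circle) Ph"
  "!!p. p:pts P ==> pr p:U ==> fst (Ph p) = pr p"
  "!!p z. p:pts P ==> pr p:U ==> z:sphere 0 1 ==> Ph (act z p) = (pr p, z * snd (Ph p))"
proof -
 note principal(2)[unfolded principal_circle_bundle_def, THEN conjunct2, THEN conjunct2, THEN bspec, OF pr_pts[OF assms]]
 thus ?thesis using that by (elim exE conjE) blast
qed

lemma preU_open: "openin (mtop (prod_fam {1..m} N)) U ==> openin (mtop P) {p:pts P. pr p:U}"
proof -
 assume U: "openin (mtop (prod_fam {1..m} N)) U"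
 have "continuous_map (mtop P) (mtop (prod_fam {1..m} N)) pr" using principal(2) unfolding principal_circle_bundle_def smooth_map_def by blast
 from openin_continuous_map_preimage[OF this U] show ?thesis by (simp add: topspace_mfd[OF mP])
qed

text \<open>A local trivialisation of the circle bundle provides the lift. Only the projections are
  prescribed; the value of the connection form is adjusted in \<open>surj\<close>.\<close>

lemma horizontal_lift:
 assumes y: "y:pts P" and w: "!!i. i:{1..m} ==> w i:Tan (N i) (pr y i)" shows "EX u:Tan P y. ALL i:{1..m}. push (N i) (%y. pr y i) y u = w i"
proof -
 obtain U Ph where U: "openin (mtop (prod_fam {1..m} N)) U" "pr y:U"
  and dif: "diffeo (open_sub P {p:pts P. pr p:U}) (prod_mfd (open_sub (prod_fam {1..m} N) U) circle) Ph"
  and Ph1: "!!p. p:pts P ==> pr p:U ==> fst (Ph p) = pr p" by (rule trivialization[OF y]) blast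
 let ?S = "{p:pts P. pr p:U}" and ?B = "prod_fam {1..m} N"
 let ?X = "prod_mfd (open_sub ?B U) circle"
 define Ps where "Ps = inv_into ?S Ph"
 have S: "openin (mtop P) ?S" by (rule preU_open[OF U(1)])
 have X: "premfd ?X" by (rule premfd_prod[OF premfd_open_sub[OF B_pre U(1)] premfd_circle])
 have bij: "bij_betw Ph ?S (pts ?X)" and sm: "smooth_map ?X (open_sub P ?S) Ps" using dif unfolding diffeo_def Ps_def by (auto simp: open_sub_def)
 have PsS: "Ps z:?S" if "z:pts ?X" for z using bij_betwE[OF bij_betw_inv_into[OF bij]] that unfolding Ps_def by blast
 have FPs: "pr (Ps z) = fst z" if "z:pts ?X" for z
 proof -
  have "Ph (Ps z) = z" using bij_betw_inv_into_right[OF bij that] unfolding Ps_def .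
  thus ?thesis using Ph1[of "Ps z"] PsS[OF that] by simp
 qed
 have yS: "y:?S" using y U(2) by blast
 have Psy: "Ps (Ph y) = y" using bij_betw_inv_into_left[OF bij yS] unfolding Ps_def .
 have Phy: "Ph y:pts ?X" using bij_betwE[OF bij] yS by blast
 have fy: "fst (Ph y) = pr y" using Ph1 y U(2) by blast
 have "ALL i:{1..m}. EX e. e:atlas (N i) & pr y i:fst e"
 proof
  fix i assume i: "i:{1..m}"
  have "pr y i:pts (N i)" using pr_lsm[OF y i] unfolding lsm_def by blast
  thus "EX e. e:atlas (N i) & pr y i:fst e" using mfd_cover[OF mN[OF i]] by blast
 qed
 then obtain e where e: "!!i. i:{1..m} ==> e i:atlas (N i)" "!!i. i:{1..m} ==> pr y i:fst (e i)" by metis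
 define dB where "dB = fam_chart {1..m} (%i. idx (N i)) e"
 have dB: "dB:atlas ?B" unfolding atlas_prod_fam dB_def using e by blast
 have prB: "pr y:fst dB" using e(2) pr_pts[OF y] by (auto simp: dB_def fam_chart_def prod_fam_def PiE_iff)
 \<comment> \<open>The branch cut \<open>cis a\<close> has to avoid the fibre coordinate of
   \<open>y\<close>: it is \<open>- 1\<close> if that coordinate is \<open>1\<close>, and
   \<open>1\<close> otherwise.\<close>
 obtain a where a: "snd (Ph y):sphere 0 1 - {cis a}"
 proof (cases "snd (Ph y) = cis 0")
  case True
  thus ?thesis using that[of pi] by simp
 next
  case False
  thus ?thesis using that[of 0] Phy by (auto simp: prod_mfd_def circle_def)
 qed
 define d where "d = ((fst dB Int U) \<times> (sphere 0 1 - {cis a}), %(p, z). case_sum (snd dB p) (%_ :: unit. arg_branch a z))"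
 have d: "d:atlas ?X"
 proof -
  have "(sphere 0 1 - {cis a}, %z _. arg_branch a z):atlas circle" unfolding atlas_circle by blast
  from prod_chart[OF open_sub_chart[OF dB, of U] this] show ?thesis by (simp add: d_def)
 qed
 have zd: "Ph y:fst d" using prB U(2) a fy by (cases "Ph y") (auto simp: d_def)
 define ze where "ze = case_sum (%(i, k). w i (%r. snd (e i) r k)) (%_ :: unit. 0)"
 obtain u where u: "u:Tan P y" "!!f. smooth_near P y f ==> u f = (SUM j:idx ?X. ze j*pd j (%w. f (Ps (cinv d w))) (snd d (Ph y)))"
  using curve_tangent_sub[OF mP S X sm d zd, of ze] unfolding Psy by blast
 have O: "opn (idx ?X) (img d)" by (rule pre_chart_opn[OF X d])
 have dX: "z:pts ?X" if "z:fst d" for z using pre_chart(2)[OF X d] that by blast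
 have "u (%r. snd (e i) (pr r i) k) = w i (%r. snd (e i) r k)" if i: "i:{1..m}" and k: "k:idx (N i)" for i k
 proof -
  let ?f = "%r. snd (e i) (pr r i) k"
  have n: "smooth_near P y ?f" using lsm_near[OF mP mN[OF i] pr_lsm[OF y i] crd_near[OF mN[OF i] e(1)[OF i] e(2)[OF i] k]] by (simp add: o_def)
  have ik: "Inl (i, k):idx ?X" using i k by (auto simp: prod_mfd_def open_sub_def prod_fam_def)
  have "pd j (%w. ?f (Ps (cinv d w))) (snd d (Ph y)) = (if j = Inl (i, k) then 1 else 0)" (is "?L = _") if j: "j:idx ?X" for j
  proof -
   have "?L = pd j (%w. w (Inl (i, k))) (snd d (Ph y))"
   proof (rule pd_cong[OF O j])
    show "snd d (Ph y):img d" using zd by blast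
    fix w assume "w:img d"
    then obtain z where z: "z:fst d" "w = snd d z" by blast
    thus "?f (Ps (cinv d w)) = w (Inl (i, k))" using FPs[OF dX[OF z(1)]] pre_cinv[OF X d z(1)] i k by (cases z) (simp add: d_def dB_def fam_chart_def)
   qed
   thus ?thesis by (simp add: pd_coord)
  qed
  hence "u ?f = (SUM j:idx ?X. ze j*(if j = Inl (i, k) then 1 else 0))" using u(2)[OF n] by simp
  thus ?thesis using sum_dm(4)[OF pre_fin[OF X] ik] by (simp add: ze_def)
 qed
 hence "push (N i) (%y. pr y i) y u = w i" if i: "i:{1..m}" for i unfolding push_comp1[OF mP mN[OF i] pr_lsm[OF y i] u(1) e(1)[OF i] e(2)[OF i]]
  using tangent_eq_tvec[OF mN[OF i] w[OF i] e(1)[OF i] e(2)[OF i]] i by (simp add: tvec_def cong: sum.cong)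
 thus ?thesis using u(1) by blast
qed

text \<open>The generator is the velocity at \<open>1\<close> of the action, in the branch of the
  argument cut at \<open>- 1\<close>. Its projection vanishes because the action moves points inside
  a fibre.\<close>

lemma generator_facts:
 assumes y: "y:pts P" shows "generator P act y:Tan P y" "i:{1..m} ==> push (N i) (%y. pr y i) y (generator P act y) = (%_. 0)"
proof -
 let ?X = "prod_mfd circle P" and ?A = "%(z, p). act z p"
 have X: "premfd ?X" by (rule premfd_prod[OF premfd_circle manifold_premfd[OF mP]])
 have ca: "circle_action P act" using principal(2) unfolding principal_circle_bundle_def by blast
 hence sm: "smooth_map ?X P ?A" and act1: "act 1 y = y" using y unfolding circle_action_def by auto
 obtain c' where c': "c':atlas P" "y:fst c'" using mfd_cover[OF mP y] by blast
 define d where "d = ((sphere 0 1 - {cis (-pi)}) \<times> fst c', %(z, p). case_sum (%_ :: unit. arg_branch (-pi) z) (snd c' p))"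
 have d: "d:atlas ?X"
 proof -
  have "(sphere 0 1 - {cis (-pi)}, %z _. arg_branch (-pi) z):atlas circle" unfolding atlas_circle by blast
  from prod_chart[OF this c'(1)] show ?thesis by (simp add: d_def)
 qed
 have ab: "cis t:sphere 0 1 - {cis (-pi)}" "arg_branch (-pi) (cis t) = t" if t: "-pi < t" "t < pi" for t
 proof -
  have "cis t ~= cis (-pi)"
  proof
   assume "cis t = cis (-pi)"
   hence "cos t = cos (- pi)" by (metis cis.simps(1))
   hence "cos \<bar>t\<bar> = cos pi" by simp
   have "\<bar>t\<bar> = pi" by (rule cos_inj_pi[OF _ _ _ _ \<open>cos \<bar>t\<bar> = cos pi\<close>]) (use t in linarith)+
   thus False using t by linarith
  qed
  thus 1: "cis t:sphere 0 1 - {cis (-pi)}" by auto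
  show "arg_branch (-pi) (cis t) = t" by (rule arg_branch(4)[OF 1]) (use t in auto)
 qed
 have ab0: "1:sphere 0 1 - {cis (-pi)}" "arg_branch (-pi) 1 = 0" using ab[of 0] by auto
 have zd: "(1, y):fst d" using ab0 c' by (simp add: d_def)
 let ?z0 = "snd d (1, y)"
 have line: "?z0(Inl () := t) = snd d (cis t, y)" "(cis t, y):fst d" if "-pi < t" "t < pi" for t using ab[OF that] c' by (auto simp: d_def fun_eq_iff split: sum.splits)
 have z00: "?z0 (Inl ()) = 0" using ab0 by (simp add: d_def)
 have evpi: "\<forall>\<^sub>F t in nhds (0::real). -pi < t & t < pi" using eventually_nhds_in_open[of "{-pi<..<pi}" 0] by simp
 define ze where "ze j = (if j = Inl () then 1 else (0::real))" for j :: "unit + 'l"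
 have Inl: "Inl ():idx ?X" by (auto simp: prod_mfd_def circle_def)
 obtain v where v: "v:Tan P y" "!!f. smooth_near P y f ==> v f = (SUM j:idx ?X. ze j*pd j (%w. f (?A (cinv d w))) ?z0)"
  using curve_tangent_map[OF mP X sm d zd, of ze] act1 by auto
 have "v f = deriv (%t. f (act (cis t) y)) 0" if n: "smooth_near P y f" for f
 proof -
  have "v f = (SUM j:idx ?X. (if j = Inl () then 1 else 0)*pd j (%w. f (?A (cinv d w))) ?z0)" using v(2)[OF n] by (simp only: ze_def)
  also have "... = pd (Inl ()) (%w. f (?A (cinv d w))) ?z0" by (rule sum_dm(2)[OF pre_fin[OF X] Inl])
  also have "... = deriv (%t. f (?A (cinv d (?z0(Inl () := t))))) 0" unfolding pd_def z00 ..
  also have "... = deriv (%t. f (act (cis t) y)) 0"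
  proof (rule deriv_cong_ev[OF _ refl])
   show "\<forall>\<^sub>F t in nhds 0. f (?A (cinv d (?z0(Inl () := t)))) = f (act (cis t) y)" using evpi by eventually_elim (use line pre_cinv[OF X d] in auto)
  qed
  finally show ?thesis .
 qed
 hence "generator P act y = v" using tangent_far[OF mP v(1)] by (auto simp: generator_def fun_eq_iff)
 thus gt: "generator P act y:Tan P y" using v(1) by simp
 assume i: "i:{1..m}"
 obtain U Ph where U: "openin (mtop (prod_fam {1..m} N)) U" "pr y:U"
  and Ph: "!!p. p:pts P ==> pr p:U ==> fst (Ph p) = pr p"
  "!!p z. p:pts P ==> pr p:U ==> z:sphere 0 1 ==> Ph (act z p) = (pr p, z * snd (Ph p))" by (rule trivialization[OF y]) blast
 let ?S = "{p:pts P. pr p:U}"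
 have "openin (mtop ?X) {z:pts ?X. ?A z:?S}" using openin_continuous_map_preimage[OF _ preU_open[OF U(1)], of "mtop ?X" ?A] sm pre_topspace[OF X]
  unfolding smooth_map_def by auto
 hence O: "opn (idx ?X) (snd d ` ({z:pts ?X. ?A z:?S} Int fst d))" using d unfolding pre_openin[OF X] by blast
 have z0: "?z0:snd d ` ({z:pts ?X. ?A z:?S} Int fst d)" using zd pre_chart(2)[OF X d] y U(2) act1 by (intro imageI) auto
 \<comment> \<open>For small \<open>t\<close> the point \<open>act (cis t) y\<close> stays over the
   trivialising set by continuity of the action; equivariance of \<open>Ph\<close> then shows that
   its projection is constant.\<close>
 have evS: "\<forall>\<^sub>F t in nhds 0. act (cis t) y:?S" using eventually_line[OF O Inl z0] evpi unfolding z00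
 proof eventually_elim
  case (elim t)
  then obtain z where z: "z:fst d" "?A z:?S" "snd d (cis t, y) = snd d z" using line by auto
  hence "z = (cis t, y)" using line(2)[of t] elim pre_chart(1)[OF X d] by (auto dest: inj_onD)
  thus ?case using z by auto
 qed
 have evpr: "\<forall>\<^sub>F t in nhds 0. pr (act (cis t) y) = pr y" using evS
 proof eventually_elim
  case (elim t)
  have "Ph (act (cis t) y) = (pr y, cis t * snd (Ph y))" using Ph(2)[OF y U(2), of "cis t"] by simp
  thus ?case using Ph(1)[of "act (cis t) y"] elim by simp
 qed
 show "push (N i) (%y. pr y i) y (generator P act y) = (%_. 0)"
 proof
  fix f
  have "deriv (%t. f (pr (act (cis t) y) i)) 0 = deriv (%t. f (pr y i)) 0" by (rule deriv_cong_ev[OF _ refl]) (use evpr in eventually_elim, simp)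
  thus "push (N i) (%y. pr y i) y (generator P act y) f = 0" by (simp add: push_def generator_def)
 qed
qed

text \<open>The generator has connection value \<open>1\<close> and projection \<open>0\<close>, so
  adding the multiple \<open>tu - \<theta> ?y u\<close> of it sets the vertical component and leaves
  the others alone. The independence of the coframe and the explicit form of the new
  \<open>J\<close> rest on this.\<close>

lemma surj:
 assumes p: "p:W" and w: "!!i. i:{1..m} ==> w i:Tan (N i) (pr (q p) i)" shows "EX v:Tan M p. v x = xx & vert p v = tu & (ALL i:{1..m}. base i p v = w i)"
proof -
 let ?y = "q p"
 have y: "?y:pts P" by (rule qP[OF p])
 obtain u where u: "u:Tan P ?y" "!!i. i:{1..m} ==> push (N i) (%y. pr y i) ?y u = w i" using horizontal_lift[OF y w] by blast
 have g: "\<theta> ?y (generator P act ?y) = 1" using connection y unfolding connection_form_def by blast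
 define u' where "u' = lincomb 1 u (tu - \<theta> ?y u) (generator P act ?y)"
 have u': "u':Tan P ?y" unfolding u'_def by (rule tangent_lincomb[OF mP y u(1) generator_facts(1)[OF y]])
 have "\<theta> ?y u' = tu" unfolding u'_def using tlinD[OF tlin_\<theta>[OF y] u(1) generator_facts(1)[OF y]] g by simp
 moreover have "push (N i) (%y. pr y i) ?y u' = w i" if "i:{1..m}" for i
  unfolding u'_def push_lincomb using u(2)[OF that] generator_facts(2)[OF y that] by (simp add: lincomb_def)
 moreover obtain v where "v:Tan M p" "v x = xx" "push P q p v = u'" using principal_lift[OF p u'] by blast
 ultimately show ?thesis using base_push[OF p] by (auto simp: vert_def)
qed

end

section \<open>Bilinear forms and Kaehler structures in charts\<close>

definition tbil :: "('p, 'k) mfd=>'p=>('p tv=>'p tv=>real)=>bool" where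
 "tbil M p B = ((ALL u:Tan M p. tlin M p (B u) & tlin M p (%w. B w u)))"

lemma tbil_expand:
 assumes M: "manifold M" and c: "c:atlas M" "p:fst c" and B: "tbil M p B"
 shows "B (tvec M c p xx) (tvec M c p et) = (SUM k:idx M. SUM l:idx M. xx k*et l*B (cvec M c p k) (cvec M c p l))" (is "?L = _")
proof -
 have t: "tlin M p (B u)" "tlin M p (%w. B w u)" if "u:Tan M p" for u using B that unfolding tbil_def by auto
 have "?L = (SUM k:idx M. xx k*B (cvec M c p k) (tvec M c p et))" by (rule tlin_expand[OF M c t(2)[OF tvec_tangent[OF M c]]])
 also have "... = (SUM k:idx M. xx k*(SUM l:idx M. et l*B (cvec M c p k) (cvec M c p l)))"
  by (intro sum.cong refl arg_cong2[where f = "(*)"] tlin_expand[OF M c] t(1) cvec_tangent[OF M c])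
 finally show ?thesis by (simp add: sdl mult.assoc)
qed

lemma riemannian_tbil: "riemannian M g ==> p:pts M ==> manifold M ==> tbil M p (g p)"
proof -
 assume a: "riemannian M g" "p:pts M" "manifold M"
 have s: "g p u v = g p v u" and l: "w:Tan M p ==> g p (lincomb r u s w) v = r*g p u v + s*g p w v" if "u:Tan M p" "v:Tan M p" for u v w r s
  using a that unfolding riemannian_def by blast+
 have "g p u (lincomb r v s w) = r*g p u v + s*g p u w" if "u:Tan M p" "v:Tan M p" "w:Tan M p" for u v w r s
  using s[OF that(1) tangent_lincomb[OF a(3,2) that(2,3), of r s]] l[OF that(2,1,3), of r s] s[OF that(1,2)] s[OF that(1,3)] by simp
 thus ?thesis unfolding tbil_def tlin_def using l by blast
qed

lemma endo_kform_tbil: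
 assumes g: "tbil M p (g p)"
  and J: "!!u. u:Tan M p ==> J p u:Tan M p"
  "!!u w r s. u:Tan M p ==> w:Tan M p ==> J p (lincomb r u s w) = lincomb r (J p u) s (J p w)" shows "tbil M p (kform g J p)"
 using assms unfolding tbil_def tlin_def kform_def by auto

lemma kaehler_facts:
 assumes k: "kaehler M g J" and M: "manifold M" and p: "p:pts M" shows "tbil M p (g p)" "tbil M p (kform g J p)" (is ?A)
  "u:Tan M p ==> J p u:Tan M p" (is "PROP ?B") "u:Tan M p ==> J p (J p u) = (%f. - u f)" (is "PROP ?C")
  "u:Tan M p ==> w:Tan M p ==> J p (lincomb r u s w) = lincomb r (J p u) s (J p w)" (is "PROP ?D")
  "u:Tan M p ==> w:Tan M p ==> g p u w = g p w u" (is "PROP ?E")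
  "u:Tan M p ==> u ~= (%_. 0) ==> g p u u > 0" (is "PROP ?G")
  "u:Tan M p ==> w:Tan M p ==> g p (J p u) (J p w) = g p u w" (is "PROP ?H")
proof -
 have r: "riemannian M g" and a: "almost_complex M J" using k unfolding kaehler_def complex_structure_def by auto
 show g: "tbil M p (g p)" by (rule riemannian_tbil[OF r p M])
 have aa: "u:Tan M p ==> J p u:Tan M p" "u:Tan M p ==> J p (J p u) = (%f. - u f)"
  "u:Tan M p ==> w:Tan M p ==> J p (lincomb r u s w) = lincomb r (J p u) s (J p w)" for u w r s using a p unfolding almost_complex_def by blast+
 show ?A using endo_kform_tbil[where J = J and g = g, OF g] aa(1,3) by blast
 show "PROP ?B" "PROP ?C"
  "PROP ?D" by (rule aa; assumption)+
 show "PROP ?E"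
  "PROP ?G"
  "PROP ?H" using r k p unfolding riemannian_def kaehler_def by blast+
qed

text \<open>
  A chart of \<open>M\<close> over which the projections to the factors are in the domains of charts \<open>e i\<close>;
  \<open>F i k\<close> are the coordinates of the projections, \<open>tu a\<close> the components of the connection form.
\<close>

locale orbit_chart = construction_two +
 fixes c :: "('e, 'f) chart" and e :: "nat=>('a, 'b) chart" and S :: "('f=>real) set"
  and F :: "nat=>'b=>('f=>real)=>real" and tu X :: "'f=>('f=>real)=>real"
 defines "F == %i k v. snd (e i) (pr (q (cinv c v)) i) k"
  and "tu == %a v. vert (cinv c v) (cvec M c (cinv c v) a)"
  and "X == %a v. pd a (%v. x (cinv c v)) v"
 assumes c: "c:atlas M" and S: "opn (idx M) S" "S <= snd c ` (W Int fst c)"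
  and e: "!!i. i:{1..m} ==> e i:atlas (N i)" "!!v i. v:S ==> i:{1..m} ==> pr (q (cinv c v)) i:fst (e i)"
  and smF: "!!i k. i:{1..m} ==> k:idx (N i) ==> smo M S (F i k)"
  and smtu: "!!a. a:idx M ==> smo M S (tu a)"
  and dtu: "!!v a a'. v:S ==> a:idx M ==> a':idx M ==> pd a (tu a') v - pd a' (tu a) v =
   (SUM i=1..m. b i*kform (gN i) (JN i) (pr (q (cinv c v)) i)
    (base i (cinv c v) (cvec M c (cinv c v) a)) (base i (cinv c v) (cvec M c (cinv c v) a')))"

context construction_two begin

text \<open>The domains of finitely many chart representatives are intersected. The equation for
  \<open>tu\<close> is the curvature assumption on \<open>P\<close>, pulled back along
  \<open>q\<close> by \<open>pullback_form\<close>.\<close>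

lemma orbit_chart_exists:
 assumes p: "p:W" and c: "c:atlas M" "p:fst c"
 obtains e S where "snd c p:S" "orbit_chart m N gN JN b P act pr \<theta> M x q c e S"
proof -
 have "ALL i:{1..m}. EX d. d:atlas (N i) & pr (q p) i:fst d"
 proof
  fix i assume i: "i:{1..m}"
  have "pr (q p) i:pts (N i)" using prq_lsm[OF p i] unfolding lsm_def by blast
  thus "EX e. e:atlas (N i) & pr (q p) i:fst e" using mfd_cover[OF mN[OF i]] by blast
 qed
 then obtain e where e: "!!i. i:{1..m} ==> e i:atlas (N i)" "!!i. i:{1..m} ==> pr (q p) i:fst (e i)" by metis
 have "EX T. opn (idx M) T & snd c p:T & T <= img c & (ALL v:T. pr (q (cinv c v)) i:fst (e i)) &
   (ALL k:idx (N i). smo M T (%v. snd (e i) (pr (q (cinv c v)) i) k))" if i: "i:{1..m}" for i by (rule lsmE[OF prq_lsm[OF p i] c e(1)[OF i] e(2)[OF i]]) blast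
 then obtain T where T: "!!i. i:{1..m} ==> opn (idx M) (T i)" "!!i. i:{1..m} ==> snd c p:T i"
  "!!i v. i:{1..m} ==> v:T i ==> pr (q (cinv c v)) i:fst (e i)"
  "!!i k. i:{1..m} ==> k:idx (N i) ==> smo M (T i) (%v. snd (e i) (pr (q (cinv c v)) i) k)" by metis
 obtain c' where c': "c':atlas P" "q p:fst c'" using mfd_cover[OF mP qP[OF p]] by blast
 obtain U where U: "opn (idx M) U" "snd c p:U" "U <= img c"
  "!!v. v:U ==> q (cinv c v):fst c'"
  "!!a. a:idx M ==> smo M U (%v. SUM l:idx P. fcomp P c' \<theta> l (rep c q c' v)*pd a (%v. rep c q c' v l) v)"
  "!!a b v. a:idx M ==> b:idx M ==> v:U ==>
   pd a (%v. SUM l:idx P. fcomp P c' \<theta> l (rep c q c' v)*pd b (%v. rep c q c' v l) v) v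
   - pd b (%v. SUM l:idx P. fcomp P c' \<theta> l (rep c q c' v)*pd a (%v. rep c q c' v l) v) v
   = (SUM k:idx P. SUM l:idx P. (pd k (fcomp P c' \<theta> l) (rep c q c' v) - pd l (fcomp P c' \<theta> k) (rep c q c' v))
      * pd a (%v. rep c q c' v k) v * pd b (%v. rep c q c' v l) v)" by (rule pullback_form[OF mM mP q_lsm[OF p] c c' one_form_\<theta>]) blast
 define S where "S = U Int snd c ` (W Int fst c) Int (INT i:{1..m}. T i)"
 have W': "opn (idx M) (snd c ` (W Int fst c))" using W_open c(1) unfolding mfd_openin[OF mM] by blast
 have T': "opn (idx M) (INT i:{1..m}. T i)" by (rule openin_INT2) (use T(1) m_pos in auto)
 have S: "opn (idx M) S" unfolding S_def by (intro openin_Int U(1) W' T')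
 have pS: "snd c p:S" using U(2) p c(2) T(2) unfolding S_def by blast
 have SU: "S <= U" "S <= snd c ` (W Int fst c)" "!!i. i:{1..m} ==> S <= T i" unfolding S_def by auto
 let ?tu = "%a v. vert (cinv c v) (cvec M c (cinv c v) a)"
 let ?t = "%a v. SUM l:idx P. fcomp P c' \<theta> l (rep c q c' v)*pd a (%v. rep c q c' v l) v"
 have vS: "cinv c v:W & cinv c v:fst c & snd c (cinv c v) = v & q (cinv c v):fst c'" if "v:S" for v
 proof -
  obtain r where r: "r:W" "r:fst c" "v = snd c r" using SU(2) \<open>v:S\<close> by blast
  moreover have "q (cinv c v):fst c'" using U(4) SU(1) \<open>v:S\<close> by blast
  ultimately show ?thesis using cinv_chart[OF mM c(1) r(2)] by simp
 qed
 have pc: "push P q (cinv c v) (cvec M c (cinv c v) a) = tvec P c' (q (cinv c v)) (%j. pd a (%v. rep c q c' v j) v)" if "v:S" "a:idx M" for v a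
  using push_cvec[OF mM mP q_lsm c(1) _ c'(1) _ that(2), of "cinv c v"] vS[OF that(1)] by simp
 have tut: "?tu a v = ?t a v" if "v:S" "a:idx M" for a v
 proof -
  let ?y = "q (cinv c v)"
  have y: "?y:fst c'" using vS[OF that(1)] by blast
  have "vert (cinv c v) (cvec M c (cinv c v) a) = (SUM l:idx P. pd a (%v. rep c q c' v l) v * \<theta> ?y (cvec P c' ?y l))"
   unfolding vert_def pc[OF that] using vS[OF that(1)] by (intro tlin_expand[OF mP c'(1) y] tlin_\<theta> qP) blast
  also have "... = ?t a v" by (simp add: fcomp_def cinv_chart[OF mP c'(1) y] mult.commute)
  finally show ?thesis .
 qed
 have oc: "orbit_chart m N gN JN b P act pr \<theta> M x q c e S"
 proof unfold_locales
  show "c:atlas M" by fact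
  show "opn (idx M) S" by fact
  show "S <= snd c ` (W Int fst c)" by fact
  show "e i:atlas (N i)" if "i:{1..m}" for i using e(1) that .
  show "pr (q (cinv c v)) i:fst (e i)" if "v:S" "i:{1..m}" for v i using T(3) SU(3) that by blast
  show "smo M S (%v. snd (e i) (pr (q (cinv c v)) i) k)" if "i:{1..m}" "k:idx (N i)" for i k by (rule smooth_subset[OF T(1)[OF that(1)] T(4)[OF that] SU(3)[OF that(1)]])
  show "smo M S (?tu a)" if "a:idx M" for a by (rule smooth_cong[OF S tut[OF _ that, symmetric] smooth_subset[OF U(1) U(5)[OF that] SU(1)]])
  fix v a a' assume v: "v:S" and a: "a:idx M" "a':idx M"
  let ?p = "cinv c v" and ?y = "q (cinv c v)"
  note vS' = vS[OF v]
  have y: "?y:fst c'" "?y:pts P" using vS' qP by blast+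
  let ?w = "%y u v. SUM i=1..m. b i*kform (gN i) (JN i) (pr y i) (push (N i) (%p. pr p i) y u) (push (N i) (%p. pr p i) y v)"
  have tb: "tbil P ?y (?w ?y)"
  proof -
   have "tbil P ?y (%u v. kform (gN i) (JN i) (pr ?y i) (push (N i) (%p. pr p i) ?y u) (push (N i) (%p. pr p i) ?y v))" if i: "i:{1..m}" for i
   proof -
    have l: "lsm P (N i) (%y. pr y i) ?y" by (rule pr_lsm[OF y(2) i])
    hence "pr ?y i:pts (N i)" unfolding lsm_def by blast
    hence "tbil (N i) (pr ?y i) (kform (gN i) (JN i) (pr ?y i))" using kaehler_facts(2)[OF _ mN[OF i]] factors[OF i] by blast
    thus ?thesis using push_tangent[OF mP mN[OF i] l] unfolding tbil_def tlin_def by (auto simp: push_lincomb)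
   qed
   thus ?thesis unfolding tbil_def tlin_def by (auto simp: sdl sum.distrib[symmetric] alg intro!: sum.cong)
  qed
  have "pd a (?tu a') v - pd a' (?tu a) v = pd a (?t a') v - pd a' (?t a) v"
   using pd_cong[OF S a(1) v, of "?tu a'" "?t a'"] pd_cong[OF S a(2) v, of "?tu a" "?t a"] tut a by simp
  also have "... = (SUM k:idx P. SUM l:idx P. gcomp P c' ?w k l (snd c' ?y)*pd a (%v. rep c q c' v k) v * pd a' (%v. rep c q c' v l) v)"
   unfolding U(6)[OF a subsetD[OF SU(1) v]] by (intro sum.cong refl arg_cong2[where f = "(*)"] curvature[unfolded ext_deriv_eq_def, rule_format, OF c'(1) y(1)])
  also have "... = (SUM k:idx P. SUM l:idx P. pd a (%v. rep c q c' v k) v * pd a' (%v. rep c q c' v l) v * ?w ?y (cvec P c' ?y k) (cvec P c' ?y l))"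
   by (simp add: gcomp_def cinv_chart[OF mP c'(1) y(1)] mult_ac)
  also have "... = ?w ?y (push P q ?p (cvec M c ?p a)) (push P q ?p (cvec M c ?p a'))"
   unfolding pc[OF v a(1)] pc[OF v a(2)] by (rule tbil_expand[OF mP c'(1) y(1) tb, symmetric])
  also have "... = (SUM i=1..m. b i*kform (gN i) (JN i) (pr ?y i) (base i ?p (cvec M c ?p a)) (base i ?p (cvec M c ?p a')))"
   using vS' by (intro scr) (simp add: base_push)
  finally show "pd a (?tu a') v - pd a' (?tu a) v = (SUM i=1..m. b i*kform (gN i) (JN i) (pr ?y i) (base i ?p (cvec M c ?p a)) (base i ?p (cvec M c ?p a')))" .
 qed
 show ?thesis by (rule that[OF pS oc])
qed

end

context orbit_chart begin

lemma S_facts: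
 assumes "v:S" shows "cinv c v:W" "cinv c v:fst c" "snd c (cinv c v) = v" (is ?A) "cinv c v:pts M" "v:img c"
proof -
 obtain r where r: "r:W" "r:fst c" "v = snd c r" using S(2) assms by blast
 thus "cinv c v:W" "cinv c v:fst c" ?A "cinv c v:pts M" "v:img c" using cinv_chart[OF mM c r(2)] W_pts by auto
qed

lemma tvec_x: "v:S ==> tvec M c (cinv c v) xx x = (SUM a:idx M. xx a*X a v)" using tvec_near[OF mM x_near[OF S_facts(4)]] S_facts(3) by (simp add: X_def)

lemma tvec_vert: "v:S ==> vert (cinv c v) (tvec M c (cinv c v) xx) = (SUM a:idx M. xx a*tu a v)"
 unfolding tu_def by (rule tlin_expand[OF mM c S_facts(2) vert_lin[OF S_facts(1)]])

lemma tvec_base: "v:S ==> i:{1..m} ==>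
 base i (cinv c v) (tvec M c (cinv c v) xx) = tvec (N i) (e i) (pr (q (cinv c v)) i) (%k. SUM a:idx M. xx a*pd a (F i k) v)"
proof -
 assume v: "v:S" and i: "i:{1..m}"
 note l = prq_lsm[OF S_facts(1)[OF v] i]
 have "tvec M c (cinv c v) xx (%p. snd (e i) (pr (q p) i) k) = (SUM a:idx M. xx a*pd a (F i k) v)" if "k:idx (N i)" for k
  using lsm_near[OF mM mN[OF i] l crd_near[OF mN[OF i] e(1)[OF i] e(2)[OF v i] that]] S_facts(3)[OF v] by (simp add: tvec_near[OF mM] o_def F_def)
 thus ?thesis unfolding base_def push_comp1[OF mM mN[OF i] l tvec_tangent[OF mM c S_facts(2)[OF v]] e(1)[OF i] e(2)[OF v i]] by (simp add: tvec_def cong: sum.cong)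
qed

lemma coframe_surj:
 assumes v: "v:S"
 obtains xx where "(SUM a:idx M. xx a*X a v) = s" "(SUM a:idx M. xx a*tu a v) = t"
  "!!i k. i:{1..m} ==> k:idx (N i) ==> (SUM a:idx M. xx a*pd a (F i k) v) = w i k"
proof -
 let ?p = "cinv c v"
 have w: "tvec (N i) (e i) (pr (q ?p) i) (w i):Tan (N i) (pr (q ?p) i)" if "i:{1..m}" for i by (rule tvec_tangent[OF mN[OF that] e(1)[OF that] e(2)[OF v that]])
 obtain u where u: "u:Tan M ?p" "u x = s" "vert ?p u = t" "!!i. i:{1..m} ==> base i ?p u = tvec (N i) (e i) (pr (q ?p) i) (w i)"
  using surj[OF S_facts(1)[OF v], of "%i. tvec (N i) (e i) (pr (q ?p) i) (w i)" s t] w by blast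
 define xx where "xx = (%k. u (%q. snd c q k))"
 have ut: "u = tvec M c ?p xx" unfolding xx_def by (rule tangent_eq_tvec[OF mM u(1) c S_facts(2)[OF v]])
 have "(SUM a:idx M. xx a*pd a (F i k) v) = w i k" if i: "i:{1..m}" and k: "k:idx (N i)" for i k
 proof -
  have "tvec (N i) (e i) (pr (q ?p) i) (%k. SUM a:idx M. xx a*pd a (F i k) v) = tvec (N i) (e i) (pr (q ?p) i) (w i)" using u(4)[OF i] tvec_base[OF v i, of xx] ut by simp
  from arg_cong[OF this, of "%u. u (%r. snd (e i) r k)"] show ?thesis by (simp only: tvec_crd[OF mN[OF i] e(1)[OF i] e(2)[OF v i] k])
 qed
 moreover have "(SUM a:idx M. xx a*X a v) = s" using u(2) tvec_x[OF v, of xx] ut by simp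
 moreover have "(SUM a:idx M. xx a*tu a v) = t" using u(3) tvec_vert[OF v, of xx] ut by simp
 ultimately show ?thesis using that[of xx] by blast
qed

end

lemma posdef_gcomp:
 assumes M: "manifold M" and g: "riemannian M g" and c: "c:atlas M" and v: "v:img c" shows "posdef (idx M) (%i j. gcomp M c g i j v)"
proof -
 let ?p = "cinv c v"
 have p: "?p:fst c" "?p:pts M" using chart_cinv(2)[OF M v] mfd_chart(2)[OF M c] by auto
 have sy: "g ?p u w = g ?p w u" and ps: "u ~= (%_. 0) ==> g ?p u u > 0" if "u:Tan M ?p" "w:Tan M ?p" for u w using g p(2) that unfolding riemannian_def by blast+
 have "(SUM i:idx M. SUM j:idx M. gcomp M c g i j v * u i*u j) > 0" if u: "EX i:idx M. u i ~= 0" for u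
 proof -
  have "tvec M c ?p u ~= (%_. 0)" using u tvec_crd[OF M c p(1)] by metis
  hence "g ?p (tvec M c ?p u) (tvec M c ?p u) > 0" using ps tvec_tangent[OF M c p(1)] by blast
  also have "g ?p (tvec M c ?p u) (tvec M c ?p u) = (SUM i:idx M. SUM j:idx M. gcomp M c g i j v * u i*u j)"
   unfolding tbil_expand[OF M c p(1) riemannian_tbil[OF g p(2) M]] gcomp_def by (simp add: mult_ac)
  finally show ?thesis .
 qed
 thus ?thesis unfolding posdef_def gcomp_def using sy cvec_tangent[OF M c p(1)] by blast
qed

lemma local_metric_gcomp:
 assumes M: "manifold M" and g: "riemannian M g" and c: "c:atlas M" shows "local_metric (idx M) (img c) (gcomp M c g)"
 by unfold_locales (use mfd_fin[OF M] mfd_chart(3)[OF M c] posdef_gcomp[OF assms] g c in \<open>auto simp: riemannian_def simp del: image_iff\<close>)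

lemma endo_cvec:
 assumes M: "manifold M" and c: "c:atlas M" "p:fst c" and J: "!!u. u:Tan M p ==> J p u:Tan M p" and k: "k:idx M"
 shows "J p (cvec M c p k) = tvec M c p (%m. jcomp M c J m k (snd c p))"
 using tangent_eq_tvec[OF M J[OF cvec_tangent[OF M c k]] c] unfolding jcomp_def cinv_chart[OF M c] .

lemma kaehler_comp:
 assumes M: "manifold M" and K: "kaehler M g J" and c: "c:atlas M" "p:fst c" and k: "k:idx M" "l:idx M"
 shows "kform g J p (cvec M c p k) (cvec M c p l) = (SUM m:idx M. jcomp M c J m k (snd c p)*gcomp M c g m l (snd c p))" (is ?A)
  "(SUM m:idx M. jcomp M c J m k (snd c p)*gcomp M c g m l (snd c p)) = - (SUM m:idx M. jcomp M c J m l (snd c p)*gcomp M c g m k (snd c p))" (is ?B)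
  "(SUM m:idx M. jcomp M c J k m (snd c p)*jcomp M c J m l (snd c p)) = (if k = l then - 1 else 0)" (is ?C)
proof -
 have p: "p:pts M" using c mfd_chart(2)[OF M] by blast
 note f = kaehler_facts[OF K M p]
 note t = cvec_tangent[OF M c]
 have kf: "kform g J p (cvec M c p k) (cvec M c p l) = (SUM m:idx M. jcomp M c J m k (snd c p)*gcomp M c g m l (snd c p))" if "k:idx M" "l:idx M" for k l
 proof -
  have "g p (J p (cvec M c p k)) (cvec M c p l) = (SUM m:idx M. jcomp M c J m k (snd c p)*g p (cvec M c p m) (cvec M c p l))"
  proof -
   have tl: "tlin M p (%u. g p u (cvec M c p l))" using f(1) t[OF that(2)] unfolding tbil_def by blast
   show ?thesis using tlin_expand[OF M c tl, of "%m. jcomp M c J m k (snd c p)"] endo_cvec[where J = J, OF M c f(3) that(1)] by simp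
  qed
  thus ?thesis by (simp add: kform_def gcomp_def cinv_chart[OF M c])
 qed
 show ?A by (rule kf[OF k])
 have neg: "g p (%f. - u f) w = - g p u w" if "u:Tan M p" "w:Tan M p" for u w
 proof -
  have "(%f. - u f) = lincomb (-1) u 0 u" by (simp add: lincomb_def)
  thus ?thesis using f(1) that unfolding tbil_def tlin_def by simp
 qed
 have "kform g J p u w = - kform g J p w u" if u: "u:Tan M p" "w:Tan M p" for u w
  unfolding kform_def using f(8)[OF f(3)[OF u(1)] u(2)] f(4)[OF u(1)] neg[OF u(1) f(3)[OF u(2)]] f(6)[OF u(1) f(3)[OF u(2)]] by simp
 from this[OF t[OF k(1)] t[OF k(2)]]
 show ?B
  unfolding kf[OF k] kf[OF k(2,1)] .
 have tl: "tlin M p (%u. J p u (%q. snd c q k))" unfolding tlin_def by (auto simp: f(5)) (simp add: lincomb_def)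
 have "J p (J p (cvec M c p l)) (%q. snd c q k) = (SUM m:idx M. jcomp M c J m l (snd c p)*J p (cvec M c p m) (%q. snd c q k))"
  using tlin_expand[OF M c tl, of "%m. jcomp M c J m l (snd c p)"] endo_cvec[where J = J, OF M c f(3) k(2)] by simp
 hence "(SUM m:idx M. jcomp M c J k m (snd c p)*jcomp M c J m l (snd c p)) = J p (J p (cvec M c p l)) (%q. snd c q k)"
  by (simp add: jcomp_def cinv_chart[OF M c] mult.commute)
 also have "... = - cvec M c p l (%q. snd c q k)" using f(4)[OF t[OF k(2)]] by simp
 also have "... = (if k = l then - 1 else 0)" using tvec_crd[OF M c k(1)] by (simp add: cvec_tvec[OF M k(2)])
 finally show ?C .
qed

lemma pd_comp_fun:
 assumes S: "opn I S" and f: "smooth_on I S f" and k: "k:I" and v: "v:S" and D: "DERIV fi (f v) :> D" shows "pd k (%v. fi (f v)) v = D*pd k f v"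
proof (rule pd_eqI)
 show "DERIV (%t. fi (f (v(k := t)))) (v k) :> D*pd k f v" by (rule DERIV_chain2[where f = fi, OF _ has_pd[OF S f k v]]) (simp add: D)
qed

lemma sum_Sigma_block:
 assumes "finite I" "!!i. i:I ==> finite (B i)" "i:I" shows "(SUM n:Sigma I B. if i = fst n then f (snd n) else 0) = (SUM k:B i. f k :: real)" (is "?L = _")
proof -
 have "?L = (SUM j:I. SUM k:B j. if i = j then f k else 0)" using assms by (subst sum.Sigma) (auto intro!: sum.cong)
 also have "... = (SUM j:I. if i = j then (SUM k:B i. f k) else 0)" by (intro sum.cong) auto
 also have "... = (SUM k:B i. f k)" using assms by simp
 finally show ?thesis .
qed

locale orbit_metric = orbit_chart +
 fixes h :: "real=>real" and a :: "nat=>real" and g :: "'e metric" and J :: "'e endo" and D :: "nat=>real=>real"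
 assumes rg: "riemannian M g" and pf: "profile m b h a"
  and mf: "mform h a g J"
  and D: "!!t. t:{0..1} ==> D 0 t = h t" "!!k t. t:{0..1} ==> der01 (D k) (D (Suc k) t) t"
begin

abbreviation "cG i == gcomp (N i) (e i) (gN i)"
abbreviation "cH i == ginv (N i) (e i) (gN i)"
abbreviation "cJ i == jcomp (N i) (e i) (JN i)"
abbreviation "cC i == christoffel (N i) (e i) (gN i)"
abbreviation "cV i == snd (e i) ` fst (e i)"
abbreviation "yN i v == pr (q (cinv c v)) i"
abbreviation "tvN i v == tvec (N i) (e i) (yN i v)"
abbreviation "kfN i v == kform (gN i) (JN i) (yN i v)"

lemma gW: "p:W ==> u:Tan M p ==> w:Tan M p ==>
 g p u w = gf h a p u w" using mf unfolding metric_form_def Let_def vert_def base_def W_def by blast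

definition K where "K = Sigma {1..m} (%i. idx (N i))"
definition FF where "FF i v = snd (e i) (yN i v)"
definition cof where "cof B i v = (case B of Inl False=>X i v | Inl True=>tu i v | Inr k=>pd i (F (fst k) (snd k)) v)"
definition gam where "gam k l v = (if fst k = fst l then cG (fst k) (snd k) (snd l) (FF (fst k) v) else 0)"
definition gai where "gai k l v = (if fst k = fst l then cH (fst k) (snd k) (snd l) (FF (fst k) v) else 0)"
definition JJ where "JJ k l v = (if fst k = fst l then cJ (fst k) (snd k) (snd l) (FF (fst k) v) else 0)"
definition Ga where "Ga n k l v = (if fst n = fst k & fst n = fst l then cC (fst n) (snd n) (snd k) (snd l) (FF (fst n) v) else 0)"
definition Aa where "Aa k v = b (fst k)*x (cinv c v) + a (fst k)"
definition hD where "hD k v = D k (x (cinv c v))"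
definition Gs where "Gs B C v = (case (B, C) of (Inl False, Inl False)=>1/hD 0 v | (Inl True, Inl True)=>hD 0 v
 | (Inr k, Inr l)=>Aa k v * gam k l v | _=>0)"
text \<open>The dual frame without inverting the coframe: pairing \<open>E B\<close> with the metric
  must give the covector sum of \<open>Gs B C * cof C\<close>, so this covector is raised with the
  inverse metric, which is smooth by \<open>cramer\<close>.\<close>

definition E where "E B i v = (SUM C:bK K. Gs B C v * (SUM j:idx M. ginv M c g i j v * cof C j v))"

lemma finK: "finite K" unfolding K_def using mfd_fin[OF mN] by (auto intro: finite_SigmaI)

lemma KD: "k:K ==> fst k:{1..m}" "k:K ==> snd k:idx (N (fst k))" unfolding K_def by auto

lemma sum_block:
 assumes "i:{1..m}" "!!n. n:K ==> f n = (if i = fst n then f' (snd n) else 0)" shows "(SUM n:K. f n) = (SUM k:idx (N i). f' k :: real)"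
proof -
 have "(SUM n:K. f n) = (SUM n:K. if i = fst n then f' (snd n) else 0)" using assms(2) by (rule scr)
 also have "... = (SUM k:idx (N i). f' k)" unfolding K_def by (rule sum_Sigma_block[OF finite_atLeastAtMost mfd_fin[OF mN] assms(1)])
 finally show ?thesis .
qed

lemma finM: "finite (idx M)" by (rule mfd_fin[OF mM])

lemma kN: "i:{1..m} ==> kaehler (N i) (gN i) (JN i)" using factors by blast

lemma rN: "i:{1..m} ==> riemannian (N i) (gN i)" using kN unfolding kaehler_def by blast

lemma lmN: "i:{1..m} ==> local_metric (idx (N i)) (cV i) (cG i)" by (rule local_metric_gcomp[OF mN rN e(1)])

lemma x01: "v:S ==> 0 < x (cinv c v)" "v:S ==> x (cinv c v) < 1" "v:S ==> x (cinv c v):{0..1}" using S_facts(1) unfolding W_def by force+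

lemma hD0: "v:S ==> hD 0 v = h (x (cinv c v))" "v:S ==> hD 0 v > 0" using x01[of v] D(1) pf unfolding hD_def profile_def by auto

lemma Aa_pos: "v:S ==> k:K ==> Aa k v > 0"
proof -
 assume v: "v:S" and k: "k:K"
 show "Aa k v > 0"
 proof (cases "fst k = 1")
  case True
  thus ?thesis using b_first pf x01[OF v] by (simp add: Aa_def profile_def)
 next
  case False
  hence "fst k:{2..m}" using KD(1)[OF k] by auto
  thus ?thesis using pf x01(3)[OF v] unfolding profile_def Aa_def by blast
 qed
qed

lemma sm_x: "smo M S (%v. x (cinv c v))" by (rule smooth_subset[OF mfd_chart(3)[OF mM c] x_smooth[OF c]]) (use S_facts(5) in blast)

lemma sm_X: "i:idx M ==> smo M S (X i)" unfolding X_def using smooth_on_pd[OF sm_x] by simp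

lemma sm_hD: "smo M S (hD k)"
proof -
 have "smo M S (%v. (%n. D (n + k)) 0 (x (cinv c v)))" by (rule smooth_comp1[OF S(1) sm_x, where R = "{0..1}"]) (use x01 D(2) in auto)
 thus ?thesis by (simp add: hD_def[abs_def])
qed

lemma pd_hD: "i:idx M ==> v:S ==> pd i (hD k) v = hD (Suc k) v * X i v"
proof -
 assume i: "i:idx M" and v: "v:S"
 have "DERIV (D k) (x (cinv c v)) :> D (Suc k) (x (cinv c v))" using D(2)[OF x01(3)[OF v], of k] x01[OF v] by (simp only: at_within_Icc_at)
 from pd_comp_fun[OF S(1) sm_x i v this] show ?thesis by (simp add: hD_def[abs_def] X_def)
qed

lemma FF_rn: "v:S ==> i:{1..m} ==> FF i v:cV i" unfolding FF_def using e(2) by blast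

lemma sm_FF: "i:{1..m} ==> smooth_on (idx (N i)) (cV i) f ==> smo M S (%v. f (FF i v))"
proof -
 assume a: "i:{1..m}" "smooth_on (idx (N i)) (cV i) f"
 have "smo M S (%v. FF i v k)" if "k:idx (N i)" for k using smF[OF a(1) that] by (simp add: F_def FF_def)
 from smooth_comp[OF S(1) mfd_fin[OF mN[OF a(1)]] mfd_chart(3)[OF mN[OF a(1)] e(1)[OF a(1)]] FF_rn[OF _ a(1)] this a(2)]
 show ?thesis .
qed

lemma pd_FF: "i:{1..m} ==> smooth_on (idx (N i)) (cV i) f ==> i':idx M ==> v:S ==>
  pd i' (%v. f (FF i v)) v = (SUM k:idx (N i). pd k f (FF i v)*pd i' (F i k) v)"
proof -
 assume a: "i:{1..m}" "smooth_on (idx (N i)) (cV i) f" "i':idx M" "v:S"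
 have "smo M S (%v. FF i v k)" if "k:idx (N i)" for k using smF[OF a(1) that] by (simp add: F_def FF_def)
 from pd_comp[OF S(1) mfd_fin[OF mN[OF a(1)]] mfd_chart(3)[OF mN[OF a(1)] e(1)[OF a(1)]] FF_rn[OF _ a(1)] this a(2,3,4)]
 show ?thesis by (simp add: F_def FF_def)
qed

lemma G_cof:
 assumes v: "v:S" and i: "i:idx M" "j:idx M" shows "gcomp M c g i j v = (SUM B:bK K. SUM C:bK K. Gs B C v * cof B i v * cof C j v)"
proof -
 let ?p = "cinv c v"
 note p = S_facts[OF v]
 have ct: "cvec M c ?p a = tvec M c ?p (%j. if j = a then 1 else 0)" if "a:idx M" for a by (rule cvec_tvec[OF mM that])
 have bs: "base n ?p (cvec M c ?p a) = tvec (N n) (e n) (pr (q ?p) n) (%k. pd a (F n k) v)" if "a:idx M" "n:{1..m}" for a n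
  unfolding ct[OF that(1)] tvec_base[OF v that(2)] sum_dm(2)[OF finM that(1)] ..
 have xs: "cvec M c ?p a x = X a v" if "a:idx M" for a unfolding ct[OF that] tvec_x[OF v] sum_dm(2)[OF finM that] ..
 have blk: "gN n (pr (q ?p) n) (base n ?p (cvec M c ?p i)) (base n ?p (cvec M c ?p j))
   = (SUM k:idx (N n). SUM l:idx (N n). cG n k l (FF n v)*pd i (F n k) v * pd j (F n l) v)" if n: "n:{1..m}" for n
 proof -
  have y: "pr (q ?p) n:fst (e n)" "pr (q ?p) n:pts (N n)" using e(2)[OF v n] mfd_chart(2)[OF mN[OF n] e(1)[OF n]] by auto
  show ?thesis unfolding bs[OF i(1) n] bs[OF i(2) n] tbil_expand[OF mN[OF n] e(1)[OF n] y(1) riemannian_tbil[OF rN[OF n] y(2) mN[OF n]]] gcomp_def FF_def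
    cinv_chart[OF mN[OF n] e(1)[OF n] y(1)] by (simp add: mult_ac)
 qed
 have KK: "(SUM k:K. SUM l:K. Aa k v * gam k l v * pd i (F (fst k) (snd k)) v * pd j (F (fst l) (snd l)) v)
  = (SUM n=1..m. (b n*x ?p + a n)*(SUM k:idx (N n). SUM l:idx (N n). cG n k l (FF n v)*pd i (F n k) v * pd j (F n l) v))"
 proof -
  have "(SUM l:K. Aa k v * gam k l v * pd i (F (fst k) (snd k)) v * pd j (F (fst l) (snd l)) v)
   = (SUM l:idx (N (fst k)). Aa k v * cG (fst k) (snd k) l (FF (fst k) v)*pd i (F (fst k) (snd k)) v * pd j (F (fst k) l) v)"
   if "k:K" for k by (rule sum_block[OF KD(1)[OF that]]) (simp add: gam_def)
  hence "(SUM k:K. SUM l:K. Aa k v * gam k l v * pd i (F (fst k) (snd k)) v * pd j (F (fst l) (snd l)) v)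
   = (SUM k:K. (%(n, k). SUM l:idx (N n). Aa (n, k) v * cG n k l (FF n v)*pd i (F n k) v * pd j (F n l) v) k)"
   by (intro scr) (auto simp: case_prod_beta)
  also have "... = (SUM n=1..m. SUM k:idx (N n). SUM l:idx (N n). Aa (n, k) v * cG n k l (FF n v)*pd i (F n k) v * pd j (F n l) v)"
   unfolding K_def by (rule sum.Sigma[symmetric]) (use mfd_fin[OF mN] in auto)
  finally show ?thesis by (simp add: Aa_def sdl mult_ac)
 qed
 have "gcomp M c g i j v = X i v * X j v/hD 0 v + hD 0 v * tu i v * tu j v + (SUM n=1..m. (b n*x ?p + a n)*gN n (pr (q ?p) n) (base n ?p (cvec M c ?p i)) (base n ?p (cvec M c ?p j)))"
  unfolding gcomp_def gW[OF p(1) cvec_tangent[OF mM c p(2) i(1)] cvec_tangent[OF mM c p(2) i(2)]] hD0(1)[OF v] tu_def xs[OF i(1)] xs[OF i(2)] ..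
 thus ?thesis unfolding sum_Plus_bool[OF finK] by (simp add: Gs_def cof_def KK blk sdl)
qed

lemma lmM: "local_metric (idx M) S (gcomp M c g)"
proof -
 interpret l: local_metric "idx M" "img c" "gcomp M c g" by (rule local_metric_gcomp[OF mM rg c])
 have "S <= img c" using S_facts(5) by blast
 thus ?thesis by unfold_locales (use finM S(1) l.pos l.S smooth_subset[OF l.S l.smG] in auto)
qed

lemma Gs_sym: "v:S ==> B:bK K ==> C:bK K ==> Gs B C v = Gs C B v"
proof -
 assume v: "v:S" and BC: "B:bK K" "C:bK K"
 have g: "gam k l v = gam l k v" "fst k = fst l ==> Aa k v = Aa l v" if "k:K" "l:K" for k l
  using local_metric.symG[OF lmN[OF KD(1)[OF that(1)]] FF_rn[OF v KD(1)[OF that(1)]]] KD(2)[OF that(1)] KD(2)[OF that(2)] by (auto simp: gam_def Aa_def)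
 have z: "gam k l v = 0" if "fst k ~= fst l" for k l using that by (simp add: gam_def)
 have "Aa k v * gam k l v = Aa l v * gam l k v" if "k:K" "l:K" for k l using g[OF that] z[of k l] by (cases "fst k = fst l") auto
 thus ?thesis using BC by (auto simp: Gs_def split: sum.splits bool.splits)
qed

lemma sm_gam: "k:K ==> l:K ==> smo M S (gam k l)"
 and sm_JJ: "k:K ==> l:K ==> smo M S (JJ k l)"
 and sm_Ga: "n:K ==> k:K ==> l:K ==> smo M S (Ga n k l)"
proof -
 have jc: "smooth_on (idx (N i)) (cV i) (cJ i k l)" if "i:{1..m}" "k:idx (N i)" "l:idx (N i)" for i k l
  using kN[OF that(1)] e(1)[OF that(1)] that unfolding kaehler_def complex_structure_def almost_complex_def by blast
 show "smo M S (gam k l)" if kl: "k:K" "l:K" for k l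
 proof (cases "fst k = fst l")
  case True
  hence "smo M S (%v. cG (fst k) (snd k) (snd l) (FF (fst k) v))"
   using KD(2)[OF kl(2)] by (intro sm_FF[OF KD(1)[OF kl(1)] local_metric.smG[OF lmN[OF KD(1)[OF kl(1)]] KD(2)[OF kl(1)]]]) simp
  thus ?thesis using True by (simp add: gam_def[abs_def])
 qed (simp add: gam_def[abs_def] smooth_const[OF S(1)])
 show "smo M S (JJ k l)" if kl: "k:K" "l:K" for k l
 proof (cases "fst k = fst l")
  case True
  hence "smo M S (%v. cJ (fst k) (snd k) (snd l) (FF (fst k) v))"
   using KD(2)[OF kl(2)] by (intro sm_FF[OF KD(1)[OF kl(1)] jc[OF KD(1)[OF kl(1)] KD(2)[OF kl(1)]]]) simp
  thus ?thesis using True by (simp add: JJ_def[abs_def])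
 qed (simp add: JJ_def[abs_def] smooth_const[OF S(1)])
 show "smo M S (Ga n k l)" if kl: "n:K" "k:K" "l:K" for n k l
 proof (cases "fst n = fst k & fst n = fst l")
  case True
  hence "smo M S (%v. cC (fst n) (snd n) (snd k) (snd l) (FF (fst n) v))"
   unfolding christoffel_eq using KD(2)[OF kl(2)] KD(2)[OF kl(3)]
   by (intro sm_FF[OF KD(1)[OF kl(1)] local_metric.smGam[OF lmN[OF KD(1)[OF kl(1)]] KD(2)[OF kl(1)]]]) metis+
  thus ?thesis using True by (simp add: Ga_def[abs_def])
 next
  case False
  hence "Ga n k l = (%_. 0)" by (auto simp: Ga_def fun_eq_iff)
  thus ?thesis by (simp add: smooth_const[OF S(1)])
 qed
qed

lemma sm_Aa: "smo M S (Aa k)" unfolding Aa_def[abs_def] by (intro smooth_add[OF S(1)] smooth_mult[OF S(1)] smooth_const[OF S(1)] sm_x)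

lemma sm_cof: "B:bK K ==> i:idx M ==> smo M S (cof B i)"
proof -
 assume B: "B:bK K" and i: "i:idx M"
 from B show ?thesis by (cases rule: casesA) (use sm_X smtu smooth_on_pd[OF smF[OF KD]] i in \<open>auto simp: cof_def[abs_def]\<close>)
qed

lemma sm_E: "B:bK K ==> i:idx M ==> smo M S (E B i)"
proof -
 assume B: "B:bK K" "i:idx M"
 have gi: "smo M S (ginv M c g i j)" if "j:idx M" for j using local_metric.Ginv(1)[OF lmM B(2) that] by (simp add: ginv_def[abs_def])
 have h: "smo M S (%v. 1/hD 0 v)" by (rule smooth_divide[OF S(1) smooth_const[OF S(1)] sm_hD]) (use hD0(2) in force)
 have "smo M S (Gs B C)" if "C:bK K" for C by (rule casesA[OF B(1)]; rule casesA[OF that])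
   (simp_all add: Gs_def[abs_def] h sm_hD smooth_const[OF S(1)] smooth_mult[OF S(1) sm_Aa sm_gam])
 thus ?thesis unfolding E_def[abs_def] using gi B by (intro smooth_sum[OF S(1)] smooth_mult[OF S(1)] sm_cof) auto
qed

text \<open>The sum is the inverse metric times the metric, the latter written in the coframe by
  \<open>G_cof\<close>.\<close>

lemma dual2: "v:S ==> i:idx M ==> j:idx M ==> (SUM B:bK K. E B i v * cof B j v) = (if i = j then 1 else 0)"
proof -
 assume v: "v:S" and i: "i:idx M" "j:idx M"
 let ?A = "bK K"
 have "(SUM B:?A. E B i v * cof B j v) = (SUM B:?A. SUM C:?A. SUM l:idx M. ginv M c g i l v * (Gs C B v * cof C l v * cof B j v))"
  unfolding E_def sdr sdl using Gs_sym[OF v] by (intro scr) (simp add: mult_ac)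
 also have "... = (SUM C:?A. SUM B:?A. SUM l:idx M. ginv M c g i l v * (Gs C B v * cof C l v * cof B j v))" by (rule sum.swap)
 also have "... = (SUM C:?A. SUM l:idx M. SUM B:?A. ginv M c g i l v * (Gs C B v * cof C l v * cof B j v))" by (intro sum.cong refl sum.swap)
 also have "... = (SUM l:idx M. SUM C:?A. SUM B:?A. ginv M c g i l v * (Gs C B v * cof C l v * cof B j v))" by (rule sum.swap)
 also have "... = (SUM l:idx M. ginv M c g i l v * gcomp M c g l j v)" using G_cof[OF v _ i(2)] by (intro scr) (simp add: sdl)
 also have "... = (if i = j then 1 else 0)" using local_metric.Ginv(4)[OF lmM i v] by (simp add: ginv_def)
 finally show ?thesis .
qed

text \<open>The covectors are linearly independent by \<open>coframe_surj\<close>, so the right inverse is a left inverse.\<close>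

lemma dual1: "v:S ==> B:bK K ==> C:bK K ==> (SUM i:idx M. cof B i v * E C i v) = (if B = C then 1 else 0)"
proof -
 assume v: "v:S" and BC: "B:bK K" "C:bK K"
 let ?d = "%B. if B = C then 1 else (0::real)"
 obtain xx where xx: "(SUM i:idx M. xx i*X i v) = ?d XF" "(SUM i:idx M. xx i*tu i v) = ?d XT"
  "!!n k. n:{1..m} ==> k:idx (N n) ==> (SUM i:idx M. xx i*pd i (F n k) v) = ?d (Inr (n, k))"
  by (rule coframe_surj[OF v, of "?d XF" "?d XT" "%n k. ?d (Inr (n, k))"]) blast
 have w: "(SUM i:idx M. cof B i v * xx i) = ?d B" if "B:bK K" for B
  by (rule casesA[OF that]) (use xx(1,2) xx(3)[OF KD] in \<open>simp_all add: cof_def mult.commute\<close>)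
 have "xx i = E C i v" if i: "i:idx M" for i
 proof -
  have "xx i = (SUM j:idx M. (SUM B:bK K. E B i v * cof B j v)*xx j)" using sum_dm(1)[OF finM i, of xx] dual2[OF v i] by simp
  also have "... = (SUM B:bK K. E B i v * (SUM j:idx M. cof B j v * xx j))" unfolding sdl sdr mult.assoc by (rule sum.swap)
  also have "... = (SUM B:bK K. E B i v * ?d B)" using w by simp
  also have "... = E C i v" using sum_dm(4)[of "bK K" C "%B. E B i v"] finK BC(2) by auto
  finally show ?thesis .
 qed
 thus ?thesis using w[OF BC(1)] by simp
qed

end

context orbit_metric begin

lemma frameM: "frame (idx M) S (gcomp M c g) (bK K) E cof"
proof -
 interpret l: local_metric "idx M" S "gcomp M c g" by (rule lmM)
 show ?thesis by unfold_locales (use finK sm_E sm_cof dual1 dual2 in auto)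
qed

sublocale fr: frame "idx M" S "gcomp M c g" "bK K" E cof by (rule frameM)

lemma gE_Gs:
 assumes v: "v:S" and BC: "B:bK K" "C:bK K" shows "fr.gE B C v = Gs B C v"
proof -
 let ?A = "bK K :: (bool + nat \<times> 'b) set"
 have fA: "finite ?A" by (rule finite_Plus[OF _ finK]) simp
 have "fr.gE B C v = (SUM i:idx M. SUM j:idx M. SUM B':?A. SUM C':?A. Gs B' C' v * (cof B' i v * E B i v)*(cof C' j v * E C j v))"
  unfolding fr.gE_def by (intro scr) (simp add: G_cof[OF v] sdl sdr mult_ac)
 also have "... = (SUM i:idx M. SUM B':?A. SUM C':?A. SUM j:idx M. Gs B' C' v * (cof B' i v * E B i v)*(cof C' j v * E C j v))"
  by (subst sum.swap, subst (2) sum.swap) (rule refl)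
 also have "... = (SUM i:idx M. SUM B':?A. SUM C':?A. Gs B' C' v * (cof B' i v * E B i v)*(if C' = C then 1 else 0))"
  using dual1[OF v _ BC(2)] by (intro scr) (simp flip: sdl)
 also have "... = (SUM i:idx M. SUM B':?A. Gs B' C v * (cof B' i v * E B i v))" by (intro sum.cong refl sum_dm(4)[OF fA BC(2)])
 also have "... = (SUM B':?A. Gs B' C v * (SUM i:idx M. cof B' i v * E B i v))" unfolding sdl by (rule sum.swap)
 also have "... = (SUM B':?A. Gs B' C v * (if B' = B then 1 else 0))" using dual1[OF v _ BC(1)] by (intro scr) simp
 also have "... = Gs B C v" by (rule sum_dm(4)[OF fA BC(1)])
 finally show ?thesis .
qed

lemma dE_hD: "v:S ==> B:bK K ==> fr.dE B (hD k) v = (if B = Inl False then hD (Suc k) v else 0)"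
proof -
 assume v: "v:S" and B: "B:bK K"
 have "fr.dE B (hD k) v = hD (Suc k) v * (SUM i:idx M. cof XF i v * E B i v)" unfolding fr.dE_def by (simp add: pd_hD[OF _ v] sdl cof_def mult_ac)
 thus ?thesis using dual1[OF v InlI[OF UNIV_I] B, of False] by auto
qed

lemma dE_Aa: "v:S ==> B:bK K ==> fr.dE B (Aa k) v = (if B = Inl False then b (fst k) else 0)"
proof -
 assume v: "v:S" and B: "B:bK K"
 have "pd i (Aa k) v = b (fst k)*X i v" if i: "i:idx M" for i
 proof -
  have "DERIV (%t. b (fst k)*t + a (fst k)) (x (cinv c v)) :> b (fst k)" by (auto intro!: derivative_eq_intros)
  from pd_comp_fun[OF S(1) sm_x i v this] show ?thesis by (simp add: Aa_def[abs_def] X_def)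
 qed
 hence "fr.dE B (Aa k) v = b (fst k)*(SUM i:idx M. cof XF i v * E B i v)" unfolding fr.dE_def by (simp add: sdl cof_def mult_ac)
 thus ?thesis using dual1[OF v InlI[OF UNIV_I] B, of False] by auto
qed

lemma F_E: "v:S ==> i:{1..m} ==> k:idx (N i) ==> B:bK K ==>
  (SUM j:idx M. pd j (F i k) v * E B j v) = (if B = Inr (i, k) then 1 else 0)"
proof -
 assume a: "v:S" "i:{1..m}" "k:idx (N i)" "B:bK K"
 have "(i, k):K" unfolding K_def using a by blast
 from dual1[OF a(1) InrI[OF this] a(4)] show ?thesis by (auto simp: cof_def)
qed

text \<open>Only the frame fields over factor \<open>i\<close> see a function pulled back from it;
  all others project to zero there.\<close>

lemma dE_FF:
 assumes v: "v:S" and i: "i:{1..m}" and f: "smooth_on (idx (N i)) (cV i) f" and B: "B:bK K"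
 shows "fr.dE B (%v. f (FF i v)) v = (case B of Inl c=>0 | Inr k=>if fst k = i then pd (snd k) f (FF i v) else 0)" (is "?L = _")
proof -
 have "?L = (SUM j:idx M. SUM k:idx (N i). pd k f (FF i v)*(pd j (F i k) v * E B j v))" unfolding fr.dE_def by (simp add: pd_FF[OF i f _ v] sdl mult_ac)
 also have "... = (SUM k:idx (N i). pd k f (FF i v)*(SUM j:idx M. pd j (F i k) v * E B j v))" unfolding sdl by (rule sum.swap)
 also have "... = (SUM k:idx (N i). pd k f (FF i v)*(if B = Inr (i, k) then 1 else 0))" using F_E[OF v i _ B] by simp
 also have "... = (case B of Inl c=>0 | Inr k=>if fst k = i then pd (snd k) f (FF i v) else 0)"
 proof (cases "EX k. B = Inr (i, k)")
  case True
  then obtain k where k: "B = Inr (i, k)" by blast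
  hence "k:idx (N i)" using B by (auto simp: K_def)
  from sum_dm(4)[OF mfd_fin[OF mN[OF i]] this, of "%k. pd k f (FF i v)"] show ?thesis by (simp add: k eq_commute)
 next
  case False
  thus ?thesis by (auto split: sum.splits)
 qed
 finally show ?thesis .
qed

lemma base_E: "v:S ==> i:{1..m} ==> B:bK K ==>
 base i (cinv c v) (tvec M c (cinv c v) (%j. E B j v)) = tvN i v (%k. if B = Inr (i, k) then 1 else 0)"
 unfolding tvec_base using F_E[of v i _ B] by (simp add: tvec_def mult.commute cong: sum.cong)

lemma ext_tu:
 assumes v: "v:S" and BC: "B:bK K" "C:bK K" shows "fr.ext XT B C v = (SUM i=1..m. b i*kfN i v
  (tvN i v (%k. if B = Inr (i, k) then 1 else 0))
  (tvN i v (%k. if C = Inr (i, k) then 1 else 0)))"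
proof -
 let ?p = "cinv c v"
 let ?w = "%i. kform (gN i) (JN i) (pr (q ?p) i)"
 let ?t = "%B. tvec M c ?p (%j. E B j v)"
 note p = S_facts[OF v]
 have tb: "tbil M ?p (%u w. ?w i (base i ?p u) (base i ?p w))" if i: "i:{1..m}" for i
 proof -
  have "pr (q ?p) i:pts (N i)" using e(2)[OF v i] mfd_chart(2)[OF mN[OF i] e(1)[OF i]] by blast
  hence "tbil (N i) (pr (q ?p) i) (?w i)" by (rule kaehler_facts(2)[OF kN[OF i] mN[OF i]])
  thus ?thesis using base_tangent[OF p(1) i] unfolding tbil_def tlin_def base_lincomb by auto
 qed
 have "fr.ext XT B C v = (SUM j:idx M. SUM k:idx M. (SUM i=1..m. b i*?w i (base i ?p (cvec M c ?p k)) (base i ?p (cvec M c ?p j)))*E B k v * E C j v)"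
  unfolding fr.ext_def by (intro sum.cong refl arg_cong2[where f = "(*)"]) (simp add: cof_def[abs_def] dtu[OF v])
 also have "... = (SUM i=1..m. b i*(SUM k:idx M. SUM j:idx M. E B k v * E C j v * ?w i (base i ?p (cvec M c ?p k)) (base i ?p (cvec M c ?p j))))"
  by (simp add: sdl sdr, subst sum.swap, subst (2) sum.swap, subst sum.swap) (simp add: mult_ac)
 also have "... = (SUM i=1..m. b i*?w i (base i ?p (?t B)) (base i ?p (?t C)))"
  by (intro sum.cong refl arg_cong2[where f = "(*)"] tbil_expand[OF mM c p(2) tb, symmetric])
 finally show ?thesis using base_E[OF v _ BC(1)] base_E[OF v _ BC(2)] by simp
qed

lemma ext_exact:
 assumes v: "v:S" and f: "smo M S f" and Z: "!!i w. i:idx M ==> w:S ==> cof Z i w = pd i f w" shows "fr.ext Z B C v = 0"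
proof -
 have "pd j (cof Z i) v = pd i (cof Z j) v" if "i:idx M" "j:idx M" for i j using pd_cong[OF S(1) that(2) v Z[OF that(1)]] pd_cong[OF S(1) that(1) v Z[OF that(2)]]
   pd_swap[OF finM S(1) f that(2,1) v] by simp
 thus ?thesis unfolding fr.ext_def by (simp cong: sum.cong)
qed

lemma Sig: "k:K ==> l:K ==> fst k = fst l ==> snd l:idx (N (fst k))" using KD(2) by metis

lemma smJN: "i:{1..m} ==> k:idx (N i) ==> l:idx (N i) ==> smooth_on (idx (N i)) (cV i) (cJ i k l)"
 using kN e(1) unfolding kaehler_def complex_structure_def almost_complex_def by blast

lemma dE_gam: "v:S ==> k:K ==> l:K ==> B:bK K ==> fr.dE B (gam k l) v =
 (case B of Inl c=>0 | Inr n=>if fst n = fst k & fst k = fst l then pd (snd n) (cG (fst k) (snd k) (snd l)) (FF (fst k) v) else 0)"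
proof (cases "fst k = fst l")
 case True
 assume a: "v:S" "k:K" "l:K" "B:bK K"
 have "fr.dE B (gam k l) v = fr.dE B (%v. cG (fst k) (snd k) (snd l) (FF (fst k) v)) v"
  by (rule fr.dE_cong[OF _ a(1)]) (simp add: gam_def True)
 also have "... = (case B of Inl c=>0 | Inr n=>if fst n = fst k then pd (snd n) (cG (fst k) (snd k) (snd l)) (FF (fst k) v) else 0)"
  by (rule dE_FF[OF a(1) KD(1)[OF a(2)] local_metric.smG[OF lmN[OF KD(1)[OF a(2)]] KD(2)[OF a(2)] Sig[OF a(2,3) True]] a(4)])
 finally show ?thesis using True by (simp split: sum.splits)
qed (simp add: gam_def[abs_def] fr.dE_const split: sum.splits)

lemma dE_JJ: "v:S ==> k:K ==> l:K ==> fr.dE (Inl s) (JJ k l) v = 0"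
proof (cases "fst k = fst l")
 case True
 assume a: "v:S" "k:K" "l:K"
 have "fr.dE (Inl s) (JJ k l) v = fr.dE (Inl s) (%v. cJ (fst k) (snd k) (snd l) (FF (fst k) v)) v"
  by (rule fr.dE_cong[OF _ a(1)]) (simp add: JJ_def True)
 thus ?thesis using dE_FF[OF a(1) KD(1)[OF a(2)] smJN[OF KD(1)[OF a(2)] KD(2)[OF a(2)] Sig[OF a(2,3) True]], of "Inl s"] by auto
qed (simp add: JJ_def[abs_def] fr.dE_const)

lemma dE_Ga: "v:S ==> n:K ==> k:K ==> l:K ==> B:bK K ==> fr.dE B (Ga n k l) v =
 (case B of Inl c=>0 | Inr j=>if fst j = fst n & fst n = fst k & fst n = fst l then pd (snd j) (cC (fst n) (snd n) (snd k) (snd l)) (FF (fst n) v) else 0)"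
proof (cases "fst n = fst k & fst n = fst l")
 case True
 assume a: "v:S" "n:K" "k:K" "l:K" "B:bK K"
 have "fr.dE B (Ga n k l) v = fr.dE B (%v. cC (fst n) (snd n) (snd k) (snd l) (FF (fst n) v)) v"
  by (rule fr.dE_cong[OF _ a(1)]) (use True in \<open>simp add: Ga_def\<close>)
 also have "... = (case B of Inl c=>0 | Inr j=>if fst j = fst n then pd (snd j) (cC (fst n) (snd n) (snd k) (snd l)) (FF (fst n) v) else 0)"
  unfolding christoffel_eq using Sig[OF a(2,3)] Sig[OF a(2,4)] True
  by (intro dE_FF[OF a(1) KD(1)[OF a(2)] local_metric.smGam[OF lmN[OF KD(1)[OF a(2)]] KD(2)[OF a(2)]] a(5)]) simp_all
 finally show ?thesis using True by (auto split: sum.splits)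
next
 case False
 hence "Ga n k l = (%_. 0)" by (auto simp: Ga_def fun_eq_iff)
 thus ?thesis using False by (auto simp: fr.dE_const split: sum.splits)
qed

lemma FF_cinv: "v:S ==> i:{1..m} ==> cinv (e i) (FF i v) = pr (q (cinv c v)) i" unfolding FF_def using cinv_chart[OF mN e(1) e(2)] by blast

text \<open>\<open>XF\<close> and the horizontal members of the coframe are exact, so only
  \<open>XT\<close> has a differential, given by the curvature of the connection form. The
  conditions on \<open>gam\<close>, \<open>gai\<close>, \<open>JJ\<close>, \<open>Ga\<close> split
  into blocks, where they are facts about one factor at the point \<open>FF i v\<close>;
  \<open>sum_block\<close> collapses the sums.\<close>

lemma adapted: "adapted_frame (idx M) S (gcomp M c g) K E cof fst (%k. b (fst k)) Aa (hD 0) (hD 1) (hD 2) gam gai JJ Ga"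
proof unfold_locales
 show "finite K" by (rule finK)
 show "smo M S (hD 0)" "smo M S (hD 1)" "smo M S (Aa k)" for k by (rule sm_hD sm_Aa)+
 show "smo M S (gam k l)" "smo M S (JJ k l)" if "k:K" "l:K" for k l using sm_gam sm_JJ that by auto
 show "smo M S (Ga n k l)" if "n:K" "k:K" "l:K" for n k l by (rule sm_Ga[OF that])
 show "b (fst k) = b (fst l)" if "fst k = fst l" for k l :: "nat \<times> 'b" using that by simp
 fix v assume v: "v:S"
 show "hD 0 v > 0" by (rule hD0(2)[OF v])
 show "Aa k v > 0" if "k:K" for k by (rule Aa_pos[OF v that])
 show "fr.gE XF XF v = 1/hD 0 v" "fr.gE XT XT v = hD 0 v"
  "fr.gE XF XT v = 0" using gE_Gs[OF v InlI[OF UNIV_I] InlI[OF UNIV_I]] by (simp_all add: Gs_def)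
 show "fr.gE (Inl s) (Inr k) v = 0" if "k:K" for s k using gE_Gs[OF v InlI[OF UNIV_I] InrI[OF that]] by (simp add: Gs_def split: bool.splits)
 show "fr.gE (Inr k) (Inr l) v = Aa k v * gam k l v" if "k:K" "l:K" for k l using gE_Gs[OF v InrI[OF that(1)] InrI[OF that(2)]] by (simp add: Gs_def)
 show "fr.ext XF B C v = 0" for B C by (rule ext_exact[OF v sm_x]) (simp add: cof_def X_def)
 show "fr.ext (Inr k) B C v = 0" if "k:K" for B C k by (rule ext_exact[OF v smF[OF KD[OF that]]]) (simp add: cof_def)
 have inpts: "yN i v:fst (e i)" "yN i v:pts (N i)" if "i:{1..m}" for i using e(2)[OF v that] mfd_chart(2)[OF mN[OF that] e(1)[OF that]] by auto
 have z: "kfN i v (tvN i v (%k. 0)) u = 0" (is "?L = _")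
  "kfN i v u (tvN i v (%k. 0)) = 0"
  if i: "i:{1..m}" and u: "u:Tan (N i) (yN i v)" for i u
 proof -
  note tb = kaehler_facts(2)[OF kN[OF i] mN[OF i] inpts(2)[OF i]]
  show "kfN i v u (tvN i v (%k. 0)) = 0"
   using tb u tlin_expand[OF mN[OF i] e(1)[OF i] inpts(1)[OF i], of "kfN i v u" "%_. 0"] unfolding tbil_def by simp
  show "?L = 0" using tb u tlin_expand[OF mN[OF i] e(1)[OF i] inpts(1)[OF i], of "%w. kfN i v w u" "%_. 0"] unfolding tbil_def by simp
 qed
 have tt: "tvN i v xx:Tan (N i) (yN i v)" if "i:{1..m}" for i xx
  by (rule tvec_tangent[OF mN[OF that] e(1)[OF that] inpts(1)[OF that]])
 show "fr.ext XT (Inl s) C v = 0" if "C:bK K" for s C unfolding ext_tu[OF v InlI[OF UNIV_I] that] using z(1)[OF _ tt] by simp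
 show "fr.ext XT (Inr k) (Inr l) v = b (fst k)*(SUM n:K. JJ n k v * gam n l v)" (is "?L = _") if k: "k:K" "l:K" for k l
 proof -
  let ?w = "%i. kfN i v" and ?t = "%i. tvN i v"
  note i = KD(1)[OF k(1)]
  have "?L = (SUM i=1..m. if i = fst k then b i*?w i (?t i (%n. if k = (i, n) then 1 else 0)) (?t i (%n. if l = (i, n) then 1 else 0)) else 0)"
   unfolding ext_tu[OF v InrI[OF k(1)] InrI[OF k(2)]] sum.inject
  proof (intro scr)
   fix i assume i: "i:{1..m}"
   have "(%n. if k = (i, n) then 1 else (0::real)) = (%_. 0)" if "i ~= fst k" using that by (auto simp: fun_eq_iff)
   thus "b i*?w i (?t i (%n. if k = (i, n) then 1 else 0)) (?t i (%n. if l = (i, n) then 1 else 0))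
    = (if i = fst k then b i*?w i (?t i (%n. if k = (i, n) then 1 else 0)) (?t i (%n. if l = (i, n) then 1 else 0)) else 0)" using z(1)[OF i tt[OF i]] by simp
  qed
  also have "... = b (fst k)*?w (fst k) (?t (fst k) (%n. if k = (fst k, n) then 1 else 0)) (?t (fst k) (%n. if l = (fst k, n) then 1 else 0))"
   using i by (subst sum.delta) auto
  also have "?w (fst k) (?t (fst k) (%n. if k = (fst k, n) then 1 else 0)) (?t (fst k) (%n. if l = (fst k, n) then 1 else 0)) = (SUM n:K. JJ n k v * gam n l v)"
  proof (cases "fst k = fst l")
   case True
   have 1: "?t (fst k) (%n. if l = (fst k, n) then 1 else 0) = cvec (N (fst k)) (e (fst k)) (yN (fst k) v) (snd l)"
    unfolding cvec_tvec[OF mN[OF i] Sig[OF k True]] using True by (intro arg_cong[where f = "?t (fst k)"]) (auto simp: fun_eq_iff prod_eq_iff)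
   have 2: "?t (fst k) (%n. if k = (fst k, n) then 1 else 0) = cvec (N (fst k)) (e (fst k)) (yN (fst k) v) (snd k)"
    unfolding cvec_tvec[OF mN[OF i] KD(2)[OF k(1)]] by (intro arg_cong[where f = "?t (fst k)"]) (auto simp: fun_eq_iff prod_eq_iff)
   have "?w (fst k) (?t (fst k) (%n. if k = (fst k, n) then 1 else 0)) (?t (fst k) (%n. if l = (fst k, n) then 1 else 0))
    = (SUM n:idx (N (fst k)). cJ (fst k) n (snd k) (FF (fst k) v)*cG (fst k) n (snd l) (FF (fst k) v))"
    unfolding 1 2 FF_def by (rule kaehler_comp(1)[OF mN[OF i] kN[OF i] e(1)[OF i] inpts(1)[OF i] KD(2)[OF k(1)] Sig[OF k True]])
   also have "... = (SUM n:K. JJ n k v * gam n l v)" by (rule sum_block[OF i, symmetric]) (use True in \<open>auto simp: JJ_def gam_def\<close>)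
   finally show ?thesis .
  next
   case False
   hence "(%n. if l = (fst k, n) then 1 else (0::real)) = (%_. 0)" by (auto simp: fun_eq_iff)
   moreover have "(SUM n:K. JJ n k v * gam n l v) = 0" using False by (intro sum.neutral) (auto simp: JJ_def gam_def)
   ultimately show ?thesis using z(2)[OF i tt[OF i]] by simp
  qed
  finally show ?thesis .
 qed
 show "fr.dE XF (hD 0) v = hD 1 v" "fr.dE XF (hD 1) v = hD 2 v" "fr.dE XT (hD 0) v = 0" "fr.dE XT (hD 1) v = 0"
  using dE_hD[OF v InlI[OF UNIV_I]] by (simp_all add: numeral_2_eq_2)
 show "fr.dE (Inr k) (hD 0) v = 0" "fr.dE (Inr k) (hD 1) v = 0" if "k:K" for k using dE_hD[OF v InrI[OF that]] by simp_all
 show "fr.dE XF (Aa k) v = b (fst k)" "fr.dE XT (Aa k) v = 0" for k :: "nat \<times> 'b" using dE_Aa[OF v InlI[OF UNIV_I], where k = k] by simp_all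
 show "fr.dE (Inr n) (Aa k) v = 0" if "n:K" for k n using dE_Aa[OF v InrI[OF that]] by simp
 show "fr.dE (Inl s) (gam k l) v = 0" "fr.dE (Inl s) (JJ k l) v = 0" if "k:K" "l:K" for s k l using dE_gam[OF v that, of "Inl s"] dE_JJ[OF v that] by auto
 show "fr.dE (Inl s) (Ga n k l) v = 0" if "n:K" "k:K" "l:K" for s n k l using dE_Ga[OF v that, of "Inl s"] by auto
 have GD: "FF (fst k) v:cV (fst k)" if "k:K" for k by (rule FF_rn[OF v KD(1)[OF that]])
 show "fr.dE (Inr j) (gam k l) v = (SUM n:K. Ga n j k v * gam n l v) + (SUM n:K. Ga n j l v * gam k n v)" (is "?L = _") if k: "j:K" "k:K" "l:K" for j k l
 proof (cases "fst j = fst k & fst k = fst l")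
  case True
  let ?i = "fst k"
  note i = KD(1)[OF k(2)]
  let ?G = "cG ?i"
  have j: "snd j:idx (N ?i)" "snd k:idx (N ?i)" "snd l:idx (N ?i)" using KD(2)[OF k(1)] KD(2)[OF k(2)] KD(2)[OF k(3)] True by metis+
  have "?L = pd (snd j) (?G (snd k) (snd l)) (FF ?i v)" using dE_gam[OF v k(2,3) InrI[OF k(1)]] True by simp
  also have "... = (SUM d:idx (N ?i). chr (idx (N ?i)) ?G d (snd j) (snd k) (FF ?i v)*?G d (snd l) (FF ?i v)) + (SUM d:idx (N ?i). chr (idx (N ?i)) ?G d (snd j) (snd l) (FF ?i v)*?G (snd k) d (FF ?i v))"
   by (rule local_metric.pd_G[OF lmN[OF i] GD[OF k(2)] j])
  also have "(SUM d:idx (N ?i). chr (idx (N ?i)) ?G d (snd j) (snd k) (FF ?i v)*?G d (snd l) (FF ?i v)) = (SUM n:K. Ga n j k v * gam n l v)"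
   by (rule sum_block[OF i, symmetric]) (use True in \<open>auto simp: Ga_def gam_def christoffel_eq\<close>)
  also have "(SUM d:idx (N ?i). chr (idx (N ?i)) ?G d (snd j) (snd l) (FF ?i v)*?G (snd k) d (FF ?i v)) = (SUM n:K. Ga n j l v * gam k n v)"
   by (rule sum_block[OF i, symmetric]) (use True in \<open>auto simp: Ga_def gam_def christoffel_eq\<close>)
  finally show ?thesis .
 next
  case False
  hence "(SUM n:K. Ga n j k v * gam n l v) = 0" "(SUM n:K. Ga n j l v * gam k n v) = 0" by (auto simp: Ga_def gam_def intro!: sum.neutral)
  thus ?thesis using dE_gam[OF v k(2,3) InrI[OF k(1)]] False by auto
 qed
 show "gam k l v = 0" "JJ k l v = 0" "gai k l v = 0" if "fst k ~= fst l" for k l using that by (simp_all add: gam_def JJ_def gai_def)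
 show "Ga n k l v = 0" if "fst n ~= fst k | fst n ~= fst l" for n k l :: "nat \<times> 'b" using that by (auto simp: Ga_def)
 show "Aa k v = Aa l v" if "fst k = fst l" for k l :: "nat \<times> 'b" using that by (simp_all add: Aa_def)
 have gt: "minv (idx (N (fst k))) (%i j. cG (fst k) i j (FF (fst k) v)) i j = cH (fst k) i j (FF (fst k) v)" for k i j
  by (simp add: ginv_def)
 show "gam k l v = gam l k v" if k: "k:K" "l:K" for k l using local_metric.symG[OF lmN[OF KD(1)[OF k(1)]] GD[OF k(1)] KD(2)[OF k(1)] Sig[OF k]] by (auto simp: gam_def)
 show "gai k l v = gai l k v" if k: "k:K" "l:K" for k l
  using local_metric.Ginv(3)[OF lmN[OF KD(1)[OF k(1)]] KD(2)[OF k(1)] Sig[OF k] GD[OF k(1)]] by (auto simp: gai_def gt)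
 show "Ga n k l v = Ga n l k v" if k: "n:K" "k:K" "l:K" for n k l
  using local_metric.Gam_sym[OF lmN[OF KD(1)[OF k(1)]] GD[OF k(1)] KD(2)[OF k(1)] Sig[OF k(1,2)] Sig[OF k(1,3)]] by (auto simp: Ga_def christoffel_eq)
 show "(SUM n:K. gam k n v * gai n l v) = (if k = l then 1 else 0)" (is "?L = _") if k: "k:K" "l:K" for k l
 proof (cases "fst k = fst l")
  case True
  have "?L = (SUM d:idx (N (fst k)). cG (fst k) (snd k) d (FF (fst k) v)*cH (fst k) d (snd l) (FF (fst k) v))"
   by (rule sum_block[OF KD(1)[OF k(1)]]) (use True in \<open>auto simp: gam_def gai_def\<close>)
  thus ?thesis using local_metric.Ginv(2)[OF lmN[OF KD(1)[OF k(1)]] KD(2)[OF k(1)] Sig[OF k True] GD[OF k(1)]] True by (auto simp: gt prod_eq_iff)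
 qed (auto simp: gam_def gai_def intro!: sum.neutral)
 note kc = kaehler_comp[OF mN kN e(1) inpts(1), folded FF_def]
 show "(SUM n:K. JJ n k v * gam n l v) = - (SUM n:K. JJ n l v * gam n k v)" (is "?L = _") if k: "k:K" "l:K" for k l
 proof (cases "fst k = fst l")
  case True
  note i = KD(1)[OF k(1)]
  have "?L = (SUM n:idx (N (fst k)). cJ (fst k) n (snd k) (FF (fst k) v)*cG (fst k) n (snd l) (FF (fst k) v))"
   by (rule sum_block[OF i]) (use True in \<open>auto simp: gam_def JJ_def\<close>)
  also have "... = - (SUM n:idx (N (fst k)). cJ (fst k) n (snd l) (FF (fst k) v)*cG (fst k) n (snd k) (FF (fst k) v))"
   by (rule kc(2)[OF i i i i KD(2)[OF k(1)] Sig[OF k True]])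
  also have "(SUM n:idx (N (fst k)). cJ (fst k) n (snd l) (FF (fst k) v)*cG (fst k) n (snd k) (FF (fst k) v)) = (SUM n:K. JJ n l v * gam n k v)"
   by (rule sum_block[OF i, symmetric]) (use True in \<open>auto simp: gam_def JJ_def\<close>)
  finally show ?thesis .
 next
  case False
  hence "?L = 0" "(SUM n:K. JJ n l v * gam n k v) = 0" by (auto simp: gam_def JJ_def intro!: sum.neutral)
  thus ?thesis by simp
 qed
 show "(SUM n:K. JJ k n v * JJ n l v) = (if k = l then - 1 else 0)" (is "?L = _") if k: "k:K" "l:K" for k l
 proof (cases "fst k = fst l")
  case True
  note i = KD(1)[OF k(1)]
  have "?L = (SUM n:idx (N (fst k)). cJ (fst k) (snd k) n (FF (fst k) v)*cJ (fst k) n (snd l) (FF (fst k) v))"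
   by (rule sum_block[OF i]) (use True in \<open>auto simp: JJ_def\<close>)
  also have "... = (if snd k = snd l then - 1 else 0)" by (rule kc(3)[OF i i i i KD(2)[OF k(1)] Sig[OF k True]])
  finally show ?thesis using True by (auto simp: prod_eq_iff)
 qed (auto simp: JJ_def intro!: sum.neutral)
 show "(SUM n:K. fr.dE (Inr n) (Ga n l k) v - fr.dE (Inr l) (Ga n n k) v) + (SUM n:K. SUM j:K. Ga n n j v * Ga j l k v - Ga n l j v * Ga j n k v) = gam k l v"
  if k: "k:K" "l:K" "fst k = fst l" for k l
 proof -
  let ?i = "fst k"
  note i = KD(1)[OF k(1)]
  let ?G = "cG ?i"
  let ?C = "%n j k. chr (idx (N ?i)) ?G n j k" and ?f = "FF ?i v" and ?k = "snd k" and ?l = "snd l"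
  note kl = KD(2)[OF k(1)] Sig[OF k]
  have 1: "(SUM n:K. fr.dE (Inr n) (Ga n l k) v - fr.dE (Inr l) (Ga n n k) v) = (SUM n:idx (N ?i). pd n (?C n ?l ?k) ?f - pd ?l (?C n n ?k) ?f)"
  proof (rule sum_block[OF i])
   fix n assume n: "n:K"
   show "fr.dE (Inr n) (Ga n l k) v - fr.dE (Inr l) (Ga n n k) v = (if ?i = fst n then pd (snd n) (?C (snd n) ?l ?k) ?f - pd ?l (?C (snd n) (snd n) ?k) ?f else 0)"
    using dE_Ga[OF v n k(2,1) InrI[OF n]] dE_Ga[OF v n n k(1) InrI[OF k(2)]] k(3) by (auto simp: christoffel_eq)
  qed
  have 2: "(SUM n:K. SUM j:K. Ga n n j v * Ga j l k v - Ga n l j v * Ga j n k v) = (SUM n:idx (N ?i). SUM j:idx (N ?i). ?C n n j ?f*?C j ?l ?k ?f - ?C n ?l j ?f*?C j n ?k ?f)"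
  proof (rule sum_block[OF i])
   fix n assume n: "n:K"
   show "(SUM j:K. Ga n n j v * Ga j l k v - Ga n l j v * Ga j n k v) = (if ?i = fst n then SUM j:idx (N ?i). ?C (snd n) (snd n) j ?f*?C j ?l ?k ?f - ?C (snd n) ?l j ?f*?C j (snd n) ?k ?f else 0)" (is "?L = _")
   proof (cases "?i = fst n")
    case True
    have "?L = (SUM j:idx (N ?i). ?C (snd n) (snd n) j ?f*?C j ?l ?k ?f - ?C (snd n) ?l j ?f*?C j (snd n) ?k ?f)"
     by (rule sum_block[OF i]) (use True k(3) in \<open>auto simp: Ga_def christoffel_eq\<close>)
    thus ?thesis using True by simp
   next
    case False
    thus ?thesis using k(3) by (auto simp: Ga_def intro!: sum.neutral)
   qed
  qed
  \<comment> \<open>The frame condition has its lower indices in the order \<open>l\<close>,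
    \<open>k\<close>, the Ricci tensor of the factor in the order \<open>k\<close>,
    \<open>l\<close>; the symmetry of the symbols reconciles them.\<close>
  have s1: "pd n (?C n ?l ?k) ?f = pd n (?C n ?k ?l) ?f" if "n:idx (N ?i)" for n by (rule local_metric.pd_Gam_sym[OF lmN[OF i] GD[OF k(1)] that kl(2,1) that])
  have s2: "?C j ?l ?k ?f = ?C j ?k ?l ?f" if "j:idx (N ?i)" for j by (rule local_metric.Gam_sym[OF lmN[OF i] GD[OF k(1)] that kl(2,1)])
  have ri: "ricci (N ?i) (e ?i) (gN ?i) ?k ?l ?f = 1*cG ?i ?k ?l ?f"
   using factors[OF i] kl e(1)[OF i] inpts(1)[OF i] unfolding einstein_def FF_def by blast
  have s3: "pd ?l (?C n n ?k) ?f = pd ?l (?C n n ?k) ?f" for n ..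
  show ?thesis using ri s1 s2 k(3) unfolding 1 2 ricci_eq ric_def by (simp add: gam_def)
 qed
qed

lemma scalar_curv_W:
 assumes v: "v:S"
 defines "T == S1 a (x (cinv c v))"
 shows "scalar_curv M c g v = S0 a (x (cinv c v)) - hD 2 v - 2*T*hD 1 v
  - (T\<^sup>2 - S2 a (x (cinv c v)))*hD 0 v"
proof -
 have s: "(SUM k:K. f (fst k)) = (SUM i=1..m. real (mdim (N i))*f i)" for f :: "nat=>real"
 proof -
  have "(SUM k:K. f (fst k)) = (SUM k:K. (%(i, k). f i) k)" by (simp add: case_prod_beta)
  also have "... = (SUM i=1..m. SUM k:idx (N i). f i)" unfolding K_def by (rule sum.Sigma[symmetric]) (use mfd_fin[OF mN] in auto)
  finally show ?thesis by (simp add: mdim_def)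
 qed
 let ?A = "%i. b i*x (cinv c v) + a i"
 show ?thesis unfolding scalar_curv_eq adapted_frame.adapted_scal[OF adapted v] T_def Aa_def
  using s[of "%i. 1/?A i"] s[of "%i. b i/(2*?A i)"] s[of "%i. (b i)\<^sup>2/(2*(?A i)\<^sup>2)"] by (simp add: mult_ac)
qed

end

lemma image_opn_openin:
 assumes M: "manifold M" and c: "c:atlas M" and T: "opn (idx M) T" "T <= img c" shows "openin (mtop M) (cinv c ` T)" unfolding mfd_openin[OF M]
proof (intro conjI ballI)
 show "cinv c ` T <= pts M"
 proof
  fix p assume "p:cinv c ` T"
  then obtain v where v: "v:T" "p = cinv c v" by blast
  thus "p:pts M" using chart_cinv(2)[OF M subsetD[OF T(2) v(1)]] mfd_chart(2)[OF M c] by blast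
 qed
 show "opn (idx M) (snd c' ` (cinv c ` T Int fst c'))" if "c':atlas M" for c' by (rule smooth_transition(1)[where f = "%_. 0", OF M c that T smooth_const[OF T(1)]])
qed

context construction_two begin

text \<open>The extension principle: if \<open>f\<close> left the closed set \<open>A\<close> at
  some point, it would do so on an open set, which meets the dense union of the principal
  orbits.\<close>

lemma W_dense:
 assumes c: "c:atlas M" and f: "smo M (img c) f" and A: "closed A"
  and fW: "!!v. v:snd c ` (W Int fst c) ==> f v:A" and v: "v:img c" shows "f v:A"
proof (rule ccontr)
 assume n: "f v ~: A"
 let ?T = "{v:img c. f v:- A}"
 have T: "opn (idx M) ?T" by (rule opn_vimage[OF mfd_chart(3)[OF mM c] f]) (use A in auto)
 have "openin (mtop M) (cinv c ` ?T)" by (rule image_opn_openin[OF mM c T]) blast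
 moreover have "cinv c v:cinv c ` ?T" using n v by blast
 moreover have "cinv c v:mtop M closure_of W"
 proof -
  have "cinv c v:pts M" using chart_cinv(2)[OF mM v] mfd_chart(2)[OF mM c] by blast
  thus ?thesis using principal_dense unfolding W_def by simp
 qed
 ultimately have "EX y. y:W & y:cinv c ` ?T" unfolding in_closure_of by (metis (no_types))
 then obtain p where p: "p:W" "p:cinv c ` ?T" by blast
 then obtain w where w: "w:?T" "p = cinv c w" by blast
 hence "w:img c" by blast
 hence "p:fst c" "snd c p = w" using chart_cinv[OF mM, of w c] w(2) by simp_all
 hence "w:snd c ` (W Int fst c)" using p(1) by blast
 thus False using fW w(1) by blast
qed

lemma const_scalar_curv_from_ODE:
 assumes rg: "riemannian M g" and pf: "profile m b h a" and mf: "mform h a g J"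
  and D: "!!t. t:{0..1} ==> D 0 t = h t" "!!k t. t:{0..1} ==> der01 (D k) (D (Suc k) t) t"
  and ode: "!!t T. 0 < t ==> t < 1 ==> T = S1 a t ==>
   S0 a t - D 2 t - 2*T*D 1 t
    - (T\<^sup>2 - S2 a t)*D 0 t = s" shows "const_scalar_curv M g s" unfolding const_scalar_curv_def
proof (intro ballI)
 fix c p assume c: "c:atlas M" "p:fst c"
 have "scalar_curv M c g v:{s}" if v: "v:snd c ` (W Int fst c)" for v
 proof -
  obtain r where r: "r:W" "r:fst c" "v = snd c r" using v by blast
  obtain e S where S: "snd c r:S" "orbit_chart m N gN JN b P act pr \<theta> M x q c e S" by (rule orbit_chart_exists[OF r(1) c(1) r(2)])
  interpret o: orbit_metric m N gN JN b P act pr \<theta> M x q c e S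
   "%i k v. snd (e i) (pr (q (cinv c v)) i) k" "%a v. vert (cinv c v) (cvec M c (cinv c v) a)" "%a v. pd a (%v. x (cinv c v)) v"
   h a g J D by (rule orbit_metric.intro[OF S(2)], unfold_locales) (rule rg pf mf D reflexive, (assumption+)?)+
  have "v:S" using S(1) r(3) by simp
  from o.scalar_curv_W[OF this] o.x01(1,2)[OF this] show ?thesis using ode[of "x (cinv c v)"] by (simp add: o.hD_def)
 qed
 from W_dense[where f = "scalar_curv M c g", OF c(1) _ closed_singleton this, of "snd c p"] c(2)
  local_metric.smscal[OF local_metric_gcomp[OF mM rg c(1)]]
 show "scalar_curv M c g (snd c p) = s" unfolding scalar_curv_eq by blast
qed

end

section \<open>Raising indices and pullback\<close>

definition sharp :: "('p, 'k) mfd=>'p metric=>'p=>('p tv=>real)=>'p tv" where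
 "sharp M g p fi = (THE w. w:Tan M p & (ALL u:Tan M p. g p w u = fi u))"

context
 fixes M :: "('p, 'k) mfd" and g :: "'p metric" and p
 assumes M: "manifold M" and g: "riemannian M g" and p: "p:pts M"
begin

lemma riesz_unique:
 assumes w: "w:Tan M p" "w':Tan M p" and eq: "!!u. u:Tan M p ==> g p w u = g p w' u" shows "w = w'"
proof (rule ccontr)
 assume n: "w ~= w'"
 let ?d = "lincomb 1 w (-1) w'"
 have d: "?d:Tan M p" by (rule tangent_lincomb[OF M p w])
 have "?d ~= (%_. 0)"
 proof
  assume "?d = (%_. 0)"
  hence "w f = w' f" for f by (auto simp: lincomb_def fun_eq_iff)
  thus False using n by blast
 qed
 hence "g p ?d ?d > 0" using g p d unfolding riemannian_def by blast
 moreover have "g p ?d ?d = 1*g p w ?d + (-1)*g p w' ?d" using riemannian_tbil[OF g p M] w d unfolding tbil_def tlin_def by blast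
 ultimately show False using eq[OF d] by simp
qed

text \<open>The components, written with the inverse matrix of the metric, are what makes the raised
  vector depend smoothly on the point.\<close>

lemma sharp:
 assumes fi: "tlin M p fi" shows "sharp M g p fi:Tan M p" (is ?A) "u:Tan M p ==> g p (sharp M g p fi) u = fi u" (is "PROP ?B")
  "c:atlas M ==> p:fst c ==> k:idx M ==> sharp M g p fi (%q. snd c q k) = (SUM l:idx M. ginv M c g k l (snd c p)*fi (cvec M c p l))" (is "PROP ?C")
proof -
 have ex: "tvec M c p (%k. SUM l:idx M. ginv M c g k l (snd c p)*fi (cvec M c p l)):Tan M p &
  (ALL u:Tan M p. g p (tvec M c p (%k. SUM l:idx M. ginv M c g k l (snd c p)*fi (cvec M c p l))) u = fi u)" (is "?w:_ & _") if c: "c:atlas M" "p:fst c" for c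
 proof (intro conjI ballI)
  show w: "?w:Tan M p" by (rule tvec_tangent[OF M c])
  fix u assume u: "u:Tan M p"
  let ?et = "%k. u (%q. snd c q k)"
  have v: "snd c p:img c" using c(2) by blast
  have ut: "u = tvec M c p ?et" by (rule tangent_eq_tvec[OF M u c])
  have gc: "g p (cvec M c p k) (cvec M c p j) = gcomp M c g k j (snd c p)" for k j by (simp add: gcomp_def cinv_chart[OF M c])
  have "g p ?w (tvec M c p ?et) = (SUM k:idx M. SUM j:idx M. (SUM l:idx M. ginv M c g k l (snd c p)*fi (cvec M c p l))*?et j*gcomp M c g k j (snd c p))"
   unfolding tbil_expand[OF M c riemannian_tbil[OF g p M]] gc ..
  also have "... = (SUM j:idx M. ?et j*(SUM l:idx M. (SUM k:idx M. gcomp M c g j k (snd c p)*ginv M c g k l (snd c p))*fi (cvec M c p l)))"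
  proof -
   have "(SUM k:idx M. SUM j:idx M. (SUM l:idx M. ginv M c g k l (snd c p)*fi (cvec M c p l))*?et j*gcomp M c g k j (snd c p))
    = (SUM j:idx M. SUM k:idx M. SUM l:idx M. ?et j*(gcomp M c g j k (snd c p)*ginv M c g k l (snd c p)*fi (cvec M c p l)))"
    using local_metric.symG[OF local_metric_gcomp[OF M g c(1)] v] by (subst sum.swap) (simp add: sdl sdr mult_ac)
   also have "... = (SUM j:idx M. SUM l:idx M. SUM k:idx M. ?et j*(gcomp M c g j k (snd c p)*ginv M c g k l (snd c p)*fi (cvec M c p l)))"
    by (intro sum.cong refl sum.swap)
   finally show ?thesis by (simp add: sdl sdr)
  qed
  also have "... = (SUM j:idx M. ?et j*(SUM l:idx M. (if j = l then 1 else 0)*fi (cvec M c p l)))"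
   using local_metric.Ginv(2)[OF local_metric_gcomp[OF M g c(1)] _ _ v] by (intro scr) (simp add: ginv_def)
  also have "... = fi u" unfolding tlin_expand[OF M c fi, of ?et, folded ut] using sum_dm(1)[OF mfd_fin[OF M]] by (intro scr) simp
  finally have "g p ?w (tvec M c p ?et) = fi u" .
  thus "g p ?w u = fi u" by (simp only: ut[symmetric])
 qed
 have eq: "sharp M g p fi = tvec M c p (%k. SUM l:idx M. ginv M c g k l (snd c p)*fi (cvec M c p l))" if c: "c:atlas M" "p:fst c" for c unfolding sharp_def
 proof (rule the_equality, rule ex[OF c])
  fix w assume w: "w:Tan M p & (ALL u:Tan M p. g p w u = fi u)"
  show "w = tvec M c p (%k. SUM l:idx M. ginv M c g k l (snd c p)*fi (cvec M c p l))" by (rule riesz_unique) (use w ex[OF c] in auto)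
 qed
 obtain d where d: "d:atlas M" "p:fst d" using mfd_cover[OF M p] by blast
 show ?A "PROP ?B" using ex[OF d] unfolding eq[OF d] by auto
 show "PROP ?C"
  unfolding eq by (rule tvec_crd[OF M])
qed

end

lemma sum_rotate: "(SUM a:A. SUM b:B. SUM c:C. f a b c) = (SUM b:B. SUM c:C. SUM a:A. f a b c)" by (subst sum.swap) (intro sum.cong refl sum.swap)

definition pullback :: "('q, 'l) mfd=>('p=>'q)=>'q metric=>'p metric" where
 "pullback N F B p u v = B (F p) (push N F p u) (push N F p v)"

context
 fixes M :: "('p, 'k) mfd" and N :: "('q, 'l) mfd" and F B
 assumes M: "manifold M" and N: "manifold N" and F: "!!p. p:pts M ==> lsm M N F p"
  and B: "!!y. y:pts N ==> tbil N y (B y)"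
  and smB: "!!c k l. c:atlas N ==> k:idx N ==> l:idx N ==> smo N (img c) (gcomp N c B k l)"
begin

lemma pullback_tbil: "p:pts M ==> tbil M p (pullback N F B p)"
proof -
 assume p: "p:pts M"
 have "F p:pts N" using F[OF p] unfolding lsm_def by blast
 from B[OF this] show ?thesis using push_tangent[OF M N F[OF p]] unfolding tbil_def tlin_def pullback_def by (auto simp: push_lincomb)
qed

text \<open>Around \<open>v0\<close> the components of the pullback are those of \<open>B\<close>
  along the map, contracted with its Jacobian; one predicate keeps the local data together.\<close>

definition pb_chart :: "('p, 'k) chart=>('k=>real)=>('q, 'l) chart=>('k=>real) set=>bool" where
 "pb_chart c v0 c' T = (c':atlas N & opn (idx M) T & v0:T & T <= img c &
  (ALL v:T. rep c F c' v:img c') &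
  (ALL j:idx N. smo M T (%v. rep c F c' v j)) &
  (ALL v:T. ALL i:idx M. ALL j:idx M. gcomp M c (pullback N F B) i j v
   = (SUM k:idx N. SUM l:idx N. gcomp N c' B k l (rep c F c' v)*pd i (%v. rep c F c' v k) v * pd j (%v. rep c F c' v l) v)))"

lemma pullback_comp:
 assumes c: "c:atlas M" and v0: "v0:img c" shows "EX c' T. pb_chart c v0 c' T"
proof -
 let ?p = "cinv c v0"
 have p: "?p:fst c" "snd c ?p = v0" "?p:pts M" using chart_cinv[OF M v0] mfd_chart(2)[OF M c] by auto
 have "F ?p:pts N" using F[OF p(3)] unfolding lsm_def by blast
 then obtain c' where c': "c':atlas N" "F ?p:fst c'" using mfd_cover[OF N] by blast
 obtain T where T: "opn (idx M) T" "snd c ?p:T" "T <= img c" "!!v. v:T ==> F (cinv c v):fst c'"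
  "!!j. j:idx N ==> smo M T (%v. rep c F c' v j)" by (rule lsmE[OF F[OF p(3)] c p(1) c']) blast
 have "pb_chart c v0 c' T" unfolding pb_chart_def
 proof (intro conjI ballI)
  show "c':atlas N" "opn (idx M) T" "v0:T" "T <= img c" using c' T p by auto
  show "rep c F c' v:img c'" if "v:T" for v using T(4) that by blast
  show "smo M T (%v. rep c F c' v j)" if "j:idx N" for j by (rule T(5)[OF that])
  fix v i j assume v: "v:T" and ij: "i:idx M" "j:idx M"
  let ?r = "cinv c v"
  have r: "?r:fst c" "snd c ?r = v" "?r:pts M" "F ?r:fst c'" "F ?r:pts N"
   using chart_cinv[OF M subsetD[OF T(3) v]] mfd_chart(2)[OF M c] T(4)[OF v] mfd_chart(2)[OF N c'(1)] by auto
  show "gcomp M c (pullback N F B) i j v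
   = (SUM k:idx N. SUM l:idx N. gcomp N c' B k l (rep c F c' v)*pd i (%v. rep c F c' v k) v * pd j (%v. rep c F c' v l) v)"
   unfolding gcomp_def pullback_def push_cvec[OF M N F[OF r(3)] c r(1) c'(1) r(4) ij(1)] push_cvec[OF M N F[OF r(3)] c r(1) c'(1) r(4) ij(2)]
    tbil_expand[OF N c'(1) r(4) B[OF r(5)]] r(2) cinv_chart[OF N c'(1) r(4)] by (simp add: mult_ac)
 qed
 thus ?thesis by blast
qed

lemmas pbD = pb_chart_def[THEN iffD1, THEN conjunct1]
 pb_chart_def[THEN iffD1, THEN conjunct2, THEN conjunct1]
 pb_chart_def[THEN iffD1, THEN conjunct2, THEN conjunct2, THEN conjunct1]
 pb_chart_def[THEN iffD1, THEN conjunct2, THEN conjunct2, THEN conjunct2, THEN conjunct1]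
 pb_chart_def[THEN iffD1, THEN conjunct2, THEN conjunct2, THEN conjunct2, THEN conjunct2, THEN conjunct1, rule_format]
 pb_chart_def[THEN iffD1, THEN conjunct2, THEN conjunct2, THEN conjunct2, THEN conjunct2, THEN conjunct2, THEN conjunct1, rule_format]
 pb_chart_def[THEN iffD1, THEN conjunct2, THEN conjunct2, THEN conjunct2, THEN conjunct2, THEN conjunct2, THEN conjunct2, rule_format]

lemma pullback_smooth:
 assumes c: "c:atlas M" and ij: "i:idx M" "j:idx M" shows "smo M (img c) (gcomp M c (pullback N F B) i j)"
proof (rule smooth_on_local[OF mfd_chart(3)[OF M c]])
 fix v0 assume v0: "v0:img c"
 obtain c' T where "pb_chart c v0 c' T" using pullback_comp[OF c v0] by blast
 note T = pbD[OF this]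
 have "smo M T (%v. gcomp N c' B k l (rep c F c' v))" if "k:idx N" "l:idx N" for k l
  by (rule smooth_comp[OF T(2) mfd_fin[OF N] mfd_chart(3)[OF N T(1)] T(5,6) smB[OF T(1) that]])
 hence "smo M T (%v. SUM k:idx N. SUM l:idx N. gcomp N c' B k l (rep c F c' v)*pd i (%v. rep c F c' v k) v * pd j (%v. rep c F c' v l) v)"
  using ij T(6) by (intro smooth_sum[OF T(2)] smooth_mult[OF T(2)] smooth_on_pd)
 hence "smo M T (gcomp M c (pullback N F B) i j)" by (rule smooth_cong[OF T(2), rotated]) (rule T(7)[OF _ ij, symmetric])
 thus "EX T. opn (idx M) T & v0:T & T <= img c & smo M T (gcomp M c (pullback N F B) i j)" using T(2,3,4) by (intro exI[of _ T] conjI)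
qed

text \<open>The product rule splits a derivative into \<open>R\<close>, the derivative of
  \<open>B\<close> contracted with first derivatives of the map, and two terms \<open>Q\<close> with
  its second derivatives. The cyclic sum of the \<open>R\<close> vanishes since \<open>B\<close> is
  closed; the \<open>Q\<close> cancel because they are symmetric in the first two
  directions.\<close>

lemma pullback_closed:
 assumes anti: "!!y u w. y:pts N ==> u:Tan N y ==> w:Tan N y ==> B y u w = - B y w u"
  and cl: "closed_2form N B"
  and c: "c:atlas M" and v0: "v0:img c" and I: "i1:idx M" "i2:idx M" "i3:idx M"
 shows "pd i1 (gcomp M c (pullback N F B) i2 i3) v0 + pd i2 (gcomp M c (pullback N F B) i3 i1) v0 + pd i3 (gcomp M c (pullback N F B) i1 i2) v0 = 0"
proof -
 obtain c' T where "pb_chart c v0 c' T" using pullback_comp[OF c v0] by blast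
 note T = pbD[OF this]
 define Ph where "Ph v = rep c F c' v" for v
 define f where "f k v = Ph v k" for k v
 define w where "w = gcomp N c' B"
 define y where "y = Ph v0"
 let ?K = "idx N"
 have sf: "smo M T (f k)" if "k:?K" for k using T(6)[OF that] by (simp add: f_def[abs_def] Ph_def)
 have smPh: "smo M T (%v. Ph v k)" if "k:?K" for k using sf[OF that] by (simp add: f_def[abs_def])
 have PhT: "Ph v:img c'" if "v:T" for v using T(5)[OF that] by (simp add: Ph_def)
 have sw: "smooth_on ?K (img c') (w k l)" if "k:?K" "l:?K" for k l unfolding w_def by (rule smB[OF T(1) that])
 have swPh: "smo M T (%v. w k l (Ph v))" if "k:?K" "l:?K" for k l by (rule smooth_comp[OF T(2) mfd_fin[OF N] mfd_chart(3)[OF N T(1)] PhT smPh sw[OF that]])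
 have eq: "gcomp M c (pullback N F B) i j v = (SUM k:?K. SUM l:?K. w k l (Ph v)*(pd i (f k) v * pd j (f l) v))" if "v:T" "i:idx M" "j:idx M" for v i j
  using T(7)[OF that] by (simp add: w_def f_def[abs_def] Ph_def mult.assoc)
 define Q where "Q i j n = (SUM k:?K. SUM l:?K. w k l y*(pd i (pd j (f k)) v0*pd n (f l) v0))" for i j n
 define R where "R i j n = (SUM k:?K. SUM l:?K. SUM a:?K. pd a (w k l) y*pd i (f a) v0*pd j (f k) v0*pd n (f l) v0)" for i j n
 have anti': "w k l y = - w l k y" if "k:?K" "l:?K" for k l
 proof -
  have c'y: "y:img c'" unfolding y_def by (rule PhT[OF T(3)])
  have q: "cinv c' y:fst c'" "cinv c' y:pts N" using chart_cinv(2)[OF N c'y] mfd_chart(2)[OF N T(1)] by auto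
  show ?thesis unfolding w_def gcomp_def by (rule anti[OF q(2) cvec_tangent[OF N T(1) q(1) that(1)] cvec_tangent[OF N T(1) q(1) that(2)]])
 qed
 have pdG: "pd i (gcomp M c (pullback N F B) j n) v0 = R i j n + Q i j n - Q i n j" (is "?L = _") if i: "i:idx M" "j:idx M" "n:idx M" for i j n
 proof -
  have "?L = pd i (%v. SUM k:?K. SUM l:?K. w k l (Ph v)*(pd j (f k) v * pd n (f l) v)) v0" by (rule pd_cong[OF T(2) i(1) T(3)]) (rule eq[OF _ i(2,3)])
  also have "... = (SUM k:?K. pd i (%v. SUM l:?K. w k l (Ph v)*(pd j (f k) v * pd n (f l) v)) v0)"
   using i by (intro pd_sum[OF T(2) _ _ T(3)] smooth_sum[OF T(2)] smooth_mult[OF T(2)] swPh smooth_on_pd sf)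
  also have "... = (SUM k:?K. SUM l:?K. pd i (%v. w k l (Ph v)*(pd j (f k) v * pd n (f l) v)) v0)"
   using i by (intro sum.cong refl pd_sum[OF T(2) _ _ T(3)] smooth_mult[OF T(2)] swPh smooth_on_pd sf)
  also have "... = (SUM k:?K. SUM l:?K. (SUM a:?K. pd a (w k l) y*pd i (f a) v0)*(pd j (f k) v0*pd n (f l) v0)
    + w k l y*(pd i (pd j (f k)) v0*pd n (f l) v0 + pd j (f k) v0*pd i (pd n (f l)) v0))"
  proof (intro scr)
   fix k l assume kl: "k:?K" "l:?K"
   have "pd i (%v. w k l (Ph v)) v0 = (SUM a:?K. pd a (w k l) y*pd i (f a) v0)"
    using pd_comp[OF T(2) mfd_fin[OF N] mfd_chart(3)[OF N T(1)] PhT smPh sw[OF kl] i(1) T(3)] by (simp add: y_def f_def[abs_def])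
   moreover have "pd i (%v. pd j (f k) v * pd n (f l) v) v0 = pd i (pd j (f k)) v0*pd n (f l) v0 + pd j (f k) v0*pd i (pd n (f l)) v0"
    by (rule pd_mult[OF T(2) smooth_on_pd[OF sf[OF kl(1)] i(2)] smooth_on_pd[OF sf[OF kl(2)] i(3)] i(1) T(3)])
   ultimately show "pd i (%v. w k l (Ph v)*(pd j (f k) v * pd n (f l) v)) v0 = (SUM a:?K. pd a (w k l) y*pd i (f a) v0)*(pd j (f k) v0*pd n (f l) v0)
    + w k l y*(pd i (pd j (f k)) v0*pd n (f l) v0 + pd j (f k) v0*pd i (pd n (f l)) v0)"
    using pd_mult[OF T(2) swPh[OF kl] smooth_mult[OF T(2) smooth_on_pd[OF sf[OF kl(1)] i(2)] smooth_on_pd[OF sf[OF kl(2)] i(3)]] i(1) T(3)] by (simp add: y_def)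
  qed
  also have "... = R i j n + Q i j n + (SUM k:?K. SUM l:?K. w k l y*(pd j (f k) v0*pd i (pd n (f l)) v0))"
   by (simp add: R_def Q_def sdr sum.distrib distrib_left mult.assoc)
  also have "(SUM k:?K. SUM l:?K. w k l y*(pd j (f k) v0*pd i (pd n (f l)) v0)) = (SUM l:?K. SUM k:?K. - w l k y*(pd i (pd n (f l)) v0*pd j (f k) v0))"
   by (subst sum.swap, intro sum.cong refl, subst anti', assumption+) (simp add: mult.commute)
  also have "... = - Q i n j" by (simp add: Q_def sum_negf)
  finally show ?thesis by simp
 qed
 have sw2: "Q i j n = Q j i n" if "i:idx M" "j:idx M" for i j n unfolding Q_def using pd_swap[OF mfd_fin[OF M] T(2) sf that T(3)] by (intro scr) simp
 have "cinv c' y:fst c'" "snd c' (cinv c' y) = y" using chart_cinv[OF N PhT[OF T(3)]] by (simp_all add: y_def)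
 hence cl': "pd a (w k l) y + pd k (w l a) y + pd l (w a k) y = 0" if "a:?K" "k:?K" "l:?K" for a k l using cl T(1) that unfolding closed_2form_def w_def by metis
 have "R i1 i2 i3 = (SUM a:?K. SUM k:?K. SUM l:?K. pd a (w k l) y*pd i1 (f a) v0*pd i2 (f k) v0*pd i3 (f l) v0)" unfolding R_def by (rule sum_rotate[symmetric])
 moreover have "R i2 i3 i1 = (SUM a:?K. SUM k:?K. SUM l:?K. pd k (w l a) y*pd i1 (f a) v0*pd i2 (f k) v0*pd i3 (f l) v0)"
  unfolding R_def by (subst sum_rotate) (simp add: mult_ac)
 moreover have "R i3 i1 i2 = (SUM a:?K. SUM k:?K. SUM l:?K. pd l (w a k) y*pd i1 (f a) v0*pd i2 (f k) v0*pd i3 (f l) v0)" unfolding R_def by (simp add: mult_ac)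
 ultimately have "R i1 i2 i3 + R i2 i3 i1 + R i3 i1 i2 = (SUM a:?K. SUM k:?K. SUM l:?K. (pd a (w k l) y + pd k (w l a) y + pd l (w a k) y)*pd i1 (f a) v0*pd i2 (f k) v0*pd i3 (f l) v0)"
  by (simp add: sum.distrib distrib_right)
 also have "... = 0" using cl' by (intro sum.neutral ballI) simp
 finally show ?thesis using pdG I sw2 by simp
qed

end

lemma kform_smooth:
 assumes M: "manifold M" and K: "kaehler M g J" and c: "c:atlas M" and kl: "k:idx M" "l:idx M" shows "smo M (img c) (gcomp M c (kform g J) k l)"
proof (rule smooth_cong[OF mfd_chart(3)[OF M c]])
 have a: "almost_complex M J" "riemannian M g" using K unfolding kaehler_def complex_structure_def by auto
 show "smo M (img c) (%v. SUM n:idx M. jcomp M c J n k v * gcomp M c g n l v)" by (intro smooth_sum[OF mfd_chart(3)[OF M c]] smooth_mult[OF mfd_chart(3)[OF M c]])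
   (use a c kl in \<open>auto simp: almost_complex_def riemannian_def\<close>)
 fix v assume v: "v:img c"
 show "(SUM n:idx M. jcomp M c J n k v * gcomp M c g n l v) = gcomp M c (kform g J) k l v"
  using kaehler_comp(1)[OF M K c chart_cinv(2)[OF M v] kl] chart_cinv(1)[OF M v] by (simp add: gcomp_def)
qed

lemma kform_antisym:
 assumes M: "manifold M" and K: "kaehler M g J" and p: "p:pts M" and u: "u:Tan M p" "w:Tan M p" shows "kform g J p u w = - kform g J p w u"
proof -
 note f = kaehler_facts[OF K M p]
 have "(%f. - u f) = lincomb (-1) u 0 u" by (simp add: lincomb_def)
 hence "g p (%f. - u f) (J p w) = - g p u (J p w)" using f(1) f(3)[OF u(2)] u unfolding tbil_def tlin_def by simp
 thus ?thesis unfolding kform_def using f(8)[OF f(3)[OF u(1)] u(2)] f(4)[OF u(1)] f(6)[OF u(1) f(3)[OF u(2)]] by simp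
qed

section \<open>Smooth functions on the closed unit interval\<close>

text \<open>A derivative inside the class \<open>P\<close> is chosen by \<open>SOME\<close> and the
  choice is iterated, which gives the sequence \<open>D\<close> of
  \<open>smooth_closed_interval\<close>.\<close>

lemma sci_coinduct:
 assumes P: "P f" and step: "!!f. P f ==> EX f'. P f' & (ALL t:{0..1}. der01 f (f' t) t)" shows "sci f"
proof -
 define d where "d f = (SOME f'. P f' & (ALL t:{0..1}. der01 f (f' t) t))" for f
 have d: "P (d f) & (ALL t:{0..1}. der01 f (d f t) t)" if "P f" for f unfolding d_def by (rule someI_ex[OF step[OF that]])
 have "P ((d ^^ k) f)" for k by (induction k) (use P d in auto)
 thus ?thesis unfolding smooth_closed_interval_def using d by (intro exI[of _ "%k. (d ^^ k) f"]) auto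
qed

lemma sci_deriv:
 assumes "sci f" shows "EX f'. sci f' & (ALL t:{0..1}. der01 f (f' t) t)"
proof -
 obtain D where D: "!!t. t:{0..1} ==> D 0 t = f t" "!!k t. t:{0..1} ==> der01 (D k) (D (Suc k) t) t" using assms unfolding smooth_closed_interval_def by blast
 have "sci (D 1)" unfolding smooth_closed_interval_def by (rule exI[of _ "%k. D (Suc k)"]) (use D(2) in auto)
 moreover have "der01 f (D 1 t) t" if "t:{0..1}" for t using has_field_derivative_transform_within[OF D(2)[OF that, of 0], of 1 f] D(1) that by simp
 ultimately show ?thesis by blast
qed

inductive sci_cl :: "(real=>real)=>bool" where
 base: "sci f ==> sci_cl f"
| const: "sci_cl (%_. c)"
| add: "sci_cl f ==> sci_cl g ==> sci_cl (%t. f t + g t)"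
| mult: "sci_cl f ==> sci_cl g ==> sci_cl (%t. f t*g t)"
| inv: "sci_cl f ==> (ALL t:{0..1}. f t ~= 0) ==> sci_cl (%t. inverse (f t))"

lemma sci_cl_step: "sci_cl f ==> EX f'. sci_cl f' & (ALL t:{0..1}. der01 f (f' t) t)"
proof (induction rule: sci_cl.induct)
 case (base f)
 thus ?case using sci_deriv sci_cl.base by blast
next
 case (const c)
 show ?case by (rule exI[of _ "%_. 0"]) (auto intro: sci_cl.const)
next
 case (add f g)
 then obtain f' g' where "sci_cl f'" "sci_cl g'" "ALL t:{0..1}. der01 f (f' t) t" "ALL t:{0..1}. der01 g (g' t) t" by blast
 thus ?case by (intro exI[of _ "%t. f' t + g' t"]) (auto intro: sci_cl.add DERIV_add)
next
 case (mult f g)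
 then obtain f' g' where *: "sci_cl f'" "sci_cl g'" "ALL t:{0..1}. der01 f (f' t) t" "ALL t:{0..1}. der01 g (g' t) t" by blast
 show ?case by (intro exI[of _ "%t. f' t*g t + g' t*f t"] conjI ballI sci_cl.add sci_cl.mult*mult.hyps DERIV_mult) (use*in auto)
next
 case (inv f)
 then obtain f' where *: "sci_cl f'" "ALL t:{0..1}. der01 f (f' t) t" by blast
 have "der01 (%t. inverse (f t)) ((-1)*f' t*(inverse (f t)*inverse (f t))) t" if "t:{0..1}" for t
  using DERIV_inverse'[of f "f' t" t "{0..1}"]*inv.hyps that by (auto simp: mult_ac)
 thus ?case by (intro exI[of _ "%t. (-1)*f' t*(inverse (f t)*inverse (f t))"] conjI ballI sci_cl.mult sci_cl.const sci_cl.inv inv.hyps *) auto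
qed

lemma sci_cl_sci: "sci_cl f ==> sci f" by (rule sci_coinduct[of sci_cl, OF _ sci_cl_step])

lemma sci_cont: "sci f ==> cont {0..1} f" using sci_deriv[of f] DERIV_continuous by (metis continuous_on_eq_continuous_within)

lemma sci_id: "sci (%t. t)" unfolding smooth_closed_interval_def by (rule exI[of _ "%k t. if k = 0 then t else if k = 1 then 1 else 0"]) auto

lemma sci_flip: "sci f ==> sci (%t. f (1 - t))"
proof -
 assume "sci f"
 then obtain D where D: "!!t. t:{0..1} ==> D 0 t = f t" "!!k t. t:{0..1} ==> der01 (D k) (D (Suc k) t) t" unfolding smooth_closed_interval_def by blast
 have "der01 (%t. (-1)^k*D k (1 - t)) ((-1)^Suc k*D (Suc k) (1 - t)) t" if t: "t:{0..1}" for k t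
 proof -
  have "(%t. 1 - t) ` {0..1::real} = {0..1}" by (auto simp: image_iff intro!: bexI[of _ "1 - _"])
  hence "(D k has_real_derivative D (Suc k) (1 - t)) (at (1 - t) within (%t. 1 - t) ` {0..1})" using D(2)[of "1 - t" k] t by auto
  moreover have "der01 (%t. 1 - t) (-1) t" by (auto intro!: derivative_eq_intros)
  ultimately have "der01 (%t. D k (1 - t)) (D (Suc k) (1 - t)*-1) t"
   using DERIV_image_chain[of "D k" "D (Suc k) (1 - t)" "%t. 1 - t" t "{0..1}" "-1"] by (simp add: o_def)
  from DERIV_cmult[OF this, of "(-1)^k"] show ?thesis by simp
 qed
 thus ?thesis unfolding smooth_closed_interval_def by (intro exI[of _ "%k t. (-1)^k*D k (1 - t)"]) (use D(1) in auto)
qed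

text \<open>Hadamard's lemma: the quotient is \<open>\<integral>\<^sub>0\<^sup>1 f'(s t) ds\<close>.\<close>

lemma sci_divide_id:
 assumes f: "sci f" "f 0 = 0" shows "EX k. sci k & (ALL t:{0..1}. f t = t*k t)"
proof -
 obtain D where D: "!!t. t:{0..1} ==> D 0 t = f t" "!!k t. t:{0..1} ==> der01 (D k) (D (Suc k) t) t" using f(1) unfolding smooth_closed_interval_def by blast
 \<comment> \<open>The \<open>n\<close>-th derivative of the quotient, differentiated under the
   integral sign.\<close>
 define L where "L n t = integral (cbox 0 1) (%s. s^n*D (Suc n) (t * s))" for n t
 have m: "t * s:{0..1}" if "t:{0..1}" "s:{0..1}" for t s :: real using that by (auto intro: mult_le_one)
 have cD: "cont {0..1} (D n)" for n using D(2)[of _ n] DERIV_continuous by (metis continuous_on_eq_continuous_within)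
 have chain: "der01 (%t. D n (t * s)) (s*D (Suc n) (t * s)) t" if "t:{0..1}" "s:{0..1}" for n t s
 proof -
  have "(D n has_real_derivative D (Suc n) (t * s)) (at (t * s) within (%t. t * s) ` {0..1})" by (rule DERIV_subset[OF D(2)[OF m[OF that]]]) (use m that(2) in auto)
  moreover have "der01 (%t. t * s) s t" by (auto intro!: derivative_eq_intros)
  ultimately show ?thesis using DERIV_image_chain[of "D n" "D (Suc n) (t * s)" "%t. t * s" t "{0..1}" s] by (simp add: o_def mult.commute)
 qed
 have cont2: "cont ({0..1} \<times> {0..1}) (%(t, s). s^n*D k (t * s))" for n k
 proof -
  have "cont ({0..1} \<times> {0..1}) (%z. D k (fst z * snd z))" by (rule continuous_on_compose2[OF cD]) (use m in \<open>auto intro!: continuous_intros\<close>)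
  thus ?thesis by (auto simp: case_prod_beta intro!: continuous_intros)
 qed
 have "der01 (L n) (L (Suc n) t) t" if t: "t:{0..1}" for n t unfolding L_def
 proof (rule leibniz_rule_field_derivative[OF _ _ _ t])
  show "der01 (%t. s^n*D (Suc n) (t * s)) (s^Suc n*D (Suc (Suc n)) (t * s)) t" if "t:{0..1}" "s:cbox 0 1" for t s
   using DERIV_cmult[OF chain[OF that(1), of s "Suc n"], of "s^n"] that(2) by (simp add: mult_ac)
  show "(%s. s^n*D (Suc n) (t * s)) integrable_on cbox 0 1" if "t:{0..1}" for t
  proof (rule integrable_continuous)
   have "cont (cbox 0 1) (%s. D (Suc n) (t * s))" by (rule continuous_on_compose2[OF cD]) (use m that in \<open>auto intro!: continuous_intros\<close>)
   thus "cont (cbox 0 1) (%s. s^n*D (Suc n) (t * s))" by (intro continuous_intros)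
  qed
  show "cont ({0..1} \<times> cbox 0 1) (%(t, s). s^Suc n*D (Suc (Suc n)) (t * s))" using cont2[of "Suc n"] by simp
 qed auto
 hence "sci (L 0)" unfolding smooth_closed_interval_def by (intro exI[of _ L]) auto
 moreover have "f t = t*L 0 t" if t: "t:{0..1}" for t
 proof -
  have "((%s. D 0 (t * s)) has_vector_derivative t*D 1 (t * s)) (at s within {0..1})" if "s:{0..1}" for s
   using chain[of s t 0] t that by (simp add: mult.commute has_real_derivative_iff_has_vector_derivative)
  hence "((%s. t*D 1 (t * s)) has_integral D 0 (t*1) - D 0 (t*0)) {0..1}" by (intro fundamental_theorem_of_calculus) auto
  moreover have "D 0 (t*1) - D 0 (t*0) = f t" using D(1)[OF t] D(1)[of 0] f(2) by simp
  ultimately have "integral {0..1} (%s. t*D 1 (t * s)) = f t" by (simp only: integral_unique)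
  thus ?thesis by (simp add: L_def)
 qed
 ultimately show ?thesis by blast
qed

text \<open>Hadamard's lemma at \<open>0\<close>, then again after the reflection that exchanges the
  end points.\<close>

lemma sci_divide_both:
 assumes f: "sci f" "f 0 = 0" "f 1 = 0" shows "EX k. sci k & (ALL t:{0..1}. f t = t*(1 - t)*k t)"
proof -
 obtain k1 where k1: "sci k1" "!!t. t:{0..1} ==> f t = t*k1 t" using sci_divide_id[OF f(1,2)] by blast
 have "k1 (1 - 0) = 0" using k1(2)[of 1] f(3) by simp
 from sci_divide_id[OF sci_flip[OF k1(1)] this] obtain k2
  where k2: "sci k2" "!!t. t:{0..1} ==> k1 (1 - t) = t*k2 t" by blast
 have "f t = t*(1 - t)*k2 (1 - t)" if "t:{0..1}" for t using k1(2)[OF that] k2(2)[of "1 - t"] that by simp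
 thus ?thesis using sci_flip[OF k2(1)] by blast
qed

lemma deriv_at_zero_factor:
 assumes D: "der01 f d t0" and t0: "t0:{0..1}"
  and f: "!!t. t:{0..1} ==> f t = (t - t0)*k t" and k: "cont {0..1} k" shows "d = k t0"
proof -
 have "((%t. (f t - f t0)/(t - t0)) \<longlongrightarrow> d) (at t0 within {0..1})" using D unfolding has_field_derivative_iff .
 moreover have "((%t. (f t - f t0)/(t - t0)) \<longlongrightarrow> k t0) (at t0 within {0..1})"
 proof (rule Lim_transform_eventually)
  show "(k \<longlongrightarrow> k t0) (at t0 within {0..1})" using k t0 by (auto simp: continuous_on_def)
  show "\<forall>\<^sub>F t in at t0 within {0..1}. k t = (f t - f t0)/(t - t0)" using f t0 unfolding eventually_at by (intro exI[of _ 1]) auto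
 qed
 moreover have "at t0 within {0..1} ~= bot" using connected_imp_perfect[of "{0..1::real}" t0] t0 by (simp add: trivial_limit_within)
 ultimately show ?thesis using tendsto_unique by blast
qed

text \<open>The end conditions on \<open>h\<close> become values of the cofactor \<open>k\<close>,
  which is positive on the closed interval; so its reciprocal is smooth up to the ends.\<close>

lemma profile_factor:
 assumes "profile m b h a" shows "EX k. sci k & (ALL t:{0..1}. h t = t*(1 - t)*k t & k t > 0) & k 0 = 2 & k 1 = 2"
proof -
 have h: "sci h" "!!t. 0 < t ==> t < 1 ==> h t > 0" "h 0 = 0" "h 1 = 0"
  "der01 h 2 0" "der01 h (-2) 1" using assms unfolding profile_def by auto
 obtain k where k: "sci k" "!!t. t:{0..1} ==> h t = t*(1 - t)*k t" using sci_divide_both[OF h(1,3,4)] by blast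
 note c = sci_cont[OF k(1)]
 have "2 = (%t. (1 - t)*k t) 0" by (rule deriv_at_zero_factor[OF h(5)]) (use k(2) c in \<open>auto intro!: continuous_intros\<close>)
 hence k0: "k 0 = 2" by simp
 have "-2 = (%t. - t*k t) 1" by (rule deriv_at_zero_factor[OF h(6)]) (use k(2) c in \<open>auto intro!: continuous_intros simp: alg\<close>)
 hence k1: "k 1 = 2" by simp
 have "k t > 0" if t: "t:{0..1}" for t
 proof (cases "t = 0 | t = 1")
  case False
  hence "0 < t" "t < 1" using t by auto
  hence "0 < t*(1 - t)*k t" "0 < t*(1 - t)" using h(2)[of t] k(2)[OF t] by simp_all
  thus ?thesis by (simp add: zero_less_mult_iff)
 qed (use k0 k1 in auto)
 thus ?thesis using k k0 k1 by blast
qed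

lemma pos_ratio_bound:
 fixes f g :: "real=>real"
 assumes "cont {0..1} f" "cont {0..1} g" "!!t. t:{0..1} ==> f t > 0" "!!t. t:{0..1} ==> g t > 0" shows "EX c>0. ALL t:{0..1}. c*g t <= f t"
proof -
 have "cont {0..1} (%t. f t/g t)" using assms by (intro continuous_intros) force+
 then obtain s where s: "s:{0..1}" "!!t. t:{0..1} ==> f s/g s <= f t/g t" using continuous_attains_inf[of "{0..1}" "%t. f t/g t"] by auto
 show ?thesis by (rule exI[of _ "f s/g s"]) (use s assms in \<open>auto simp: pos_le_divide_eq\<close>)
qed

text \<open>The cofactors of both profiles equal \<open>2\<close> at the ends, so their difference
  is \<open>t * (1 - t) * l\<close>. This cancels the poles: \<open>fi = l / (k * k0)\<close> and
  \<open>si = - l / k0^2\<close>.\<close>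

lemma profile_compare:
 assumes "profile m b h a" "profile m b h0 a0"
 obtains fi si where "sci fi" "sci si"
  "!!t. 0 < t ==> t < 1 ==> fi t = 1/h t - 1/h0 t" "!!t. 0 < t ==> t < 1 ==> si t = (h t - h0 t)/(h0 t)\<^sup>2"
proof -
 obtain k where k: "sci k" "!!t. t:{0..1} ==> h t = t*(1 - t)*k t" "!!t. t:{0..1} ==> k t > 0" "k 0 = 2" "k 1 = 2" using profile_factor[OF assms(1)] by blast
 obtain k0 where k0: "sci k0" "!!t. t:{0..1} ==> h0 t = t*(1 - t)*k0 t" "!!t. t:{0..1} ==> k0 t > 0" "k0 0 = 2" "k0 1 = 2" using profile_factor[OF assms(2)] by blast
 have "sci (%t. k0 t + (-1)*k t)" by (intro sci_cl_sci sci_cl.add sci_cl.mult sci_cl.const sci_cl.base[OF k(1)] sci_cl.base[OF k0(1)])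
 moreover have "k0 0 + (-1)*k 0 = 0" "k0 1 + (-1)*k 1 = 0" using k(4,5) k0(4,5) by simp_all
 ultimately obtain l where l: "sci l" "!!t. t:{0..1} ==> k0 t + (-1)*k t = t*(1 - t)*l t" using sci_divide_both[of "%t. k0 t + (-1)*k t"] by blast
 show ?thesis
 proof (rule that[of "%t. l t*inverse (k t)*inverse (k0 t)" "%t. (-1)*l t*inverse (k0 t)*inverse (k0 t)"])
  have nz: "ALL t:{0..1}. k t ~= 0" "ALL t:{0..1}. k0 t ~= 0" using k(3) k0(3) by (metis less_irrefl)+
  show "sci (%t. l t*inverse (k t)*inverse (k0 t))" "sci (%t. (-1)*l t*inverse (k0 t)*inverse (k0 t))"
   by (intro sci_cl_sci sci_cl.mult sci_cl.inv sci_cl.const nz; rule sci_cl.base; fact)+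
  fix t :: real assume t: "0 < t" "t < 1"
  have kk: "h t = t*(1 - t)*k t" "h0 t = t*(1 - t)*k0 t" "k t > 0" "k0 t > 0" "k0 t - k t = t*(1 - t)*l t" "t*(1 - t) > 0"
   using k(2,3)[of t] k0(2,3)[of t] l(2)[of t] t by auto
  define r where "r = t*(1 - t)"
  have *: "h t = r*k t" "h0 t = r*k0 t" "k t = k0 t - r*l t" "r ~= 0" "k t ~= 0" "k0 t ~= 0" using kk unfolding r_def by auto
  have "1/h t - 1/h0 t = (k0 t - k t)/(r*k t*k0 t)" unfolding *(1,2) using *(4-6) by (simp add: field_simps)
  also have "... = l t/(k t*k0 t)" unfolding *(3) using *(4) by simp
  finally show "l t*inverse (k t)*inverse (k0 t) = 1/h t - 1/h0 t" by (simp add: divide_inverse)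
  have "(h t - h0 t)/(h0 t)\<^sup>2 = r*(k t - k0 t)/(r\<^sup>2*(k0 t)\<^sup>2)" using *(1,2) by (simp add: power_mult_distrib right_diff_distrib)
  also have "k t - k0 t = - r*l t" using *(3) by simp
  also have "r*(- r*l t)/(r\<^sup>2*(k0 t)\<^sup>2) = - l t/(k0 t)\<^sup>2" using *(4) by (simp add: power2_eq_square)
  finally show "(-1)*l t*inverse (k0 t)*inverse (k0 t) = (h t - h0 t)/(h0 t)\<^sup>2" by (simp add: divide_inverse power2_eq_square)
 qed
qed

text \<open>One constant for three comparisons: \<open>h\<close> with \<open>h0\<close> for the
  vertical direction, \<open>h0\<close> with \<open>h\<close> for \<open>dx\<close>, and the
  coefficients of the factors. Compactness gives each of them; \<open>C <= 1\<close> serves the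
  first factor, where the coefficients agree.\<close>

lemma profile_bound:
 assumes "profile m b h a" "profile m b h0 a0"
 obtains C where "C > 0" "C <= 1" "!!t. 0 < t ==> t < 1 ==> C*h0 t <= h t & C*h t <= h0 t"
  "!!t i. i:{2..m} ==> t:{0..1} ==> C*(b i*t + a0 i) <= b i*t + a i"
proof -
 obtain k where k: "sci k" "!!t. t:{0..1} ==> h t = t*(1 - t)*k t" "!!t. t:{0..1} ==> k t > 0" using profile_factor[OF assms(1)] by blast
 obtain k0 where k0: "sci k0" "!!t. t:{0..1} ==> h0 t = t*(1 - t)*k0 t" "!!t. t:{0..1} ==> k0 t > 0" using profile_factor[OF assms(2)] by blast
 obtain c1 where c1: "c1 > 0" "!!t. t:{0..1} ==> c1*k0 t <= k t" using pos_ratio_bound[OF sci_cont[OF k(1)] sci_cont[OF k0(1)] k(3) k0(3)] by blast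
 obtain c2 where c2: "c2 > 0" "!!t. t:{0..1} ==> c2*k t <= k0 t" using pos_ratio_bound[OF sci_cont[OF k0(1)] sci_cont[OF k(1)] k0(3) k(3)] by blast
 have A: "b i*t + a i > 0" "b i*t + a0 i > 0" if "i:{2..m}" "t:{0..1}" for i t using assms that unfolding profile_def by auto
 have "EX c>0. ALL t:{0..1}. c*(b i*t + a0 i) <= b i*t + a i" if "i:{2..m}" for i
  by (rule pos_ratio_bound) (use A[OF that] in \<open>auto intro!: continuous_intros\<close>)
 hence "EX c. ALL i:{2..m}. c i > 0 & (ALL t:{0..1}. c i*(b i*t + a0 i) <= b i*t + a i)" by (intro bchoice ballI) blast
 then obtain c where cc: "ALL i:{2..m}. c i > 0 & (ALL t:{0..1}. c i*(b i*t + a0 i) <= b i*t + a i)" ..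
 note c = cc[THEN bspec, THEN conjunct1] cc[THEN bspec, THEN conjunct2, THEN bspec]
 define C where "C = Min ({1, c1, c2} \<union> c ` {2..m})"
 have C: "C <= 1" "C <= c1" "C <= c2" "!!i. i:{2..m} ==> C <= c i" unfolding C_def by (rule Min_le; blast)+
 have "C > 0" unfolding C_def by (subst Min_gr_iff) (use c1(1) c2(1) c(1) in auto)
 have mono: "C*y <= z" if "d*y <= z" "C <= d" "y > 0" for d y z using order_trans[OF mult_right_mono[OF that(2) less_imp_le[OF that(3)]] that(1)] .
 show ?thesis
 proof (rule that[OF \<open>C > 0\<close> C(1)])
  fix t :: real assume t: "0 < t" "t < 1"
  hence t': "t:{0..1}" "0 <= t*(1 - t)" by auto
  have "C*k0 t <= k t" "C*k t <= k0 t" using mono[OF c1(2)[OF t'(1)] C(2) k0(3)[OF t'(1)]] mono[OF c2(2)[OF t'(1)] C(3) k(3)[OF t'(1)]] .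
  thus "C*h0 t <= h t & C*h t <= h0 t" unfolding k(2)[OF t'(1)] k0(2)[OF t'(1)]
   using mult_left_mono[OF _ t'(2), of "C*k0 t" "k t"] mult_left_mono[OF _ t'(2), of "C*k t" "k0 t"] by (simp add: mult_ac)
 next
  show "C*(b i*t + a0 i) <= b i*t + a i" if "i:{2..m}" "t:{0..1}" for t i by (rule mono[OF c(2)[OF that] C(4)[OF that(1)] A(2)[OF that]])
 qed
qed

lemma smooth_sci:
 assumes S: "opn I S" and f: "smooth_on I S f" "!!v. v:S ==> f v:{0..1}" and fi: "sci fi" shows "smooth_on I S (%v. fi (f v))"
proof -
 obtain D where D: "!!t. t:{0..1} ==> D 0 t = fi t" "!!k t. t:{0..1} ==> der01 (D k) (D (Suc k) t) t" using fi unfolding smooth_closed_interval_def by blast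
 show ?thesis by (rule smooth_cong[OF S _ smooth_comp1[OF S f(1), where R = "{0..1}" and D = D and k = 0]]) (use f(2) D in auto)
qed

lemma sum_first: "1 <= (m::nat) ==> (SUM i=1..m. f i) = f 1 + (SUM i=2..m. f i :: real)" by (simp add: sum.atLeast_Suc_atMost numeral_2_eq_2)

section \<open>Deformation of the metric\<close>

locale new_metric = construction_two +
 fixes g0 :: "'e metric" and J0 :: "'e endo" and h0 h fi si :: "real=>real" and a0 a :: "nat=>real" and rh :: "'e=>nat=>'a"
 assumes K0: "kaehler M g0 J0" and pf0: "profile m b h0 a0" and mf0: "mform h0 a0 g0 J0"
  and pf: "profile m b h a"
  and sci: "sci fi" "sci si"
  and fisi: "!!t. 0 < t ==> t < 1 ==> fi t = 1/h t - 1/h0 t" "!!t. 0 < t ==> t < 1 ==> si t = (h t - h0 t)/(h0 t)\<^sup>2"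
  and rh: "smooth_map M (prod_fam {2..m} N) rh" "!!p i. p:W ==> i:{2..m} ==> rh p i = pr (q p) i"
begin

lemma mN2: "i:{2..m} ==> manifold (N i)" using mN by auto

lemma kN2: "i:{2..m} ==> kaehler (N i) (gN i) (JN i)" using factors by auto

lemma R_lsm: "p:pts M ==> i:{2..m} ==> lsm M (N i) (%p. rh p i) p" by (rule lsm_prod_fam[OF mM finite_atLeastAtMost mN2 rh(1)])

definition gB where "gB i = pullback (N i) (%p. rh p i) (gN i)"
definition wB where "wB i = pullback (N i) (%p. rh p i) (kform (gN i) (JN i))"
text \<open>\<open>J0 p u x\<close> is \<open>- h0\<close> times the connection form on the
  principal part. The connection form itself does not extend to the special orbits, hence the square
  of \<open>h0\<close> in the denominator of \<open>si\<close>.\<close>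

definition g where "g p u v = g0 p u v + fi (x p)*(u x * v x) + si (x p)*(J0 p u x*J0 p v x) + (SUM i=2..m. (a i - a0 i)*gB i p u v)"
definition om where "om p u v = kform g0 J0 p u v + (SUM i=2..m. (a i - a0 i)*wB i p u v)"
text \<open>Raising an index of the new Kaehler form yields an endomorphism that is smooth on all of
  \<open>M\<close>, without formulas at the special orbits.\<close>

definition J where "J p u = sharp M g p (om p u)"

lemma R_pts: "p:pts M ==> i:{2..m} ==> rh p i:pts (N i)" using R_lsm unfolding lsm_def by blast

lemma riemN: "i:{2..m} ==> riemannian (N i) (gN i)" using kN2 unfolding kaehler_def by blast

lemma gB: "i:{2..m} ==> p:pts M ==> tbil M p (gB i p)"
 "i:{2..m} ==> c:atlas M ==> j:idx M ==> l:idx M ==> smo M (img c) (gcomp M c (gB i) j l)"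
proof -
 assume i: "i:{2..m}"
 have B: "tbil (N i) y (gN i y)" if "y:pts (N i)" for y by (rule riemannian_tbil[OF riemN[OF i] that mN2[OF i]])
 have s: "smooth_on (idx (N i)) (img c) (gcomp (N i) c (gN i) k l)" if "c:atlas (N i)" "k:idx (N i)" "l:idx (N i)" for c k l
  using riemN[OF i] that unfolding riemannian_def by blast
 show "p:pts M ==> tbil M p (gB i p)" unfolding gB_def by (rule pullback_tbil[where N = "N i", OF mM mN2[OF i] R_lsm[OF _ i] B s])
 show "c:atlas M ==> j:idx M ==> l:idx M ==> smo M (img c) (gcomp M c (gB i) j l)"
  unfolding gB_def by (rule pullback_smooth[where N = "N i", OF mM mN2[OF i] R_lsm[OF _ i] B s])
qed

lemma wB: "i:{2..m} ==> p:pts M ==> tbil M p (wB i p)"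
 "i:{2..m} ==> c:atlas M ==> j:idx M ==> l:idx M ==> smo M (img c) (gcomp M c (wB i) j l)"
 "i:{2..m} ==> c:atlas M ==> v:img c ==> j:idx M ==> k:idx M ==> l:idx M ==>
  pd j (gcomp M c (wB i) k l) v + pd k (gcomp M c (wB i) l j) v + pd l (gcomp M c (wB i) j k) v = 0"
 "i:{2..m} ==> p:pts M ==> u:Tan M p ==> w:Tan M p ==> wB i p u w = - wB i p w u"
proof -
 assume i: "i:{2..m}"
 note B = kaehler_facts(2)[OF kN2[OF i] mN2[OF i]]
 note s = kform_smooth[OF mN2[OF i] kN2[OF i]]
 note as = kform_antisym[OF mN2[OF i] kN2[OF i]]
 have cl: "closed_2form (N i) (kform (gN i) (JN i))" using kN2[OF i] unfolding kaehler_def by blast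
 show "p:pts M ==> tbil M p (wB i p)" unfolding wB_def by (rule pullback_tbil[where N = "N i", OF mM mN2[OF i] R_lsm[OF _ i] B s])
 show "c:atlas M ==> j:idx M ==> l:idx M ==> smo M (img c) (gcomp M c (wB i) j l)"
  unfolding wB_def by (rule pullback_smooth[where N = "N i", OF mM mN2[OF i] R_lsm[OF _ i] B s])
 show "c:atlas M ==> v:img c ==> j:idx M ==> k:idx M ==> l:idx M ==>
  pd j (gcomp M c (wB i) k l) v + pd k (gcomp M c (wB i) l j) v + pd l (gcomp M c (wB i) j k) v = 0"
  unfolding wB_def by (rule pullback_closed[where N = "N i", OF mM mN2[OF i] R_lsm[OF _ i] B s as cl])
 show "p:pts M ==> u:Tan M p ==> w:Tan M p ==> wB i p u w = - wB i p w u"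
  unfolding wB_def pullback_def by (rule as[OF R_pts[OF _ i]]; (rule push_tangent[OF mM mN2[OF i] R_lsm[OF _ i]])?)
qed

lemma R_base: "p:W ==> i:{2..m} ==> u:Tan M p ==> push (N i) (%p. rh p i) p u = base i p u"
proof -
 assume a: "p:W" "i:{2..m}" "u:Tan M p"
 have "u (f \<circ> (%p. rh p i)) = u (f \<circ> (%p. pr (q p) i))" for f by (rule tangent_local(2)[OF mM W_open a(1) _ a(3)]) (use rh(2)[OF _ a(2)] in simp)
 thus ?thesis using rh(2)[OF a(1,2)] by (simp add: push_def base_def fun_eq_iff)
qed

lemma kf0: "p:pts M ==> tbil M p (g0 p)" "p:pts M ==> tbil M p (kform g0 J0 p)"
 "p:pts M ==> u:Tan M p ==> w:Tan M p ==> J0 p (lincomb r u s w) = lincomb r (J0 p u) s (J0 p w)"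
 "p:pts M ==> u:Tan M p ==> J0 p u:Tan M p" by (rule kaehler_facts[OF K0 mM]; assumption)+

lemma tbil_add: "tbil M p A ==> tbil M p B ==> tbil M p (%u w. A u w + B u w)" unfolding tbil_def tlin_def by (auto simp: alg)

lemma tbil_prod: "tlin M p A ==> tlin M p B ==> tbil M p (%u w. k*(A u*B w))" unfolding tbil_def tlin_def by (auto simp: alg)

lemma tbil_sum: "(!!i. i:I ==> tbil M p (A i)) ==> tbil M p (%u w. SUM i:I. k i*A i u w)"
 unfolding tbil_def tlin_def by (auto simp: sdl sum.distrib[symmetric] alg intro!: sum.cong)

lemma tlin_x: "tlin M p (%u. u x)" "p:pts M ==> tlin M p (%u. J0 p u x)" unfolding tlin_def by (auto simp: kf0(3)) (auto simp: lincomb_def)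

lemma g_tbil: "p:pts M ==> tbil M p (g p)" unfolding g_def[abs_def] by (intro tbil_add tbil_prod tbil_sum kf0(1) gB(1) tlin_x)

lemma om_tbil: "p:pts M ==> tbil M p (om p)" unfolding om_def[abs_def] by (intro tbil_add tbil_sum kf0(2) wB(1))

lemma om_antisym: "p:pts M ==> u:Tan M p ==> w:Tan M p ==> om p u w = - om p w u"
 unfolding om_def using kform_antisym[OF mM K0, of p u w] wB(4)[of _ p u w] by (simp add: sum_negf)

lemma g_sym: "p:pts M ==> u:Tan M p ==> w:Tan M p ==> g p u w = g p w u"
proof -
 assume p: "p:pts M" and u: "u:Tan M p" "w:Tan M p"
 have "gB i p u w = gB i p w u" if i: "i:{2..m}" for i unfolding gB_def pullback_def
  by (rule kaehler_facts(6)[OF kN2[OF i] mN2[OF i] R_pts[OF p i]]; rule push_tangent[OF mM mN2[OF i] R_lsm[OF p i]]; rule u)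
 thus ?thesis unfolding g_def using kaehler_facts(6)[OF K0 mM p u] by (simp add: mult.commute)
qed

lemma W01: "p:W ==> 0 < x p" "p:W ==> x p < 1" unfolding W_def by auto

lemma g0W: "p:W ==> u:Tan M p ==> w:Tan M p ==>
 g0 p u w = gf h0 a0 p u w" using mf0 unfolding metric_form_def Let_def vert_def base_def W_def by blast

lemma J0W: "p:W ==> u:Tan M p ==> vert p (J0 p u) = u x/h0 (x p)"
 "p:W ==> u:Tan M p ==> J0 p u x = - h0 (x p) * vert p u"
 "p:W ==> u:Tan M p ==> i:{1..m} ==> base i p (J0 p u) = JN i (pr (q p) i) (base i p u)" using mf0 unfolding metric_form_def Let_def vert_def base_def W_def by blast+

lemma hpos: "p:W ==> h (x p) > 0" "p:W ==> h0 (x p) > 0" using pf pf0 unfolding profile_def W_def by auto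

lemma a1: "a 1 = 0" "a0 1 = 0" using pf pf0 unfolding profile_def by auto

lemma gW: "p:W ==> u:Tan M p ==> w:Tan M p ==>
 g p u w = gf h a p u w"
proof -
 assume p: "p:W" and u: "u:Tan M p" "w:Tan M p"
 let ?G = "%i. gb i p u w"
 have "gB i p u w = ?G i" if "i:{2..m}" for i unfolding gB_def pullback_def R_base[OF p that u(1)] R_base[OF p that u(2)] rh(2)[OF p that] ..
 hence s: "(SUM i=2..m. (a i - a0 i)*gB i p u w) = (SUM i=2..m. (b i*x p + a i)*?G i) - (SUM i=2..m. (b i*x p + a0 i)*?G i)"
  by (simp add: sum_subtractf[symmetric] alg)
 have h: "h (x p) ~= 0" "h0 (x p) ~= 0" using hpos[OF p] by auto
 have 1: "u x*w x/h0 (x p) + fi (x p)*(u x*w x) = u x*w x/h (x p)" unfolding fisi(1)[OF W01[OF p]] by (simp add: alg)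
 have "si (x p)*(h0 (x p))\<^sup>2 = h (x p) - h0 (x p)" unfolding fisi(2)[OF W01[OF p]] using h by simp
 hence "si (x p)*(J0 p u x*J0 p w x) = (h (x p) - h0 (x p))*(vert p u * vert p w)" unfolding J0W(2)[OF p u(1)] J0W(2)[OF p u(2)] by (simp add: power2_eq_square mult_ac)
 \<comment> \<open>Only the factors from \<open>2\<close> on are deformed; the terms of the first
   factor agree because \<open>a 1 = a0 1 = 0\<close>.\<close>
 thus ?thesis unfolding g_def g0W[OF p u] s sum_first[OF m_pos, of "%i. (b i*x p + a0 i)*?G i"] sum_first[OF m_pos, of "%i. (b i*x p + a i)*?G i"] a1 using 1 by (simp add: alg)
qed

lemma g_smooth:
 assumes c: "c:atlas M" and ij: "i:idx M" "j:idx M" shows "smo M (img c) (gcomp M c g i j)"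
proof -
 let ?S = "img c"
 note S = mfd_chart(3)[OF mM c]
 let ?X = "%i v. pd i (%v. x (cinv c v)) v"
 let ?Y = "%i v. SUM l:idx M. jcomp M c J0 l i v * ?X l v"
 have X: "cvec M c (cinv c v) i x = ?X i v" (is "?L = _") and Y: "J0 (cinv c v) (cvec M c (cinv c v) i) x = ?Y i v" if v: "v:?S" and i: "i:idx M" for v i
 proof -
  have p: "cinv c v:fst c" "snd c (cinv c v) = v" "cinv c v:pts M" using chart_cinv[OF mM v] mfd_chart(2)[OF mM c] by auto
  show "?L = ?X i v" using x_near[OF p(3)] p(2) by (simp add: cvec_def)
  show "J0 (cinv c v) (cvec M c (cinv c v) i) x = ?Y i v"
   using endo_cvec[where J = J0, OF mM c p(1) kf0(4)[OF p(3)] i] tvec_near[OF mM x_near[OF p(3)], of c] p(2) by simp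
 qed
 have j0: "smo M ?S (jcomp M c J0 k l)" if "k:idx M" "l:idx M" for k l using K0 c that unfolding kaehler_def complex_structure_def almost_complex_def by blast
 have g0: "smo M ?S (gcomp M c g0 i j)" using K0 c ij unfolding kaehler_def riemannian_def by blast
 have xr: "x (cinv c v):{0..1}" if "v:?S" for v using x_range chart_cinv(2)[OF mM that] mfd_chart(2)[OF mM c] by blast
 have sX: "smo M ?S (?X k)" if "k:idx M" for k using smooth_on_pd[OF x_smooth[OF c] that] .
 have "smo M ?S (%v. gcomp M c g0 i j v + fi (x (cinv c v))*(?X i v * ?X j v) + si (x (cinv c v))*(?Y i v * ?Y j v) + (SUM n=2..m. (a n - a0 n)*gcomp M c (gB n) i j v))"
  by (intro smooth_add[OF S] smooth_mult[OF S] smooth_sum[OF S] smooth_const[OF S] g0 smooth_sci[OF S x_smooth[OF c] xr] sci sX ij j0 gB(2) c)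
 thus ?thesis by (rule smooth_cong[OF S, rotated]) (use X Y ij in \<open>simp add: g_def gcomp_def\<close>)
qed

lemma om_smooth:
 assumes c: "c:atlas M" and ij: "i:idx M" "j:idx M" shows "smo M (img c) (gcomp M c om i j)"
proof -
 note S = mfd_chart(3)[OF mM c]
 have "smo M (img c) (%v. gcomp M c (kform g0 J0) i j v + (SUM n=2..m. (a n - a0 n)*gcomp M c (wB n) i j v))"
  by (intro smooth_add[OF S] smooth_mult[OF S] smooth_sum[OF S] smooth_const[OF S] kform_smooth[OF mM K0 c ij] ij wB(2) c)
 thus ?thesis by (simp add: om_def gcomp_def[abs_def])
qed

text \<open>Positivity is an open condition and would not survive the limit to the special orbits.
  The bound against \<open>g0\<close> is closed, and \<open>g0\<close> is positive there as
  well.\<close>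

lemma g_ge:
 obtains C where "C > 0" "!!p u. p:pts M ==> u:Tan M p ==> C*g0 p u u <= g p u u"
proof -
 obtain C where C: "C > 0" "C <= 1" "!!t. 0 < t ==> t < 1 ==> C*h0 t <= h t & C*h t <= h0 t"
  "!!t i. i:{2..m} ==> t:{0..1} ==> C*(b i*t + a0 i) <= b i*t + a i" by (rule profile_bound[OF pf pf0]) blast
 have W: "C*g0 p u u <= g p u u" if p: "p:W" and u: "u:Tan M p" for p u
 proof -
  note x01 = W01[OF p]
  have G: "gb i p u u >= 0" if i: "i:{1..m}" for i
  proof -
   have y: "pr (q p) i:pts (N i)" using prq_lsm[OF p i] unfolding lsm_def by blast
   have kN: "kaehler (N i) (gN i) (JN i)" using factors[OF i] by blast
   note f = kaehler_facts[OF kN mN[OF i] y]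
   show ?thesis
   proof (cases "base i p u = (%_. 0)")
    case True
    have "gN i (pr (q p) i) (lincomb 0 (base i p u) 0 (base i p u)) (base i p u) = 0" using f(1) base_tangent[OF p i u] unfolding tbil_def tlin_def by simp
    thus ?thesis using True by (simp add: lincomb_def)
   qed (use f(7)[OF base_tangent[OF p i u]] in force)
  qed
  have A: "C*(b i*x p + a0 i) <= b i*x p + a i" if "i:{1..m}" for i
  proof (cases "i = 1")
   case True
   have "b 1*x p >= 0" using b_first x01 by simp
   thus ?thesis using True a1 C(2) mult_right_mono[of C 1 "b 1*x p"] by simp
  next
   case False
   thus ?thesis using that C(4)[of i "x p"] x01 by auto
  qed
  have "C*(SUM i=1..m. (b i*x p + a0 i)*gb i p u u) <= (SUM i=1..m. (b i*x p + a i)*gb i p u u)"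
   unfolding sdl mult.assoc[symmetric] by (intro sum_mono mult_right_mono A G)
  moreover have "C*(u x*u x/h0 (x p)) <= u x*u x/h (x p)"
  proof -
   have "C/h0 (x p) <= 1/h (x p)" using C(3)[OF x01] hpos[OF p] by (simp add: field_simps)
   from mult_right_mono[OF this, of "u x*u x"] show ?thesis by simp
  qed
  moreover have "C*(h0 (x p) * vert p u * vert p u) <= h (x p) * vert p u * vert p u"
   using mult_right_mono[of "C*h0 (x p)" "h (x p)" "vert p u * vert p u"] C(3)[OF x01] by (simp add: mult.assoc)
  ultimately show ?thesis unfolding gW[OF p u u] g0W[OF p u u] by (simp only: distrib_left)
 qed
 have "C*g0 p u u <= g p u u" if p: "p:pts M" and u: "u:Tan M p" for p u
 proof -
  obtain c where c: "c:atlas M" "p:fst c" using mfd_cover[OF mM p] by blast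
  note S = mfd_chart(3)[OF mM c(1)]
  \<comment> \<open>The components of \<open>u\<close> at \<open>p\<close> are kept fixed over the
    whole chart, which turns the inequality into one for a smooth function of the chart
    point.\<close>
  define xx where "xx = (%k. u (%q. snd c q k))"
  have ut: "u = tvec M c p xx" unfolding xx_def by (rule tangent_eq_tvec[OF mM u c])
  define f where "f v = (SUM k:idx M. SUM l:idx M. xx k*xx l*(gcomp M c g k l v - C*gcomp M c g0 k l v))" for v
  have f: "f (snd c r) = g r (tvec M c r xx) (tvec M c r xx) - C*g0 r (tvec M c r xx) (tvec M c r xx)" if r: "r:fst c" for r
  proof -
   have rM: "r:pts M" using mfd_chart(2)[OF mM c(1)] r by blast
   show ?thesis unfolding f_def tbil_expand[OF mM c(1) r g_tbil[OF rM]] tbil_expand[OF mM c(1) r kf0(1)[OF rM]] gcomp_def cinv_chart[OF mM c(1) r]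
    by (simp add: sdl sum_subtractf[symmetric] alg)
  qed
  have g0: "smo M (img c) (gcomp M c g0 i j)" if "i:idx M" "j:idx M" for i j using K0 c(1) that unfolding kaehler_def riemannian_def by blast
  have sf: "smo M (img c) f" unfolding f_def by (intro smooth_sum[OF S] smooth_mult[OF S] smooth_diff[OF S] smooth_const[OF S] g_smooth[OF c(1)] g0)
  have "f v:{0..}" if "v:snd c ` (W Int fst c)" for v
  proof -
   obtain r where r: "r:W" "r:fst c" "v = snd c r" using \<open>v:_\<close> by blast
   show ?thesis using W[OF r(1) tvec_tangent[OF mM c(1) r(2)], of xx] f[OF r(2)] r(3) by simp
  qed
  from W_dense[OF c(1) sf closed_real_atLeast this, of "snd c p"] c(2) f[OF c(2)] ut show ?thesis by simp
 qed
 thus ?thesis using that C(1) by blast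
qed

lemma g_riem: "riemannian M g" unfolding riemannian_def
proof (intro conjI ballI impI allI)
 fix p u v assume p: "p:pts M" and u: "u:Tan M p" "v:Tan M p"
 show "g p u v = g p v u" by (rule g_sym[OF p u])
 obtain C where C: "C > 0" "!!p u. p:pts M ==> u:Tan M p ==> C*g0 p u u <= g p u u" by (rule g_ge) blast
 show "g p u u > 0" if "u ~= (%_. 0)" using C(2)[OF p u(1)] mult_pos_pos[OF C(1) kaehler_facts(7)[OF K0 mM p u(1) that]] by linarith
 show "g p (lincomb r u s w) v = r*g p u v + s*g p w v" if "w:Tan M p" for w r s using g_tbil[OF p] u that unfolding tbil_def tlin_def by blast
qed (rule g_smooth)

end

section \<open>Integrability of the complex structure\<close>

definition nij :: "'k set=>('k=>'k=>('k=>real)=>real)=>'k=>'k=>'k=>('k=>real)=>real" where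
 "nij I J i j k v = (SUM l:I. J l j v * pd l (J i k) v - J l k v * pd l (J i j) v - J i l v * (pd j (J l k) v - pd k (J l j) v))"

lemma nijenhuis_eq: "nijenhuis M c J = nij (idx M) (jcomp M c J)" by (simp add: fun_eq_iff nijenhuis_def nij_def)

text \<open>
  Invariantly: \<open>d\<gamma>(Ju,v) + d\<gamma>(u,Jv) + d\<beta>(u,v) - d\<beta>(Ju,Jv)\<close> for the one-forms \<open>\<beta>\<close> (\<open>bt\<close>) and
  \<open>\<gamma> = \<beta> \<circ> J\<close> (\<open>ga\<close>).
\<close>

lemma nij_form:
 assumes fin: "finite I" and S: "opn I S"
  and J: "!!i j. i:I ==> j:I ==> smooth_on I S (J i j)"
  and JJ: "!!v i j. v:S ==> i:I ==> j:I ==> (SUM l:I. J i l v * J l j v) = (if i = j then - 1 else 0)"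
  and bt: "!!i. i:I ==> smooth_on I S (bt i)"
  and ga: "!!v k. v:S ==> k:I ==> ga k v = (SUM i:I. bt i v * J i k v)"
  and v: "v:S" and jk: "j:I" "k:I"
 shows "(SUM i:I. bt i v * nij I J i j k v) = (SUM l:I. J l j v * (pd l (ga k) v - pd k (ga l) v)) + (SUM l:I. J l k v * (pd j (ga l) v - pd l (ga j) v))
  + (pd j (bt k) v - pd k (bt j) v) - (SUM l:I. SUM i:I. J l j v * J i k v * (pd l (bt i) v - pd i (bt l) v))" (is "?L = _")
proof -
 have sga: "smooth_on I S (ga k)" if "k:I" for k by (rule smooth_cong[OF S ga[OF _ that, symmetric]]) (auto intro!: smooth_sum[OF S] smooth_mult[OF S] bt J that)
 have pdga: "(SUM i:I. bt i v * pd l (J i k) v) = pd l (ga k) v - (SUM i:I. pd l (bt i) v * J i k v)" if "l:I" "k:I" for l k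
 proof -
  have "pd l (ga k) v = pd l (%v. SUM i:I. bt i v * J i k v) v" by (rule pd_cong[OF S that(1) v]) (rule ga[OF _ that(2)])
  also have "... = (SUM i:I. pd l (%v. bt i v * J i k v) v)" using that by (intro pd_sum[OF S _ _ v] smooth_mult[OF S] bt J)
  also have "... = (SUM i:I. pd l (bt i) v * J i k v + bt i v * pd l (J i k) v)" using that by (intro sum.cong refl pd_mult[OF S _ _ _ v] bt J)
  finally show ?thesis by (simp add: sum.distrib)
 qed
 have gJ: "(SUM l:I. ga l w*J l k w) = - bt k w" (is "?L1 = _") if "w:S" "k:I" for w k
 proof -
  have "?L1 = (SUM l:I. SUM i:I. bt i w*(J i l w*J l k w))" using ga[OF that(1)] by (simp add: sdr mult.assoc)
  also have "... = (SUM i:I. bt i w*(SUM l:I. J i l w*J l k w))" unfolding sdl by (rule sum.swap)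
  also have "... = (SUM i:I. - bt i w*(if i = k then 1 else 0))" using JJ[OF that(1) _ that(2)] by (intro scr) simp
  also have "... = - bt k w" by (rule sum_dm(4)[OF fin that(2)])
  finally show ?thesis .
 qed
 have pdJ: "(SUM l:I. ga l v * pd j (J l k) v) = - pd j (bt k) v - (SUM l:I. pd j (ga l) v * J l k v)" if "j:I" "k:I" for j k
 proof -
  have "- pd j (bt k) v = pd j (%v. - bt k v) v" by (rule pd_minus[OF S bt[OF that(2)] that(1) v, symmetric])
  also have "... = pd j (%v. SUM l:I. ga l v * J l k v) v" by (rule pd_cong[OF S that(1) v]) (rule gJ[OF _ that(2), symmetric])
  also have "... = (SUM l:I. pd j (%v. ga l v * J l k v) v)" using that by (intro pd_sum[OF S _ _ v] smooth_mult[OF S] sga J)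
  also have "... = (SUM l:I. pd j (ga l) v * J l k v + ga l v * pd j (J l k) v)" using that by (intro sum.cong refl pd_mult[OF S _ _ _ v] sga J)
  finally show ?thesis by (simp add: sum.distrib)
 qed
 have "?L = (SUM i:I. SUM l:I. J l j v * (bt i v * pd l (J i k) v) - J l k v * (bt i v * pd l (J i j) v) - bt i v * J i l v * (pd j (J l k) v - pd k (J l j) v))"
  unfolding nij_def sdl by (intro scr) (simp add: alg)
 also have "... = (SUM l:I. J l j v * (SUM i:I. bt i v * pd l (J i k) v) - J l k v * (SUM i:I. bt i v * pd l (J i j) v) - (SUM i:I. bt i v * J i l v)*(pd j (J l k) v - pd k (J l j) v))"
  by (subst sum.swap) (simp only: sum_subtractf sdl sdr)
 also have "... = (SUM l:I. J l j v * (pd l (ga k) v - (SUM i:I. pd l (bt i) v * J i k v))) - (SUM l:I. J l k v * (pd l (ga j) v - (SUM i:I. pd l (bt i) v * J i j v)))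
   - ((SUM l:I. ga l v * pd j (J l k) v) - (SUM l:I. ga l v * pd k (J l j) v))" using pdga jk ga[OF v] by (simp add: sum_subtractf right_diff_distrib)
 also have "(SUM l:I. J l j v * (pd l (ga k) v - (SUM i:I. pd l (bt i) v * J i k v))) = (SUM l:I. J l j v * pd l (ga k) v) - (SUM l:I. SUM i:I. J l j v * J i k v * pd l (bt i) v)"
  by (simp add: right_diff_distrib sum_subtractf sdl mult_ac)
 also have "(SUM l:I. J l k v * (pd l (ga j) v - (SUM i:I. pd l (bt i) v * J i j v))) = (SUM l:I. J l k v * pd l (ga j) v) - (SUM l:I. SUM i:I. J l j v * J i k v * pd i (bt l) v)"
  by (simp add: right_diff_distrib sum_subtractf sdl, subst (2) sum.swap) (simp add: mult_ac)
 finally show ?thesis unfolding pdJ[OF jk] pdJ[OF jk(2,1)] by (simp add: right_diff_distrib sum_subtractf mult.commute)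
qed

locale orbit_complex = orbit_metric +
 assumes aJ: "almost_complex M J"
begin

lemma Jf: "p:pts M ==> u:Tan M p ==> J p u:Tan M p" "p:pts M ==> u:Tan M p ==> J p (J p u) = (%f. - u f)"
 "p:pts M ==> u:Tan M p ==> w:Tan M p ==> J p (lincomb r u s w) = lincomb r (J p u) s (J p w)" using aJ unfolding almost_complex_def by blast+

lemma JW: "p:W ==> u:Tan M p ==> vert p (J p u) = u x/h (x p)"
 "p:W ==> u:Tan M p ==> J p u x = - h (x p) * vert p u"
 "p:W ==> u:Tan M p ==> i:{1..m} ==> base i p (J p u) = JN i (pr (q p) i) (base i p u)" using mf unfolding metric_form_def Let_def vert_def base_def W_def by blast+

definition Jc where "Jc = jcomp M c J"

lemma sm_Jc: "i:idx M ==> j:idx M ==> smo M S (Jc i j)"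
proof -
 assume "i:idx M" "j:idx M"
 hence "smo M (img c) (Jc i j)" unfolding Jc_def using aJ c unfolding almost_complex_def by blast
 thus ?thesis by (rule smooth_subset[OF mfd_chart(3)[OF mM c]]) (use S_facts(5) in blast)
qed

lemma J_cvec: "v:S ==> k:idx M ==> J (cinv c v) (cvec M c (cinv c v) k) = tvec M c (cinv c v) (%i. Jc i k v)"
 using endo_cvec[where J = J, OF mM c S_facts(2) Jf(1)[OF S_facts(4)]] S_facts(3) by (simp add: Jc_def)

lemma cvec_facts:
 assumes v: "v:S" and k: "k:idx M" shows "cvec M c (cinv c v) k:Tan M (cinv c v)" (is ?A) "cvec M c (cinv c v) k x = X k v" (is ?B) "vert (cinv c v) (cvec M c (cinv c v) k) = tu k v" (is ?C)
  "i:{1..m} ==> base i (cinv c v) (cvec M c (cinv c v) k) = tvN i v (%l. pd k (F i l) v)" (is "PROP ?D")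
proof -
 have ct: "cvec M c (cinv c v) k = tvec M c (cinv c v) (%j. if j = k then 1 else 0)" by (rule cvec_tvec[OF mM k])
 show ?A by (rule cvec_tangent[OF mM c S_facts(2)[OF v] k])
 show ?B unfolding ct tvec_x[OF v] sum_dm(2)[OF finM k] ..
 show ?C by (simp add: tu_def)
 show "PROP ?D"
  unfolding ct by (subst tvec_base[OF v]) (simp_all only: sum_dm(2)[OF finM k])
qed

lemma JJc: "v:S ==> i:idx M ==> j:idx M ==> (SUM l:idx M. Jc i l v * Jc l j v) = (if i = j then - 1 else 0)"
proof -
 assume v: "v:S" and ij: "i:idx M" "j:idx M"
 let ?p = "cinv c v"
 note p = S_facts[OF v]
 have tl: "tlin M ?p (%u. J ?p u (%q. snd c q i))" unfolding tlin_def by (auto simp: Jf(3)[OF p(4)]) (simp add: lincomb_def)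
 have "J ?p (J ?p (cvec M c ?p j)) (%q. snd c q i) = (SUM l:idx M. Jc l j v * J ?p (cvec M c ?p l) (%q. snd c q i))"
  unfolding J_cvec[OF v ij(2)] by (rule tlin_expand[OF mM c p(2) tl])
 hence "(SUM l:idx M. Jc i l v * Jc l j v) = J ?p (J ?p (cvec M c ?p j)) (%q. snd c q i)" by (simp add: Jc_def jcomp_def mult.commute)
 also have "... = - cvec M c ?p j (%q. snd c q i)" using Jf(2)[OF p(4) cvec_facts(1)[OF v ij(2)]] by simp
 also have "... = (if i = j then - 1 else 0)" using tvec_crd[OF mM c p(2) ij(1)] by (simp add: cvec_tvec[OF mM ij(2)])
 finally show ?thesis .
qed

lemma X_J: "v:S ==> k:idx M ==> (SUM i:idx M. X i v * Jc i k v) = - hD 0 v * tu k v"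
 and tu_J: "v:S ==> k:idx M ==> (SUM i:idx M. tu i v * Jc i k v) = X k v/hD 0 v"
proof -
 assume v: "v:S" and k: "k:idx M"
 show "(SUM i:idx M. X i v * Jc i k v) = - hD 0 v * tu k v" "(SUM i:idx M. tu i v * Jc i k v) = X k v/hD 0 v" using JW(1,2)[OF S_facts(1)[OF v] cvec_facts(1)[OF v k]]
  unfolding J_cvec[OF v k] tvec_x[OF v] tvec_vert[OF v] cvec_facts(2,3)[OF v k] hD0(1)[OF v] by (simp_all add: mult.commute)
qed

lemma F_J:
 assumes v: "v:S" and k: "k:idx M" and n: "n:{1..m}" and l: "l:idx (N n)"
 shows "(SUM i:idx M. pd i (F n l) v * Jc i k v) = (SUM r:idx (N n). cJ n l r (FF n v)*pd k (F n r) v)"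
proof -
 let ?p = "cinv c v" and ?y = "pr (q (cinv c v)) n"
 have y: "?y:fst (e n)" "?y:pts (N n)" using e(2)[OF v n] mfd_chart(2)[OF mN[OF n] e(1)[OF n]] by auto
 note kf = kaehler_facts[OF kN[OF n] mN[OF n] y(2)]
 have tl: "tlin (N n) ?y (%u. JN n ?y u (%q. snd (e n) q l))" unfolding tlin_def by (auto simp: kf(5)) (simp add: lincomb_def)
 have "(SUM i:idx M. Jc i k v * pd i (F n l) v) = base n ?p (J ?p (cvec M c ?p k)) (%q. snd (e n) q l)"
  unfolding J_cvec[OF v k] tvec_base[OF v n] by (rule tvec_crd[OF mN[OF n] e(1)[OF n] y(1) l, symmetric])
 also have "... = JN n ?y (tvec (N n) (e n) ?y (%r. pd k (F n r) v)) (%q. snd (e n) q l)"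
  unfolding JW(3)[OF S_facts(1)[OF v] cvec_facts(1)[OF v k] n] cvec_facts(4)[OF v k n] ..
 also have "... = (SUM r:idx (N n). pd k (F n r) v * JN n ?y (cvec (N n) (e n) ?y r) (%q. snd (e n) q l))" by (rule tlin_expand[OF mN[OF n] e(1)[OF n] y(1) tl])
 finally show ?thesis by (simp add: jcomp_def FF_cinv[OF v n] mult.commute)
qed

definition dtu' where "dtu' i j v = pd i (tu j) v - pd j (tu i) v"

text \<open>The curvature of the connection form is a combination of pulled back Kaehler forms, and
  these are invariant under the complex structures of the factors, to which \<open>J\<close>
  projects.\<close>

lemma dtu_J: "v:S ==> j:idx M ==> k:idx M ==> (SUM l:idx M. Jc l j v * dtu' l k v) + (SUM l:idx M. Jc l k v * dtu' j l v) = 0"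
proof -
 assume v: "v:S" and jk: "j:idx M" "k:idx M"
 let ?p = "cinv c v" and ?C = "%i. cvec M c (cinv c v) i"
 let ?w = "%i. kform (gN i) (JN i) (pr (q ?p) i)"
 let ?w' = "%u w. SUM i=1..m. b i*?w i (base i ?p u) (base i ?p w)"
 note p = S_facts[OF v]
 have y: "pr (q ?p) i:pts (N i)" if "i:{1..m}" for i using e(2)[OF v that] mfd_chart(2)[OF mN[OF that] e(1)[OF that]] by blast
 have "tbil M ?p (%u w. ?w i (base i ?p u) (base i ?p w))" if i: "i:{1..m}" for i
  using kaehler_facts(2)[OF kN[OF i] mN[OF i] y[OF i]] base_tangent[OF p(1) i] unfolding tbil_def tlin_def base_lincomb by auto
 hence tb: "tbil M ?p ?w'" unfolding tbil_def tlin_def by (auto simp: sdl sum.distrib[symmetric] alg intro!: sum.cong)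
 have t1: "tlin M ?p (%u. ?w' u w)" "tlin M ?p (?w' w)" if "w:Tan M ?p" for w using tb that unfolding tbil_def by auto
 have "(SUM l:idx M. Jc l j v * dtu' l k v) = (SUM l:idx M. Jc l j v * ?w' (?C l) (?C k))" using dtu[OF v _ jk(2)] by (intro scr) (simp add: dtu'_def)
 also have "... = ?w' (J ?p (?C j)) (?C k)" unfolding J_cvec[OF v jk(1)] by (rule tlin_expand[OF mM c p(2) t1(1)[OF cvec_facts(1)[OF v jk(2)]], symmetric])
 finally have 1: "(SUM l:idx M. Jc l j v * dtu' l k v) = ?w' (J ?p (?C j)) (?C k)" .
 have "(SUM l:idx M. Jc l k v * dtu' j l v) = (SUM l:idx M. Jc l k v * ?w' (?C j) (?C l))" using dtu[OF v jk(1)] by (intro scr) (simp add: dtu'_def)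
 also have "... = ?w' (?C j) (J ?p (?C k))" unfolding J_cvec[OF v jk(2)] by (rule tlin_expand[OF mM c p(2) t1(2)[OF cvec_facts(1)[OF v jk(1)]], symmetric])
 finally have 2: "(SUM l:idx M. Jc l k v * dtu' j l v) = ?w' (?C j) (J ?p (?C k))" .
 have "?w i (base i ?p (J ?p (?C j))) (base i ?p (?C k)) = - ?w i (base i ?p (?C j)) (base i ?p (J ?p (?C k)))" if i: "i:{1..m}" for i
 proof -
  note kf = kaehler_facts[OF kN[OF i] mN[OF i] y[OF i]]
  let ?u = "base i ?p (?C j)" and ?z = "base i ?p (?C k)"
  have u: "?u:Tan (N i) (pr (q ?p) i)" "?z:Tan (N i) (pr (q ?p) i)" by (rule base_tangent[OF p(1) i cvec_facts(1)[OF v]]; fact)+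
  have "(%f. - ?u f) = lincomb (-1) ?u 0 ?u" by (simp add: lincomb_def)
  hence "gN i (pr (q ?p) i) (%f. - ?u f) ?z = - gN i (pr (q ?p) i) ?u ?z" using kf(1) u unfolding tbil_def tlin_def by simp
  thus ?thesis unfolding JW(3)[OF p(1) cvec_facts(1)[OF v jk(1)] i] JW(3)[OF p(1) cvec_facts(1)[OF v jk(2)] i] kform_def kf(4)[OF u(1)] kf(8)[OF u] .
 qed
 thus ?thesis unfolding 1 2 by (simp add: sum.distrib[symmetric])
qed

lemma dtu_JJ: "v:S ==> j:idx M ==> k:idx M ==> (SUM l:idx M. SUM i:idx M. Jc l j v * Jc i k v * dtu' l i v) = dtu' j k v"
proof -
 assume v: "v:S" and jk: "j:idx M" "k:idx M"
 have "(SUM l:idx M. SUM i:idx M. Jc l j v * Jc i k v * dtu' l i v) = (SUM l:idx M. Jc l j v * (SUM i:idx M. Jc i k v * dtu' l i v))" by (simp add: sdl mult.assoc)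
 also have "... = (SUM l:idx M. Jc l j v * - (SUM i:idx M. Jc i l v * dtu' i k v))"
  using dtu_J[OF v _ jk(2)] by (intro sum.cong refl arg_cong2[where f = "(*)"]) (simp add: eq_neg_iff_add_eq_0 add.commute)
 also have "... = - (SUM i:idx M. SUM l:idx M. Jc i l v * Jc l j v * dtu' i k v)" by (subst sum.swap) (simp add: sdl sum_negf mult_ac)
 also have "... = - (SUM i:idx M. (if i = j then - 1 else 0)*dtu' i k v)" using JJc[OF v _ jk(1)] by (simp flip: sdr)
 also have "... = (SUM i:idx M. (if i = j then 1 else 0)*dtu' i k v)" unfolding sum_negf[symmetric] by (intro scr) simp
 also have "... = dtu' j k v" by (rule sum_dm(2)[OF finM jk(1)])
 finally show ?thesis .
qed

text \<open>For the one-form \<open>dx\<close> the companion \<open>ga\<close> is \<open>- h\<close>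
  times the connection form. In \<open>nij_form\<close> the terms with the derivative of
  \<open>h\<close> cancel each other, and the curvature terms cancel by
  \<open>dtu_J\<close>.\<close>

lemma nij_X:
 assumes v: "v:S" and jk: "j:idx M" "k:idx M" shows "(SUM i:idx M. X i v * nij (idx M) Jc i j k v) = 0"
proof -
 let ?I = "idx M"
 define ga where "ga k v = - hD 0 v * tu k v" for k v
 have pga: "pd l (ga k) v = - hD 1 v * X l v * tu k v - hD 0 v * pd l (tu k) v" if "l:?I" "k:?I" for l k
  using pd_mult[OF S(1) smooth_minus[OF S(1) sm_hD] smtu[OF that(2)] that(1) v, of 0] pd_minus[OF S(1) sm_hD that(1) v, of 0] pd_hD[OF that(1) v, of 0]
  by (simp add: ga_def[abs_def])
 have sX: "pd i (X j) v = pd j (X i) v" if "i:?I" "j:?I" for i j unfolding X_def using pd_swap[OF finM S(1) sm_x that v] by simp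
 have h: "hD 0 v ~= 0" using hD0(2)[OF v] by simp
 have dga: "pd l (ga k) v - pd k (ga l) v = - hD 1 v * (X l v * tu k v - X k v * tu l v) - hD 0 v * dtu' l k v" if "l:?I" "k:?I" for l k
  unfolding pga[OF that] pga[OF that(2,1)] dtu'_def by (simp add: alg)
 have e1: "(SUM l:?I. Jc l j v * (pd l (ga k) v - pd k (ga l) v)) = - hD 1 v * ((- hD 0 v * tu j v)*tu k v - X k v * (X j v/hD 0 v)) - hD 0 v * (SUM l:?I. Jc l j v * dtu' l k v)" (is "?L = _")
 proof -
  have "?L = (SUM l:?I. Jc l j v * (- hD 1 v * (X l v * tu k v - X k v * tu l v) - hD 0 v * dtu' l k v))" using dga[OF _ jk(2)] by (intro scr) simp
  thus ?thesis unfolding X_J[OF v jk(1), symmetric] tu_J[OF v jk(1), symmetric] by (simp add: sdl sdr sum_subtractf[symmetric] sum.distrib[symmetric] alg)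
 qed
 have e2: "(SUM l:?I. Jc l k v * (pd j (ga l) v - pd l (ga j) v)) = - hD 1 v * (X j v * (X k v/hD 0 v) - (- hD 0 v * tu k v)*tu j v) - hD 0 v * (SUM l:?I. Jc l k v * dtu' j l v)" (is "?L = _")
 proof -
  have "?L = (SUM l:?I. Jc l k v * (- hD 1 v * (X j v * tu l v - X l v * tu j v) - hD 0 v * dtu' j l v))" using dga[OF jk(1)] by (intro scr) simp
  thus ?thesis unfolding X_J[OF v jk(2), symmetric] tu_J[OF v jk(2), symmetric] by (simp add: sdl sdr sum_subtractf[symmetric] sum.distrib[symmetric] alg)
 qed
 have "(SUM i:?I. X i v * nij ?I Jc i j k v) = (SUM l:?I. Jc l j v * (pd l (ga k) v - pd k (ga l) v)) + (SUM l:?I. Jc l k v * (pd j (ga l) v - pd l (ga j) v))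
  + (pd j (X k) v - pd k (X j) v) - (SUM l:?I. SUM i:?I. Jc l j v * Jc i k v * (pd l (X i) v - pd i (X l) v))"
  by (rule nij_form[OF finM S(1) sm_Jc JJc sm_X _ v jk]) (simp_all add: X_J ga_def)
 also have "... = - hD 0 v * ((SUM l:?I. Jc l j v * dtu' l k v) + (SUM l:?I. Jc l k v * dtu' j l v))" unfolding e1 e2 using sX jk by (simp add: alg)
 finally show ?thesis using dtu_J[OF v jk] by simp
qed

text \<open>The companion of the connection form is \<open>dx / h\<close>, which is closed. What
  remains is the invariance of the curvature under \<open>J\<close>, that is
  \<open>dtu_JJ\<close>.\<close>

lemma nij_tu:
 assumes v: "v:S" and jk: "j:idx M" "k:idx M" shows "(SUM i:idx M. tu i v * nij (idx M) Jc i j k v) = 0"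
proof -
 let ?I = "idx M"
 define ga where "ga k v = inverse (hD 0 v)*X k v" for k v
 have h: "hD 0 v ~= 0" if "v:S" for v using hD0(2)[OF that] by simp
 have pga: "pd l (ga k) v = pd l (%v. inverse (hD 0 v)) v * X k v + inverse (hD 0 v)*pd l (X k) v" if "l:?I" "k:?I" for l k
  using pd_mult[OF S(1) smooth_inverse[OF S(1) sm_hD h] sm_X[OF that(2)] that(1) v] by (simp add: ga_def[abs_def])
 have pi: "pd l (%v. inverse (hD 0 v)) v = - inverse ((hD 0 v)\<^sup>2)*pd l (hD 0) v" if "l:?I" for l
  by (rule pd_comp_fun[OF S(1) sm_hD that v]) (use DERIV_inverse[OF h[OF v]] in \<open>simp add: numeral_2_eq_2\<close>)
 have sX: "pd i (X j) v = pd j (X i) v" if "i:?I" "j:?I" for i j unfolding X_def using pd_swap[OF finM S(1) sm_x that v] by simp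
 have dga: "pd l (ga k) v - pd k (ga l) v = 0" if "l:?I" "k:?I" for l k
  unfolding pga[OF that] pga[OF that(2,1)] pi[OF that(1)] pi[OF that(2)] sX[OF that] by (simp add: pd_hD[OF _ v] that)
 have "(SUM i:?I. tu i v * nij ?I Jc i j k v) = (SUM l:?I. Jc l j v * (pd l (ga k) v - pd k (ga l) v)) + (SUM l:?I. Jc l k v * (pd j (ga l) v - pd l (ga j) v))
  + (pd j (tu k) v - pd k (tu j) v) - (SUM l:?I. SUM i:?I. Jc l j v * Jc i k v * (pd l (tu i) v - pd i (tu l) v))"
  by (rule nij_form[OF finM S(1) sm_Jc JJc smtu _ v jk]) (simp_all add: tu_J ga_def divide_inverse mult.commute)
 thus ?thesis using dga jk dtu_JJ[OF v jk] by (simp add: dtu'_def)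
qed

text \<open>For a coordinate of a factor both one-forms are pulled back from the factor, so the
  expression reduces to the Nijenhuis tensor there.\<close>

lemma nij_F:
 assumes v: "v:S" and jk: "j:idx M" "k:idx M" and n: "n:{1..m}" and l: "l:idx (N n)" shows "(SUM i:idx M. pd i (F n l) v * nij (idx M) Jc i j k v) = 0"
proof -
 let ?I = "idx M" and ?K = "idx (N n)" and ?y = "FF n v"
 define jN where "jN = cJ n"
 have sj: "smooth_on ?K (cV n) (jN r s)" if "r:?K" "s:?K" for r s unfolding jN_def by (rule smJN[OF n that])
 define ga where "ga k v = (SUM r:?K. jN l r (FF n v)*pd k (F n r) v)" for k v
 define Dl where "Dl r s = pd r (jN l s) ?y - pd s (jN l r) ?y" for r s
 have sjF: "smooth_on ?I S (%v. jN l r (FF n v))" if "r:?K" for r by (rule sm_FF[OF n sj[OF l that]])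
 have pga: "pd i (ga k) v = (SUM r:?K. SUM s:?K. pd s (jN l r) ?y*pd i (F n s) v * pd k (F n r) v) + (SUM r:?K. jN l r ?y*pd i (pd k (F n r)) v)" if "i:?I" "k:?I" for i k
 proof -
  have "pd i (ga k) v = (SUM r:?K. pd i (%v. jN l r (FF n v)*pd k (F n r) v) v)"
   unfolding ga_def[abs_def] using that by (intro pd_sum[OF S(1) _ _ v] smooth_mult[OF S(1)] sjF smooth_on_pd smF[OF n])
  also have "... = (SUM r:?K. pd i (%v. jN l r (FF n v)) v * pd k (F n r) v + jN l r ?y*pd i (pd k (F n r)) v)"
   using that by (intro sum.cong refl pd_mult[OF S(1) _ _ _ v] sjF smooth_on_pd smF[OF n])
  also have "... = (SUM r:?K. (SUM s:?K. pd s (jN l r) ?y*pd i (F n s) v)*pd k (F n r) v + jN l r ?y*pd i (pd k (F n r)) v)"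
   using pd_FF[OF n sj[OF l] that(1) v] by (intro scr) simp
  finally show ?thesis by (simp add: sum.distrib sdr)
 qed
 have dga: "pd i (ga k) v - pd k (ga i) v = (SUM r:?K. SUM s:?K. Dl r s*pd i (F n r) v * pd k (F n s) v)" (is "?L = _") if "i:?I" "k:?I" for i k
 proof -
  have "pd i (pd k (F n r)) v = pd k (pd i (F n r)) v" if "r:?K" for r by (rule pd_swap[OF finM S(1) smF[OF n that] \<open>i:?I\<close> \<open>k:?I\<close> v])
  hence "?L = (SUM s:?K. SUM r:?K. pd r (jN l s) ?y*pd i (F n r) v * pd k (F n s) v) - (SUM r:?K. SUM s:?K. pd s (jN l r) ?y*pd k (F n s) v * pd i (F n r) v)"
   using pga[OF that] pga[OF that(2,1)] by simp
  also have "(SUM s:?K. SUM r:?K. pd r (jN l s) ?y*pd i (F n r) v * pd k (F n s) v) = (SUM r:?K. SUM s:?K. pd r (jN l s) ?y*pd i (F n r) v * pd k (F n s) v)" by (rule sum.swap)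
  finally show ?thesis unfolding Dl_def by (simp add: sum_subtractf[symmetric] alg)
 qed
 \<comment> \<open>\<open>nij_form\<close> on the factor, with the differential of the coordinate
   \<open>l\<close> as one-form, reads the vanishing of the Nijenhuis tensor as this
   identity.\<close>
 have zero: "(SUM r:?K. jN r s ?y*Dl r t) + (SUM r:?K. jN r t ?y*Dl s r) = 0" if st: "s:?K" "t:?K" for s t
 proof -
  have y: "yN n v:fst (e n)" "?y:cV n" using e(2)[OF v n] FF_rn[OF v n] by auto
  have jj: "(SUM l:?K. jN i l w*jN l j w) = (if i = j then - 1 else 0)" if "w:cV n" "i:?K" "j:?K" for w i j
   using kaehler_comp(3)[OF mN[OF n] kN[OF n] e(1)[OF n] chart_cinv(2)[OF mN[OF n] that(1)] that(2,3)] chart_cinv(1)[OF mN[OF n] that(1)] by (simp add: jN_def)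
  have "(SUM i:?K. (if i = l then 1 else 0)*nij ?K jN i s t ?y) = (SUM r:?K. jN r s ?y*(pd r (jN l t) ?y - pd t (jN l r) ?y)) + (SUM r:?K. jN r t ?y*(pd s (jN l r) ?y - pd r (jN l s) ?y))
   + (pd s (%_. if t = l then 1 else 0) ?y - pd t (%_. if s = l then 1 else 0) ?y) - (SUM r:?K. SUM i:?K. jN r s ?y*jN i t ?y*(pd r (%_. if i = l then 1 else 0) ?y - pd i (%_. if r = l then 1 else 0) ?y))"
   by (rule nij_form[where ga = "jN l" and bt = "%i _. if i = l then 1 else 0", OF mfd_fin[OF mN[OF n]] mfd_chart(3)[OF mN[OF n] e(1)[OF n]] sj jj smooth_const[OF mfd_chart(3)[OF mN[OF n] e(1)[OF n]]] _ y(2) st])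
    (simp_all only: sum_dm(2)[OF mfd_fin[OF mN[OF n]] l])
  moreover have "(SUM i:?K. (if i = l then 1 else 0)*nij ?K jN i s t ?y) = nij ?K jN l s t ?y" by (rule sum_dm(2)[OF mfd_fin[OF mN[OF n]] l])
  moreover have "nij ?K jN l s t ?y = 0" using kN[OF n] y(1) e(1)[OF n] l st unfolding kaehler_def complex_structure_def nijenhuis_eq jN_def FF_def by blast
  ultimately show ?thesis by (simp add: pd_const Dl_def)
 qed
 let ?f = "%i r. pd i (F n r) v"
 have FJ: "(SUM i:?I. ?f i r*Jc i k v) = (SUM s:?K. jN r s ?y*?f k s)" if "r:?K" "k:?I" for r k unfolding jN_def by (rule F_J[OF v that(2) n that(1)])
 have e1: "(SUM i:?I. Jc i j v * (pd i (ga k) v - pd k (ga i) v)) = (SUM s:?K. SUM t:?K. ?f j s*?f k t*(SUM r:?K. jN r s ?y*Dl r t))" (is "?L = _")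
 proof -
  have "?L = (SUM i:?I. SUM r:?K. SUM t:?K. Dl r t*?f k t*(?f i r*Jc i j v))" using dga[OF _ jk(2)] by (intro scr) (simp add: sdl mult_ac)
  also have "... = (SUM r:?K. SUM t:?K. Dl r t*?f k t*(SUM i:?I. ?f i r*Jc i j v))" unfolding sdl by (rule sum_rotate)
  also have "... = (SUM r:?K. SUM t:?K. SUM s:?K. ?f j s*?f k t*(jN r s ?y*Dl r t))" using FJ[OF _ jk(1)] by (intro scr) (simp add: sdl mult_ac)
  also have "... = (SUM s:?K. SUM r:?K. SUM t:?K. ?f j s*?f k t*(jN r s ?y*Dl r t))" by (rule sum_rotate[symmetric])
  also have "... = (SUM s:?K. SUM t:?K. SUM r:?K. ?f j s*?f k t*(jN r s ?y*Dl r t))" by (intro sum.cong refl sum.swap)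
  finally show ?thesis by (simp add: sdl)
 qed
 have e2: "(SUM i:?I. Jc i k v * (pd j (ga i) v - pd i (ga j) v)) = (SUM s:?K. SUM t:?K. ?f j s*?f k t*(SUM r:?K. jN r t ?y*Dl s r))" (is "?L = _")
 proof -
  have "?L = (SUM i:?I. SUM s:?K. SUM r:?K. Dl s r*?f j s*(?f i r*Jc i k v))" using dga[OF jk(1)] by (intro scr) (simp add: sdl mult_ac)
  also have "... = (SUM s:?K. SUM r:?K. Dl s r*?f j s*(SUM i:?I. ?f i r*Jc i k v))" unfolding sdl by (rule sum_rotate)
  also have "... = (SUM s:?K. SUM r:?K. SUM t:?K. ?f j s*?f k t*(jN r t ?y*Dl s r))" using FJ[OF _ jk(2)] by (intro scr) (simp add: sdl mult_ac)
  also have "... = (SUM s:?K. SUM t:?K. SUM r:?K. ?f j s*?f k t*(jN r t ?y*Dl s r))" by (intro sum.cong refl sum.swap)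
  finally show ?thesis by (simp add: sdl)
 qed
 have sF: "pd i (pd j (F n l)) v = pd j (pd i (F n l)) v" if "i:?I" "j:?I" for i j by (rule pd_swap[OF finM S(1) smF[OF n l] that v])
 have "(SUM i:?I. ?f i l*nij ?I Jc i j k v) = (SUM i:?I. Jc i j v * (pd i (ga k) v - pd k (ga i) v)) + (SUM i:?I. Jc i k v * (pd j (ga i) v - pd i (ga j) v))
  + (pd j (pd k (F n l)) v - pd k (pd j (F n l)) v) - (SUM r:?I. SUM i:?I. Jc r j v * Jc i k v * (pd r (pd i (F n l)) v - pd i (pd r (F n l)) v))"
  by (rule nij_form[where bt = "%i. pd i (F n l)", OF finM S(1) sm_Jc JJc smooth_on_pd[OF smF[OF n l]] _ v jk]) (simp_all add: F_J[OF _ _ n l] ga_def jN_def)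
 also have "... = (SUM s:?K. SUM t:?K. ?f j s*?f k t*((SUM r:?K. jN r s ?y*Dl r t) + (SUM r:?K. jN r t ?y*Dl s r)))"
  unfolding e1 e2 using sF jk by (simp add: distrib_left sum.distrib)
 finally show ?thesis using zero by simp
qed

lemma nijenhuis_W: "v:S ==> i:idx M ==> j:idx M ==> k:idx M ==> nijenhuis M c J i j k v = 0"
proof -
 assume v: "v:S" and I: "i:idx M" "j:idx M" "k:idx M"
 have "(SUM l:idx M. cof B l v * nij (idx M) Jc l j k v) = 0" if "B:bK K" for B
  by (rule casesA[OF that]) (simp_all add: cof_def nij_X[OF v I(2,3)] nij_tu[OF v I(2,3)] nij_F[OF v I(2,3) KD])
 thus ?thesis unfolding nijenhuis_eq Jc_def[symmetric] using fr.sum_expand[OF v I(1), of "%l. nij (idx M) Jc l j k v"] by simp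
qed

end

section \<open>The deformed structure is Kaehler\<close>

context new_metric begin

lemma J_sharp:
 assumes p: "p:pts M" and u: "u:Tan M p" shows "J p u:Tan M p" "w:Tan M p ==> g p (J p u) w = om p u w" (is "PROP ?A")
  "c:atlas M ==> p:fst c ==> k:idx M ==> J p u (%q. snd c q k) = (SUM l:idx M. ginv M c g k l (snd c p) * om p u (cvec M c p l))" (is "PROP ?B")
proof -
 have t: "tlin M p (om p u)" using om_tbil[OF p] u unfolding tbil_def by blast
 note s = sharp[OF mM g_riem p t]
 show "J p u:Tan M p" "PROP ?A"
  "PROP ?B" unfolding J_def by (rule s; assumption)+
qed

lemma J_lin:
 assumes p: "p:pts M" and u: "u:Tan M p" "w:Tan M p" shows "J p (lincomb r u s w) = lincomb r (J p u) s (J p w)"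
proof (rule riesz_unique[OF mM g_riem p])
 note l = tangent_lincomb[OF mM p]
 show "J p (lincomb r u s w):Tan M p" "lincomb r (J p u) s (J p w):Tan M p" by (intro J_sharp(1)[OF p] l u)+
 fix z assume z: "z:Tan M p"
 show "g p (J p (lincomb r u s w)) z = g p (lincomb r (J p u) s (J p w)) z" using om_tbil[OF p] g_tbil[OF p] J_sharp[OF p] u z l[OF u] unfolding tbil_def tlin_def by simp
qed

lemma W_eqI:
 assumes p: "p:W" and u: "u:Tan M p" "w:Tan M p" "u x = w x" "vert p u = vert p w"
  "!!i. i:{1..m} ==> base i p u = base i p w" shows "u = w" by (rule riesz_unique[OF mM g_riem W_pts[OF p] u(1,2)]) (simp add: gW[OF p] u cong: sum.cong_simp)

lemma pr_pts_N: "p:W ==> i:{1..m} ==> pr (q p) i:pts (N i)" using prq_lsm unfolding lsm_def by blast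

text \<open>A vector \<open>w\<close> with the expected components exists by \<open>surj\<close>. It
  represents the same linear form as \<open>J p v\<close>, so the nondegeneracy of \<open>g\<close>
  identifies the two.\<close>

lemma J_W:
 assumes p: "p:W" and v: "v:Tan M p" shows "vert p (J p v) = v x/h (x p)" (is ?A) "J p v x = - h (x p) * vert p v" (is ?B)
  "i:{1..m} ==> base i p (J p v) = JN i (pr (q p) i) (base i p v)" (is "PROP ?C")
proof -
 note pM = W_pts[OF p]
 have kN: "kaehler (N i) (gN i) (JN i)" if "i:{1..m}" for i using factors[OF that] by blast
 have JN: "JN i (pr (q p) i) (base i p v):Tan (N i) (pr (q p) i)" if i: "i:{1..m}" for i
  by (rule kaehler_facts(3)[OF kN[OF i] mN[OF i] pr_pts_N[OF p i] base_tangent[OF p i v]])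
 obtain w where w: "w:Tan M p" "w x = - h (x p) * vert p v" "vert p w = v x/h (x p)"
  "!!i. i:{1..m} ==> base i p w = JN i (pr (q p) i) (base i p v)"
  using surj[where w = "%i. JN i (pr (q p) i) (base i p v)" and xx = "- h (x p) * vert p v" and tu = "v x/h (x p)", OF p JN] by blast
 have "J p v = w"
 proof (rule riesz_unique[OF mM g_riem pM J_sharp(1)[OF pM v] w(1)])
  fix u assume u: "u:Tan M p"
  let ?G = "%i. gN i (pr (q p) i) (JN i (pr (q p) i) (base i p v)) (base i p u)"
  have wB: "wB i p v u = ?G i" if "i:{2..m}" for i unfolding wB_def pullback_def R_base[OF p that v] R_base[OF p that u] rh(2)[OF p that] kform_def ..
  have h: "h (x p) ~= 0" "h0 (x p) ~= 0" using hpos[OF p] by auto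
  have "g p w u = - vert p v * u x + v x * vert p u + (SUM i=1..m. (b i*x p + a i)*?G i)" unfolding gW[OF p w(1) u] using w(2-4) h by (simp cong: sum.cong_simp)
  moreover have "kform g0 J0 p v u = - vert p v * u x + v x * vert p u + (SUM i=1..m. (b i*x p + a0 i)*?G i)"
   unfolding kform_def g0W[OF p kf0(4)[OF pM v] u] using J0W[OF p v] h by (simp cong: sum.cong_simp)
  moreover have "(SUM i=2..m. (a i - a0 i)*wB i p v u) = (SUM i=2..m. (b i*x p + a i)*?G i) - (SUM i=2..m. (b i*x p + a0 i)*?G i)"
   using wB by (simp add: sum_subtractf[symmetric] alg)
  ultimately have "g p w u = om p v u" unfolding om_def sum_first[OF m_pos, of "%i. (b i*x p + a0 i)*?G i"] sum_first[OF m_pos, of "%i. (b i*x p + a i)*?G i"] a1 by simp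
  thus "g p (J p v) u = g p w u" using J_sharp(2)[OF pM v u] by simp
 qed
 thus ?A ?B
  "PROP ?C" using w by auto
qed

lemma new_metric_form: "mform h a g J" unfolding metric_form_def Let_def
proof (intro ballI impI conjI)
 fix p assume "p:pts M" "0 < x p & x p < 1"
 hence p: "p:W" unfolding W_def by blast
 fix u assume u: "u:Tan M p"
 show "g p u v = u x * v x/h (x p) + h (x p)*\<theta> (q p) (push P q p u)*\<theta> (q p) (push P q p v)
  + (SUM i=1..m. (b i*x p + a i)*gN i (pr (q p) i) (push (N i) (%p. pr (q p) i) p u) (push (N i) (%p. pr (q p) i) p v))" if v: "v:Tan M p" for v
  using gW[OF p u v] unfolding vert_def base_def .
 show "\<theta> (q p) (push P q p (J p u)) = u x/h (x p)" "J p u x = - h (x p)*\<theta> (q p) (push P q p u)"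
  "i:{1..m} ==> push (N i) (%p. pr (q p) i) p (J p u) = JN i (pr (q p) i) (push (N i) (%p. pr (q p) i) p u)" for i
  using J_W(1,2)[OF p u] J_W(3)[OF p u, of i] unfolding vert_def base_def by simp_all
qed

lemma jcomp_smooth:
 assumes c: "c:atlas M" and ij: "i:idx M" "j:idx M" shows "smo M (img c) (jcomp M c J i j)"
proof (rule smooth_cong[OF mfd_chart(3)[OF mM c]])
 note S = mfd_chart(3)[OF mM c]
 have gi: "smo M (img c) (ginv M c g i l)" if "l:idx M" for l
  using local_metric.Ginv(1)[OF local_metric_gcomp[OF mM g_riem c] ij(1) that] by (simp add: ginv_def[abs_def])
 show "smo M (img c) (%v. SUM l:idx M. ginv M c g i l v * gcomp M c om j l v)" by (intro smooth_sum[OF S] smooth_mult[OF S] gi om_smooth[OF c] ij)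
 fix v assume v: "v:img c"
 have p: "cinv c v:fst c" "snd c (cinv c v) = v" "cinv c v:pts M" using chart_cinv[OF mM v] mfd_chart(2)[OF mM c] by auto
 show "(SUM l:idx M. ginv M c g i l v * gcomp M c om j l v) = jcomp M c J i j v"
  unfolding jcomp_def J_sharp(3)[OF p(3) cvec_tangent[OF mM c p(1) ij(2)] c p(1) ij(1)] p(2) gcomp_def ..
qed

lemma J_comp:
 assumes c: "c:atlas M" "p:fst c" and u: "u:Tan M p" shows "J p u (%q. snd c q i) = (SUM l:idx M. u (%q. snd c q l)*jcomp M c J i l (snd c p))"
proof -
 have p: "p:pts M" using mfd_chart(2)[OF mM c(1)] c(2) by blast
 have tl: "tlin M p (%u. J p u (%q. snd c q i))" unfolding tlin_def by (auto simp: J_lin[OF p]) (simp add: lincomb_def)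
 show ?thesis using tlin_expand[OF mM c tl, of "%k. u (%q. snd c q k)", folded tangent_eq_tvec[OF mM u c]] by (simp add: jcomp_def cinv_chart[OF mM c])
qed

lemma JJ_comp:
 assumes c: "c:atlas M" and v: "v:img c" and ij: "i:idx M" "j:idx M" shows "(SUM l:idx M. jcomp M c J i l v * jcomp M c J l j v) = (if i = j then - 1 else 0)"
proof -
 note S = mfd_chart(3)[OF mM c]
 let ?f = "%v. SUM l:idx M. jcomp M c J i l v * jcomp M c J l j v"
 have sf: "smo M (img c) ?f" by (intro smooth_sum[OF S] smooth_mult[OF S] jcomp_smooth[OF c] ij)
 have "?f v:{if i = j then - 1 else 0}" if "v:snd c ` (W Int fst c)" for v
 proof -
  obtain p where p: "p:W" "p:fst c" "v = snd c p" using \<open>v:_\<close> by blast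
  note pM = W_pts[OF p(1)]
  let ?u = "cvec M c p j"
  have u: "?u:Tan M p" by (rule cvec_tangent[OF mM c p(2) ij(2)])
  note Ju = J_sharp(1)[OF pM u] and nu = tangent_lincomb[OF mM pM u u, of "-1" 0]
  have "J p (J p ?u) = lincomb (-1) ?u 0 ?u"
  proof (rule W_eqI[OF p(1) J_sharp(1)[OF pM Ju] nu])
   have h: "h (x p) ~= 0" using hpos[OF p(1)] by simp
   show "J p (J p ?u) x = lincomb (-1) ?u 0 ?u x" unfolding J_W(2)[OF p(1) Ju] J_W(1)[OF p(1) u] using h by (simp add: lincomb_def)
   show "vert p (J p (J p ?u)) = vert p (lincomb (-1) ?u 0 ?u)" unfolding J_W(1)[OF p(1) Ju] J_W(2)[OF p(1) u] tlinD[OF vert_lin[OF p(1)] u u] using h by simp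
   fix i assume i: "i:{1..m}"
   have kN: "kaehler (N i) (gN i) (JN i)" using factors[OF i] by blast
   show "base i p (J p (J p ?u)) = base i p (lincomb (-1) ?u 0 ?u)" unfolding J_W(3)[OF p(1) Ju i] J_W(3)[OF p(1) u i] base_lincomb
    using kaehler_facts(4)[OF kN mN[OF i] pr_pts_N[OF p(1) i] base_tangent[OF p(1) i u]] by (simp add: lincomb_def)
  qed
  hence "J p (J p ?u) (%q. snd c q i) = - ?u (%q. snd c q i)" by (simp add: lincomb_def)
  also have "... = (if i = j then - 1 else 0)" using tvec_crd[OF mM c p(2) ij(1)] by (simp add: cvec_tvec[OF mM ij(2)])
  finally show ?thesis unfolding J_comp[OF c p(2) Ju] p(3) by (simp add: jcomp_def cinv_chart[OF mM c p(2)] mult.commute)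
 qed
 from W_dense[OF c sf closed_singleton this v] show ?thesis by simp
qed

lemma JJ: "p:pts M ==> u:Tan M p ==> J p (J p u) = (%f. - u f)"
proof -
 assume p: "p:pts M" and u: "u:Tan M p"
 obtain c where c: "c:atlas M" "p:fst c" using mfd_cover[OF mM p] by blast
 have v: "snd c p:img c" using c(2) by blast
 note Ju = J_sharp(1)[OF p u]
 have "J p (J p u) = lincomb (-1) u 0 u"
 proof (rule tangent_eqI[OF mM J_sharp(1)[OF p Ju] tangent_lincomb[OF mM p u u] c])
  fix i assume i: "i:idx M"
  have "J p (J p u) (%q. snd c q i) = (SUM l:idx M. SUM j:idx M. u (%q. snd c q j)*(jcomp M c J i l (snd c p)*jcomp M c J l j (snd c p)))"
   unfolding J_comp[OF c Ju] J_comp[OF c u] by (simp add: sdl sdr mult_ac)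
  also have "... = (SUM j:idx M. u (%q. snd c q j)*(SUM l:idx M. jcomp M c J i l (snd c p)*jcomp M c J l j (snd c p)))" unfolding sdl by (rule sum.swap)
  also have "... = (SUM j:idx M. - u (%q. snd c q j)*(if i = j then 1 else 0))" by (intro scr) (simp add: JJ_comp[OF c(1) v i])
  also have "... = - u (%q. snd c q i)" by (rule sum_dm(3)[OF mfd_fin[OF mM] i])
  finally show "J p (J p u) (%q. snd c q i) = lincomb (-1) u 0 u (%q. snd c q i)" by (simp add: lincomb_def)
 qed
 thus ?thesis by (simp add: lincomb_def)
qed

lemma new_almost_complex: "almost_complex M J" unfolding almost_complex_def using J_sharp(1) JJ J_lin jcomp_smooth by blast

lemma new_kaehler: "kaehler M g J" unfolding kaehler_def complex_structure_def
proof (intro conjI g_riem new_almost_complex ballI)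
 fix p u v assume p: "p:pts M" and u: "u:Tan M p" "v:Tan M p"
 note Jv = J_sharp(1)[OF p u(2)]
 have "g p (J p u) (J p v) = - g p (J p (J p v)) u" unfolding J_sharp(2)[OF p u(1) Jv] J_sharp(2)[OF p Jv u(1)] by (rule om_antisym[OF p u(1) Jv])
 also have "J p (J p v) = lincomb (-1) v 0 v" unfolding JJ[OF p u(2)] by (simp add: lincomb_def)
 also have "g p (lincomb (-1) v 0 v) u = - g p v u" using g_tbil[OF p] u unfolding tbil_def tlin_def by simp
 finally show "g p (J p u) (J p v) = g p u v" using g_sym[OF p u] by simp
next
 fix c p i j k assume c: "c:atlas M" "p:fst c" and I: "i:idx M" "j:idx M" "k:idx M"
 note S = mfd_chart(3)[OF mM c(1)]
 have sn: "smo M (img c) (nijenhuis M c J i j k)" unfolding nijenhuis_eq nij_def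
  by (intro smooth_sum[OF S] smooth_diff[OF S] smooth_mult[OF S] smooth_on_pd jcomp_smooth[OF c(1)] I)
 obtain D where D: "!!t. t:{0..1} ==> D 0 t = h t" "!!k t. t:{0..1} ==> der01 (D k) (D (Suc k) t) t" using pf unfolding profile_def smooth_closed_interval_def by blast
 have "nijenhuis M c J i j k v:{0}" if v: "v:snd c ` (W Int fst c)" for v
 proof -
  obtain r where r: "r:W" "r:fst c" "v = snd c r" using v by blast
  obtain e S where S: "snd c r:S" "orbit_chart m N gN JN b P act pr \<theta> M x q c e S" by (rule orbit_chart_exists[OF r(1) c(1) r(2)])
  interpret o: orbit_complex m N gN JN b P act pr \<theta> M x q c e S
   "%i k v. snd (e i) (pr (q (cinv c v)) i) k" "%a v. vert (cinv c v) (cvec M c (cinv c v) a)" "%a v. pd a (%v. x (cinv c v)) v"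
   h a g J D by (rule orbit_complex.intro[OF orbit_metric.intro[OF S(2)]], unfold_locales)
    (rule g_riem pf new_metric_form new_almost_complex D reflexive, (assumption+)?)+
  show ?thesis using o.nijenhuis_W[of v] S(1) r(3) I by simp
 qed
 from W_dense[OF c(1) sn closed_singleton this, of "snd c p"] c(2) show "nijenhuis M c J i j k (snd c p) = 0" by blast
next
 show "closed_2form M (kform g J)" unfolding closed_2form_def
 proof (intro ballI)
  fix c p i j k assume c: "c:atlas M" "p:fst c" and I: "i:idx M" "j:idx M" "k:idx M"
  note S = mfd_chart(3)[OF mM c(1)]
  let ?v = "snd c p"
  have v: "?v:img c" using c(2) by blast
  have eq: "gcomp M c (kform g J) i j v = gcomp M c (kform g0 J0) i j v + (SUM n=2..m. (a n - a0 n)*gcomp M c (wB n) i j v)"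
   if "i:idx M" "j:idx M" "v:img c" for i j v
  proof -
   have r: "cinv c v:fst c" "cinv c v:pts M" using chart_cinv[OF mM that(3)] mfd_chart(2)[OF mM c(1)] by auto
   show ?thesis unfolding gcomp_def kform_def[of g] J_sharp(2)[OF r(2) cvec_tangent[OF mM c(1) r(1) that(1)] cvec_tangent[OF mM c(1) r(1) that(2)]] om_def ..
  qed
  have pdk: "pd l (gcomp M c (kform g J) i j) ?v = pd l (gcomp M c (kform g0 J0) i j) ?v + (SUM n=2..m. (a n - a0 n)*pd l (gcomp M c (wB n) i j) ?v)" (is "?L = _")
   if "i:idx M" "j:idx M" "l:idx M" for i j l
  proof -
   have s: "smo M (img c) (%v. (a n - a0 n)*gcomp M c (wB n) i j v)" if "n:{2..m}" for n by (intro smooth_mult[OF S] smooth_const[OF S] wB(2) that c(1)) fact+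
   have "pd l (%v. (a n - a0 n)*gcomp M c (wB n) i j v) ?v = (a n - a0 n)*pd l (gcomp M c (wB n) i j) ?v" if "n:{2..m}" for n
    using pd_mult[OF S smooth_const[OF S] wB(2)[OF that c(1) \<open>i:idx M\<close> \<open>j:idx M\<close>] \<open>l:idx M\<close> v] by (simp add: pd_const)
   moreover have "?L = pd l (%v. gcomp M c (kform g0 J0) i j v + (SUM n=2..m. (a n - a0 n)*gcomp M c (wB n) i j v)) ?v"
    by (rule pd_cong[OF S that(3) v]) (rule eq[OF that(1,2)])
   moreover have "... = pd l (gcomp M c (kform g0 J0) i j) ?v + pd l (%v. SUM n=2..m. (a n - a0 n)*gcomp M c (wB n) i j v) ?v"
    by (rule pd_add[OF S kform_smooth[OF mM K0 c(1) that(1,2)] _ that(3) v]) (intro smooth_sum[OF S] s)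
   moreover have "pd l (%v. SUM n=2..m. (a n - a0 n)*gcomp M c (wB n) i j v) ?v = (SUM n=2..m. pd l (%v. (a n - a0 n)*gcomp M c (wB n) i j v) ?v)"
    by (rule pd_sum[OF S s that(3) v])
   ultimately show ?thesis by (simp cong: sum.cong_simp)
  qed
  have "pd i (gcomp M c (kform g0 J0) j k) ?v + pd j (gcomp M c (kform g0 J0) k i) ?v + pd k (gcomp M c (kform g0 J0) i j) ?v = 0"
   using K0 c I unfolding kaehler_def closed_2form_def by blast
  moreover have "(SUM n=2..m. (a n - a0 n)*pd i (gcomp M c (wB n) j k) ?v) + (SUM n=2..m. (a n - a0 n)*pd j (gcomp M c (wB n) k i) ?v)
    + (SUM n=2..m. (a n - a0 n)*pd k (gcomp M c (wB n) i j) ?v) = (SUM n=2..m. (a n - a0 n)*0)"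
   unfolding sum.distrib[symmetric] distrib_left[symmetric] using wB(3)[OF _ c(1) v I] by (intro scr) simp
  ultimately show "pd i (gcomp M c (kform g J) j k) ?v + pd j (gcomp M c (kform g J) k i) ?v + pd k (gcomp M c (kform g J) i j) ?v = 0"
   unfolding pdk[OF I(2,3,1)] pdk[OF I(3,1,2)] pdk[OF I(1,2,3)] by simp
 qed
qed

end

context construction_two begin

lemma deformation:
 assumes K0: "kaehler M g0 J0" and pf0: "profile m b h0 a0" and mf0: "mform h0 a0 g0 J0"
  and pf: "profile m b h a" shows "EX g J. kaehler M g J & mform h a g J"
proof -
 obtain fi si where ph: "sci fi" "sci si"
  "!!t. 0 < t ==> t < 1 ==> fi t = 1/h t - 1/h0 t" "!!t. 0 < t ==> t < 1 ==> si t = (h t - h0 t)/(h0 t)\<^sup>2" by (rule profile_compare[OF pf pf0]) blast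
 obtain rh where "fibre_bundle M (prod_fam {2..m} N) (CP ((mdim (N 1) + 2) div 2)) rh"
  and r': "ALL p:pts M. 0 < x p & x p < 1 --> (ALL i:{2..m}. rh p i = pr (q p) i)" using special_orbit_0 by (elim exE conjE) (rule that)
 hence r: "smooth_map M (prod_fam {2..m} N) rh" "!!p i. p:W ==> i:{2..m} ==> rh p i = pr (q p) i" unfolding fibre_bundle_def W_def by auto
 interpret n: new_metric m N gN JN b P act pr \<theta> M x q g0 J0 h0 h fi si a0 a rh by unfold_locales (rule K0 pf0 mf0 pf ph r, (assumption+)?)+
 show ?thesis using n.new_kaehler n.new_metric_form by blast
qed

text \<open>The metrics are compared over \<open>x = 1/2\<close> on vectors that project to a single
  factor. On the first factor both have the coefficient \<open>b 1 / 2\<close>, so the ratio is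
  \<open>1\<close>; on factor \<open>i\<close> the coefficients differ.\<close>

lemma not_homothetic:
 assumes mf: "mform h a g J" "mform h' a' g' J'"
  and a1: "a 1 = 0" "a' 1 = 0" and i: "i:{1..m}" "a i ~= a' i" shows "~ (EX c. ALL p:pts M. ALL u:Tan M p. ALL v:Tan M p. g p u v = c*g' p u v)"
proof
 assume "EX c. ALL p:pts M. ALL u:Tan M p. ALL v:Tan M p. g p u v = c*g' p u v"
 then obtain c where c: "!!p u v. p:pts M ==> u:Tan M p ==> v:Tan M p ==> g p u v = c*g' p u v" by blast
 have "1/2:x ` pts M" unfolding total(3) by simp
 then obtain p where xp: "p:pts M" "x p = 1/2" by auto
 hence p: "p:W" by (simp add: W_def)
 have *: "EX u:Tan M p. EX G>0. g p u u = (b n*x p + a n)*G & g' p u u = (b n*x p + a' n)*G" if n: "n:{1..m}" for n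
 proof -
  have y: "pr (q p) i:pts (N i)" if "i:{1..m}" for i using prq_lsm[OF p that] unfolding lsm_def by blast
  have kN: "kaehler (N i) (gN i) (JN i)" if "i:{1..m}" for i using factors[OF that] by blast
  note kf = kaehler_facts[OF kN mN y]
  obtain e where e: "e:atlas (N n)" "pr (q p) n:fst e" using mfd_cover[OF mN[OF n] y[OF n]] by blast
  have "idx (N n) ~= {}" using factors[OF n] unfolding mdim_def by force
  then obtain k where k: "k:idx (N n)" by blast
  let ?e = "cvec (N n) e (pr (q p) n) k"
  have t0: "(%_. 0):Tan (N i) (pr (q p) i)" if i: "i:{1..m}" for i
  proof -
   obtain d where "d:atlas (N i)" "pr (q p) i:fst d" using mfd_cover[OF mN[OF i] y[OF i]] by blast
   from tvec_tangent[OF mN[OF i] this, of "%_. 0"] show ?thesis by (simp add: tvec_def)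
  qed
  have ne: "?e ~= (%_. 0)" using tvec_crd[OF mN[OF n] e k, of "%j. if j = k then 1 else 0"] by (auto simp: cvec_tvec[OF mN[OF n] k] dest: fun_cong)
  have te: "?e:Tan (N n) (pr (q p) n)" by (rule cvec_tangent[OF mN[OF n] e k])
  define w where "w i = (if i = n then ?e else (%_. 0))" for i
  have wt: "w i:Tan (N i) (pr (q p) i)" if "i:{1..m}" for i using te t0[OF that] by (simp add: w_def)
  obtain u where u: "u:Tan M p" "u x = 0" "vert p u = 0" "!!i. i:{1..m} ==> base i p u = w i" using surj[where w = w and xx = 0 and tu = 0, OF p wt] by blast
  let ?G = "gN n (pr (q p) n) ?e ?e"
  have z: "gN i (pr (q p) i) (%_. 0) (%_. 0) = 0" if i: "i:{1..m}" for i
  proof -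
   have "gN i (pr (q p) i) (lincomb 0 (%_. 0) 0 (%_. 0)) (%_. 0) = 0" using kf(1)[OF i i i] t0[OF i] unfolding tbil_def tlin_def by simp
   thus ?thesis by (simp add: lincomb_def)
  qed
  have s: "(SUM i=1..m. A i*gb i p u u) = A n*?G" (is "?L = _") for A
  proof -
   have "?L = (SUM i=1..m. if i = n then A n*?G else 0)" using u(4) z by (intro scr) (auto simp: w_def)
   thus ?thesis using n by simp
  qed
  have "g p u u = (b n*x p + a n)*?G" "g' p u u = (b n*x p + a' n)*?G" using mf xp u(1-3) p s[of "%i. b i*x p + a i"] s[of "%i. b i*x p + a' i"]
   unfolding metric_form_def Let_def vert_def base_def by simp_all
  thus ?thesis using u(1) kf(7)[OF n n n te ne] by blast
 qed
 have 1: "1:{1..m}" using m_pos by simp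
 obtain u1 G1 where "u1:Tan M p" "G1 > 0" "g p u1 u1 = (b 1*x p + a 1)*G1" "g' p u1 u1 = (b 1*x p + a' 1)*G1" using *[OF 1] by blast
 moreover have "b 1*x p > 0" using b_first xp by simp
 ultimately have "b 1*x p*G1 = c*(b 1*x p*G1)" "b 1*x p*G1 > 0" using c[OF xp(1), of u1 u1] a1 by auto
 hence c1: "c = 1" using mult_cancel_right1[of "b 1*x p*G1" c] by linarith
 obtain u G where "u:Tan M p" "G > 0" "g p u u = (b i*x p + a i)*G" "g' p u u = (b i*x p + a' i)*G" using *[OF i(1)] by blast
 thus False using c[OF xp(1), of u u] c1 i(2) by simp
qed

end

section \<open>The one-parameter family of profiles\<close>

text \<open>
  Functions of \<open>(t, r)\<close> that are \<open>C\<^sup>1\<close> in \<open>r\<close>, jointly continuously; \<open>jet f f0 f1\<close> says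
  \<open>f = f0 + t f1 + O(t\<^sup>2)\<close> with a remainder of this class.
\<close>

definition cls :: "(real=>real=>real)=>bool" where
 "cls f = (cont UNIV (%(t, r). f t r) &
  (EX f'. cont UNIV (%(t, r). f' t r) & (ALL t r. DERIV (f t) r :> f' t r)))"

lemma clsI: "cont UNIV (%(t, r). f t r) ==> cont UNIV (%(t, r). f' t r) ==>
 (!!t r. DERIV (f t) r :> f' t r) ==> cls f" unfolding cls_def by blast

lemma cls_const: "cls (%t r. k)" by (rule clsI[where f' = "%t r. 0"]) (auto simp: case_prod_beta)

lemma cls_t: "cls (%t r. t)" by (rule clsI[where f' = "%t r. 0"]) (auto simp: case_prod_beta intro!: continuous_intros)

lemma cls_r: "cls (%t r. r)" by (rule clsI[where f' = "%t r. 1"]) (auto simp: case_prod_beta intro!: continuous_intros)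

lemma cls_add: "cls f ==> cls g ==> cls (%t r. f t r + g t r)"
proof -
 assume "cls f" "cls g"
 then obtain f' g' where *: "cont UNIV (%(t, r). f t r)" "cont UNIV (%(t, r). f' t r)" "!!t r. DERIV (f t) r :> f' t r"
  "cont UNIV (%(t, r). g t r)" "cont UNIV (%(t, r). g' t r)" "!!t r. DERIV (g t) r :> g' t r" unfolding cls_def by blast
 thus ?thesis by (intro clsI[where f' = "%t r. f' t r + g' t r"]) (auto simp: case_prod_beta intro!: continuous_intros DERIV_add)
qed

lemma cls_mult: "cls f ==> cls g ==> cls (%t r. f t r*g t r)"
proof -
 assume "cls f" "cls g"
 then obtain f' g' where *: "cont UNIV (%(t, r). f t r)" "cont UNIV (%(t, r). f' t r)" "!!t r. DERIV (f t) r :> f' t r"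
  "cont UNIV (%(t, r). g t r)" "cont UNIV (%(t, r). g' t r)" "!!t r. DERIV (g t) r :> g' t r" unfolding cls_def by blast
 thus ?thesis by (intro clsI[where f' = "%t r. f' t r*g t r + g' t r*f t r"]) (auto simp: case_prod_beta intro!: continuous_intros DERIV_mult)
qed

lemma cls_sum: "(!!i. i:A ==> cls (f i)) ==> cls (%t r. SUM i:A. f i t r)" by (induction A rule: infinite_finite_induct) (auto intro: cls_const cls_add)

definition jet :: "(real=>real=>real)=>(real=>real)=>(real=>real)=>bool" where
 "jet f f0 f1 = (cls (%t. f0) & cls (%t. f1) & (EX f2. cls f2 & (ALL t r. f t r = f0 r + t*f1 r + t\<^sup>2*f2 t r)))"

lemma jetI: "cls (%t. f0) ==> cls (%t. f1) ==> cls R ==> (!!t r. f t r = f0 r + t*f1 r + t\<^sup>2 * R t r) ==> jet f f0 f1" unfolding jet_def by blast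

lemma jet_cls: "jet f f0 f1 ==> cls f"
proof -
 assume "jet f f0 f1"
 then obtain f2 where f: "cls (%t. f0)" "cls (%t. f1)" "cls f2" "!!t r. f t r = f0 r + t*f1 r + t\<^sup>2*f2 t r" unfolding jet_def by blast
 have "f = (%t r. f0 r + t*f1 r + (t*t)*f2 t r)" using f(4) by (simp add: fun_eq_iff power2_eq_square)
 thus ?thesis using cls_add[OF cls_add[OF f(1) cls_mult[OF cls_t f(2)]] cls_mult[OF cls_mult[OF cls_t cls_t] f(3)]] by simp
qed

lemma jet_const: "jet (%t r. k) (%r. k) (%r. 0)" by (rule jetI[where R = "%t r. 0"]) (auto intro: cls_const)

lemma jet_t_mult: "cls (%t. f) ==> jet (%t r. t*f r) (%r. 0) f" by (rule jetI[where R = "%t r. 0"]) (auto intro: cls_const)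

lemma jet_add: "jet f f0 f1 ==> jet g g0 g1 ==> jet (%t r. f t r + g t r) (%r. f0 r + g0 r) (%r. f1 r + g1 r)"
proof -
 assume "jet f f0 f1" "jet g g0 g1"
 then obtain f2 g2 where *: "cls (%t. f0)" "cls (%t. f1)" "cls f2" "!!t r. f t r = f0 r + t*f1 r + t\<^sup>2*f2 t r"
  "cls (%t. g0)" "cls (%t. g1)" "cls g2" "!!t r. g t r = g0 r + t*g1 r + t\<^sup>2*g2 t r" unfolding jet_def by blast
 thus ?thesis by (intro jetI[where R = "%t r. f2 t r + g2 t r"] cls_add) (auto simp: alg)
qed

lemma jet_mult: "jet f f0 f1 ==> jet g g0 g1 ==> jet (%t r. f t r*g t r) (%r. f0 r*g0 r) (%r. f0 r*g1 r + f1 r*g0 r)"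
proof -
 assume "jet f f0 f1" "jet g g0 g1"
 then obtain f2 g2 where *: "cls (%t. f0)" "cls (%t. f1)" "cls f2" "!!t r. f t r = f0 r + t*f1 r + t\<^sup>2*f2 t r"
  "cls (%t. g0)" "cls (%t. g1)" "cls g2" "!!t r. g t r = g0 r + t*g1 r + t\<^sup>2*g2 t r" unfolding jet_def by blast
 show ?thesis by (intro jetI[where R = "%t r. f0 r*g2 t r + f1 r*g1 r + f2 t r*g0 r + t*(f1 r*g2 t r + f2 t r*g1 r) + (t*t)*(f2 t r*g2 t r)"] cls_add cls_mult cls_t *)
   (simp add: *(4,8) alg power2_eq_square)
qed

lemma jet_sum: "(!!i. i:A ==> jet (f i) (f0 i) (f1 i)) ==> jet (%t r. SUM i:A. f i t r) (%r. SUM i:A. f0 i r) (%r. SUM i:A. f1 i r)"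
 by (induction A rule: infinite_finite_induct) (auto intro: jet_const jet_add)

text \<open>Jets of polynomials by coefficients. The uniform degree bound turns evaluation and
  moments into finite sums of fixed length, to which \<open>jet_sum\<close> applies.\<close>

definition pjet :: "(real=>real=>real poly)=>(real=>real poly)=>(real=>real poly)=>bool" where
 "pjet p p0 p1 = ((ALL k. jet (%t r. coeff (p t r) k) (%r. coeff (p0 r) k) (%r. coeff (p1 r) k)) &
  (EX d. ALL t r. degree (p t r) <= d & degree (p0 r) <= d & degree (p1 r) <= d))"

lemma pjet_add: "pjet p p0 p1 ==> pjet q q0 q1 ==> pjet (%t r. p t r + q t r) (%r. p0 r + q0 r) (%r. p1 r + q1 r)"
proof -
 assume *: "pjet p p0 p1" "pjet q q0 q1"
 obtain d d' where d: "ALL t r. degree (p t r) <= d & degree (p0 r) <= d & degree (p1 r) <= d" "ALL t r. degree (q t r) <= d' & degree (q0 r) <= d' & degree (q1 r) <= d'"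
  using*unfolding pjet_def by blast
 have "degree (f + g) <= max d d'" if "degree f <= d" "degree g <= d'" for f g :: "real poly" using degree_add_le_max[of f g] that by linarith
 thus ?thesis using*d unfolding pjet_def by (auto intro!: jet_add exI[of _ "max d d'"])
qed

lemma pjet_mult: "pjet p p0 p1 ==> pjet q q0 q1 ==> pjet (%t r. p t r*q t r) (%r. p0 r*q0 r) (%r. p0 r*q1 r + p1 r*q0 r)"
proof -
 assume *: "pjet p p0 p1" "pjet q q0 q1"
 obtain d d' where d: "!!t r. degree (p t r) <= d & degree (p0 r) <= d & degree (p1 r) <= d" "!!t r. degree (q t r) <= d' & degree (q0 r) <= d' & degree (q1 r) <= d'"
  using*unfolding pjet_def by blast
 have dm: "degree (f*g) <= d + d'" if "degree f <= d" "degree g <= d'" for f g :: "real poly" using degree_mult_le[of f g] that by linarith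
 have da: "degree (f + g) <= d + d'" if "degree f <= d + d'" "degree g <= d + d'" for f g :: "real poly" using degree_add_le_max[of f g] that by linarith
 have "jet (%t r. coeff (p t r*q t r) k) (%r. coeff (p0 r*q0 r) k) (%r. coeff (p0 r*q1 r + p1 r*q0 r) k)" for k
  unfolding coeff_mult coeff_add sum.distrib[symmetric] using*unfolding pjet_def by (intro jet_sum jet_mult) auto
 thus ?thesis unfolding pjet_def using d by (intro conjI allI exI[of _ "d + d'"] dm da) auto
qed

lemma pjet_const: "pjet (%t r. p) (%r. p) (%r. 0)" unfolding pjet_def using jet_const by (auto intro!: exI[of _ "degree p"])

lemma pjet_sum: "(!!i. i:A ==> pjet (f i) (f0 i) (f1 i)) ==> pjet (%t r. SUM i:A. f i t r) (%r. SUM i:A. f0 i r) (%r. SUM i:A. f1 i r)"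
 by (induction A rule: infinite_finite_induct) (auto intro: pjet_const pjet_add)

lemma pjet_prod1: "finite A ==> (!!i. i:A ==> pjet (f i) (%_. 1) (f1 i)) ==> pjet (%t r. PROD i:A. f i t r) (%_. 1) (%r. SUM i:A. f1 i r)"
proof (induction A rule: finite_induct)
 case empty
 thus ?case using pjet_const[of 1] by simp
next
 case (insert i A)
 thus ?case using pjet_mult[OF insert.prems[OF insertI1] insert.IH[OF insert.prems[OF insertI2]]] by (simp add: add.commute)
qed

lemma pjet_linear: "cls (%t. e) ==> pjet (%t r. [:1, t*e r:]) (%_. 1) (%r. [:0, e r:])" unfolding pjet_def
proof (intro conjI allI)
 assume e: "cls (%t. e)"
 show "jet (%t r. coeff [:1, t*e r:] k) (%r. coeff 1 k) (%r. coeff [:0, e r:] k)" for k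
 proof (cases k)
  case (Suc j)
  thus ?thesis using jet_const[of 0] jet_t_mult[OF e] by (cases j) simp_all
 qed (use jet_const[of 1] in simp)
 show "EX d. ALL t r. degree [:1, t*e r:] <= d & degree (1 :: real poly) <= d & degree [:0, e r:] <= d" by (intro exI[of _ 1]) auto
qed

lemma pjet_t_const: "cls (%t. e) ==> pjet (%t r. [:t*e r:]) (%_. 0) (%r. [:e r:])" unfolding pjet_def
proof (intro conjI allI)
 assume e: "cls (%t. e)"
 show "jet (%t r. coeff [:t*e r:] k) (%r. coeff 0 k) (%r. coeff [:e r:] k)" for k using jet_const[of 0] jet_t_mult[OF e] by (cases k) simp_all
qed auto

text \<open>The moment \<open>\<integral>\<^sub>0\<^sup>1 x\<^sup>j\<^sup>-\<^sup>1 p(x) dx\<close>.\<close>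

definition mom :: "nat=>real poly=>real" where
 "mom j p = (SUM k<=degree p. coeff p k/real (k + j))"

lemma sum_coeff_upto: "degree p <= d ==> (SUM k<=degree p. coeff p k*f k) = (SUM k<=d. coeff p k*(f k :: real))" by (rule sum.mono_neutral_left) (auto simp: coeff_eq_0)

lemma mom_upto: "degree p <= d ==> mom j p = (SUM k<=d. coeff p k*(1/real (k + j)))" unfolding mom_def using sum_coeff_upto[of p d "%k. 1/real (k + j)"] by simp

lemma mom_add: "mom j (p + q) = mom j p + mom j q"
proof -
 let ?d = "max (degree p) (degree q)"
 have "degree (p + q) <= ?d" by (rule degree_add_le_max)
 thus ?thesis by (simp add: mom_upto[of _ ?d] sum.distrib add_divide_distrib)
qed

lemma mom_smult: "mom j (Polynomial.smult c p) = c*mom j p" by (simp add: mom_upto[of _ "degree p"] sdl mult.assoc)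

lemma mom_shift: "mom j ([:0, 1:]*p) = mom (Suc j) p"
proof -
 have "degree ([:0, 1:]*p) <= Suc (degree p)" by (simp add: degree_pCons_le)
 hence "mom j ([:0, 1:]*p) = (SUM k<=Suc (degree p). coeff ([:0, 1:]*p) k*(1/real (k + j)))" by (rule mom_upto)
 also have "... = (SUM k<=degree p. coeff p k*(1/real (k + Suc j)))" by (subst sum.atMost_Suc_shift) (simp add: add.commute)
 finally show ?thesis by (simp add: mom_def)
qed

lemma jet_mom: "pjet p p0 p1 ==> jet (%t r. mom j (p t r)) (%r. mom j (p0 r)) (%r. mom j (p1 r))"
 and jet_poly1: "pjet p p0 p1 ==> jet (%t r. poly (p t r) 1) (%r. poly (p0 r) 1) (%r. poly (p1 r) 1)"
proof -
 assume p: "pjet p p0 p1"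
 then obtain d where d: "!!t r. degree (p t r) <= d" "!!r. degree (p0 r) <= d" "!!r. degree (p1 r) <= d" unfolding pjet_def by blast
 have j: "jet (%t r. SUM k<=d. coeff (p t r) k*c k) (%r. SUM k<=d. coeff (p0 r) k*c k) (%r. SUM k<=d. coeff (p1 r) k*c k)" for c
 proof (rule jet_sum)
  fix k
  have "jet (%t r. coeff (p t r) k) (%r. coeff (p0 r) k) (%r. coeff (p1 r) k)" using p unfolding pjet_def by blast
  from jet_mult[OF this jet_const[of "c k"]]
  show "jet (%t r. coeff (p t r) k*c k) (%r. coeff (p0 r) k*c k) (%r. coeff (p1 r) k*c k)" by simp
 qed
 show "jet (%t r. mom j (p t r)) (%r. mom j (p0 r)) (%r. mom j (p1 r))"
  using j[of "%k. 1/real (k + j)"] by (simp only: mom_upto[OF d(1)] mom_upto[OF d(2)] mom_upto[OF d(3)])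
 have e: "poly f 1 = (SUM k<=d. coeff f k*1)" if "degree f <= d" for f :: "real poly" using sum_coeff_upto[OF that, of "%_. 1"] by (simp add: poly_altdef)
 show "jet (%t r. poly (p t r) 1) (%r. poly (p0 r) 1) (%r. poly (p1 r) 1)" using j[of "%_. 1"] by (simp only: e[OF d(1)] e[OF d(2)] e[OF d(3)])
qed

text \<open>\<open>f 0\<close> has a positive minimum on the segment; uniform continuity on a
  compact rectangle keeps the variation in \<open>t\<close> below it.\<close>

lemma cls_tube:
 fixes f :: "real=>real=>real"
 assumes f: "cont UNIV (%(t, r). f t r)" and pos: "!!r. r:{r1..r2} ==> f 0 r > (0::real)" shows "EX t0>0. ALL t:{0..t0}. ALL r:{r1..r2}. f t (r::real) > 0"
proof (cases "r1 <= r2")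
 case True
 have "cont {r1..r2} (%r. f 0 r)" using continuous_on_compose2[OF f, of "{r1..r2}" "%r. (0, r)"] by (simp add: continuous_intros)
 then obtain s where s: "s:{r1..r2}" "!!r. r:{r1..r2} ==> f 0 s <= f 0 r" using continuous_attains_inf[of "{r1..r2}" "f 0"] True by auto
 have "uniformly_continuous_on ({0..1} \<times> {r1..r2}) (%(t, r). f t r)" by (intro compact_uniformly_continuous continuous_on_subset[OF f] compact_Times) auto
 then obtain de where de: "de > 0" "!!z z'. z:{0..1} \<times> {r1..r2} ==> z':{0..1} \<times> {r1..r2} ==> dist z' z < de ==> dist ((%(t, r). f t r) z') ((%(t, r). f t r) z) < f 0 s"
  using pos[OF s(1)] unfolding uniformly_continuous_on_def by metis
 have "f t r > 0" if "t:{0..min 1 (de/2)}" "r:{r1..r2}" for t r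
 proof -
  have "dist (t, r) (0, r) < de" using that de(1) by (simp add: dist_Pair_Pair)
  hence "dist (f t r) (f 0 r) < f 0 s" using de(2)[of "(0, r)" "(t, r)"] that by auto
  thus ?thesis using s(2)[OF that(2)] by (simp add: dist_real_def)
 qed
 thus ?thesis using de(1) by (intro exI[of _ "min 1 (de/2)"]) auto
qed (intro exI[of _ 1], auto)

text \<open>Existence comes from the intermediate value theorem, uniqueness from monotonicity in
  \<open>r\<close>. Continuity of the root is read off from the equivalence of
  \<open>s < rh t\<close> with \<open>G t s < 0\<close>, an open condition in
  \<open>t\<close>.\<close>

lemma implicit_root:
 assumes G: "cls G" and neg: "G 0 r1 < 0" and pos: "G 0 r2 > 0" and r: "r1 < r2"
  and mono: "!!r G'. r:{r1..r2} ==> DERIV (G 0) r :> G' ==> G' > 0"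
 shows "EX t0>0. EX rh. cont {0..t0} rh & (ALL t:{0..t0}. rh t:{r1..r2} & G t (rh t) = 0)"
proof -
 obtain G' where c: "cont UNIV (%(t, r). G t r)" "cont UNIV (%(t, r). G' t r)" and d: "!!t r. DERIV (G t) r :> G' t r"
  using G unfolding cls_def by blast
 have ct: "cont A (%t. G t s)" and cr: "cont A (G u)" for s u A
  using continuous_on_compose2[OF c(1), of A "%t. (t, s)"] continuous_on_compose2[OF c(1), of A "%r. (u, r)"] by (simp_all add: continuous_intros)
 have cm: "cont UNIV (%(t, r). - G t r1)" "cont UNIV (%(t, r). G t r2)"
  using continuous_on_compose2[OF ct[of UNIV r1] continuous_on_fst[OF continuous_on_id]] continuous_on_compose2[OF ct[of UNIV r2] continuous_on_fst[OF continuous_on_id]]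
  by (auto simp: case_prod_beta intro!: continuous_on_minus)
 obtain ta where ta: "ta > 0" "!!t r. t:{0..ta} ==> r:{r1..r2} ==> G' t r > 0" using cls_tube[OF c(2), of r1 r2] mono d by blast
 obtain tb where tb: "tb > 0" "!!t r. t:{0..tb} ==> r:{r1..r2} ==> - G t r1 > 0" using cls_tube[OF cm(1), of r1 r2] neg by auto
 obtain tc where tc: "tc > 0" "!!t r. t:{0..tc} ==> r:{r1..r2} ==> G t r2 > 0" using cls_tube[OF cm(2), of r1 r2] pos by auto
 define t0 where "t0 = min ta (min tb tc)"
 have t0: "t0 > 0" "!!t r. t:{0..t0} ==> r:{r1..r2} ==> G' t r > 0" "!!t. t:{0..t0} ==> G t r1 < 0" "!!t. t:{0..t0} ==> G t r2 > 0"
  using ta tb(1) tb(2)[of _ r1] tc(1) tc(2)[of _ r1] r unfolding t0_def by auto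
 have inc: "G t s < G t s'" if "t:{0..t0}" "r1 <= s" "s < s'" "s' <= r2" for t s s' by (rule DERIV_pos_imp_increasing[OF that(3)]) (use d t0(2)[OF that(1)] that in force)
 have "EX s:{r1..r2}. G t s = 0" if "t:{0..t0}" for t using IVT'[of "G t" r1 0 r2, OF _ _ _ cr] t0(3,4)[OF that] r by force
 then obtain rh where rh: "!!t. t:{0..t0} ==> rh t:{r1..r2}" "!!t. t:{0..t0} ==> G t (rh t) = 0" by metis
 have iff: "s < rh t \<longleftrightarrow> G t s < 0" "rh t < s \<longleftrightarrow> G t s > 0" if "t:{0..t0}" "s:{r1..r2}" for t s
  using inc[OF that(1), of s "rh t"] inc[OF that(1), of "rh t" s] rh[OF that(1)] that(2) by (cases s "rh t" rule: linorder_cases; force)+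
 have "cont {0..t0} rh" unfolding continuous_on_def
 proof (intro ballI order_tendstoI)
  fix t a assume t: "t:{0..t0}"
  let ?F = "at t within {0..t0}"
  have lim: "((%t'. G t' s) \<longlongrightarrow> G t s) ?F" for s using ct[of "{0..t0}" s] t unfolding continuous_on_def by blast
  have ev: "\<forall>\<^sub>F t' in ?F. t':{0..t0}" by (simp add: eventually_at_filter)
  show "\<forall>\<^sub>F t' in ?F. a < rh t'" if a: "a < rh t"
  proof (cases "a < r1")
   case True
   show ?thesis using ev by eventually_elim (use True rh(1) in force)
  next
   case False
   hence s: "a:{r1..r2}" using a rh(1)[OF t] by auto
   have "\<forall>\<^sub>F t' in ?F. G t' a < 0" by (rule order_tendstoD(2)[OF lim]) (use iff(1)[OF t s] a in simp)
   thus ?thesis using ev by eventually_elim (use iff(1)[OF _ s] in simp)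
  qed
  show "\<forall>\<^sub>F t' in ?F. rh t' < a" if a: "rh t < a"
  proof (cases "a > r2")
   case True
   show ?thesis using ev by eventually_elim (use True rh(1) in force)
  next
   case False
   hence s: "a:{r1..r2}" using a rh(1)[OF t] by auto
   have "\<forall>\<^sub>F t' in ?F. G t' a > 0" by (rule order_tendstoD(1)[OF lim]) (use iff(2)[OF t s] a in simp)
   thus ?thesis using ev by eventually_elim (use iff(2)[OF _ s] in simp)
  qed
 qed
 thus ?thesis using t0(1) rh by blast
qed

text \<open>For \<open>j > 0\<close>, \<open>x^j * pint j p\<close> is the integral of
  \<open>y^(j - 1) * p y\<close> from \<open>0\<close> to \<open>x\<close>. Splitting off the power
  of \<open>x\<close> keeps the double integral polynomial and makes its quotient by
  \<open>V\<close> regular at \<open>0\<close>.\<close>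

definition pint :: "nat=>real poly=>real poly" where
 "pint j p = (SUM k<=degree p. monom (coeff p k/real (k + j)) k)"

lemma coeff_pint: "coeff (pint j p) k = coeff p k/real (k + j)" by (simp add: pint_def coeff_sum coeff_eq_0)

lemma poly_pint_1: "poly (pint j p) 1 = mom j p" by (simp add: pint_def mom_def poly_sum poly_monom)

lemma degree_pint: "degree (pint j p) <= degree p" unfolding pint_def by (intro degree_sum_le) (auto intro: order_trans[OF degree_monom_le])

lemma pderiv_pint: "pderiv (monom 1 (Suc j)*pint (Suc j) p) = monom 1 j*p"
 by (rule poly_eqI) (auto simp: coeff_pderiv coeff_monom_mult coeff_pint add.commute simp del: of_nat_Suc)

text \<open>Partial fractions. The value of the double integral at \<open>1\<close> becomes a
  difference of two moments, so that both end conditions are conditions on moments.\<close>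

lemma mom_pint: "j > 0 ==> mom (Suc j) (pint j p) = mom j p - mom (Suc j) p"
proof -
 assume j: "j > 0"
 have "coeff p k/real (k + j)*(1/real (k + Suc j)) = coeff p k*(1/real (k + j)) - coeff p k*(1/real (k + Suc j))" for k
  using j by (simp add: divide_simps) (simp add: alg)
 thus ?thesis unfolding mom_upto[OF degree_pint, of "Suc j" j p] mom_upto[OF order_refl, of _ p] coeff_pint sum_subtractf[symmetric] by (intro scr)
qed

text \<open>With \<open>A i\<close> proportional to \<open>1 + e i * x\<close>,
  \<open>x^nd * Wp\<close> is \<open>V\<close> up to a constant. \<open>Yp\<close> is
  \<open>Wp\<close> times the sum of the \<open>c i / (1 + e i * x)\<close>, cleared of
  denominators, and \<open>Q0p\<close> is \<open>x * Wp\<close> times the sum of all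
  \<open>d_i / A i\<close>.\<close>

definition Wp :: "nat set=>(nat=>nat)=>(nat=>real)=>real poly" where
 "Wp L n e = (PROD i:L. [:1, e i:]^n i)"
definition Yp :: "nat set=>(nat=>nat)=>(nat=>real)=>(nat=>real)=>real poly" where
 "Yp L n e c = (SUM i:L. [:c i:]*([:1, e i:]^(n i - 1)*(PROD k:L - {i}. [:1, e k:]^n k)))"
definition Q0p :: "nat=>nat set=>(nat=>nat)=>(nat=>real)=>(nat=>real)=>real poly" where
 "Q0p nd L n e c = [:2*real nd*(real nd + 1):]*Wp L n e + [:0, 1:]*Yp L n e c"

text \<open>With \<open>V = x^nd * W\<close> the equation for \<open>h\<close> reads
  \<open>(V h)'' = x^(nd - 1) * Q\<close>, and two integrations from \<open>0\<close> give
  \<open>V h = x^(nd + 1) * H\<close>. The moment conditions say that at \<open>1\<close> the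
  function \<open>V h\<close> has derivative \<open>- 2 * W(1)\<close> and, through
  \<open>mom_pint\<close>, value \<open>0\<close>.\<close>

locale momentum =
 fixes L :: "nat set" and n :: "nat=>nat" and nd :: nat and e c :: "nat=>real" and s :: real
  and Q H :: "real poly" and h :: "real=>real"
 defines "Q == Q0p nd L n e c - [:s:]*([:0, 1:]*Wp L n e)" and "H == pint (Suc nd) (pint nd Q)"
  and "h == %x. x*poly H x/poly (Wp L n e) x"
 assumes fin: "finite L" and n: "!!i. i:L ==> n i >= 1" and nd: "nd >= 1" and e: "!!i. i:L ==> 1 + e i > 0"
  and c: "!!i. i:L ==> c i >= 0"
  and m1: "mom nd Q = - 2*poly (Wp L n e) 1" and m2: "mom (Suc nd) Q = - 2*poly (Wp L n e) 1"
begin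

abbreviation "W == Wp L n e"

lemma fac_pos: "i:L ==> x:{0..1} ==> 1 + e i*x > 0"
proof -
 assume i: "i:L" and x: "x:{0..1}"
 have "0 < (1 - x) + x*(1 + e i)" using e[OF i] x by (cases "x = 0") (auto intro!: add_nonneg_pos mult_pos_pos)
 thus ?thesis by (simp add: alg)
qed

lemma poly_W: "poly W x = (PROD i:L. (1 + e i*x)^n i)" by (simp add: Wp_def poly_prod mult.commute)

lemma W_pos: "x:{0..1} ==> poly W x > 0" unfolding poly_W by (intro prod_pos ballI zero_less_power fac_pos)

lemma W_0: "poly W 0 = 1" by (simp add: poly_W)

lemma poly_Y: "x:{0..1} ==> poly (Yp L n e c) x = poly W x*(SUM i:L. c i/(1 + e i*x))"
proof -
 assume x: "x:{0..1}"
 have "poly (Yp L n e c) x = (SUM i:L. c i*((1 + e i*x)^(n i - 1)*(PROD k:L - {i}. (1 + e k*x)^n k)))" by (simp add: Yp_def poly_sum poly_prod mult.commute)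
 also have "... = (SUM i:L. poly W x*(c i/(1 + e i*x)))"
 proof (intro scr)
  fix i assume i: "i:L"
  have "poly W x = (1 + e i*x)^n i*(PROD k:L - {i}. (1 + e k*x)^n k)" unfolding poly_W using fin i by (rule prod.remove)
  also have "(1 + e i*x)^n i = (1 + e i*x)*(1 + e i*x)^(n i - 1)" using n[OF i] by (cases "n i") auto
  finally show "c i*((1 + e i*x)^(n i - 1)*(PROD k:L - {i}. (1 + e k*x)^n k)) = poly W x*(c i/(1 + e i*x))" using fac_pos[OF i x] by simp
 qed
 finally show ?thesis by (simp add: sdl)
qed

definition R where "R x = 2*real nd*(real nd + 1)/x + (SUM i:L. c i/(1 + e i*x))"

lemma poly_Q: "0 < x ==> x <= 1 ==> poly Q x = x*poly W x*(R x - s)" unfolding Q_def Q0p_def R_def using poly_Y[of x] by (simp add: field_simps)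

definition u where "u = monom 1 (Suc nd)*H"
definition u1 where "u1 = monom 1 nd*pint nd Q"

lemma du: "DERIV (poly u) x :> poly u1 x" (is ?A) "DERIV (poly u1) x :> x^(nd - 1)*poly Q x" (is ?B)
proof -
 have "pderiv u = u1" unfolding u_def u1_def H_def by (rule pderiv_pint)
 thus ?A using poly_DERIV[of u] by simp
 have "pderiv u1 = monom 1 (nd - 1)*Q" unfolding u1_def using pderiv_pint[of "nd - 1" Q] nd by simp
 thus ?B using poly_DERIV[of u1 x] by (simp add: poly_monom)
qed

lemma bdry: "poly H 0 = 2" "poly H 1 = 0" "poly u 0 = 0" "poly u1 0 = 0" "poly u 1 = 0" "poly u1 1 = - 2*poly W 1" (is ?A)
proof -
 \<comment> \<open>The constant term of \<open>H\<close> is that of \<open>Q\<close> divided by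
   \<open>nd * (nd + 1)\<close>, hence \<open>2\<close>, the slope required at \<open>0\<close>. The
   coefficient \<open>2 * nd * (nd + 1)\<close> is \<open>d_1 / b 1\<close>: here the value of
   \<open>b 1\<close> enters.\<close>
 have "coeff Q 0 = 2*real nd*(real nd + 1)" using W_0 by (simp add: Q_def Q0p_def poly_0_coeff_0[symmetric])
 thus "poly H 0 = 2" using nd by (simp add: poly_0_coeff_0 H_def coeff_pint divide_simps)
 have "poly H 1 = mom nd Q - mom (Suc nd) Q" unfolding H_def poly_pint_1 by (rule mom_pint) (use nd in simp)
 thus H1: "poly H 1 = 0" using m1 m2 by simp
 show "poly u 0 = 0" "poly u1 0 = 0" "poly u 1 = 0" ?A using nd H1 m1 by (simp_all add: u_def u1_def poly_monom poly_pint_1)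
qed

lemma R_pos: "0 < x ==> x <= 1 ==> R x > 0" unfolding R_def by (intro add_pos_nonneg sum_nonneg divide_nonneg_pos c fac_pos) (use nd in auto)

lemma u2_sign: "0 < x ==> x <= 1 ==> x^(nd - 1)*poly Q x < 0 \<longleftrightarrow> R x < s" "0 < x ==> x <= 1 ==> x^(nd - 1)*poly Q x > 0 \<longleftrightarrow> R x > s"
 using W_pos[of x] by (simp_all add: poly_Q mult_less_0_iff zero_less_mult_iff)

text \<open>The derivative of \<open>u\<close> falls from \<open>0\<close> to a negative value, so
  the second derivative is negative somewhere, and there \<open>s > R > 0\<close>.\<close>

lemma s_pos: "s > 0"
proof -
 obtain z where z: "0 < z" "z < 1" "poly u1 1 - poly u1 0 = (1 - 0)*(z^(nd - 1)*poly Q z)" using MVT2[of 0 1 "poly u1", OF _ du(2)] by auto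
 hence "z^(nd - 1)*poly Q z < 0" using bdry(4,6) W_pos[of 1] by simp
 thus ?thesis using u2_sign(1)[of z] R_pos[of z] z by simp
qed

text \<open>\<open>R\<close> is a sum of nonnegative multiples of reciprocals of positive affine
  functions, hence convex, and its sublevel sets are intervals.\<close>

lemma R_convex: "0 < y1 ==> y1 < y2 ==> y2 < y3 ==> y3 <= 1 ==> R y1 < s ==> R y3 < s ==> R y2 < s"
proof -
 assume y: "0 < y1" "y1 < y2" "y2 < y3" "y3 <= 1" and R: "R y1 < s" "R y3 < s"
 define l where "l = (y3 - y2)/(y3 - y1)"
 have l: "0 <= l" "l <= 1" unfolding l_def using y by (auto simp: divide_simps)
 have "l*(y3 - y1) = y3 - y2" unfolding l_def using y by simp
 hence y2: "y2 = l*y1 + (1 - l)*y3" by (simp add: alg)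
 have cv: "k/(alu + bt*y2) <= l*(k/(alu + bt*y1)) + (1 - l)*(k/(alu + bt*y3))" if "alu + bt*y1 > 0" "alu + bt*y3 > 0" "k >= 0" for alu bt k
 proof -
  have "inverse ((1 - l) *\<^sub>R (alu + bt*y3) + l *\<^sub>R (alu + bt*y1)) <= (1 - l)*inverse (alu + bt*y3) + l*inverse (alu + bt*y1)"
   by (rule convex_onD[OF convex_on_inverse[of "{0<..}"]]) (use l that in auto)
  also have "(1 - l) *\<^sub>R (alu + bt*y3) + l *\<^sub>R (alu + bt*y1) = alu + bt*y2" unfolding y2 by (simp add: alg)
  finally have "k*inverse (alu + bt*y2) <= k*((1 - l)*inverse (alu + bt*y3) + l*inverse (alu + bt*y1))" using that(3) by (rule mult_left_mono)
  thus ?thesis by (simp add: divide_inverse alg)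
 qed
 have "(SUM i:L. c i/(1 + e i*y2)) <= (SUM i:L. l*(c i/(1 + e i*y1)) + (1 - l)*(c i/(1 + e i*y3)))" by (intro sum_mono cv c fac_pos) (use y in auto)
 moreover have "2*real nd*(real nd + 1)/y2 <= l*(2*real nd*(real nd + 1)/y1) + (1 - l)*(2*real nd*(real nd + 1)/y3)" using cv[of 0 1 "2*real nd*(real nd + 1)"] y by simp
 ultimately have "R y2 <= l * R y1 + (1 - l) * R y3" unfolding R_def by (simp add: sum.distrib sdl alg)
 also have "... < s"
 proof (cases "l = 0")
  case False
  hence "l * R y1 < l * s" "(1 - l) * R y3 <= (1 - l) * s" using l R by (auto intro: mult_left_mono)
  thus ?thesis by (simp add: alg)
 qed (use R in simp)
 finally show ?thesis .
qed

text \<open>Near \<open>0\<close> the sign is that of \<open>H\<close>, with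
  \<open>poly H 0 = 2\<close>; near \<open>1\<close> the function falls to \<open>0\<close> with
  negative slope.\<close>

lemma u_near: "EX x. 0 < x & x < y & poly u x > 0" (is ?A) "EX x. y < x & x < 1 & poly u x > 0" (is ?B) if y: "0 < y" "y < 1" for y
proof -
 have "isCont (poly H) 0" by simp
 hence "(poly H \<longlongrightarrow> 2) (at 0)" using bdry(1) by (simp add: isCont_def)
 hence "\<forall>\<^sub>F x in at 0. poly H x > 0" by (rule order_tendstoD(1)) simp
 then obtain d where d: "d > 0" "!!x. x ~= 0 ==> dist x 0 < d ==> poly H x > 0" unfolding eventually_at by auto
 define x where "x = min (y/2) (d/2)"
 have "poly H x > 0" "0 < x" "x < y" using d(2)[of x] d(1) y unfolding x_def by (auto simp: dist_real_def)
 thus ?A by (intro exI[of _ x]) (simp add: u_def poly_monom)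
 have "poly u1 1 < 0" using bdry(6) W_pos[of 1] by simp
 from DERIV_neg_dec_left[OF du(1) this] obtain d where d: "d > 0" "!!h. 0 < h ==> h < d ==> poly u 1 < poly u (1 - h)" by blast
 define k where "k = min ((1 - y)/2) (d/2)"
 have "poly u (1 - k) > 0" "y < 1 - k" "1 - k < 1" using d(2)[of k] d(1) y bdry(5) unfolding k_def by (auto simp: min_def field_simps split: if_splits)
 thus ?B by blast
qed

text \<open>
  If \<open>u\<close> had a non-positive value inside \<open>(0,1)\<close>, then \<open>u''\<close> would take the signs \<open>-\<close>, \<open>+\<close>, \<open>-\<close> in
  this order, against the convexity of \<open>R\<close>.
\<close>

lemma u_pos: assumes y: "0 < y" "y < 1" shows "poly u y > 0"
proof (rule ccontr)
 assume n: "~ poly u y > 0"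
 obtain xa where xa: "0 < xa" "xa < y" "poly u xa > 0" using u_near(1)[OF y] by blast
 obtain xb where xb: "y < xb" "xb < 1" "poly u xb > 0" using u_near(2)[OF y] by blast
 have mv: "EX z. p < z & z < r & poly u r - poly u p = (r - p)*poly u1 z" if "p < r" for p r using MVT2[OF that du(1)] by blast
 obtain z0 where z0: "0 < z0" "z0 < xa" "poly u xa - poly u 0 = (xa - 0)*poly u1 z0" using mv[OF xa(1)] by blast
 obtain z1 where z1: "xa < z1" "z1 < y" "poly u y - poly u xa = (y - xa)*poly u1 z1" using mv[OF xa(2)] by blast
 obtain z2 where z2: "y < z2" "z2 < xb" "poly u xb - poly u y = (xb - y)*poly u1 z2" using mv[OF xb(1)] by blast
 obtain z3 where z3: "xb < z3" "z3 < 1" "poly u 1 - poly u xb = (1 - xb)*poly u1 z3" using mv[OF xb(2)] by blast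
 have s0: "poly u1 z0 > 0" using z0(3) xa bdry(3) by (simp add: zero_less_mult_iff)
 have "(y - xa)*poly u1 z1 < 0" using z1(3) n xa(3) by linarith
 hence s1: "poly u1 z1 < 0" using xa(2) by (simp add: mult_less_0_iff)
 have "(xb - y)*poly u1 z2 > 0" using z2(3) n xb(3) by linarith
 hence s2: "poly u1 z2 > 0" using xb(1) by (simp add: zero_less_mult_iff)
 have "(1 - xb)*poly u1 z3 < 0" using z3(3) xb(3) bdry(5) by linarith
 hence s3: "poly u1 z3 < 0" using xb(2) by (simp add: mult_less_0_iff)
 have mv2: "EX z. p < z & z < r & poly u1 r - poly u1 p = (r - p)*(z^(nd - 1)*poly Q z)" if "p < r" for p r using MVT2[OF that du(2)] by blast
 obtain w1 where w1: "z0 < w1" "w1 < z1" "poly u1 z1 - poly u1 z0 = (z1 - z0)*(w1^(nd - 1)*poly Q w1)" using mv2[of z0 z1] z0 z1 by auto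
 obtain w2 where w2: "z1 < w2" "w2 < z2" "poly u1 z2 - poly u1 z1 = (z2 - z1)*(w2^(nd - 1)*poly Q w2)" using mv2[of z1 z2] z1 z2 by auto
 obtain w3 where w3: "z2 < w3" "w3 < z3" "poly u1 z3 - poly u1 z2 = (z3 - z2)*(w3^(nd - 1)*poly Q w3)" using mv2[of z2 z3] z2 z3 by auto
 have "(z1 - z0)*(w1^(nd - 1)*poly Q w1) < 0" using w1(3) s0 s1 by linarith
 hence "w1^(nd - 1)*poly Q w1 < 0" using w1 by (simp only: mult_less_0_iff) linarith
 hence r1: "R w1 < s" using u2_sign(1)[of w1] w1 z0 z1 y by simp
 have "(z3 - z2)*(w3^(nd - 1)*poly Q w3) < 0" using w3(3) s2 s3 by linarith
 hence "w3^(nd - 1)*poly Q w3 < 0" using w3 by (simp only: mult_less_0_iff) linarith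
 hence r3: "R w3 < s" using u2_sign(1)[of w3] w3 z3 z2 y by simp
 have "(z2 - z1)*(w2^(nd - 1)*poly Q w2) > 0" using w2(3) s1 s2 by linarith
 hence "w2^(nd - 1)*poly Q w2 > 0" using w2 by (simp only: zero_less_mult_iff) linarith
 hence r2: "R w2 > s" using u2_sign(2)[of w2] w2 z0 z1 z2 xb xa by simp
 show False using R_convex[of w1 w2 w3] r1 r2 r3 w1 w2 w3 z0 z3 by simp
qed

lemma h_eq: "0 < x ==> h x = poly u x/(x^nd*poly W x)" by (simp add: h_def u_def poly_monom)

lemma h_pos: "0 < x ==> x < 1 ==> h x > 0" using u_pos[of x] W_pos[of x] by (simp add: h_eq)

lemma sci_poly: "sci (poly p)"
proof -
 have "der01 (poly ((pderiv ^^ k) p)) (poly ((pderiv ^^ Suc k) p) t) t" for k t using has_field_derivative_at_within[OF poly_DERIV] by simp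
 thus ?thesis unfolding smooth_closed_interval_def by (intro exI[of _ "%k. poly ((pderiv ^^ k) p)"]) auto
qed

lemma h_sci: "sci h"
proof -
 have nz: "ALL t:{0..1}. poly W t ~= 0" using W_pos by force
 have "sci (%x. x*poly H x*inverse (poly W x))" by (intro sci_cl_sci sci_cl.mult sci_cl.inv nz sci_cl.base[OF sci_poly] sci_cl.base[OF sci_id])
 thus ?thesis by (simp add: h_def divide_inverse)
qed

lemma h_deriv_0: "DERIV h 0 :> 2"
proof -
 have "DERIV (%x. x*poly H x/poly W x) 0 :> ((1*poly H 0 + poly (pderiv H) 0*0)*poly W 0 - 0*poly H 0*poly (pderiv W) 0)/(poly W 0*poly W 0)"
  by (intro DERIV_divide DERIV_mult DERIV_ident poly_DERIV) (simp add: W_0)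
 thus ?thesis by (simp add: h_def[abs_def] bdry(1) W_0)
qed

lemma h_deriv_1: "DERIV h 1 :> -2"
proof -
 have "pderiv u = u1" unfolding u_def u1_def H_def by (rule pderiv_pint)
 hence "poly (pderiv (monom 1 (Suc nd)*H)) 1 = - 2*poly W 1" using bdry(6) by (simp add: u_def)
 hence H1: "poly (pderiv H) 1 = - 2*poly W 1" using bdry(2) by (simp add: pderiv_mult poly_monom)
 have W1: "poly W 1 ~= 0" using W_pos[of 1] by simp
 have "DERIV (%x. x*poly H x/poly W x) 1 :> ((1*poly H 1 + poly (pderiv H) 1*1)*poly W 1 - 1*poly H 1*poly (pderiv W) 1)/(poly W 1*poly W 1)"
  by (intro DERIV_divide DERIV_mult DERIV_ident poly_DERIV W1)
 thus ?thesis using W1 by (simp add: h_def[abs_def] bdry(2) H1)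
qed

definition T where "T x = real nd/x + (SUM i:L. real (n i)*e i/(1 + e i*x))"
definition T' where "T' x = - real nd/x\<^sup>2 - (SUM i:L. real (n i)*(e i)\<^sup>2/(1 + e i*x)\<^sup>2)"
definition V where "V x = x^nd*poly W x"

lemma dW: "x:{0..1} ==> DERIV (poly W) x :> poly W x*(SUM i:L. real (n i)*e i/(1 + e i*x))"
proof -
 assume x: "x:{0..1}"
 have "DERIV (%x. PROD i:K. (1 + e i*x)^n i) x :> (PROD i:K. (1 + e i*x)^n i)*(SUM i:K. real (n i)*e i/(1 + e i*x))" if "K <= L" for K
  using finite_subset[OF that fin] that
 proof (induction K rule: finite_induct)
  case (insert i K)
  have p: "1 + e i*x > 0" using fac_pos[of i x] insert.prems x by blast
  have "DERIV (%x. 1 + e i*x) x :> e i" by (auto intro!: derivative_eq_intros)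
  from DERIV_power[OF this, of "n i"]
  have "DERIV (%x. (1 + e i*x)^n i) x :> (1 + e i*x)^n i*(real (n i)*e i/(1 + e i*x))" by (rule DERIV_cong) (use p in \<open>cases "n i"; simp\<close>)
  from DERIV_mult[OF this insert.IH] insert show ?case by (simp add: alg)
 qed simp
 from this[of L] show ?thesis unfolding poly_W[abs_def] by simp
qed

lemma dV: "0 < x ==> x < 1 ==> DERIV V x :> V x*T x"
proof -
 assume x: "0 < x" "x < 1"
 have "DERIV (%x. x^nd) x :> x^nd*(real nd/x)" by (rule DERIV_cong[OF DERIV_pow]) (use x in \<open>simp add: power_eq_if\<close>)
 from DERIV_mult[OF this dW[of x]] x show ?thesis unfolding V_def[abs_def] T_def by (simp add: alg)
qed

lemma dT: "0 < x ==> x < 1 ==> DERIV T x :> T' x"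
proof -
 assume x: "0 < x" "x < 1"
 have "DERIV (%x. real (n i)*e i/(1 + e i*x)) x :> - (real (n i)*(e i)\<^sup>2/(1 + e i*x)\<^sup>2)" if "i:L" for i
  using fac_pos[OF that, of x] x by (auto intro!: derivative_eq_intros simp: power2_eq_square)
 hence "DERIV (%x. SUM i:L. real (n i)*e i/(1 + e i*x)) x :> (SUM i:L. - (real (n i)*(e i)\<^sup>2/(1 + e i*x)\<^sup>2))" by (intro DERIV_sum) auto
 moreover have "DERIV (%x. real nd/x) x :> - (real nd/x\<^sup>2)" using x by (auto intro!: derivative_eq_intros simp: power2_eq_square)
 ultimately show ?thesis unfolding T_def[abs_def] T'_def by (auto intro!: DERIV_cong[OF DERIV_add] simp: sum_negf)
qed

text \<open>The two derivatives of \<open>u = V h\<close> are expanded by the product rule with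
  \<open>V' = V * T\<close>, compared with \<open>u'' = V * (R - s)\<close>, and divided by
  \<open>V\<close>. Inside the interval the one-sided derivatives \<open>D\<close> are ordinary
  ones.\<close>

lemma ode:
 assumes D: "!!t. t:{0..1} ==> D 0 t = h t" "!!k t. t:{0..1} ==> der01 (D k) (D (Suc k) t) t"
  and x: "0 < x" "x < 1" shows "R x - D 2 x - 2*T x*D 1 x - (T' x + (T x)\<^sup>2)*D 0 x = s"
proof -
 have Dk: "DERIV (D k) y :> D (Suc k) y" if "0 < y" "y < 1" for k y using D(2)[of y k] that by (simp add: at_within_Icc_at)
 have uV: "poly u y = V y*D 0 y" if "0 < y" "y < 1" for y using h_eq[of y] W_pos[of y] D(1)[of y] that by (simp add: V_def)
 have ev: "\<forall>\<^sub>F y in nhds z. 0 < y & y < 1" if "0 < z" "z < 1" for z :: real using eventually_nhds_in_open[of "{0<..<1}" z] that by simp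
 have u1V: "poly u1 y = V y*(T y*D 0 y + D 1 y)" if y: "0 < y" "y < 1" for y
 proof -
  have "DERIV (poly u) y :> V y*T y*D 0 y + D (Suc 0) y*V y"
   using DERIV_cong_ev[OF refl eventually_mono[OF ev[OF y]] refl, of "poly u" "%y. V y*D 0 y"] uV
    DERIV_mult[OF dV[OF y] Dk[OF y, of 0]] by blast
  from DERIV_unique[OF du(1) this] show ?thesis by (simp add: alg)
 qed
 have "DERIV (poly u1) x :> V x*T x*(T x*D 0 x + D 1 x) + (T' x*D 0 x + D (Suc 0) x*T x + D (Suc 1) x)*V x"
  using DERIV_cong_ev[OF refl eventually_mono[OF ev[OF x]] refl, of "poly u1" "%y. V y*(T y*D 0 y + D 1 y)"] u1V
   DERIV_mult[OF dV[OF x] DERIV_add[OF DERIV_mult[OF dT[OF x] Dk[OF x, of 0]] Dk[OF x, of 1]]] by blast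
 from DERIV_unique[OF du(2) this]
 have "x^(nd - 1)*poly Q x = V x*(D 2 x + 2*T x*D 1 x + (T' x + (T x)\<^sup>2)*D 0 x)" by (simp add: alg numeral_2_eq_2 power2_eq_square)
 moreover have "x^(nd - 1)*poly Q x = V x*(R x - s)" using poly_Q[of x] x power_minus_mult[of nd x] nd by (simp add: V_def mult_ac)
 ultimately have "V x*(R x - s) = V x*(D 2 x + 2*T x*D 1 x + (T' x + (T x)\<^sup>2)*D 0 x)" by (simp only:)
 moreover have "V x ~= 0" using W_pos[of x] x by (simp add: V_def)
 ultimately show ?thesis by (simp only: mult_cancel_left simp_thms)
qed

end

text \<open>The square of the determinant is a power of \<open>- 1\<close> and must be nonnegative.
  Even dimensions of the factors make \<open>V\<close> a polynomial.\<close>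

lemma even_card_square_minus_one:
 fixes A :: "'i=>'i=>real"
 assumes fin: "finite I" and A: "!!i j. i:I ==> j:I ==> (SUM l:I. A i l*A l j) = (if i = j then - 1 else 0)" shows "even (card I)"
proof -
 let ?d = "card I"
 obtain f where f: "bij_betw f {0..<?d} I" using ex_bij_betw_nat_finite[OF fin] by blast
 define B where "B = mat ?d ?d (%(i, j). A (f i) (f j))"
 have B: "B:carrier_mat ?d ?d" by (simp add: B_def)
 have "B*B = (- 1) \<cdot>\<^sub>m 1\<^sub>m ?d"
 proof (rule eq_matI)
  fix i j assume "i < dim_row ((- 1) \<cdot>\<^sub>m 1\<^sub>m ?d :: real mat)" "j < dim_col ((- 1) \<cdot>\<^sub>m 1\<^sub>m ?d :: real mat)"
  hence ij: "i < ?d" "j < ?d" by auto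
  hence "f i:I" "f j:I" "f i = f j \<longleftrightarrow> i = j" using f by (auto simp: bij_betw_def inj_on_eq_iff)
  moreover have "(B*B) $$ (i, j) = (SUM k = 0..<?d. A (f i) (f k)*A (f k) (f j))" using ij by (simp add: B_def scalar_prod_def)
  moreover have "... = (SUM l:I. A (f i) l*A l (f j))" by (rule sum.reindex_bij_betw[OF f])
  ultimately show "(B*B) $$ (i, j) = ((- 1) \<cdot>\<^sub>m 1\<^sub>m ?d) $$ (i, j)" using A ij by simp
 qed (use B in auto)
 hence "det B*det B = (- 1)^?d" using det_mult[OF B B] by simp
 hence "(- 1 :: real)^?d >= 0" by (metis zero_le_square)
 thus ?thesis by (cases "even ?d") (auto simp: uminus_power_if)
qed

lemma even_mdim:
 assumes M: "manifold M" and K: "kaehler M g J" and ne: "pts M ~= {}" shows "even (mdim M)"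
proof -
 obtain p where "p:pts M" using ne by blast
 then obtain c where c: "c:atlas M" "p:fst c" using mfd_cover[OF M] by blast
 show ?thesis unfolding mdim_def by (rule even_card_square_minus_one[OF mfd_fin[OF M] kaehler_comp(3)[OF M K c]])
qed

section \<open>The determinant condition and its solution curve\<close>

definition hfun :: "nat=>nat set=>(nat=>nat)=>(nat=>real)=>(nat=>real)=>real=>real=>real" where
 "hfun nd L n e c s = (%x. x*poly (pint (Suc nd) (pint nd (Q0p nd L n e c - [:s:]*([:0, 1:]*Wp L n e)))) x/poly (Wp L n e) x)"

text \<open>
  The two boundary conditions at \<open>x = 1\<close> are linear in \<open>s\<close>; \<open>E1\<close>, \<open>E2\<close> are the inhomogeneous terms and
  solvability is the vanishing of a determinant, divided by \<open>t\<close> in \<open>G\<close>.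
\<close>

locale parameters =
 fixes m :: nat and n :: "nat=>nat" and b :: "nat=>real" and i0 j0 :: nat
 assumes m: "1 <= m" and n: "!!i. i:{1..m} ==> n i >= 1" and b1: "b 1 = 1/(real (n 1) + 1)"
  and i0: "i0:{2..m}" "b i0 > 0" and j0: "j0:{2..m}" "b j0 < 0"
begin

abbreviation "L == {2..m}"
definition nd where "nd = n 1"
text \<open>Chosen so that \<open>n i0 * b i0 * C\<close> exceeds the absolute sum over the indices
  other than \<open>i0\<close>, \<open>j0\<close> by \<open>1\<close>. The sum without
  \<open>j0\<close> is then positive, and so is \<open>rs\<close>, the zero of
  \<open>B\<close>.\<close>

definition C where "C = (\<bar>SUM i:L - {i0} - {j0}. real (n i)*b i\<bar> + 1)/(real (n i0)*b i0)"
definition z where "z i r = (if i = j0 then r else if i = i0 then C else 1)"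
definition B where "B r = (SUM i:L. real (n i)*(z i r*b i))"
definition rs where "rs = ((SUM i:L - {i0} - {j0}. real (n i)*b i) + real (n i0)*b i0 * C)/(real (n j0)*- b j0)"
definition ee where "ee t r i = t*(z i r*b i)"
definition cc where "cc t r i = t*(2*real (n i)*z i r)"
definition WW where "WW t r = Wp L n (ee t r)"
definition YY where "YY t r = Yp L n (ee t r) (cc t r)"
definition mu where "mu j t r = mom j (WW t r)"
definition E1 where "E1 t r = 2*real nd*(real nd + 1)*mu nd t r + mom (Suc nd) (YY t r) + 2*poly (WW t r) 1"
definition E2 where "E2 t r = 2*real nd*(real nd + 1)*mu (Suc nd) t r + mom (Suc (Suc nd)) (YY t r) + 2*poly (WW t r) 1"
text \<open>The end conditions are \<open>E1 = s * mu (nd + 1)\<close> and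
  \<open>E2 = s * mu (nd + 2)\<close>; this value solves the first.\<close>

definition ss where "ss t r = E1 t r/mu (Suc nd) t r"

abbreviation "QQ t r == Q0p nd L n (ee t r) (cc t r) - [:ss t r:]*([:0, 1:]*Wp L n (ee t r))"
abbreviation "n1 == real nd"

lemma n2: "i:L ==> n i >= 1" using n by auto
lemma nd: "nd >= 1" unfolding nd_def using n m by auto
lemma ij: "i0 ~= j0" using i0 j0 by auto

lemma C_pos: "C > 0" "rs > 0"
proof -
 let ?S = "SUM i:L - {i0} - {j0}. real (n i)*b i"
 have p: "real (n i0)*b i0 > 0" using n2[OF i0(1)] i0(2) by simp
 have p': "real (n j0)*- b j0 > 0" using n2[OF j0(1)] j0(2) by (simp add: mult_pos_neg)
 show "C > 0" unfolding C_def using p by (intro divide_pos_pos) auto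
 have "real (n i0)*b i0 * C = \<bar>?S\<bar> + 1" unfolding C_def times_divide_eq_right by (rule nonzero_mult_div_cancel_left) (use p in linarith)
 hence "?S + real (n i0)*b i0 * C > 0" by linarith
 thus "rs > 0" unfolding rs_def using p' by (intro divide_pos_pos)
qed

lemma B_eq: "B r = real (n j0)*- b j0*(rs - r)"
proof -
 have "B r = (SUM i:L - {i0}. real (n i)*(z i r*b i)) + real (n i0)*b i0 * C" unfolding B_def using i0 ij by (subst sum.remove[of L i0]) (auto simp: z_def)
 also have "(SUM i:L - {i0}. real (n i)*(z i r*b i)) = (SUM i:L - {i0} - {j0}. real (n i)*(z i r*b i)) + real (n j0)*(r*b j0)"
  using j0 ij by (subst sum.remove[of "L - {i0}" j0]) (auto simp: z_def)
 also have "(SUM i:L - {i0} - {j0}. real (n i)*(z i r*b i)) = (SUM i:L - {i0} - {j0}. real (n i)*b i)" by (intro sum.cong) (auto simp: z_def)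
 finally have "B r = (real (n j0)*- b j0)*rs + real (n j0)*(r*b j0)" unfolding rs_def using n2[OF j0(1)] j0(2) by simp
 thus ?thesis by (simp add: alg)
qed

lemma cls_z: "cls (%t. z i)" unfolding z_def using cls_const cls_r by (cases "i = j0"; cases "i = i0") simp_all

lemma pjet_pow: "pjet (%t r. [:1, ee t r i:]^k) (%_. 1) (%r. SUM _<k. [:0, z i r*b i:])"
proof -
 have "pjet (%t r. [:1, t*(z i r*b i):]) (%_. 1) (%r. [:0, z i r*b i:])" by (rule pjet_linear[OF cls_mult[OF cls_z cls_const]])
 from pjet_prod1[of "{..<k}" "%_ t r. [:1, t*(z i r*b i):]", OF _ this] show ?thesis by (simp add: ee_def)
qed

lemma pjet_W: "pjet WW (%_. 1) (%r. [:0, B r:])"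
proof -
 have "(SUM i:L. SUM _<n i. [:0, z i r*b i:]) = [:0, B r:]" for r by (rule poly_eqI, unfold coeff_sum) (auto simp: B_def coeff_pCons split: nat.splits)
 thus ?thesis using pjet_prod1[where A = L and f = "%i t r. [:1, ee t r i:]^n i", OF finite_atLeastAtMost pjet_pow] unfolding WW_def[abs_def] Wp_def by simp
qed

lemma pjet_Y: "pjet YY (%_. 0) (%r. [:SUM i:L. 2*real (n i)*z i r:])"
proof -
 have "pjet (%t r. [:1, ee t r i:]^(n i - 1)*(PROD k:L - {i}. [:1, ee t r k:]^n k)) (%_. 1*1)
  (%r. 1*(SUM k:L - {i}. SUM _<n k. [:0, z k r*b k:]) + (SUM _<n i - 1. [:0, z i r*b i:])*1)" for i by (intro pjet_mult pjet_pow pjet_prod1) auto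
 from pjet_mult[OF pjet_t_const[OF cls_mult[OF cls_const cls_z]] this]
 have "pjet (%t r. [:cc t r i:]*([:1, ee t r i:]^(n i - 1)*(PROD k:L - {i}. [:1, ee t r k:]^n k))) (%_. 0) (%r. [:2*real (n i)*z i r:])" for i unfolding cc_def by simp
 from pjet_sum[where A = L, OF this] have "pjet YY (%_. 0) (%r. SUM i:L. [:2*real (n i)*z i r:])" unfolding YY_def[abs_def] Yp_def by simp
 moreover have "(SUM i:L. [:2*real (n i)*z i r:]) = [:SUM i:L. 2*real (n i)*z i r:]" for r by (rule poly_eqI) (auto simp: coeff_sum coeff_pCons split: nat.splits)
 ultimately show ?thesis by simp
qed

lemma mom_simple: "mom j 1 = 1/real j" "mom j [:k:] = k/real j" (is ?A) "mom j [:0, k:] = k/(real j + 1)" (is ?B) "mom j 0 = 0"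
proof -
 show "mom j 1 = 1/real j" ?A "mom j 0 = 0" by (simp_all add: mom_def)
 show ?B using mom_upto[of "[:0, k:]" 1 j] by (simp add: add.commute)
qed

lemma jet_mu: "jet (mu j) (%r. 1/real j) (%r. B r/(real j + 1))" using jet_mom[OF pjet_W, of j] by (simp add: mu_def[abs_def] mom_simple)

abbreviation "\<Gamma> r == SUM i:L. 2*real (n i)*z i r"

lemma jet_E: "jet E1 (%r. 2*n1*(n1 + 1)*(1/n1) + 0 + 2*1) (%r. 2*n1*(n1 + 1)*(B r/(n1 + 1)) + \<Gamma> r/real (Suc nd) + 2*B r)" (is ?A)
 "jet E2 (%r. 2*n1*(n1 + 1)*(1/real (Suc nd)) + 0 + 2*1) (%r. 2*n1*(n1 + 1)*(B r/(real (Suc nd) + 1)) + \<Gamma> r/real (Suc (Suc nd)) + 2*B r)" (is ?B)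
proof -
 have c: "jet (%t r. k*f t r) (%r. k*f0 r) (%r. k*f1 r)" if "jet f f0 f1" for k f f0 f1 using jet_mult[OF jet_const[of k] that] by simp
 have y: "jet (%t r. mom j (YY t r)) (%r. 0) (%r. \<Gamma> r/real j)" for j using jet_mom[OF pjet_Y, of j] by (simp add: mom_simple)
 have w: "jet (%t r. poly (WW t r) 1) (%r. 1) (%r. B r)" using jet_poly1[OF pjet_W] by simp
 show ?A
  unfolding E1_def[abs_def] by (intro jet_add c jet_mu y w)
 show ?B
  unfolding E2_def[abs_def] by (intro jet_add c jet_mu y w)
qed

text \<open>At \<open>t = 0\<close> both end conditions hold with
  \<open>s = 2 * (nd + 1) * (nd + 2)\<close>, so the determinant has no constant term. In the
  first-order term the contributions of \<open>\<Gamma>\<close> cancel and a negative multiple of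
  \<open>B r\<close> remains.\<close>

lemma G_exists: "EX G. cls G & (ALL t r. E1 t r*mu (Suc (Suc nd)) t r - E2 t r*mu (Suc nd) t r = t*G t r) &
  (ALL r. G 0 r = 4/((n1 + 1)*(n1 + 2)*(n1 + 3))*(real (n j0)*- b j0)*(r - rs))"
proof -
 let ?x = "n1"
 let ?kp = "4/((?x + 1)*(?x + 2)*(?x + 3))"
 have c: "jet (%t r. (- 1)*f t r) (%r. (- 1)*f0 r) (%r. (- 1)*f1 r)" if "jet f f0 f1" for f f0 f1 using jet_mult[OF jet_const[of "- 1"] that] by simp
 note j = jet_add[OF jet_mult[OF jet_E(1) jet_mu[of "Suc (Suc nd)"]] c[OF jet_mult[OF jet_E(2) jet_mu[of "Suc nd"]]]]
 have x: "?x > 0" using nd by simp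
 have x': "?x ~= 0" "?x + 1 ~= 0" "?x + 2 ~= 0" "?x + 3 ~= 0" using x by linarith+
 have 0: "(2*?x*(?x + 1)*(1/?x) + 0 + 2*1)*(1/(?x + 2)) + (- 1)*((2*?x*(?x + 1)*(1/(?x + 1)) + 0 + 2*1)*(1/(?x + 1))) = 0"
  using x' by (simp add: divide_simps) (simp add: alg)
 have 1: "(2*?x*(?x + 1)*(1/?x) + 0 + 2*1)*(bt/(?x + 3)) + (2*?x*(?x + 1)*(bt/(?x + 1)) + ga/(?x + 1) + 2*bt)*(1/(?x + 2))
  + (- 1)*((2*?x*(?x + 1)*(1/(?x + 1)) + 0 + 2*1)*(bt/(?x + 2)) + (2*?x*(?x + 1)*(bt/(?x + 2)) + ga/(?x + 2) + 2*bt)*(1/(?x + 1))) = - ?kp*bt" for bt ga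
  using x' by (simp add: divide_simps) (simp add: alg)
 have n: "real (Suc nd) = ?x + 1" "real (Suc (Suc nd)) = ?x + 2" "?x + 1 + 1 = ?x + 2" "?x + 2 + 1 = ?x + 3" by simp_all
 obtain R where R: "cls R" "!!t r. E1 t r*mu (Suc (Suc nd)) t r + (- 1)*(E2 t r*mu (Suc nd) t r) = 0 + t*(- ?kp*B r) + t\<^sup>2 * R t r"
  using j unfolding n 0 1 jet_def by blast
 have cB: "cls (%t. B)" unfolding B_def[abs_def] by (intro cls_sum cls_mult cls_const cls_z)
 show ?thesis
 proof (intro exI[of _ "%t r. - ?kp*B r + t * R t r"] conjI allI)
  show "cls (%t r. - ?kp*B r + t * R t r)" by (intro cls_add cls_mult cls_const cls_t cB R)
  show "E1 t r*mu (Suc (Suc nd)) t r - E2 t r*mu (Suc nd) t r = t*(- ?kp*B r + t * R t r)" for t r using R(2)[of t r] by (simp add: alg power2_eq_square)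
  show "- ?kp*B r + 0 * R 0 r = ?kp*(real (n j0)*- b j0)*(r - rs)" for r unfolding B_eq by (simp add: alg)
 qed
qed

definition good where "good t r = (t > 0 & r > 0 & mu (Suc nd) t r > 0 & (ALL i:L. 1 + ee t r i > 0) & E1 t r*mu (Suc (Suc nd)) t r = E2 t r*mu (Suc nd) t r)"

text \<open>The zero \<open>rs\<close> of \<open>G 0\<close> is bracketed by \<open>rs / 2\<close>
  and \<open>2 * rs\<close>. On this segment the inequalities for \<open>mu\<close> and for the
  factors \<open>1 + ee\<close> hold at \<open>t = 0\<close>, where the values are
  \<open>1 / (nd + 1)\<close> and \<open>1\<close>; \<open>t0\<close> is small enough to keep
  them.\<close>

lemma curve: "EX t0>0. EX rh. cont {0..t0} rh & (ALL t:{0<..t0}. good t (rh t))"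
proof -
 obtain G where G: "cls G" "!!t r. E1 t r*mu (Suc (Suc nd)) t r - E2 t r*mu (Suc nd) t r = t*G t r"
  "!!r. G 0 r = 4/((n1 + 1)*(n1 + 2)*(n1 + 3))*(real (n j0)*- b j0)*(r - rs)" using G_exists by blast
 define k where "k = 4/((n1 + 1)*(n1 + 2)*(n1 + 3))*(real (n j0)*- b j0)"
 have k: "k > 0" unfolding k_def using n2[OF j0(1)] j0(2) by (intro mult_pos_pos divide_pos_pos) auto
 have G0: "G 0 = (%r. k*(r - rs))" using G(3) by (auto simp: k_def)
 have rs: "rs > 0" by (rule C_pos)
 have "EX t0>0. EX rh. cont {0..t0} rh & (ALL t:{0..t0}. rh t:{rs/2..2*rs} & G t (rh t) = 0)"
 proof (rule implicit_root[OF G(1)])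
  show "G 0 (rs/2) < 0" "G 0 (2*rs) > 0" "rs/2 < 2*rs" unfolding G0 using k rs by (auto simp: mult_pos_neg)
  fix r G' assume d: "DERIV (G 0) r :> G'"
  have "DERIV (G 0) r :> k" unfolding G0 by (auto intro!: derivative_eq_intros)
  from DERIV_unique[OF d this] show "G' > 0" using k by simp
 qed
 then obtain t1 rh where t1: "t1 > 0" and rh: "cont {0..t1} rh" "!!t. t:{0..t1} ==> rh t:{rs/2..2*rs}" "!!t. t:{0..t1} ==> G t (rh t) = 0" by blast
 have cmu: "cont UNIV (%(t, r). mu (Suc nd) t r)" using jet_cls[OF jet_mu] unfolding cls_def by blast
 have m0: "mu (Suc nd) 0 r > 0" for r using jet_mu[of "Suc nd"] unfolding jet_def by auto
 obtain t2 where t2: "t2 > 0" "!!t r. t:{0..t2} ==> r:{rs/2..2*rs} ==> mu (Suc nd) t r > 0" using cls_tube[OF cmu, of "rs/2" "2*rs"] m0 by blast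
 have "EX t0>0. ALL t:{0..t0}. ALL r:{rs/2..2*rs}. 1 + ee t r i > 0" for i
 proof (rule cls_tube)
  have "cls (%t r. 1 + t*(z i r*b i))" by (intro cls_add cls_mult cls_const cls_t cls_z)
  thus "cont UNIV (%(t, r). 1 + ee t r i)" unfolding cls_def ee_def by blast
 qed (simp add: ee_def)
 then obtain tu where tu: "!!i. tu i > 0" "!!i t r. t:{0..tu i} ==> r:{rs/2..2*rs} ==> 1 + ee t r i > 0" by metis
 define t0 where "t0 = Min ({t1, t2} \<union> tu ` L)"
 have t0: "t0 <= t1" "t0 <= t2" "!!i. i:L ==> t0 <= tu i" unfolding t0_def by (rule Min_le; blast)+
 have "t0 > 0" unfolding t0_def by (subst Min_gr_iff) (use t1 t2(1) tu(1) in auto)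
 moreover have "cont {0..t0} rh" by (rule continuous_on_subset[OF rh(1)]) (use t0(1) in auto)
 moreover have "good t (rh t)" if t: "t:{0<..t0}" for t
 proof -
  have r: "rh t:{rs/2..2*rs}" "G t (rh t) = 0" using rh(2,3)[of t] t t0(1) by auto
  thus ?thesis unfolding good_def using t t2(2)[of t "rh t"] tu(2)[of t _ "rh t"] t0 rs G(2)[of t "rh t"] by force
 qed
 ultimately show ?thesis by blast
qed

lemma z_pos: "r > 0 ==> z i r > 0" using C_pos(1) by (simp add: z_def)

lemma good_momentum:
 assumes "good t r" shows "momentum L n nd (ee t r) (cc t r) (ss t r)"
proof -
 have g: "t > 0" "r > 0" "mu (Suc nd) t r > 0" "!!i. i:L ==> 1 + ee t r i > 0" "E1 t r*mu (Suc (Suc nd)) t r = E2 t r*mu (Suc nd) t r"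
  using assms unfolding good_def by auto
 have mQ: "mom j (Q0p nd L n (ee t r) (cc t r) - [:s:]*([:0, 1:]*Wp L n (ee t r)))
  = 2*n1*(n1 + 1)*mu j t r + mom (Suc j) (YY t r) - s*mu (Suc j) t r" for j s
 proof -
  have s: "[:k:]*p = Polynomial.smult k p" for k and p :: "real poly" by simp
  have "p - [:s:]*p' = p + Polynomial.smult (- s) p'" for p p' :: "real poly" by simp
  hence eq: "Q0p nd L n (ee t r) (cc t r) - [:s:]*([:0, 1:]*Wp L n (ee t r)) = Q0p nd L n (ee t r) (cc t r) + Polynomial.smult (- s) ([:0, 1:]*WW t r)"
   by (simp only: WW_def)
  show ?thesis unfolding eq unfolding Q0p_def mom_add mom_smult mom_shift s WW_def[symmetric] YY_def[symmetric] by (simp add: mu_def)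
 qed
 show ?thesis
 proof (rule momentum.intro)
  show "finite L" by simp
  show "n i >= 1" if "i:L" for i by (rule n2[OF that])
  show "nd >= 1" by (rule nd)
  show "1 + ee t r i > 0" if "i:L" for i by (rule g(4)[OF that])
  show "cc t r i >= 0" for i using g(1) z_pos[OF g(2), of i] by (simp add: cc_def)
  show "mom nd (QQ t r) = - 2*poly (Wp L n (ee t r)) 1"
   unfolding mQ using g(3) by (simp add: ss_def E1_def WW_def)
  \<comment> \<open>The vanishing determinant at work: the value of \<open>s\<close> that solves the
    first end condition also solves the second.\<close>
  have "ss t r*mu (Suc (Suc nd)) t r = E2 t r" using g(3,5) by (simp add: ss_def field_simps)
  thus "mom (Suc nd) (QQ t r) = - 2*poly (Wp L n (ee t r)) 1" unfolding mQ by (simp add: E2_def WW_def)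
 qed
qed

definition hh where "hh t r = hfun nd L n (ee t r) (cc t r) (ss t r)"
definition aa where "aa t r i = (if i = 1 then 0 else 1/(t*z i r))"

lemma good_profile:
 assumes g: "good t r" shows "profile m b (hh t r) (aa t r)" (is ?A) "ss t r > 0"
proof -
 interpret mo: momentum L n nd "ee t r" "cc t r" "ss t r" "QQ t r"
  "pint (Suc nd) (pint nd (QQ t r))" "hh t r"
  by (rule good_momentum[OF g]) (rule reflexive | simp add: hh_def hfun_def)+
 have t: "t > 0" "r > 0" using g unfolding good_def by auto
 have A: "b i*y + aa t r i = (1 + ee t r i*y)/(t*z i r)" if "i:L" for i y using that t z_pos[OF t(2), of i] by (simp add: aa_def ee_def field_simps)
 have tz: "t*z i r > 0" for i using t z_pos[OF t(2), of i] by simp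
 show "ss t r > 0" by (rule mo.s_pos)
 show ?A unfolding profile_def
 proof (intro conjI ballI)
  show "sci (hh t r)" by (rule mo.h_sci)
  show "hh t r y > 0" if "y:{0<..<1}" for y using mo.h_pos[of y] that by simp
  show "hh t r 0 = 0" by (simp add: hh_def hfun_def)
  show "hh t r 1 = 0" using mo.bdry(2) by (simp add: hh_def hfun_def)
  show "der01 (hh t r) 2 0" "der01 (hh t r) (-2) 1" by (rule has_field_derivative_at_within[OF mo.h_deriv_0] has_field_derivative_at_within[OF mo.h_deriv_1])+
  show "aa t r 1 = 0" by (simp add: aa_def)
  show "b i*y + aa t r i > 0" if "i:L" "y:{0..1}" for i y unfolding A[OF that(1)] by (rule divide_pos_pos[OF mo.fac_pos[OF that] tz])
 qed
qed

text \<open>Here \<open>A i\<close> is \<open>(1 + ee t r i * y) / (t * z i r)\<close> for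
  \<open>i >= 2\<close> and \<open>A 1\<close> is \<open>y / (nd + 1)\<close>. With these values the
  three sums are \<open>mo.T\<close>, \<open>mo.R\<close> and \<open>- mo.T'\<close>, and the claim
  is \<open>mo.ode\<close>.\<close>

lemma good_ode:
 assumes g: "good t r" and D: "!!y. y:{0..1} ==> D 0 y = hh t r y"
  "!!k y. y:{0..1} ==> der01 (D k) (D (Suc k) y) y"
  and y: "0 < y" "y < 1" and T: "T = (SUM i=1..m. real (2*n i)*b i/(2*(b i*y + aa t r i)))" shows "(SUM i=1..m. real (2*n i)/(b i*y + aa t r i)) - D 2 y - 2*T*D 1 y
    - (T\<^sup>2 - (SUM i=1..m. real (2*n i)*(b i)\<^sup>2/(2*(b i*y + aa t r i)\<^sup>2)))*D 0 y = ss t r"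
proof -
 interpret mo: momentum L n nd "ee t r" "cc t r" "ss t r" "QQ t r"
  "pint (Suc nd) (pint nd (QQ t r))" "hh t r"
  by (rule good_momentum[OF g]) (rule reflexive | simp add: hh_def hfun_def)+
 have t: "t > 0" "r > 0" using g unfolding good_def by auto
 have A: "b i*y + aa t r i = (1 + ee t r i*y)/(t*z i r)" if "i:L" for i y using that t z_pos[OF t(2), of i] by (simp add: aa_def ee_def field_simps)
 have tz: "t*z i r > 0" for i using t z_pos[OF t(2), of i] by simp
 have b1y: "b 1*y + aa t r 1 = y/(n1 + 1)" "b 1 = 1/(n1 + 1)" using b1 by (simp_all add: aa_def nd_def)
 have p: "1 + ee t r i*y > 0" if "i:L" for i using mo.fac_pos[OF that, of y] y by simp
 have q: "n1 + 1 ~= 0" "y ~= 0" using y by auto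
 have frac: "real (2*k)*bt/(2*(w/(t*ze))) = real k*(t*(ze*bt))/w"
  "real (2*k)*bt\<^sup>2/(2*(w/(t*ze))\<^sup>2) = real k*(t*(ze*bt))\<^sup>2/w\<^sup>2" if "w > 0" "t*ze > 0" for k w ze bt
  by (simp_all add: power_divide power_mult_distrib mult_ac)
 have f1: "real (2*n i)*b i/(2*(b i*y + aa t r i)) = real (n i)*ee t r i/(1 + ee t r i*y)"
  "real (2*n i)/(b i*y + aa t r i) = cc t r i/(1 + ee t r i*y)"
  "real (2*n i)*(b i)\<^sup>2/(2*(b i*y + aa t r i)\<^sup>2) = real (n i)*(ee t r i)\<^sup>2/(1 + ee t r i*y)\<^sup>2" if "i:L" for i
  using frac[where k = "n i" and bt = "b i", OF p[OF that] tz[of i]] unfolding A[OF that] by (simp_all add: ee_def cc_def mult_ac)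
 have f2: "real (2*n 1)*b 1/(2*(b 1*y + aa t r 1)) = n1/y"
  "real (2*n 1)/(b 1*y + aa t r 1) = 2*n1*(n1 + 1)/y"
  "real (2*n 1)*(b 1)\<^sup>2/(2*(b 1*y + aa t r 1)\<^sup>2) = n1/y\<^sup>2" unfolding b1y(1) unfolding b1y(2) using q by (simp_all add: nd_def power_divide)
 have e1: "T = mo.T y" unfolding T mo.T_def sum_first[OF m, of "%i. real (2*n i)*b i/(2*(b i*y + aa t r i))"] f2(1) using sum.cong[OF refl f1(1), of L "%i. i"] by simp
 have e2: "(SUM i=1..m. real (2*n i)/(b i*y + aa t r i)) = mo.R y" unfolding mo.R_def sum_first[OF m, of "%i. real (2*n i)/(b i*y + aa t r i)"] f2(2)
  using sum.cong[OF refl f1(2), of L "%i. i"] by simp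
 have e3: "(SUM i=1..m. real (2*n i)*(b i)\<^sup>2/(2*(b i*y + aa t r i)\<^sup>2)) = - mo.T' y"
  unfolding mo.T'_def sum_first[OF m, of "%i. real (2*n i)*(b i)\<^sup>2/(2*(b i*y + aa t r i)\<^sup>2)"] f2(3) using sum.cong[OF refl f1(3), of L "%i. i"] by simp
 have "mo.R y - D 2 y - 2*mo.T y*D 1 y - (mo.T' y + (mo.T y)\<^sup>2)*D 0 y = ss t r" by (rule mo.ode[where D = D and x = y]) (use D y in auto)
 thus ?thesis unfolding e1 e2 e3 diff_minus_eq_add by (simp only: add.commute)
qed

end

lemma poly_upto: "degree p <= d ==> poly p y = (SUM k<=d. coeff p k*y^k)" for y :: real using sum_coeff_upto[of p d "%k. y^k"] by (simp add: poly_altdef)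

lemma cls_comp: "cls f ==> cont A T ==> cont A R ==> cont A (%t. f (T t) (R t))"
 unfolding cls_def using continuous_on_compose2[of UNIV "%(t, r). f t r" A "%t. (T t, R t)"] by (simp add: continuous_on_Pair)

lemma pjet_cont:
 assumes p: "pjet p p0 p1" and T: "cont A T" "cont A R" shows "cont (A \<times> B) (%(t, y). SUM k<=d. coeff (p (T t) (R t)) k*w k*y^k)"
proof -
 have "cls (%t r. coeff (p t r) k)" for k using p jet_cls unfolding pjet_def by blast
 hence "cont A (%t. coeff (p (T t) (R t)) k)" for k by (rule cls_comp[OF _ T])
 hence "cont (A \<times> B) (%u. coeff (p (T (fst u)) (R (fst u))) k)" for k
  by (rule continuous_on_compose2[of A _ "A \<times> B" fst]) (auto intro: continuous_intros)
 thus ?thesis unfolding case_prod_beta by (intro continuous_intros)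
qed

context parameters begin

text \<open>The degrees of the polynomials may vary with the parameters, so they are written as sums
  of fixed length. The weight \<open>w k\<close> is the effect of the double integration on the
  coefficient of \<open>y^k\<close>.\<close>

lemma hh_cont:
 assumes T: "cont A T" "cont A R" and g: "!!t. t:A ==> good (T t) (R t)" shows "cont (A \<times> {0..1}) (%(t, y). hh (T t) (R t) y)"
proof -
 let ?Q = "%t r. [:2*n1*(n1 + 1):]*WW t r + [:0, 1:]*YY t r" and ?V = "%t r. [:0, 1:]*WW t r"
 note pQ = pjet_add[OF pjet_mult[OF pjet_const[of "[:2*n1*(n1 + 1):]"] pjet_W] pjet_mult[OF pjet_const[of "[:0, 1:]"] pjet_Y]]
 note pV = pjet_mult[OF pjet_const[of "[:0, 1:]"] pjet_W]
 obtain d1 d2 d3 where d: "!!t r. degree (?Q t r) <= d1" "!!t r. degree (?V t r) <= d2" "!!t r. degree (WW t r) <= d3" using pQ pV pjet_W unfolding pjet_def by meson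
 define D where "D = max d1 d2"
 define w where "w k = 1/(real (k + nd)*real (k + Suc nd))" for k
 have H: "poly (pint (Suc nd) (pint nd (?Q t r - [:s:]*?V t r))) y
   = (SUM k<=D. coeff (?Q t r) k*w k*y^k) - s*(SUM k<=D. coeff (?V t r) k*w k*y^k)" for t r s y
 proof -
  have "degree (Polynomial.smult s (?V t r)) <= D" using degree_smult_le[of s "?V t r"] d(2)[of t r] unfolding D_def by linarith
  hence "degree (?Q t r - Polynomial.smult s (?V t r)) <= D" using degree_diff_le[of "?Q t r" D "Polynomial.smult s (?V t r)"] d(1)[of t r] unfolding D_def by linarith
  moreover have sm: "[:s:]*p = Polynomial.smult s p" for p :: "real poly" by simp
  ultimately have "degree (pint (Suc nd) (pint nd (?Q t r - [:s:]*?V t r))) <= D" unfolding sm by (intro order_trans[OF degree_pint] order_trans[OF degree_pint])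
  from poly_upto[OF this, of y] show ?thesis unfolding coeff_pint sm coeff_diff coeff_smult w_def sdl sum_subtractf[symmetric]
   by (simp only: divide_divide_eq_left) (intro sum.cong refl, simp add: diff_divide_distrib left_diff_distrib)
 qed
 have W: "poly (WW t r) y = (SUM k<=d3. coeff (WW t r) k*1*y^k)" for t r y using poly_upto[OF d(3)] by simp
 have Wnz: "poly (WW (T t) (R t)) y ~= 0" if "t:A" "y:{0..1}" for t y using momentum.W_pos[OF good_momentum[OF g[OF that(1)]] that(2)] unfolding WW_def by simp
 have "cont A (%t. ss (T t) (R t))" unfolding ss_def using g
  by (intro continuous_on_divide cls_comp[OF jet_cls[OF jet_E(1)] T] cls_comp[OF jet_cls[OF jet_mu] T]) (force simp: good_def)
 hence cs: "cont (A \<times> {0..1}) (%u. ss (T (fst u)) (R (fst u)))"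
  by (rule continuous_on_compose2[of A _ "A \<times> {0..1}" fst]) (auto intro: continuous_intros)
 have cW: "cont (A \<times> {0..1}) (%u. poly (WW (T (fst u)) (R (fst u))) (snd u))"
  using pjet_cont[OF pjet_W T, where B = "{0..1}" and d = d3 and w = "%_. 1"] unfolding W case_prod_beta .
 have "cont (A \<times> {0..1}) (%u. snd u*((SUM k<=D. coeff (?Q (T (fst u)) (R (fst u))) k*w k * snd u^k)
   - ss (T (fst u)) (R (fst u))*(SUM k<=D. coeff (?V (T (fst u)) (R (fst u))) k*w k * snd u^k))/poly (WW (T (fst u)) (R (fst u))) (snd u))"
  using pjet_cont[OF pQ T, where B = "{0..1}" and d = D and w = w, unfolded case_prod_beta] pjet_cont[OF pV T, where B = "{0..1}" and d = D and w = w, unfolded case_prod_beta] cs cW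
  by (intro continuous_on_divide continuous_on_mult continuous_on_diff continuous_on_snd[OF continuous_on_id]) (use Wnz in auto)
 thus ?thesis unfolding case_prod_beta hh_def hfun_def Q0p_def WW_def[symmetric] YY_def[symmetric] H .
qed

lemma aa_cont:
 assumes T: "cont A T" "cont A R" and g: "!!t. t:A ==> good (T t) (R t)" shows "cont A (%t. aa (T t) (R t) i)"
proof (cases "i = 1")
 case False
 have "cont A (%t. T t*z i (R t))" by (rule cls_comp[OF cls_mult[OF cls_t cls_z] T])
 moreover have "T t*z i (R t) ~= 0" if "t:A" for t using g[OF that] z_pos[of "R t" i] unfolding good_def by force
 ultimately have "cont A (%t. 1/(T t*z i (R t)))" by (intro continuous_on_divide continuous_on_const) auto
 thus ?thesis using False by (simp add: aa_def)
qed (simp add: aa_def)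

end

theorem theorem8p12:
  fixes m :: nat
    and N :: "nat \<Rightarrow> ('b, 'k) mfd" and gN :: "nat \<Rightarrow> 'b metric" and JN :: "nat \<Rightarrow> 'b endo"
    and b :: "nat \<Rightarrow> real"
    and P :: "('p, 'l) mfd" and act :: "complex \<Rightarrow> 'p \<Rightarrow> 'p" and pr :: "'p \<Rightarrow> nat \<Rightarrow> 'b"
    and \<theta> :: "'p \<Rightarrow> 'p tv \<Rightarrow> real"
    and M :: "('a, 'n) mfd" and x :: "'a \<Rightarrow> real" and q :: "'a \<Rightarrow> 'p"
    and h\<^sub>0 :: "real \<Rightarrow> real" and a\<^sub>0 :: "nat \<Rightarrow> real" and g\<^sub>0 :: "'a metric" and J\<^sub>0 :: "'a endo"
  assumes "construction_two m N gN JN b P act pr \<theta> M x q"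
    and "kaehler M g\<^sub>0 J\<^sub>0"
    and "profile m b h\<^sub>0 a\<^sub>0"
    and "metric_form m N gN JN b P pr \<theta> M x q h\<^sub>0 a\<^sub>0 g\<^sub>0 J\<^sub>0"
    and "\<exists>i\<in>{2..m}. b i > 0"
    and "\<exists>j\<in>{2..m}. b j < 0"
  shows "\<exists>(h :: real \<Rightarrow> real \<Rightarrow> real) (a :: real \<Rightarrow> nat \<Rightarrow> real)
            (g :: real \<Rightarrow> 'a metric) (J :: real \<Rightarrow> 'a endo).
           (\<forall>t\<in>{0<..<1}.
              kaehler M (g t) (J t) \<and>
              profile m b (h t) (a t) \<and>
              metric_form m N gN JN b P pr \<theta> M x q (h t) (a t) (g t) (J t) \<and>
              (\<exists>s>0. const_scalar_curv M (g t) s)) \<and>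
           (\<forall>i\<in>{1..m}. continuous_on {0<..<1} (\<lambda>t. a t i)) \<and>
           continuous_on ({0<..<1} \<times> {0..1}) (\<lambda>(t, y). h t y) \<and>
           (\<forall>t\<in>{0<..<1}. \<forall>t'\<in>{0<..<1}. t \<noteq> t' \<longrightarrow>
              \<not> (\<exists>c. \<forall>p\<in>pts M. \<forall>u\<in>tangent M p. \<forall>v\<in>tangent M p. g t p u v = c * g t' p u v))"
proof -
 interpret construction_two m N gN JN b P act pr \<theta> M x q by (rule assms(1))
 obtain i0 j0 where sg: "i0:{2..m}" "b i0 > 0" "j0:{2..m}" "b j0 < 0" using assms(5,6) by blast
 define n where "n i = mdim (N i) div 2" for i
 have d: "mdim (N i) = 2*n i" "n i >= 1" if i: "i:{1..m}" for i
 proof -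
  have "even (mdim (N i))" "mdim (N i) > 0" using even_mdim[OF mN[OF i]] factors[OF i] unfolding closed_manifold_def by blast+
  thus "mdim (N i) = 2*n i" "n i >= 1" unfolding n_def by (auto elim!: evenE)
 qed
 have 1: "1:{1..m}" using m_pos by simp
 interpret parameters m n b i0 j0
 proof
  have "real (mdim (N 1)) + 2 = 2*(real (n 1) + 1)" using d(1)[OF 1] by simp
  thus "b 1 = 1/(real (n 1) + 1)" unfolding b_first by (simp only:) (simp add: field_simps)
 qed (use m_pos d(2) sg in auto)
 obtain t0 rh where t0: "t0 > 0" and rh: "cont {0..t0} rh" "!!t. t:{0<..t0} ==> good t (rh t)" using curve by blast
 \<comment> \<open>Carries the parameter interval of the statement into the domain of the
   curve.\<close>
 define T where "T t = t*t0" for t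
 define R where "R t = rh (T t)" for t
 have Tr: "T t:{0<..t0}" if "t:{0<..<1}" for t using that t0 by (auto simp: T_def)
 have g: "good (T t) (R t)" if "t:{0<..<1}" for t unfolding R_def by (rule rh(2)[OF Tr[OF that]])
 have cT: "cont {0<..<1} T" unfolding T_def by (intro continuous_intros)
 have cR: "cont {0<..<1} R" unfolding R_def by (rule continuous_on_compose2[OF rh(1) cT]) (use Tr in force)
 let ?h = "%t. hh (T t) (R t)" and ?a = "%t. aa (T t) (R t)"
 have "EX gJ. ALL t:{0<..<1}. kaehler M (fst (gJ t)) (snd (gJ t)) & mform (?h t) (?a t) (fst (gJ t)) (snd (gJ t))"
 proof (rule bchoice, rule ballI)
  fix t :: real assume t: "t:{0<..<1}"
  show "EX gJ. kaehler M (fst gJ) (snd gJ) & mform (?h t) (?a t) (fst gJ) (snd gJ)"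
   using deformation[OF assms(2,3,4) good_profile(1)[OF g[OF t]]] by simp
 qed
 then obtain gJ where gJ: "!!t. t:{0<..<1} ==> kaehler M (fst (gJ t)) (snd (gJ t))"
  "!!t. t:{0<..<1} ==> mform (?h t) (?a t) (fst (gJ t)) (snd (gJ t))" by blast
 have sc: "EX s>0. const_scalar_curv M (fst (gJ t)) s" if t: "t:{0<..<1}" for t
 proof (intro exI conjI)
  note pf = good_profile[OF g[OF t]]
  show "ss (T t) (R t) > 0" by (rule pf(2))
  obtain D where D: "!!y. y:{0..1} ==> D 0 y = ?h t y" "!!k y. y:{0..1} ==> der01 (D k) (D (Suc k) y) y"
   using pf(1) unfolding profile_def smooth_closed_interval_def by blast
  have rg: "riemannian M (fst (gJ t))" using gJ(1)[OF t] unfolding kaehler_def by blast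
  show "const_scalar_curv M (fst (gJ t)) (ss (T t) (R t))"
  proof (rule const_scalar_curv_from_ODE[OF rg pf(1) gJ(2)[OF t] D])
   fix y S assume y: "0 < y" "y < 1" and S: "S = S1 (?a t) y"
   have e: "S1 (?a t) y = (SUM i=1..m. real (2*n i)*b i/(2*(b i*y + ?a t i)))"
    "S0 (?a t) y = (SUM i=1..m. real (2*n i)/(b i*y + ?a t i))"
    "S2 (?a t) y = (SUM i=1..m. real (2*n i)*(b i)\<^sup>2/(2*(b i*y + ?a t i)\<^sup>2))"
    by (intro scr; simp only: d(1))+
   show "S0 (?a t) y - D 2 y - 2*S*D 1 y
    - (S\<^sup>2 - S2 (?a t) y)*D 0 y = ss (T t) (R t)"
    unfolding e(2,3) by (rule good_ode[where D = D, OF g[OF t]]) (use D y S e(1) in auto)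
  qed
 qed
 have nh: "~ (EX c. ALL p:pts M. ALL u:Tan M p. ALL v:Tan M p. fst (gJ t) p u v = c*fst (gJ t') p u v)" if t: "t:{0<..<1}" "t':{0<..<1}" "t ~= t'" for t t'
 proof (rule not_homothetic[OF gJ(2)[OF t(1)] gJ(2)[OF t(2)]])
  show "?a t 1 = 0" "?a t' 1 = 0" by (simp_all add: aa_def)
  show "i0:{1..m}" using sg(1) by simp
  \<comment> \<open>\<open>z i0 = C\<close> does not involve the root, so \<open>a i0\<close> is
    \<open>1 / (t * t0 * C)\<close> and separates the parameters.\<close>
  show "?a t i0 ~= ?a t' i0" using sg t t0 C_pos(1) ij by (auto simp: aa_def z_def T_def)
 qed
 show ?thesis
 proof (rule exI[of _ ?h], rule exI[of _ ?a], rule exI[of _ "%t. fst (gJ t)"], rule exI[of _ "%t. snd (gJ t)"], intro conjI ballI impI)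
  show "cont {0<..<1} (%t. ?a t i)" for i by (rule aa_cont[OF cT cR g])
  show "cont ({0<..<1} \<times> {0..1}) (%(t, y). ?h t y)" by (rule hh_cont[OF cT cR g])
  fix t :: real assume t: "t:{0<..<1}"
  show "kaehler M (fst (gJ t)) (snd (gJ t))" "mform (?h t) (?a t) (fst (gJ t)) (snd (gJ t))" by (rule gJ[OF t])+
  show "profile m b (?h t) (?a t)" by (rule good_profile(1)[OF g[OF t]])
  show "EX s>0. const_scalar_curv M (fst (gJ t)) s" by (rule sc[OF t])
  show "~ (EX c. ALL p:pts M. ALL u:Tan M p. ALL v:Tan M p. fst (gJ t) p u v = c*fst (gJ t') p u v)" if "t':{0<..<1}" "t ~= t'" for t' by (rule nh[OF t that])
 qed
qed

end
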